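(* Let $B$ be a separable Banach space with a Schauder basis $(e_k)_{k\in\mathbb{N}}$, and let $\{(X_{i,n})_{1\le i\le n}\}_{n\in\mathbb{N}}$ be a locally stationary time series in $B$ satisfying the moment and dependence condition, the tail entropy condition and the block-length condition, all of which are spelled out in the context. Let $G=\{G(t)\}_{t\in[0,1]}$ be the centered Gaussian process in $B$ with $\mathrm{Cov}(G(t),G(s))=\int_0^{t\wedge s}\sigma^2(x)\,\mathrm{d}x$, $s,t\in[0,1]$, which is the weak limit in $D([0,1],B)$ of $G_n(t)=\sqrt n(S_n(t)-\mathbb{E}[S_n(t)])$, $S_n(t)=\frac1n\sum_{i=1}^{\lfloor tn\rfloor}X_{i,n}$. Then there exist a Hilbert space $\mathcal{H}$, a cylindrical Brownian motion $W=\{W(t)\}_{t\in[0,1]}$ in $\mathcal{H}$, and a family of bounded linear operators $\{\sigma(u)\}_{u\in[0,1]}$, $\sigma(u):\mathcal{H}\to B$, with adjoints $\sigma^*(u):B^*\to\mathcal{H}$, such that $\sigma^2(u)=\sigma(u)\sigma^*(u)$ for all $u\in[0,1]$ (meaning $\Phi(\sigma^2(u))=\sigma(u)\sigma^*(u)$ for the canonical map $\Phi$ of the context), and $G$ can be written (in law) as $$G(t)=\int_0^t\sigma(u)\,\mathrm{d}W(u),\qquad t\in[0,1].$$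
   Context: Tensor products and covariances. $B$ is a real separable Banach space with norm $\|\cdot\|_B$, dual $B^*$ and closed dual unit ball $B_1^*$. Expectations of $B$-valued random variables are Bochner integrals. $B\hat\otimes B$ is the completion of the algebraic tensor product $B\otimes B$ under the projective norm $\|u\|_\pi=\inf\{\sum_j\|x_{1j}\|_B\|x_{2j}\|_B: u=\sum_j x_{1j}\otimes x_{2j}\}$. For centered square-integrable $X,Y$ in $B$, $\mathrm{Cov}(X,Y)=\mathbb{E}[X\otimes Y]\in B\hat\otimes B$. The canonical map $\Phi:B\hat\otimes B\to\mathcal{L}(B^*,B)$ (bounded linear operators) is the linear continuous extension of $\Phi(u\otimes v)(b)=b(v)u$. $D([0,1],B)$ is the Skorokhod space of càdlàg functions $[0,1]\to B$. The adjoint $\sigma^*(u)$ takes values in $\mathcal{H}\cong\mathcal{H}^*$. The stochastic integral of an operator-valued function with respect to a cylindrical Brownian motion is the Banach-space (Pettis-type) integral: $\int_0^t\sigma(u)\,\mathrm{d}W(u)$ is the $B$-valued random variable with $b(\int_0^t\sigma(u)\,\mathrm{d}W(u))=\int_0^t\sigma^*(u)b\,\mathrm{d}W(u)$ a.s. for every $b\in B^*$. Local stationarity. Let $(E,\mathcal{E})$ be a measurable space, $(\eta_i)_{i\in\mathbb{Z}}$ i.i.d. $E$-valued random elements, $(\eta_i^* )_{i\in\mathbb{Z}}$ an independent copy, $\mathcal{F}_i=(\eta_i,\eta_{i-1},\dots)$, and for $i\ge0$ let $\mathcal{F}_i^*=(\eta_i,\dots,\eta_1,\eta_0^*,\eta_{-1},\eta_{-2},\dots)$.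 For a map $H:[0,1]\times E^{\mathbb{N}_0}\to B$ with $H(t,\mathcal{F}_i)$ measurable for all $t,i$, the physical dependence measure is $\delta_\rho(H,i)=\sup_{t\in[0,1]}\mathbb{E}[\|H(t,\mathcal{F}_i)-H(t,\mathcal{F}_i^* )\|_B^\rho]^{1/\rho}$. A triangular array is locally stationary with map $H$ if its $(i,n)$ entry equals $H(i/n,\mathcal{F}_i)$ for all $1\le i\le n$, $n\in\mathbb{N}$, with $H$ continuous in its first argument. $H$ is Lipschitz continuous with respect to the $L^2$-norm if $\sup_{0\le s<t\le1}\mathbb{E}[\|H(t,\mathcal{F}_i)-H(s,\mathcal{F}_i)\|_B^2]^{1/2}/|t-s|<\infty$. Schauder basis. $(e_k)_{k\in\mathbb{N}}$ is a Schauder basis of $B$, with coordinate functionals $(e_k^* )_{k\in\mathbb{N}}\subset B^*$. Put $\Pi_k(x)=\sum_{i=1}^k e_i^*(x)e_i$ and $T_k=I_B-\Pi_k$, with $I_B$ the identity. Moment and dependence condition. $X_{i,n}=\mu(i/n)+\varepsilon_{i,n}$ for a deterministic $\mu:[0,1]\to B$ and a centered, locally stationary error process $\{(\varepsilon_{i,n})_{1\le i\le n}\}_{n\in\mathbb{N}}$ with map $H$, such that for some $\kappa>0$: (1) $H$ is Lipschitz continuous with respect to the $L^2$-norm and $\sup_{t\in[0,1]}\mathbb{E}[\|H(t,\mathcal{F}_0)\|_B^{2+\kappa}]<\infty$; (2) $\sum_{k\in\mathbb{Z}}\Theta_{|k|}<\infty$ where $\Theta_k=\sum_{i=k}^\infty\delta_{2+\kappa}(H,i)$,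 and $\delta_{2+\kappa}(H,i)$ is non-increasing in $i$. The local long-run variance is $\sigma^2(t)=\sum_{i=-\infty}^\infty\mathrm{Cov}(H(t,\mathcal{F}_i),H(t,\mathcal{F}_0))\in B\hat\otimes B$. Tail entropy condition. Let $\mathcal{G}_k$ be the set of functions $f:B\times[0,1]\to\mathbb{R}$ of the form $f(x,u)=b(T_kx)\,\mathbf{1}(u\le t)$ with $b\in B_1^*$, $t\in[0,1]$. For functions $f$ on $B\times[0,1]$ let $\|f\|_{2,n}=(\frac1n\sum_{i=1}^n\mathbb{E}[|f(X_{i,n},i/n)|^2])^{1/2}$ and $V_{n,k}(f)=\|f\|_{2,n}+\sum_{i=1}^\infty\min\{\|f\|_{2,n},D\,\delta_2(H,i)\}$, where $D>0$ is a constant with $D\ge\sup_{f\in\mathcal{G}_k}\|f\|_{2,n}$ uniformly in $k$ and $n$. $N(\epsilon,\mathcal{G}_k,V_{n,k})$ is the bracketing number: the smallest number of brackets $[\ell,u]=\{f:\ell\le f\le u\}$ with $V_{n,k}(u-\ell)\le\epsilon$ needed to cover $\mathcal{G}_k$. Let $\beta(q)=\sum_{j=q}^\infty\delta_2(H,j)$, $q^*(x)=\min\{q\in\mathbb{N}:\beta(q)\le qx\}$, $r(\delta)=\max\{r>0:q^*(r)r\le\delta\}$ and $m(n,\delta,k)=r(\delta/D)\,D\sqrt n/\sqrt{\max\{1,\log k\}}$. The condition is: there are $\sigma_k$ with $\sup_{f\in\mathcal{G}_k}V_{n,k}(f)\le\sigma_k$ such that $$I_k=\limsup_{n\to\infty}\int_0^{\sigma_k}\sqrt{1\vee\log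 N(\epsilon,\mathcal{G}_k,V_{n,k})}\,\mathrm{d}\epsilon<\infty\ \text{ for all }k\in\mathbb{N},\qquad I_k\to0\ (k\to\infty),$$ and, for some sequence $c_k\to0$, uniformly in $n\in\mathbb{N}$, $$\frac1{\sqrt n}\sum_{i=1}^n\mathbb{E}\Big[\|T_kX_{i,n}\|_B\,\mathbf{1}\big\{\|T_kX_{i,n}\|_B>\tfrac14 m(n,\sigma_k,N(\sigma_k/2,\mathcal{G}_k,V_{n,k}))\big\}\Big]\le c_k.$$ Block-length condition. There are integer sequences $\ell_n\to\infty$, $s_n\to\infty$ with $s_n=o(\ell_n)$, $\sqrt n\,\Theta_{s_n}\to0$, and, with the same $\kappa$ as in the moment and dependence condition, $\ell_n^{2+2/\kappa}=o(n)$ as $n\to\infty$. *)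

theory Defs
  imports "HOL-Probability.Probability"
begin

text \<open>
  A list \<open>[(x\<^sub>1, y\<^sub>1), \<dots>]\<close> is a formal sum \<open>x\<^sub>1 \<otimes> y\<^sub>1 + \<dots>\<close>. Two formal sums are equal in the
  algebraic tensor product iff every bilinear form takes the same value on both; that this
  quotient is the algebraic tensor product is \<open>atensor_universal\<close> below.
\<close>

definition formal_eval :: "('a \<Rightarrow> 'a \<Rightarrow> 'c::comm_monoid_add) \<Rightarrow> ('a \<times> 'a) list \<Rightarrow> 'c" where
  "formal_eval f zs = (\<Sum>(x, y)\<leftarrow>zs. f x y)"

lemma formal_eval_simps [simp]:
  "formal_eval f [] = 0"
  "formal_eval f ((x, y) # zs) = f x y + formal_eval f zs"
  "formal_eval f (zs @ ws) = formal_eval f zs + formal_eval f ws"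
  by (auto simp: formal_eval_def)

definition tensor_eq :: "('a::real_vector \<times> 'a) list \<Rightarrow> ('a \<times> 'a) list \<Rightarrow> bool" where
  "tensor_eq zs ws \<longleftrightarrow>
     (\<forall>f :: 'a \<Rightarrow> 'a \<Rightarrow> real. bilinear f \<longrightarrow> formal_eval f zs = formal_eval f ws)"

quotient_type (overloaded) 'a atensor = "('a::real_vector \<times> 'a) list" / tensor_eq
  by (rule equivpI) (auto simp: reflp_def symp_def transp_def tensor_eq_def)

lift_definition atensor :: "'a::real_vector \<Rightarrow> 'a \<Rightarrow> 'a atensor" is "\<lambda>x y. [(x, y)]" .

lemma abs_atensor_surj: "\<exists>zs. u = abs_atensor zs"
  using Quotient3_abs_rep[OF Quotient3_atensor, of u] by metis

lemma formal_eval_scale: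
  assumes "bilinear f"
  shows "formal_eval f (map (\<lambda>(x, y). (c *\<^sub>R x, y)) zs) = c *\<^sub>R formal_eval f zs"
  by (induction zs) (auto simp: bilinear_lmul[OF assms] scaleR_add_right)

instantiation atensor :: (real_vector) real_vector
begin

lift_definition zero_atensor :: "'a atensor" is "[]" .

lift_definition plus_atensor :: "'a atensor \<Rightarrow> 'a atensor \<Rightarrow> 'a atensor" is "(@)"
  by (auto simp: tensor_eq_def)

lift_definition scaleR_atensor :: "real \<Rightarrow> 'a atensor \<Rightarrow> 'a atensor"
  is "\<lambda>c. map (\<lambda>(x, y). (c *\<^sub>R x, y))"
  by (simp add: tensor_eq_def formal_eval_scale)

definition uminus_atensor :: "'a atensor \<Rightarrow> 'a atensor" where
  "uminus_atensor u = (-1) *\<^sub>R u"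

definition minus_atensor :: "'a atensor \<Rightarrow> 'a atensor \<Rightarrow> 'a atensor" where
  "minus_atensor u v = u + - v"

instance
proof
  fix u v w :: "'a atensor" and a b :: real
  show "u + v + w = u + (v + w)" by transfer (simp add: tensor_eq_def)
  show "u + v = v + u" by transfer (simp add: tensor_eq_def)
  show "0 + u = u" by transfer (simp add: tensor_eq_def)
  show "- u + u = 0" unfolding uminus_atensor_def
    by transfer (simp add: tensor_eq_def formal_eval_scale del: scaleR_minus_left scaleR_minus1_left)
  show "u - v = u + - v" by (rule minus_atensor_def)
  show "a *\<^sub>R (u + v) = a *\<^sub>R u + a *\<^sub>R v"
    by transfer (simp add: tensor_eq_def)
  show "(a + b) *\<^sub>R u = a *\<^sub>R u + b *\<^sub>R u"
    by transfer (simp add: tensor_eq_def formal_eval_scale distrib_right)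
  show "a *\<^sub>R b *\<^sub>R u = (a * b) *\<^sub>R u"
    by transfer (simp add: tensor_eq_def formal_eval_scale flip: map_map)
  show "1 *\<^sub>R u = u" by transfer (simp add: tensor_eq_def formal_eval_scale)
qed

end

lemma bilinear_atensor: "bilinear atensor"
  unfolding bilinear_def
proof (intro conjI allI linearI)
  fix x y z :: 'a and c :: real
  show "atensor x (y + z) = atensor x y + atensor x z"
    by transfer (simp add: tensor_eq_def bilinear_radd)
  show "atensor (y + z) x = atensor y x + atensor z x"
    by transfer (simp add: tensor_eq_def bilinear_ladd)
  show "atensor x (c *\<^sub>R y) = c *\<^sub>R atensor x y"
    by transfer (simp add: tensor_eq_def bilinear_lmul bilinear_rmul)
  show "atensor (c *\<^sub>R y) x = c *\<^sub>R atensor y x"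
    by transfer (simp add: tensor_eq_def)
qed

lemma atensor_representation: "\<exists>zs. u = formal_eval atensor zs"
proof -
  obtain zs where u: "u = abs_atensor zs"
    using abs_atensor_surj by blast
  have "abs_atensor zs = formal_eval atensor zs"
  proof (induction zs)
    case Nil
    show ?case by (simp add: zero_atensor.abs_eq)
  next
    case (Cons p zs)
    obtain x y where "p = (x, y)" by (cases p)
    moreover have "abs_atensor ((x, y) # zs) = atensor x y + abs_atensor zs"
      by (simp add: atensor.abs_eq plus_atensor.abs_eq)
    ultimately show ?case using Cons by simp
  qed
  with u show ?thesis by blast
qed

lemma linear_formal_eval:
  assumes "linear g"
  shows "g (formal_eval f zs) = formal_eval (\<lambda>x y. g (f x y)) zs"
  by (induction zs) (auto simp: linear_0[OF assms] linear_add[OF assms])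

lemma separating_functional:
  fixes z :: "'c::real_vector"
  assumes "z \<noteq> 0"
  obtains g :: "'c \<Rightarrow> real" where "linear g" "g z \<noteq> 0"
proof -
  have "independent {z}" using assms by (simp add: dependent_single)
  from linear_independent_extend[OF this, of "\<lambda>_. 1::real"] show ?thesis
    using that by auto
qed

lemma tensor_eq_formal_eval:
  fixes f :: "'a::real_vector \<Rightarrow> 'a \<Rightarrow> 'c::real_vector"
  assumes "tensor_eq zs ws" and f: "bilinear f"
  shows "formal_eval f zs = formal_eval f ws"
proof (rule ccontr)
  assume "formal_eval f zs \<noteq> formal_eval f ws"
  then obtain g :: "'c \<Rightarrow> real" where g: "linear g" "g (formal_eval f zs - formal_eval f ws) \<noteq> 0"
    using separating_functional[of "formal_eval f zs - formal_eval f ws"] by auto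
  have "bilinear (\<lambda>x y. g (f x y))"
    using f linear_compose[OF _ g(1), unfolded o_def] unfolding bilinear_def by blast
  then have "formal_eval (\<lambda>x y. g (f x y)) zs = formal_eval (\<lambda>x y. g (f x y)) ws"
    using assms(1) by (simp add: tensor_eq_def)
  with g show False by (simp add: linear_diff linear_formal_eval)
qed

lemma atensor_universal:
  fixes f :: "'a::real_vector \<Rightarrow> 'a \<Rightarrow> 'c::real_vector"
  assumes f: "bilinear f"
  shows "\<exists>!g. linear g \<and> (\<forall>x y. g (atensor x y) = f x y)"
proof
  define g where "g u = formal_eval f (rep_atensor u)" for u
  have g: "g (abs_atensor zs) = formal_eval f zs" for zs
  proof -
    have "tensor_eq (rep_atensor (abs_atensor zs)) zs"
      using Quotient3_rep_abs[OF Quotient3_atensor] by (simp add: tensor_eq_def)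
    then show ?thesis
      unfolding g_def by (rule tensor_eq_formal_eval[OF _ f])
  qed
  have "linear g"
  proof
    fix u v :: "'a atensor" and c :: real
    obtain zs ws where "u = abs_atensor zs" "v = abs_atensor ws"
      using abs_atensor_surj by metis
    then show "g (u + v) = g u + g v" "g (c *\<^sub>R u) = c *\<^sub>R g u"
      by (simp_all add: plus_atensor.abs_eq scaleR_atensor.abs_eq g formal_eval_scale[OF f])
  qed
  then show "linear g \<and> (\<forall>x y. g (atensor x y) = f x y)"
    by (simp add: atensor.abs_eq g)
  fix h assume h: "linear h \<and> (\<forall>x y. h (atensor x y) = f x y)"
  show "h = g"
  proof
    fix u :: "'a atensor"
    obtain zs where zs: "u = formal_eval atensor zs" using atensor_representation by blast
    show "h u = g u"
      using h \<open>linear g\<close> unfolding zs by (simp add: linear_formal_eval atensor.abs_eq g)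
  qed
qed

definition proj_norm :: "'a::real_normed_vector atensor \<Rightarrow> real" where
  "proj_norm u = Inf {\<Sum>(x, y)\<leftarrow>zs. norm x * norm y | zs. u = (\<Sum>(x, y)\<leftarrow>zs. atensor x y)}"

abbreviation "proj_cost \<equiv> formal_eval (\<lambda>x y. norm x * norm y)"

lemma proj_cost_nonneg: "0 \<le> proj_cost zs"
  by (induction zs) auto

lemma proj_norm_alt: "proj_norm u = Inf (proj_cost ` {zs. u = formal_eval atensor zs})"
  unfolding proj_norm_def formal_eval_def by (rule arg_cong[where f=Inf]) auto

lemma proj_norm_le: "u = formal_eval atensor zs \<Longrightarrow> proj_norm u \<le> proj_cost zs"
  unfolding proj_norm_alt by (rule cInf_lower) (auto intro!: bdd_belowI[of _ 0] proj_cost_nonneg)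

lemma proj_norm_greatest:
  "(\<And>zs. u = formal_eval atensor zs \<Longrightarrow> c \<le> proj_cost zs) \<Longrightarrow> c \<le> proj_norm u"
  unfolding proj_norm_alt by (rule cInf_greatest) (use atensor_representation[of u] in auto)

lemma proj_norm_nonneg: "0 \<le> proj_norm u"
  by (rule proj_norm_greatest) (rule proj_cost_nonneg)

lemma proj_norm_approx:
  assumes "0 < e"
  obtains zs where "u = formal_eval atensor zs" "proj_cost zs < proj_norm u + e"
  using proj_norm_greatest[of u "proj_norm u + e"] assms by (meson less_add_same_cancel1 not_le)

lemma proj_norm_zero [simp]: "proj_norm 0 = 0"
  by (rule antisym) (use proj_norm_le[of 0 "[]"] in \<open>simp_all add: proj_norm_nonneg\<close>)

lemma proj_norm_triangle: "proj_norm (u + v) \<le> proj_norm u + proj_norm v"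
proof (rule field_le_epsilon)
  fix e :: real assume "0 < e"
  then obtain zs ws where zs: "u = formal_eval atensor zs" "proj_cost zs < proj_norm u + e / 2"
    and ws: "v = formal_eval atensor ws" "proj_cost ws < proj_norm v + e / 2"
    by (metis half_gt_zero proj_norm_approx)
  have "proj_norm (u + v) \<le> proj_cost (zs @ ws)"
    by (rule proj_norm_le) (simp add: zs ws)
  with zs ws show "proj_norm (u + v) \<le> proj_norm u + proj_norm v + e" by simp
qed

lemma proj_norm_scaleR_le: "proj_norm (c *\<^sub>R u) \<le> \<bar>c\<bar> * proj_norm u"
proof (cases "c = 0")
  case False
  have "proj_norm (c *\<^sub>R u) / \<bar>c\<bar> \<le> proj_norm u"
  proof (rule proj_norm_greatest)
    fix zs assume zs: "u = formal_eval atensor zs"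
    let ?ws = "map (\<lambda>(x, y). (c *\<^sub>R x, y)) zs"
    have "proj_norm (c *\<^sub>R u) \<le> proj_cost ?ws"
      by (rule proj_norm_le) (simp add: zs formal_eval_scale[OF bilinear_atensor])
    also have "proj_cost ?ws = \<bar>c\<bar> * proj_cost zs"
      by (induction zs) (auto simp: algebra_simps)
    finally show "proj_norm (c *\<^sub>R u) / \<bar>c\<bar> \<le> proj_cost zs"
      using False by (simp add: field_simps)
  qed
  with False show ?thesis by (simp add: field_simps)
qed simp

lemma proj_norm_scaleR: "proj_norm (c *\<^sub>R u) = \<bar>c\<bar> * proj_norm u"
proof (cases "c = 0")
  case False
  have "\<bar>c\<bar> * proj_norm u = \<bar>c\<bar> * proj_norm (inverse c *\<^sub>R c *\<^sub>R u)" using False by simp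
  also have "\<dots> \<le> \<bar>c\<bar> * (\<bar>inverse c\<bar> * proj_norm (c *\<^sub>R u))"
    by (intro mult_left_mono proj_norm_scaleR_le) simp
  also have "\<dots> = proj_norm (c *\<^sub>R u)"
    using False by (simp add: abs_inverse)
  finally show ?thesis using proj_norm_scaleR_le[of c u] by simp
qed simp

lemma proj_norm_minus [simp]: "proj_norm (- u) = proj_norm u"
  using proj_norm_scaleR[of "-1" u] by simp

lemma proj_norm_minus_commute: "proj_norm (u - v) = proj_norm (v - u)"
  using proj_norm_minus[of "u - v"] by simp

lemma proj_norm_triangle_sub: "proj_norm (u - w) \<le> proj_norm (u - v) + proj_norm (v - w)"
  using proj_norm_triangle[of "u - v" "v - w"] by simp

lemma proj_norm_diff_le: "\<bar>proj_norm u - proj_norm v\<bar> \<le> proj_norm (u - v)"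
  using proj_norm_triangle[of "u - v" v] proj_norm_triangle[of "v - u" u]
    proj_norm_minus_commute[of u v] by simp

lemma proj_norm_atensor_le: "proj_norm (atensor x y) \<le> norm x * norm y"
  using proj_norm_le[of "atensor x y" "[(x, y)]"] by simp

lifting_forget atensor.lifting

text \<open>
  The completion for the projective norm, by Cauchy sequences. \<open>proj_norm\<close> is only shown to be a
  seminorm on \<open>'a atensor\<close>; if it had null vectors, passing to the completion would
  identify them.
\<close>

definition proj_cauchy :: "(nat \<Rightarrow> 'a::real_normed_vector atensor) \<Rightarrow> bool" where
  "proj_cauchy X \<longleftrightarrow> (\<forall>e>0. \<exists>N. \<forall>m\<ge>N. \<forall>n\<ge>N. proj_norm (X m - X n) < e)"

definition ptensor_rel ::
    "(nat \<Rightarrow> 'a::real_normed_vector atensor) \<Rightarrow> (nat \<Rightarrow> 'a atensor) \<Rightarrow> bool" where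
  "ptensor_rel X Y \<longleftrightarrow>
     proj_cauchy X \<and> proj_cauchy Y \<and> (\<lambda>n. proj_norm (X n - Y n)) \<longlonglongrightarrow> 0"

lemma proj_cauchy_const: "proj_cauchy (\<lambda>_. u)"
  by (simp add: proj_cauchy_def)

lemma tendsto_zero_le:
  fixes f g :: "nat \<Rightarrow> real"
  assumes "g \<longlonglongrightarrow> 0" "\<And>n. 0 \<le> f n" "\<And>n. f n \<le> g n"
  shows "f \<longlonglongrightarrow> 0"
  by (rule tendsto_sandwich[OF _ _ tendsto_const assms(1)]) (auto simp: assms)

quotient_type (overloaded) 'a ptensor =
  "nat \<Rightarrow> 'a::real_normed_vector atensor" / partial: ptensor_rel
proof (rule part_equivpI)
  show "\<exists>X :: nat \<Rightarrow> 'a atensor. ptensor_rel X X"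
    by (rule exI[of _ "\<lambda>_. 0"]) (simp add: ptensor_rel_def proj_cauchy_const)
  show "symp (ptensor_rel :: (nat \<Rightarrow> 'a atensor) \<Rightarrow> _)"
    by (auto simp: symp_def ptensor_rel_def proj_norm_minus_commute)
  show "transp (ptensor_rel :: (nat \<Rightarrow> 'a atensor) \<Rightarrow> _)"
  proof (rule transpI)
    fix X Y Z :: "nat \<Rightarrow> 'a atensor"
    assume XY: "ptensor_rel X Y" and YZ: "ptensor_rel Y Z"
    have "(\<lambda>n. proj_norm (X n - Z n)) \<longlonglongrightarrow> 0"
    proof (rule tendsto_zero_le)
      show "(\<lambda>n. proj_norm (X n - Y n) + proj_norm (Y n - Z n)) \<longlonglongrightarrow> 0"
        using tendsto_add[of _ "0::real" _ _ 0] XY YZ by (fastforce simp: ptensor_rel_def)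
    qed (auto intro: proj_norm_nonneg proj_norm_triangle_sub)
    with XY YZ show "ptensor_rel X Z" by (simp add: ptensor_rel_def)
  qed
qed

lemma proj_cauchy_add:
  assumes "proj_cauchy X" "proj_cauchy Y"
  shows "proj_cauchy (\<lambda>n. X n + Y n)"
  unfolding proj_cauchy_def
proof (intro allI impI)
  fix e :: real assume "0 < e"
  then have "0 < e / 2" by simp
  then obtain M N where M: "\<And>m n. m \<ge> M \<Longrightarrow> n \<ge> M \<Longrightarrow> proj_norm (X m - X n) < e / 2"
    and N: "\<And>m n. m \<ge> N \<Longrightarrow> n \<ge> N \<Longrightarrow> proj_norm (Y m - Y n) < e / 2"
    using assms unfolding proj_cauchy_def by meson
  show "\<exists>N. \<forall>m\<ge>N. \<forall>n\<ge>N. proj_norm (X m + Y m - (X n + Y n)) < e"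
  proof (intro exI[of _ "max M N"] allI impI)
    fix m n assume mn: "max M N \<le> m" "max M N \<le> n"
    have "proj_norm (X m + Y m - (X n + Y n)) \<le> proj_norm (X m - X n) + proj_norm (Y m - Y n)"
      using proj_norm_triangle[of "X m - X n" "Y m - Y n"] by (simp add: algebra_simps)
    also have "\<dots> < e" using M[of m n] N[of m n] mn by simp
    finally show "proj_norm (X m + Y m - (X n + Y n)) < e" .
  qed
qed

lemma proj_cauchy_scaleR:
  assumes "proj_cauchy X"
  shows "proj_cauchy (\<lambda>n. c *\<^sub>R X n)"
  unfolding proj_cauchy_def
proof (intro allI impI)
  fix e :: real assume "0 < e"
  then have "0 < e / (\<bar>c\<bar> + 1)" by (simp add: field_simps add_nonneg_pos)
  then obtain N where N: "\<And>m n. m \<ge> N \<Longrightarrow> n \<ge> N \<Longrightarrow> proj_norm (X m - X n) < e / (\<bar>c\<bar> + 1)"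
    using assms unfolding proj_cauchy_def by meson
  show "\<exists>N. \<forall>m\<ge>N. \<forall>n\<ge>N. proj_norm (c *\<^sub>R X m - c *\<^sub>R X n) < e"
  proof (intro exI[of _ N] allI impI)
    fix m n assume "N \<le> m" "N \<le> n"
    from N[OF this] have "(\<bar>c\<bar> + 1) * proj_norm (X m - X n) < e"
      by (simp add: field_simps add_nonneg_pos)
    moreover have "proj_norm (c *\<^sub>R X m - c *\<^sub>R X n) = \<bar>c\<bar> * proj_norm (X m - X n)"
      by (simp add: proj_norm_scaleR flip: scaleR_diff_right)
    moreover have "\<bar>c\<bar> * proj_norm (X m - X n) \<le> (\<bar>c\<bar> + 1) * proj_norm (X m - X n)"
      by (rule mult_right_mono) (auto simp: proj_norm_nonneg)
    ultimately show "proj_norm (c *\<^sub>R X m - c *\<^sub>R X n) < e" by simp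
  qed
qed

lemma proj_cauchy_Cauchy:
  assumes "proj_cauchy X"
  shows "Cauchy (\<lambda>n. proj_norm (X n))"
proof (rule CauchyI)
  fix e :: real assume "0 < e"
  then obtain N where N: "\<And>m n. m \<ge> N \<Longrightarrow> n \<ge> N \<Longrightarrow> proj_norm (X m - X n) < e"
    using assms unfolding proj_cauchy_def by meson
  show "\<exists>M. \<forall>m\<ge>M. \<forall>n\<ge>M. norm (proj_norm (X m) - proj_norm (X n)) < e"
  proof (intro exI[of _ N] allI impI)
    fix m n assume "N \<le> m" "N \<le> n"
    from le_less_trans[OF proj_norm_diff_le N[OF this]]
    show "norm (proj_norm (X m) - proj_norm (X n)) < e" by simp
  qed
qed

instantiation ptensor :: (real_normed_vector) real_normed_vector
begin

lift_definition zero_ptensor :: "'a ptensor" is "\<lambda>_. 0"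
  by (simp add: ptensor_rel_def proj_cauchy_const)

lift_definition plus_ptensor :: "'a ptensor \<Rightarrow> 'a ptensor \<Rightarrow> 'a ptensor" is "\<lambda>X Y n. X n + Y n"
proof -
  fix X X' Y Y' :: "nat \<Rightarrow> 'a atensor"
  assume X: "ptensor_rel X X'" and Y: "ptensor_rel Y Y'"
  have "(\<lambda>n. proj_norm (X n + Y n - (X' n + Y' n))) \<longlonglongrightarrow> 0"
  proof (rule tendsto_zero_le)
    show "(\<lambda>n. proj_norm (X n - X' n) + proj_norm (Y n - Y' n)) \<longlonglongrightarrow> 0"
      using tendsto_add[of _ "0::real" _ _ 0] X Y by (fastforce simp: ptensor_rel_def)
    show "proj_norm (X n + Y n - (X' n + Y' n)) \<le> proj_norm (X n - X' n) + proj_norm (Y n - Y' n)" for n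
      using proj_norm_triangle[of "X n - X' n" "Y n - Y' n"] by (simp add: algebra_simps)
  qed (rule proj_norm_nonneg)
  with X Y show "ptensor_rel (\<lambda>n. X n + Y n) (\<lambda>n. X' n + Y' n)"
    by (simp add: ptensor_rel_def proj_cauchy_add)
qed

lift_definition scaleR_ptensor :: "real \<Rightarrow> 'a ptensor \<Rightarrow> 'a ptensor" is "\<lambda>c X n. c *\<^sub>R X n"
proof -
  fix c :: real and X X' :: "nat \<Rightarrow> 'a atensor"
  assume X: "ptensor_rel X X'"
  have "(\<lambda>n. \<bar>c\<bar> * proj_norm (X n - X' n)) \<longlonglongrightarrow> 0"
    using X by (intro tendsto_mult_right_zero) (simp add: ptensor_rel_def)
  then have "(\<lambda>n. proj_norm (c *\<^sub>R X n - c *\<^sub>R X' n)) \<longlonglongrightarrow> 0"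
    by (simp add: proj_norm_scaleR flip: scaleR_diff_right)
  with X show "ptensor_rel (\<lambda>n. c *\<^sub>R X n) (\<lambda>n. c *\<^sub>R X' n)"
    by (simp add: ptensor_rel_def proj_cauchy_scaleR)
qed

definition uminus_ptensor :: "'a ptensor \<Rightarrow> 'a ptensor" where
  "uminus_ptensor u = (-1) *\<^sub>R u"

definition minus_ptensor :: "'a ptensor \<Rightarrow> 'a ptensor \<Rightarrow> 'a ptensor" where
  "minus_ptensor u v = u + - v"

lift_definition norm_ptensor :: "'a ptensor \<Rightarrow> real" is "\<lambda>X. lim (\<lambda>n. proj_norm (X n))"
proof -
  fix X Y :: "nat \<Rightarrow> 'a atensor"
  assume XY: "ptensor_rel X Y"
  then have "convergent (\<lambda>n. proj_norm (X n))"
    by (intro Cauchy_convergent proj_cauchy_Cauchy) (simp add: ptensor_rel_def)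
  then obtain L where L: "(\<lambda>n. proj_norm (X n)) \<longlonglongrightarrow> L" by (auto simp: convergent_def)
  have "(\<lambda>n. proj_norm (Y n) - proj_norm (X n)) \<longlonglongrightarrow> 0"
    by (rule Lim_null_comparison[of _ "\<lambda>n. proj_norm (X n - Y n)"])
      (use XY in \<open>auto simp: ptensor_rel_def abs_minus_commute proj_norm_diff_le\<close>)
  from tendsto_add[OF this L] have "(\<lambda>n. proj_norm (Y n)) \<longlonglongrightarrow> L" by simp
  with L show "lim (\<lambda>n. proj_norm (X n)) = lim (\<lambda>n. proj_norm (Y n))"
    by (simp add: limI)
qed

definition sgn_ptensor :: "'a ptensor \<Rightarrow> 'a ptensor" where
  "sgn_ptensor u = inverse (norm u) *\<^sub>R u"

definition dist_ptensor :: "'a ptensor \<Rightarrow> 'a ptensor \<Rightarrow> real" where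
  "dist_ptensor u v = norm (u - v)"

definition uniformity_ptensor :: "('a ptensor \<times> 'a ptensor) filter" where
  "uniformity_ptensor = (INF e\<in>{0 <..}. principal {(x, y). dist x y < e})"

definition open_ptensor :: "'a ptensor set \<Rightarrow> bool" where
  "open_ptensor U \<longleftrightarrow> (\<forall>x\<in>U. \<forall>\<^sub>F (x', y) in uniformity. x' = x \<longrightarrow> y \<in> U)"

lemma ptensor_rel_reflD: "ptensor_rel X X \<Longrightarrow> (\<lambda>n. proj_norm (X n)) \<longlonglongrightarrow> lim (\<lambda>n. proj_norm (X n))"
  using Cauchy_convergent[OF proj_cauchy_Cauchy[of X]]
  by (auto simp: ptensor_rel_def convergent_LIMSEQ_iff)

instance
proof
  fix u v w :: "'a ptensor" and a b :: real
  show "u + v + w = u + (v + w)"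
    by transfer (simp add: ptensor_rel_def proj_cauchy_add add.assoc)
  show "u + v = v + u"
    by transfer (simp add: ptensor_rel_def proj_cauchy_add add.commute)
  show "0 + u = u" by transfer (simp add: ptensor_rel_def)
  show "- u + u = 0" unfolding uminus_ptensor_def
    by transfer (simp add: ptensor_rel_def proj_cauchy_const)
  show "u - v = u + - v" by (rule minus_ptensor_def)
  show "a *\<^sub>R (u + v) = a *\<^sub>R u + a *\<^sub>R v"
    by transfer (simp add: ptensor_rel_def proj_cauchy_add proj_cauchy_scaleR scaleR_add_right)
  show "(a + b) *\<^sub>R u = a *\<^sub>R u + b *\<^sub>R u"
    by transfer (simp add: ptensor_rel_def proj_cauchy_add proj_cauchy_scaleR scaleR_add_left)
  show "a *\<^sub>R b *\<^sub>R u = (a * b) *\<^sub>R u"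
    by transfer (simp add: ptensor_rel_def proj_cauchy_scaleR)
  show "1 *\<^sub>R u = u" by transfer (simp add: ptensor_rel_def)
  show "dist u v = norm (u - v)" by (rule dist_ptensor_def)
  show "sgn u = inverse (norm u) *\<^sub>R u" by (rule sgn_ptensor_def)
  show "uniformity = (INF e\<in>{0 <..}. principal {(x, y::'a ptensor). dist x y < e})"
    by (rule uniformity_ptensor_def)
  show "open U = (\<forall>x\<in>U. \<forall>\<^sub>F (x', y) in uniformity. x' = x \<longrightarrow> y \<in> U)" for U :: "'a ptensor set"
    by (rule open_ptensor_def)
  show "(norm u = 0) = (u = 0)"
  proof transfer
    fix X :: "nat \<Rightarrow> 'a atensor" assume X: "ptensor_rel X X"
    have "ptensor_rel X (\<lambda>_. 0) \<longleftrightarrow> (\<lambda>n. proj_norm (X n)) \<longlonglongrightarrow> 0"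
      using X by (simp add: ptensor_rel_def proj_cauchy_const)
    also have "\<dots> \<longleftrightarrow> lim (\<lambda>n. proj_norm (X n)) = 0"
      using ptensor_rel_reflD[OF X] limI by metis
    finally show "(lim (\<lambda>n. proj_norm (X n)) = 0) = ptensor_rel X (\<lambda>_. 0)" by blast
  qed
  show "norm (u + v) \<le> norm u + norm v"
  proof transfer
    fix X Y :: "nat \<Rightarrow> 'a atensor" assume X: "ptensor_rel X X" and Y: "ptensor_rel Y Y"
    then have "ptensor_rel (\<lambda>n. X n + Y n) (\<lambda>n. X n + Y n)"
      by (simp add: ptensor_rel_def proj_cauchy_add)
    from ptensor_rel_reflD[OF this] tendsto_add[OF ptensor_rel_reflD[OF X] ptensor_rel_reflD[OF Y]]
    show "lim (\<lambda>n. proj_norm (X n + Y n))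
      \<le> lim (\<lambda>n. proj_norm (X n)) + lim (\<lambda>n. proj_norm (Y n))"
      by (rule LIMSEQ_le) (intro exI allI impI proj_norm_triangle)
  qed
  show "norm (a *\<^sub>R u) = \<bar>a\<bar> * norm u"
  proof transfer
    fix c and X :: "nat \<Rightarrow> 'a atensor" assume "ptensor_rel X X"
    from tendsto_mult_left[OF ptensor_rel_reflD[OF this], of "\<bar>c\<bar>"]
    show "lim (\<lambda>n. proj_norm (c *\<^sub>R X n)) = \<bar>c\<bar> * lim (\<lambda>n. proj_norm (X n))"
      unfolding proj_norm_scaleR by (rule limI)
  qed
qed

end

lift_definition ptensor_of :: "'a::real_normed_vector atensor \<Rightarrow> 'a ptensor" is "\<lambda>u _. u"
  by (simp add: ptensor_rel_def proj_cauchy_const)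

lemma norm_ptensor_of: "norm (ptensor_of u) = proj_norm u"
  by transfer (simp add: limI)

lemma linear_ptensor_of: "linear ptensor_of"
proof
  show "ptensor_of (u + v) = ptensor_of u + ptensor_of v" for u v :: "'a atensor"
    by transfer (simp add: ptensor_rel_def proj_cauchy_const)
  show "ptensor_of (c *\<^sub>R u) = c *\<^sub>R ptensor_of u" for c and u :: "'a atensor"
    by transfer (simp add: ptensor_rel_def proj_cauchy_const)
qed

lemma ptensor_limit:
  assumes "proj_cauchy X"
  shows "(\<lambda>n. ptensor_of (X n)) \<longlonglongrightarrow> abs_ptensor X"
proof (rule LIMSEQ_I)
  fix e :: real assume "0 < e"
  then obtain N where N: "\<And>m n. m \<ge> N \<Longrightarrow> n \<ge> N \<Longrightarrow> proj_norm (X m - X n) < e / 2"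
    using assms unfolding proj_cauchy_def by (meson half_gt_zero)
  have X: "ptensor_rel X X" using assms by (simp add: ptensor_rel_def)
  show "\<exists>N. \<forall>n\<ge>N. norm (ptensor_of (X n) - abs_ptensor X) < e"
  proof (intro exI[of _ N] allI impI)
    fix n assume n: "N \<le> n"
    have c: "ptensor_rel (\<lambda>m. X n + - 1 *\<^sub>R X m) (\<lambda>m. X n + - 1 *\<^sub>R X m)"
      using assms by (simp add: ptensor_rel_def proj_cauchy_add proj_cauchy_const proj_cauchy_scaleR
          del: scaleR_minus1_left scaleR_minus_left)
    have cs: "ptensor_rel (\<lambda>m. - 1 *\<^sub>R X m) (\<lambda>m. - 1 *\<^sub>R X m)"
      using assms by (simp add: ptensor_rel_def proj_cauchy_add proj_cauchy_const proj_cauchy_scaleR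
          del: scaleR_minus1_left scaleR_minus_left)
    have cc: "ptensor_rel (\<lambda>m. X n) (\<lambda>m. X n)"
      by (simp add: ptensor_rel_def proj_cauchy_const)
    have "ptensor_of (X n) - abs_ptensor X = abs_ptensor (\<lambda>m. X n + - 1 *\<^sub>R X m)"
      unfolding minus_ptensor_def uminus_ptensor_def ptensor_of.abs_eq
        scaleR_ptensor.abs_eq[OF X] plus_ptensor.abs_eq[OF cc cs] ..
    then have "norm (ptensor_of (X n) - abs_ptensor X) = lim (\<lambda>m. proj_norm (X n + - 1 *\<^sub>R X m))"
      by (simp add: norm_ptensor.abs_eq[OF c] del: scaleR_minus1_left scaleR_minus_left)
    also have "\<dots> \<le> e / 2"
      by (rule LIMSEQ_le_const2[OF ptensor_rel_reflD[OF c]])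
        (use N[OF n] in \<open>auto intro!: exI[of _ N] less_imp_le\<close>)
    also have "\<dots> < e" using \<open>0 < e\<close> by simp
    finally show "norm (ptensor_of (X n) - abs_ptensor X) < e" .
  qed
qed

lemma ptensor_limit_exists: "\<exists>X. proj_cauchy X \<and> (\<lambda>n. ptensor_of (X n)) \<longlonglongrightarrow> U"
proof -
  have "ptensor_rel (rep_ptensor U) (rep_ptensor U)" "abs_ptensor (rep_ptensor U) = U"
    by (rule Quotient3_rep_reflp[OF Quotient3_ptensor], rule Quotient3_abs_rep[OF Quotient3_ptensor])
  then show ?thesis using ptensor_limit[of "rep_ptensor U"] by (auto simp: ptensor_rel_def)
qed

lemma ptensor_approx:
  assumes "0 < e"
  shows "\<exists>u. norm (U - ptensor_of u) < e"
proof -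
  obtain X where "(\<lambda>n. ptensor_of (X n)) \<longlonglongrightarrow> U" using ptensor_limit_exists by blast
  from LIMSEQ_D[OF this assms] show ?thesis by (metis norm_minus_commute order_refl)
qed

lemma closure_range_ptensor_of: "closure (range ptensor_of) = UNIV"
proof (intro set_eqI iffI UNIV_I)
  fix U :: "'a ptensor"
  show "U \<in> closure (range ptensor_of)"
    unfolding closure_approachable
  proof (intro allI impI)
    fix e :: real assume "0 < e"
    from ptensor_approx[OF this, of U] obtain u where "norm (U - ptensor_of u) < e" by blast
    then show "\<exists>V\<in>range ptensor_of. dist V U < e"
      by (intro bexI[of _ "ptensor_of u"]) (simp_all add: dist_norm norm_minus_commute)
  qed
qed

lemma norm_ptensor_of_diff: "norm (ptensor_of u - ptensor_of v) = proj_norm (u - v)"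
  unfolding norm_ptensor_of[symmetric] linear_diff[OF linear_ptensor_of] ..

lemma proj_cauchy_iff: "proj_cauchy X \<longleftrightarrow> Cauchy (\<lambda>n. ptensor_of (X n))"
  unfolding proj_cauchy_def Cauchy_def dist_norm norm_ptensor_of_diff ..

instance ptensor :: (real_normed_vector) banach
proof
  fix U :: "nat \<Rightarrow> 'a ptensor" assume U: "Cauchy U"
  have "\<exists>u. norm (U n - ptensor_of u) < inverse (Suc n)" for n
    by (rule ptensor_approx) simp
  then obtain X where X: "\<And>n. norm (U n - ptensor_of (X n)) < inverse (Suc n)" by metis
  have d: "(\<lambda>n. U n - ptensor_of (X n)) \<longlonglongrightarrow> 0"
    by (rule Lim_null_comparison[OF always_eventually[OF allI[OF less_imp_le[OF X]]]
          LIMSEQ_inverse_real_of_nat])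
  have "Cauchy (\<lambda>n. ptensor_of (X n))"
  proof (rule CauchyI)
    fix e :: real assume "0 < e"
    then have "0 < e / 3" by simp
    from CauchyD[OF U this] LIMSEQ_D[OF d this] obtain M N
      where M: "\<And>m n. m \<ge> M \<Longrightarrow> n \<ge> M \<Longrightarrow> norm (U m - U n) < e / 3"
        and N: "\<And>n. n \<ge> N \<Longrightarrow> norm (U n - ptensor_of (X n)) < e / 3"
      by auto
    show "\<exists>M. \<forall>m\<ge>M. \<forall>n\<ge>M. norm (ptensor_of (X m) - ptensor_of (X n)) < e"
    proof (intro exI[of _ "max M N"] allI impI)
      fix m n assume mn: "max M N \<le> m" "max M N \<le> n"
      have "ptensor_of (X m) - ptensor_of (X n)
          = (U m - U n) + ((U n - ptensor_of (X n)) - (U m - ptensor_of (X m)))" by simp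
      also have "norm \<dots>
          \<le> norm (U m - U n) + (norm (U n - ptensor_of (X n)) + norm (U m - ptensor_of (X m)))"
        by (rule order_trans[OF norm_triangle_ineq add_left_mono[OF norm_triangle_ineq4]])
      finally show "norm (ptensor_of (X m) - ptensor_of (X n)) < e"
        using M[of m n] N[of m] N[of n] mn by simp
    qed
  qed
  then have "proj_cauchy X" by (simp add: proj_cauchy_iff)
  from tendsto_add[OF d ptensor_limit[OF this]] show "convergent U"
    by (auto simp: convergent_def)
qed

definition ptensor :: "'a::real_normed_vector \<Rightarrow> 'a \<Rightarrow> 'a ptensor" (infixl \<open>\<otimes>\<^sub>\<pi>\<close> 75) where
  "x \<otimes>\<^sub>\<pi> y = ptensor_of (atensor x y)"

lemma bounded_bilinear_ptensor: "bounded_bilinear (\<otimes>\<^sub>\<pi>)"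
proof
  fix x y z :: 'a and c :: real
  show "(x + y) \<otimes>\<^sub>\<pi> z = x \<otimes>\<^sub>\<pi> z + y \<otimes>\<^sub>\<pi> z" "z \<otimes>\<^sub>\<pi> (x + y) = z \<otimes>\<^sub>\<pi> x + z \<otimes>\<^sub>\<pi> y"
    "(c *\<^sub>R x) \<otimes>\<^sub>\<pi> y = c *\<^sub>R (x \<otimes>\<^sub>\<pi> y)" "x \<otimes>\<^sub>\<pi> (c *\<^sub>R y) = c *\<^sub>R (x \<otimes>\<^sub>\<pi> y)"
    unfolding ptensor_def
    by (simp_all add: bilinear_ladd[OF bilinear_atensor] bilinear_radd[OF bilinear_atensor]
        bilinear_lmul[OF bilinear_atensor] bilinear_rmul[OF bilinear_atensor]
        linear_add[OF linear_ptensor_of] linear_cmul[OF linear_ptensor_of])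
  show "\<exists>K. \<forall>x y. norm ((x::'a) \<otimes>\<^sub>\<pi> y) \<le> norm x * norm y * K"
    by (rule exI[of _ 1]) (simp add: ptensor_def norm_ptensor_of proj_norm_atensor_le)
qed

lemma ptensor_universal:
  fixes f :: "'a::real_normed_vector \<Rightarrow> 'a \<Rightarrow> 'c::banach"
  assumes f: "bounded_bilinear f"
  shows "\<exists>!L. bounded_linear L \<and> (\<forall>x y. L (x \<otimes>\<^sub>\<pi> y) = f x y)"
proof (rule ex_ex1I)
  interpret f: bounded_bilinear f by (rule f)
  have "bilinear f"
    unfolding bilinear_def
    using f.bounded_linear_left[THEN bounded_linear.linear]
      f.bounded_linear_right[THEN bounded_linear.linear] by blast
  then obtain g where g: "linear g" "\<And>x y. g (atensor x y) = f x y"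
    using atensor_universal by metis
  obtain K where K: "0 < K" "\<And>x y. norm (f x y) \<le> norm x * norm y * K"
    using f.pos_bounded by blast
  have gK: "norm (g u) \<le> K * proj_norm u" for u
  proof -
    have "norm (g u) / K \<le> proj_norm u"
    proof (rule proj_norm_greatest)
      fix zs assume "u = formal_eval atensor zs"
      then have "norm (g u) = norm (formal_eval f zs)" by (simp add: linear_formal_eval[OF g(1)] g(2))
      also have "\<dots> \<le> K * proj_cost zs"
      proof (induction zs)
        case (Cons p zs)
        obtain x y where p: "p = (x, y)" by (cases p)
        have "norm (formal_eval f (p # zs)) \<le> norm (f x y) + norm (formal_eval f zs)"
          by (simp add: p norm_triangle_ineq)
        also have "\<dots> \<le> K * proj_cost (p # zs)"
          using Cons K(2)[of x y] by (simp add: p algebra_simps)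
        finally show ?case .
      qed simp
      finally show "norm (g u) / K \<le> proj_cost zs" using K(1) by (simp add: field_simps)
    qed
    then show ?thesis using K(1) by (simp add: field_simps)
  qed
  have lim: "\<exists>l. \<forall>X. (\<lambda>n. ptensor_of (X n)) \<longlonglongrightarrow> U \<longrightarrow> (\<lambda>n. g (X n)) \<longlonglongrightarrow> l" for U
  proof -
    obtain Y where Y: "proj_cauchy Y" "(\<lambda>n. ptensor_of (Y n)) \<longlonglongrightarrow> U"
      using ptensor_limit_exists by blast
    have gd: "norm (g u - g v) \<le> K * norm (ptensor_of u - ptensor_of v)" for u v
      using gK[of "u - v"]
      unfolding linear_diff[OF g(1)] norm_ptensor_of_diff .
    have "Cauchy (\<lambda>n. g (Y n))"
    proof (rule CauchyI)
      fix e :: real assume "0 < e"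
      then have "0 < e / K" using K(1) by simp
      then obtain N where N: "\<And>m n. m \<ge> N \<Longrightarrow> n \<ge> N \<Longrightarrow> norm (ptensor_of (Y m) - ptensor_of (Y n)) < e / K"
        using Y(1) unfolding proj_cauchy_iff by (meson CauchyD)
      show "\<exists>M. \<forall>m\<ge>M. \<forall>n\<ge>M. norm (g (Y m) - g (Y n)) < e"
      proof (intro exI[of _ N] allI impI)
        fix m n assume "N \<le> m" "N \<le> n"
        from N[OF this] K(1) have "K * norm (ptensor_of (Y m) - ptensor_of (Y n)) < e"
          by (simp add: field_simps)
        with gd[of "Y m" "Y n"] show "norm (g (Y m) - g (Y n)) < e" by simp
      qed
    qed
    then obtain l where l: "(\<lambda>n. g (Y n)) \<longlonglongrightarrow> l"
      by (metis Cauchy_convergent convergent_def)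
    have "(\<lambda>n. g (X n)) \<longlonglongrightarrow> l" if X: "(\<lambda>n. ptensor_of (X n)) \<longlonglongrightarrow> U" for X
    proof -
      have "(\<lambda>n. K * norm (ptensor_of (X n) - ptensor_of (Y n))) \<longlonglongrightarrow> 0"
        using tendsto_diff[OF X Y(2)]
        by (intro tendsto_mult_right_zero tendsto_norm_zero) simp
      then have "(\<lambda>n. g (X n) - g (Y n)) \<longlonglongrightarrow> 0"
        by (rule Lim_null_comparison[rotated]) (simp add: gd)
      from tendsto_add[OF this l] show ?thesis by simp
    qed
    then show ?thesis by blast
  qed
  then obtain L where L: "\<And>U X. (\<lambda>n. ptensor_of (X n)) \<longlonglongrightarrow> U \<Longrightarrow> (\<lambda>n. g (X n)) \<longlonglongrightarrow> L U"
    by metis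
  have ex: "\<exists>X. (\<lambda>n. ptensor_of (X n)) \<longlonglongrightarrow> U" for U :: "'a ptensor"
    using ptensor_limit_exists by blast
  have Lg: "L (ptensor_of u) = g u" for u
    using L[of "\<lambda>_. u" "ptensor_of u"] LIMSEQ_unique tendsto_const by blast
  have "bounded_linear L"
  proof (rule bounded_linear_intro)
    fix U V :: "'a ptensor" and c :: real
    obtain X Y where X: "(\<lambda>n. ptensor_of (X n)) \<longlonglongrightarrow> U" and Y: "(\<lambda>n. ptensor_of (Y n)) \<longlonglongrightarrow> V"
      using ex by metis
    have "(\<lambda>n. g (X n + Y n)) \<longlonglongrightarrow> L (U + V)"
      by (rule L) (use tendsto_add[OF X Y] in \<open>simp add: linear_add[OF linear_ptensor_of]\<close>)
    moreover have "(\<lambda>n. g (X n + Y n)) \<longlonglongrightarrow> L U + L V"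
      using tendsto_add[OF L[OF X] L[OF Y]] by (simp add: linear_add[OF g(1)])
    ultimately show "L (U + V) = L U + L V" by (rule LIMSEQ_unique)
    have "(\<lambda>n. g (c *\<^sub>R X n)) \<longlonglongrightarrow> L (c *\<^sub>R U)"
      by (rule L) (use tendsto_scaleR[OF tendsto_const X] in \<open>simp add: linear_cmul[OF linear_ptensor_of]\<close>)
    moreover have "(\<lambda>n. g (c *\<^sub>R X n)) \<longlonglongrightarrow> c *\<^sub>R L U"
      using tendsto_scaleR[OF tendsto_const L[OF X]] by (simp add: linear_cmul[OF g(1)])
    ultimately show "L (c *\<^sub>R U) = c *\<^sub>R L U" by (rule LIMSEQ_unique)
    show "norm (L U) \<le> norm U * K"
      by (rule LIMSEQ_le[OF tendsto_norm[OF L[OF X]] tendsto_mult_right[OF tendsto_norm[OF X]]])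
        (use gK in \<open>auto simp: norm_ptensor_of mult.commute\<close>)
  qed
  then show "\<exists>L. bounded_linear L \<and> (\<forall>x y. L (x \<otimes>\<^sub>\<pi> y) = f x y)"
    by (intro exI[of _ L]) (simp add: ptensor_def Lg g(2))
next
  fix L L' :: "'a ptensor \<Rightarrow> 'c"
  assume L: "bounded_linear L \<and> (\<forall>x y. L (x \<otimes>\<^sub>\<pi> y) = f x y)"
    and L': "bounded_linear L' \<and> (\<forall>x y. L' (x \<otimes>\<^sub>\<pi> y) = f x y)"
  have "L (ptensor_of u) = L' (ptensor_of u)" for u
  proof -
    obtain zs where u: "u = formal_eval atensor zs" using atensor_representation by blast
    have "M (ptensor_of u) = formal_eval (\<lambda>x y. M (x \<otimes>\<^sub>\<pi> y)) zs" if "bounded_linear M" for M :: "'a ptensor \<Rightarrow> 'c"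
      unfolding u ptensor_def
      by (simp add: linear_formal_eval[OF linear_ptensor_of] linear_formal_eval bounded_linear.linear that)
    from this[of L] this[of L'] show ?thesis using L L' by simp
  qed
  moreover have "closed {U. L U = L' U}"
    using L L' by (intro closed_Collect_eq linear_continuous_on) auto
  ultimately have "closure (range ptensor_of) \<subseteq> {U. L U = L' U}"
    by (intro closure_minimal) auto
  then show "L = L'" by (auto simp: closure_range_ptensor_of)
qed

instance ptensor :: ("{real_normed_vector, second_countable_topology}") second_countable_topology
proof
  obtain D :: "'a set" where D: "countable D" "\<And>U. open U \<Longrightarrow> U \<noteq> {} \<Longrightarrow> \<exists>d\<in>D. d \<in> U"
    using countable_dense_exists by blast
  have clD: "closure D = UNIV"
  proof -
    have "- closure D = {}" using D(2)[of "- closure D"] closure_subset[of D] by auto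
    then show ?thesis by auto
  qed
  define S :: "'a ptensor set" where "S = formal_eval (\<otimes>\<^sub>\<pi>) ` lists (D \<times> D)"
  have S: "countable S" unfolding S_def using D(1) by simp
  have S0: "0 \<in> S" unfolding S_def by (rule image_eqI[of _ _ "[]"]) auto
  have Sadd: "a + b \<in> S" if "a \<in> S" "b \<in> S" for a b
  proof -
    from that obtain zs ws where "a = formal_eval (\<otimes>\<^sub>\<pi>) zs" "b = formal_eval (\<otimes>\<^sub>\<pi>) ws"
      "zs \<in> lists (D \<times> D)" "ws \<in> lists (D \<times> D)" unfolding S_def by blast
    then show ?thesis unfolding S_def by (intro image_eqI[of _ _ "zs @ ws"]) auto
  qed
  have cladd: "a + b \<in> closure S" if "a \<in> closure S" "b \<in> closure S" for a b
  proof -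
    from that obtain A B where "\<And>n::nat. A n \<in> S" "A \<longlonglongrightarrow> a" "\<And>n::nat. B n \<in> S" "B \<longlonglongrightarrow> b"
      unfolding closure_sequential by blast
    then show ?thesis unfolding closure_sequential
      by (intro exI[of _ "\<lambda>n. A n + B n"]) (auto intro: Sadd tendsto_add)
  qed
  have xy: "x \<otimes>\<^sub>\<pi> y \<in> closure S" for x y
  proof -
    have "x \<in> closure D" "y \<in> closure D" by (simp_all add: clD)
    then obtain A B where "\<And>n::nat. A n \<in> D" "A \<longlonglongrightarrow> x" "\<And>n::nat. B n \<in> D" "B \<longlonglongrightarrow> y"
      unfolding closure_sequential by blast
    moreover from this have "A n \<otimes>\<^sub>\<pi> B n \<in> S" for n
      unfolding S_def by (intro image_eqI[of _ _ "[(A n, B n)]"]) auto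
    ultimately show ?thesis unfolding closure_sequential
      by (intro exI[of _ "\<lambda>n. A n \<otimes>\<^sub>\<pi> B n"]) (auto intro: bounded_bilinear.tendsto[OF bounded_bilinear_ptensor])
  qed
  have "ptensor_of u \<in> closure S" for u
  proof -
    obtain zs where u: "u = formal_eval atensor zs" using atensor_representation by blast
    have "formal_eval (\<otimes>\<^sub>\<pi>) zs \<in> closure S"
    proof (induction zs)
      case Nil
      then show ?case using S0 closure_subset by auto
    next
      case (Cons p zs)
      then show ?case by (cases p) (simp add: cladd xy)
    qed
    then show ?thesis unfolding u linear_formal_eval[OF linear_ptensor_of] ptensor_def .
  qed
  then have "closure (range ptensor_of) \<subseteq> closure S"
    by (intro closure_minimal) auto
  then have clS: "closure S = UNIV" by (auto simp: closure_range_ptensor_of)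
  define \<B> where "\<B> = (\<lambda>(s, q). ball s (real_of_rat q)) ` (S \<times> (UNIV :: rat set))"
  have "countable \<B>" unfolding \<B>_def using S by (intro countable_image countable_SIGMA) auto
  moreover have "topological_basis \<B>"
  proof (rule topological_basisI)
    show "open B'" if "B' \<in> \<B>" for B' using that by (auto simp: \<B>_def)
    fix O' and x :: "'a ptensor" assume "open O'" "x \<in> O'"
    then obtain e where e: "0 < e" "ball x e \<subseteq> O'" by (auto simp: open_contains_ball)
    obtain q where q: "0 < real_of_rat q" "real_of_rat q < e / 2"
      using of_rat_dense[of 0 "e / 2"] e(1) by auto
    have "x \<in> closure S" by (simp add: clS)
    then obtain s where s: "s \<in> S" "dist s x < real_of_rat q"
      using q(1) unfolding closure_approachable by blast
    show "\<exists>B'\<in>\<B>. x \<in> B' \<and> B' \<subseteq> O'"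
    proof (intro bexI conjI)
      show "ball s (real_of_rat q) \<in> \<B>" unfolding \<B>_def using s(1) by force
      show "x \<in> ball s (real_of_rat q)" using s(2) by simp
      have "ball s (real_of_rat q) \<subseteq> ball x e"
      proof
        fix z assume "z \<in> ball s (real_of_rat q)"
        then have "dist x z < real_of_rat q + real_of_rat q"
          using s(2) dist_triangle[of x z s] by (simp add: dist_commute)
        with q(2) show "z \<in> ball x e" by simp
      qed
      with e(2) show "ball s (real_of_rat q) \<subseteq> O'" by blast
    qed
  qed
  ultimately show "\<exists>B::'a ptensor set set. countable B \<and> open = generate_topology B"
    by (intro exI[of _ \<B>] conjI ext)
      (simp_all add: topological_basis_imp_subbasis)
qed

text \<open>
  HOL cannot quantify over types inside a formula, so a statement asserting the existence of a
  Hilbert space has to name one; \<open>ell2\<close> is the infinite-dimensional separable one. All notions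
  below that involve a Hilbert space are defined for an arbitrary one.
\<close>

typedef ell2 = "{f :: nat \<Rightarrow> real. summable (\<lambda>n. (f n)\<^sup>2)}"
  by (rule exI[of _ "\<lambda>_. 0"]) simp

setup_lifting type_definition_ell2

lemma summable_mult_ell2:
  fixes f g :: "nat \<Rightarrow> real"
  assumes "summable (\<lambda>n. (f n)\<^sup>2)" "summable (\<lambda>n. (g n)\<^sup>2)"
  shows "summable (\<lambda>n. f n * g n)"
proof (rule summable_comparison_test'[of "\<lambda>n. (f n)\<^sup>2 + (g n)\<^sup>2" 0])
  show "norm (f n * g n) \<le> (f n)\<^sup>2 + (g n)\<^sup>2" for n
  proof -
    have "0 \<le> \<bar>f n\<bar> * \<bar>g n\<bar>" "2 * (\<bar>f n\<bar> * \<bar>g n\<bar>) \<le> (f n)\<^sup>2 + (g n)\<^sup>2"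
      using sum_squares_bound[of "\<bar>f n\<bar>" "\<bar>g n\<bar>"] by (simp_all add: mult.assoc)
    then show ?thesis unfolding real_norm_def abs_mult by linarith
  qed
qed (intro summable_add assms)

lemma summable_add_ell2:
  fixes f g :: "nat \<Rightarrow> real"
  assumes "summable (\<lambda>n. (f n)\<^sup>2)" "summable (\<lambda>n. (g n)\<^sup>2)"
  shows "summable (\<lambda>n. (f n + g n)\<^sup>2)"
proof -
  have "summable (\<lambda>n. (f n)\<^sup>2 + (g n)\<^sup>2 + 2 * (f n * g n))"
    by (intro summable_add assms summable_mult summable_mult_ell2)
  then show ?thesis by (simp add: power2_sum mult.assoc)
qed

lemma summable_scale_ell2:
  fixes f :: "nat \<Rightarrow> real"
  assumes "summable (\<lambda>n. (f n)\<^sup>2)"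
  shows "summable (\<lambda>n. (c * f n)\<^sup>2)"
  using summable_mult[OF assms, of "c\<^sup>2"] by (simp add: power_mult_distrib)

instantiation ell2 :: real_inner
begin

lift_definition zero_ell2 :: ell2 is "\<lambda>_. 0" by simp

lift_definition plus_ell2 :: "ell2 \<Rightarrow> ell2 \<Rightarrow> ell2" is "\<lambda>f g n. f n + g n"
  by (rule summable_add_ell2)

lift_definition scaleR_ell2 :: "real \<Rightarrow> ell2 \<Rightarrow> ell2" is "\<lambda>c f n. c * f n"
  by (rule summable_scale_ell2)

lift_definition uminus_ell2 :: "ell2 \<Rightarrow> ell2" is "\<lambda>f n. - f n" by simp

lift_definition minus_ell2 :: "ell2 \<Rightarrow> ell2 \<Rightarrow> ell2" is "\<lambda>f g n. f n - g n"
  using summable_add_ell2[of _ "\<lambda>n. - g n" for g] by simp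

lift_definition inner_ell2 :: "ell2 \<Rightarrow> ell2 \<Rightarrow> real" is "\<lambda>f g. \<Sum>n. f n * g n" .

definition norm_ell2 :: "ell2 \<Rightarrow> real" where
  "norm_ell2 x = sqrt (inner x x)"

definition sgn_ell2 :: "ell2 \<Rightarrow> ell2" where
  "sgn_ell2 x = inverse (norm x) *\<^sub>R x"

definition dist_ell2 :: "ell2 \<Rightarrow> ell2 \<Rightarrow> real" where
  "dist_ell2 x y = norm (x - y)"

definition uniformity_ell2 :: "(ell2 \<times> ell2) filter" where
  "uniformity_ell2 = (INF e\<in>{0 <..}. principal {(x, y). dist x y < e})"

definition open_ell2 :: "ell2 set \<Rightarrow> bool" where
  "open_ell2 U \<longleftrightarrow> (\<forall>x\<in>U. \<forall>\<^sub>F (x', y) in uniformity. x' = x \<longrightarrow> y \<in> U)"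

instance
proof
  fix x y z :: ell2 and a b :: real
  show "x + y + z = x + (y + z)" by transfer (simp add: add.assoc)
  show "x + y = y + x" by transfer (simp add: add.commute)
  show "0 + x = x" by transfer simp
  show "- x + x = 0" by transfer simp
  show "x - y = x + - y" by transfer simp
  show "a *\<^sub>R (x + y) = a *\<^sub>R x + a *\<^sub>R y" by transfer (simp add: distrib_left)
  show "(a + b) *\<^sub>R x = a *\<^sub>R x + b *\<^sub>R x" by transfer (simp add: distrib_right)
  show "a *\<^sub>R b *\<^sub>R x = (a * b) *\<^sub>R x" by transfer (simp add: mult.assoc)
  show "1 *\<^sub>R x = x" by transfer simp
  show "sgn x = inverse (norm x) *\<^sub>R x" by (rule sgn_ell2_def)
  show "dist x y = norm (x - y)" by (rule dist_ell2_def)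
  show "uniformity = (INF e\<in>{0 <..}. principal {(x, y::ell2). dist x y < e})"
    by (rule uniformity_ell2_def)
  show "open U = (\<forall>x\<in>U. \<forall>\<^sub>F (x', y) in uniformity. x' = x \<longrightarrow> y \<in> U)" for U :: "ell2 set"
    by (rule open_ell2_def)
  show "inner x y = inner y x" by transfer (simp add: mult.commute)
  show "inner (x + y) z = inner x z + inner y z"
    by transfer (simp add: distrib_right suminf_add summable_mult_ell2)
  show "inner (a *\<^sub>R x) y = a * inner x y"
    by transfer (simp add: mult.assoc suminf_mult summable_mult_ell2)
  show "0 \<le> inner x x"
    by transfer (simp add: suminf_nonneg flip: power2_eq_square)
  show "(inner x x = 0) = (x = 0)"
  proof transfer
    fix f :: "nat \<Rightarrow> real" assume "summable (\<lambda>n. (f n)\<^sup>2)"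
    from suminf_eq_zero_iff[OF this] show "((\<Sum>n. f n * f n) = 0) = (f = (\<lambda>_. 0))"
      by (auto simp flip: power2_eq_square)
  qed
  show "norm x = sqrt (inner x x)" by (rule norm_ell2_def)
qed

end

lemma norm_ell2_square: "(norm x)\<^sup>2 = (\<Sum>n. (Rep_ell2 x n)\<^sup>2)"
  unfolding norm_ell2_def by transfer (simp add: suminf_nonneg flip: power2_eq_square)

lemma sum_le_norm_ell2: "(\<Sum>n<k. (Rep_ell2 x n)\<^sup>2) \<le> (norm x)\<^sup>2"
  unfolding norm_ell2_square using Rep_ell2[of x] by (intro sum_le_suminf) auto

lemma coordinate_le_norm_ell2: "\<bar>Rep_ell2 x n\<bar> \<le> norm x"
proof -
  have "(Rep_ell2 x n)\<^sup>2 \<le> (\<Sum>m<Suc n. (Rep_ell2 x m)\<^sup>2)"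
    by (rule member_le_sum) auto
  also have "\<dots> \<le> (norm x)\<^sup>2" by (rule sum_le_norm_ell2)
  finally show ?thesis using abs_le_square_iff[of "Rep_ell2 x n" "norm x"] by simp
qed

lemma Rep_ell2_diff: "Rep_ell2 (x - y) n = Rep_ell2 x n - Rep_ell2 y n"
  by transfer simp

instance ell2 :: banach
proof
  fix X :: "nat \<Rightarrow> ell2" assume X: "Cauchy X"
  have "Cauchy (\<lambda>m. Rep_ell2 (X m) n)" for n
  proof (rule CauchyI)
    fix e :: real assume "0 < e"
    then obtain M where M: "\<And>m k. M \<le> m \<Longrightarrow> M \<le> k \<Longrightarrow> norm (X m - X k) < e"
      using CauchyD[OF X] by blast
    show "\<exists>M. \<forall>m\<ge>M. \<forall>k\<ge>M. norm (Rep_ell2 (X m) n - Rep_ell2 (X k) n) < e"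
    proof (intro exI[of _ M] allI impI)
      fix m k assume "M \<le> m" "M \<le> k"
      from le_less_trans[OF coordinate_le_norm_ell2[of "X m - X k" n] M[OF this]]
      show "norm (Rep_ell2 (X m) n - Rep_ell2 (X k) n) < e"
        by (simp add: Rep_ell2_diff)
    qed
  qed
  then obtain l where l: "\<And>n. (\<lambda>m. Rep_ell2 (X m) n) \<longlonglongrightarrow> l n"
    unfolding Cauchy_convergent_iff convergent_def by metis
  have partial: "(\<Sum>n<k. (Rep_ell2 (X m) n - l n)\<^sup>2) \<le> e\<^sup>2"
    if M: "\<And>m j. M \<le> m \<Longrightarrow> M \<le> j \<Longrightarrow> norm (X m - X j) < e" and m: "M \<le> m" for M m e k
  proof (rule LIMSEQ_le_const2)
    show "(\<lambda>j. \<Sum>n<k. (Rep_ell2 (X m) n - Rep_ell2 (X j) n)\<^sup>2)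
        \<longlonglongrightarrow> (\<Sum>n<k. (Rep_ell2 (X m) n - l n)\<^sup>2)"
      by (intro tendsto_intros l)
    show "\<exists>N. \<forall>j\<ge>N. (\<Sum>n<k. (Rep_ell2 (X m) n - Rep_ell2 (X j) n)\<^sup>2) \<le> e\<^sup>2"
    proof (intro exI[of _ M] allI impI)
      fix j assume "M \<le> j"
      have "(\<Sum>n<k. (Rep_ell2 (X m) n - Rep_ell2 (X j) n)\<^sup>2) \<le> (norm (X m - X j))\<^sup>2"
        using sum_le_norm_ell2[of "X m - X j" k] by (simp add: Rep_ell2_diff)
      also have "\<dots> \<le> e\<^sup>2"
        using M[OF m \<open>M \<le> j\<close>] by (intro power_mono) auto
      finally show "(\<Sum>n<k. (Rep_ell2 (X m) n - Rep_ell2 (X j) n)\<^sup>2) \<le> e\<^sup>2" .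
    qed
  qed
  have sm: "summable (\<lambda>n. (Rep_ell2 (X m) n - l n)\<^sup>2)"
    if "\<And>m j. M \<le> m \<Longrightarrow> M \<le> j \<Longrightarrow> norm (X m - X j) < e" "M \<le> m" for M m e
    by (rule summableI_nonneg_bounded[of _ "e\<^sup>2"]) (use partial[OF that] in auto)
  obtain M1 where M1: "\<And>m j. M1 \<le> m \<Longrightarrow> M1 \<le> j \<Longrightarrow> norm (X m - X j) < 1"
    using CauchyD[OF X, of 1] by auto
  have "summable (\<lambda>n. (Rep_ell2 (X M1) n + - 1 * (Rep_ell2 (X M1) n - l n))\<^sup>2)"
    by (intro summable_add_ell2 summable_scale_ell2 sm[OF M1]) (use Rep_ell2 in auto)
  then have "summable (\<lambda>n. (l n)\<^sup>2)" by simp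
  then have L: "Rep_ell2 (Abs_ell2 l) = l" by (simp add: Abs_ell2_inverse)
  have "X \<longlonglongrightarrow> Abs_ell2 l"
  proof (rule LIMSEQ_I)
    fix e :: real assume "0 < e"
    then obtain M where M: "\<And>m j. M \<le> m \<Longrightarrow> M \<le> j \<Longrightarrow> norm (X m - X j) < e / 2"
      using CauchyD[OF X, of "e / 2"] by auto
    show "\<exists>N. \<forall>m\<ge>N. norm (X m - Abs_ell2 l) < e"
    proof (intro exI[of _ M] allI impI)
      fix m assume m: "M \<le> m"
      have "(norm (X m - Abs_ell2 l))\<^sup>2 \<le> (e / 2)\<^sup>2"
        unfolding norm_ell2_square Rep_ell2_diff L
        by (rule suminf_le_const[OF sm[OF M m] partial[OF M m]])
      then have "norm (X m - Abs_ell2 l) \<le> e / 2"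
        using \<open>0 < e\<close> by (simp add: power2_le_iff_abs_le)
      with \<open>0 < e\<close> show "norm (X m - Abs_ell2 l) < e" by simp
    qed
  qed
  then show "convergent X" by (auto simp: convergent_def)
qed

definition canonical_map ::
    "'b::banach ptensor \<Rightarrow> ('b \<Rightarrow>\<^sub>L real) \<Rightarrow>\<^sub>L 'b" where
  "canonical_map = (THE L. bounded_linear L \<and>
     (\<forall>u v b. blinfun_apply (L (u \<otimes>\<^sub>\<pi> v)) b = blinfun_apply b v *\<^sub>R u))"

lemma canonical_map:
  shows "bounded_linear (canonical_map :: 'b::banach ptensor \<Rightarrow> _)"
    and "blinfun_apply (canonical_map ((u::'b) \<otimes>\<^sub>\<pi> v)) b = blinfun_apply b v *\<^sub>R u"
proof -
  define f :: "'b \<Rightarrow> 'b \<Rightarrow> ('b \<Rightarrow>\<^sub>L real) \<Rightarrow>\<^sub>L 'b"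
    where "f u v = Blinfun (\<lambda>b. blinfun_apply b v *\<^sub>R u)" for u v
  have f: "blinfun_apply (f u v) b = blinfun_apply b v *\<^sub>R u" for u v b
    unfolding f_def by (subst bounded_linear_Blinfun_apply) (auto intro!: bounded_linear_intros)
  have "bounded_bilinear f"
  proof
    show "\<exists>K. \<forall>u v. norm (f u v) \<le> norm u * norm v * K"
    proof (intro exI[of _ 1] allI)
      fix u v
      show "norm (f u v) \<le> norm u * norm v * 1"
      proof (rule norm_blinfun_bound)
        fix b :: "'b \<Rightarrow>\<^sub>L real"
        have "\<bar>b v\<bar> * norm u \<le> norm b * norm v * norm u"
          using norm_blinfun[of b v] by (intro mult_right_mono) auto
        then show "norm (f u v b) \<le> norm u * norm v * 1 * norm b"
          by (simp add: f mult.commute mult.left_commute)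
      qed simp
    qed
  qed (auto intro!: blinfun_eqI simp: f blinfun.add_left blinfun.add_right blinfun.scaleR_left
      blinfun.scaleR_right scaleR_add_left scaleR_add_right)
  moreover have "(\<forall>u v. L (u \<otimes>\<^sub>\<pi> v) = f u v) \<longleftrightarrow>
      (\<forall>u v b. blinfun_apply (L (u \<otimes>\<^sub>\<pi> v)) b = blinfun_apply b v *\<^sub>R u)" for L
    by (metis blinfun_eqI f)
  ultimately have "\<exists>!L. bounded_linear L \<and>
      (\<forall>u v b. blinfun_apply (L (u \<otimes>\<^sub>\<pi> v)) b = blinfun_apply b v *\<^sub>R (u::'b))"
    using ptensor_universal[of f] by simp
  from theI'[OF this, folded canonical_map_def]
  show "bounded_linear (canonical_map :: 'b ptensor \<Rightarrow> _)"
    and "blinfun_apply (canonical_map ((u::'b) \<otimes>\<^sub>\<pi> v)) b = blinfun_apply b v *\<^sub>R u" by blast+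
qed

definition square_integrable :: "'w measure \<Rightarrow> ('w \<Rightarrow> 'b::real_normed_vector) \<Rightarrow> bool" where
  "square_integrable M Z \<longleftrightarrow>
     Z \<in> borel_measurable M \<and> integrable M (\<lambda>\<omega>. (norm (Z \<omega>))\<^sup>2)"

text \<open>Only used for centered \<open>Y\<close> and \<open>Z\<close>.\<close>

definition tensor_cov ::
    "'w measure \<Rightarrow> ('w \<Rightarrow> 'b::{banach, second_countable_topology}) \<Rightarrow> ('w \<Rightarrow> 'b) \<Rightarrow> 'b ptensor" where
  "tensor_cov M Y Z = (\<integral>\<omega>. Y \<omega> \<otimes>\<^sub>\<pi> Z \<omega> \<partial>M)"

definition epowr :: "ennreal \<Rightarrow> real \<Rightarrow> ennreal" where
  "epowr x p = (if x = \<infinity> then \<infinity> else ennreal (enn2real x powr p))"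

definition Lp_enorm :: "'w measure \<Rightarrow> real \<Rightarrow> ('w \<Rightarrow> 'b::real_normed_vector) \<Rightarrow> ennreal" where
  "Lp_enorm M \<rho> Z = epowr (\<integral>\<^sup>+\<omega>. ennreal (norm (Z \<omega>) powr \<rho>) \<partial>M) (1 / \<rho>)"

text \<open>
  The families \<open>\<eta>\<close> and \<open>\<eta>'\<close> are each i.i.d. with the same law, and independent of each other: the
  joint family indexed by the disjoint union is i.i.d.
\<close>

definition iid_with_copy ::
    "'w measure \<Rightarrow> 'e measure \<Rightarrow> (int \<Rightarrow> 'w \<Rightarrow> 'e) \<Rightarrow> (int \<Rightarrow> 'w \<Rightarrow> 'e) \<Rightarrow> bool" where
  "iid_with_copy M E \<eta> \<eta>' \<longleftrightarrow> prob_space M \<and>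
     prob_space.indep_vars M (\<lambda>_. E) (case_sum \<eta> \<eta>') UNIV \<and>
     (\<forall>j. distr M E (case_sum \<eta> \<eta>' j) = distr M E (\<eta> 0))"

definition past :: "(int \<Rightarrow> 'w \<Rightarrow> 'e) \<Rightarrow> int \<Rightarrow> 'w \<Rightarrow> nat \<Rightarrow> 'e" where
  "past \<eta> i \<omega> k = \<eta> (i - int k) \<omega>"

definition past_coupled ::
    "(int \<Rightarrow> 'w \<Rightarrow> 'e) \<Rightarrow> (int \<Rightarrow> 'w \<Rightarrow> 'e) \<Rightarrow> int \<Rightarrow> 'w \<Rightarrow> nat \<Rightarrow> 'e" where
  "past_coupled \<eta> \<eta>' i \<omega> k = (if i - int k = 0 then \<eta>' 0 \<omega> else \<eta> (i - int k) \<omega>)"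

definition phys_dep ::
    "'w measure \<Rightarrow> (int \<Rightarrow> 'w \<Rightarrow> 'e) \<Rightarrow> (int \<Rightarrow> 'w \<Rightarrow> 'e) \<Rightarrow>
     (real \<Rightarrow> (nat \<Rightarrow> 'e) \<Rightarrow> 'b::real_normed_vector) \<Rightarrow> real \<Rightarrow> nat \<Rightarrow> ennreal" where
  "phys_dep M \<eta> \<eta>' H \<rho> i =
     (SUP t\<in>{0..1}. Lp_enorm M \<rho> (\<lambda>\<omega>. H t (past \<eta> (int i) \<omega>) - H t (past_coupled \<eta> \<eta>' (int i) \<omega>)))"

definition dep_tail ::
    "'w measure \<Rightarrow> (int \<Rightarrow> 'w \<Rightarrow> 'e) \<Rightarrow> (int \<Rightarrow> 'w \<Rightarrow> 'e) \<Rightarrow>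
     (real \<Rightarrow> (nat \<Rightarrow> 'e) \<Rightarrow> 'b::real_normed_vector) \<Rightarrow> real \<Rightarrow> nat \<Rightarrow> ennreal" where
  "dep_tail M \<eta> \<eta>' H \<rho> k = (\<Sum>i. phys_dep M \<eta> \<eta>' H \<rho> (k + i))"

text \<open>
  Triangular arrays \<open>Y i n\<close> are only considered for \<open>1 \<le> i \<le> n\<close>. Measurability of \<open>H t\<close> for
  the product \<open>\<sigma>\<close>-algebra is what makes both \<open>H t (past \<eta> i \<omega>)\<close> and
  \<open>H t (past_coupled \<eta> \<eta>' i \<omega>)\<close> random variables.
\<close>

definition locally_stationary ::
    "'w measure \<Rightarrow> 'e measure \<Rightarrow> (int \<Rightarrow> 'w \<Rightarrow> 'e) \<Rightarrow>
     (real \<Rightarrow> (nat \<Rightarrow> 'e) \<Rightarrow> 'b::real_normed_vector) \<Rightarrow> (nat \<Rightarrow> nat \<Rightarrow> 'w \<Rightarrow> 'b) \<Rightarrow> bool" where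
  "locally_stationary M E \<eta> H Y \<longleftrightarrow>
     (\<forall>t\<in>{0..1}. H t \<in> borel_measurable (PiM UNIV (\<lambda>_. E))) \<and>
     (\<forall>x\<in>space (PiM UNIV (\<lambda>_. E)). continuous_on {0..1} (\<lambda>t. H t x)) \<and>
     (\<forall>n i. 1 \<le> i \<and> i \<le> n \<longrightarrow>
        (\<forall>\<omega>\<in>space M. Y i n \<omega> = H (real i / real n) (past \<eta> (int i) \<omega>)))"

definition lipschitz_L2 ::
    "'w measure \<Rightarrow> (int \<Rightarrow> 'w \<Rightarrow> 'e) \<Rightarrow>
     (real \<Rightarrow> (nat \<Rightarrow> 'e) \<Rightarrow> 'b::real_normed_vector) \<Rightarrow> bool" where
  "lipschitz_L2 M \<eta> H \<longleftrightarrow>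
     (\<forall>i. (SUP (s, t)\<in>{(s, t). 0 \<le> s \<and> s < t \<and> t \<le> 1}.
        Lp_enorm M 2 (\<lambda>\<omega>. H t (past \<eta> i \<omega>) - H s (past \<eta> i \<omega>)) / ennreal (t - s)) < \<infinity>)"

definition moment_dependence_condition ::
    "'w measure \<Rightarrow> 'e measure \<Rightarrow> (int \<Rightarrow> 'w \<Rightarrow> 'e) \<Rightarrow> (int \<Rightarrow> 'w \<Rightarrow> 'e) \<Rightarrow>
     (real \<Rightarrow> (nat \<Rightarrow> 'e) \<Rightarrow> 'b) \<Rightarrow> (real \<Rightarrow> 'b) \<Rightarrow>
     (nat \<Rightarrow> nat \<Rightarrow> 'w \<Rightarrow> 'b::{banach, second_countable_topology}) \<Rightarrow> real \<Rightarrow> bool" where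
  "moment_dependence_condition M E \<eta> \<eta>' H \<mu> X \<kappa> \<longleftrightarrow>
     0 < \<kappa> \<and>
     (\<exists>\<epsilon>. locally_stationary M E \<eta> H \<epsilon> \<and>
        (\<forall>n i. 1 \<le> i \<and> i \<le> n \<longrightarrow>
           integrable M (\<epsilon> i n) \<and> (\<integral>\<omega>. \<epsilon> i n \<omega> \<partial>M) = 0 \<and>
           (\<forall>\<omega>\<in>space M. X i n \<omega> = \<mu> (real i / real n) + \<epsilon> i n \<omega>))) \<and>
     lipschitz_L2 M \<eta> H \<and>
     (SUP t\<in>{0..1}. \<integral>\<^sup>+\<omega>. ennreal (norm (H t (past \<eta> 0 \<omega>)) powr (2 + \<kappa>)) \<partial>M) < \<infinity> \<and>
     (\<Sum>\<^sub>\<infinity>k\<in>(UNIV :: int set). dep_tail M \<eta> \<eta>' H (2 + \<kappa>) (nat \<bar>k\<bar>)) < \<infinity> \<and>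
     (\<forall>i j. i \<le> j \<longrightarrow> phys_dep M \<eta> \<eta>' H (2 + \<kappa>) j \<le> phys_dep M \<eta> \<eta>' H (2 + \<kappa>) i)"

definition local_lrv ::
    "'w measure \<Rightarrow> (int \<Rightarrow> 'w \<Rightarrow> 'e) \<Rightarrow>
     (real \<Rightarrow> (nat \<Rightarrow> 'e) \<Rightarrow> 'b::{banach, second_countable_topology}) \<Rightarrow> real \<Rightarrow> 'b ptensor" where
  "local_lrv M \<eta> H t =
     (\<Sum>\<^sub>\<infinity>i\<in>(UNIV :: int set).
        tensor_cov M (\<lambda>\<omega>. H t (past \<eta> i \<omega>)) (\<lambda>\<omega>. H t (past \<eta> 0 \<omega>)))"

text \<open>Zero-based: \<open>e k\<close> and \<open>e' k\<close> are the \<open>(k + 1)\<close>-st basis vector and coordinate functional.\<close>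

definition schauder_basis ::
    "(nat \<Rightarrow> 'b::real_normed_vector) \<Rightarrow> (nat \<Rightarrow> 'b \<Rightarrow>\<^sub>L real) \<Rightarrow> bool" where
  "schauder_basis e e' \<longleftrightarrow>
     (\<forall>x. \<exists>!a. (\<lambda>k. a k *\<^sub>R e k) sums x) \<and> (\<forall>x. (\<lambda>k. e' k x *\<^sub>R e k) sums x)"

definition basis_tail ::
    "(nat \<Rightarrow> 'b::real_normed_vector) \<Rightarrow> (nat \<Rightarrow> 'b \<Rightarrow>\<^sub>L real) \<Rightarrow> nat \<Rightarrow> 'b \<Rightarrow> 'b" where
  "basis_tail e e' k x = x - (\<Sum>i<k. e' i x *\<^sub>R e i)"

text \<open>Functions on \<open>B \<times> [0,1]\<close> are curried, and their values for second arguments outside \<open>[0,1]\<close> are irrelevant.\<close>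

definition tail_class ::
    "(nat \<Rightarrow> 'b::real_normed_vector) \<Rightarrow> (nat \<Rightarrow> 'b \<Rightarrow>\<^sub>L real) \<Rightarrow> nat \<Rightarrow> ('b \<Rightarrow> real \<Rightarrow> real) set" where
  "tail_class e e' k =
     {\<lambda>x u. blinfun_apply b (basis_tail e e' k x) * (if u \<le> t then 1 else 0) | b t.
        norm b \<le> 1 \<and> t \<in> {0..1}}"

definition array_norm ::
    "'w measure \<Rightarrow> (nat \<Rightarrow> nat \<Rightarrow> 'w \<Rightarrow> 'b) \<Rightarrow> nat \<Rightarrow> ('b \<Rightarrow> real \<Rightarrow> real) \<Rightarrow> ennreal" where
  "array_norm M X n f =
     epowr ((\<Sum>i=1..n. \<integral>\<^sup>+\<omega>. ennreal (\<bar>f (X i n \<omega>) (real i / real n)\<bar>\<^sup>2) \<partial>M) / of_nat n) (1 / 2)"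

text \<open>Here and below, \<open>\<delta>\<close> stands for the physical dependence measure with exponent 2.\<close>

definition array_V ::
    "'w measure \<Rightarrow> (nat \<Rightarrow> nat \<Rightarrow> 'w \<Rightarrow> 'b) \<Rightarrow> (nat \<Rightarrow> ennreal) \<Rightarrow> real \<Rightarrow> nat \<Rightarrow>
     ('b \<Rightarrow> real \<Rightarrow> real) \<Rightarrow> ennreal" where
  "array_V M X \<delta> D n f =
     array_norm M X n f + (\<Sum>i. min (array_norm M X n f) (ennreal D * \<delta> (Suc i)))"

text \<open>
  The bracket functions are arbitrary, except that the expectations in \<open>V (u - l)\<close> have to make
  sense, which requires Borel measurability in the first argument.
\<close>

definition bracketing_number ::
    "(('b::topological_space \<Rightarrow> real \<Rightarrow> real) \<Rightarrow> ennreal) \<Rightarrow> ('b \<Rightarrow> real \<Rightarrow> real) set \<Rightarrow>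
     real \<Rightarrow> enat" where
  "bracketing_number V F \<epsilon> =
     (INF \<B>\<in>{\<B>. finite \<B> \<and>
         (\<forall>(l, u)\<in>\<B>. (\<forall>s\<in>{0..1}. (\<lambda>x. l x s) \<in> borel_measurable borel \<and>
                                  (\<lambda>x. u x s) \<in> borel_measurable borel) \<and>
                     V (\<lambda>x s. u x s - l x s) \<le> ennreal \<epsilon>) \<and>
         (\<forall>f\<in>F. \<exists>(l, u)\<in>\<B>. \<forall>x. \<forall>s\<in>{0..1}. l x s \<le> f x s \<and> f x s \<le> u x s)}.
       enat (card \<B>))"

definition entropy_integrand :: "enat \<Rightarrow> ennreal" where
  "entropy_integrand N =
     (case N of enat m \<Rightarrow> ennreal (sqrt (max 1 (ln (real m)))) | \<infinity> \<Rightarrow> \<infinity>)"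

definition q_star :: "(nat \<Rightarrow> ennreal) \<Rightarrow> real \<Rightarrow> nat" where
  "q_star \<delta> x = (LEAST q. 1 \<le> q \<and> (\<Sum>j. \<delta> (q + j)) \<le> ennreal (real q * x))"

definition r_trunc :: "(nat \<Rightarrow> ennreal) \<Rightarrow> real \<Rightarrow> real" where
  "r_trunc \<delta> d = (GREATEST r. 0 < r \<and> real (q_star \<delta> r) * r \<le> d)"

definition m_trunc :: "(nat \<Rightarrow> ennreal) \<Rightarrow> real \<Rightarrow> nat \<Rightarrow> real \<Rightarrow> enat \<Rightarrow> real" where
  "m_trunc \<delta> D n d N =
     (case N of
        enat k \<Rightarrow> r_trunc \<delta> (d / D) * D * sqrt (real n) / sqrt (max 1 (ln (real k)))
      | \<infinity> \<Rightarrow> 0)"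

text \<open>
  The bounds \<open>\<sigma> k\<close> are taken positive because \<open>r_trunc\<close>, as a maximum over positive reals, is
  meaningless at \<open>0\<close>.
\<close>

definition tail_entropy_condition ::
    "'w measure \<Rightarrow> (int \<Rightarrow> 'w \<Rightarrow> 'e) \<Rightarrow> (int \<Rightarrow> 'w \<Rightarrow> 'e) \<Rightarrow>
     (real \<Rightarrow> (nat \<Rightarrow> 'e) \<Rightarrow> 'b) \<Rightarrow> (nat \<Rightarrow> nat \<Rightarrow> 'w \<Rightarrow> 'b) \<Rightarrow>
     (nat \<Rightarrow> 'b::real_normed_vector) \<Rightarrow> (nat \<Rightarrow> 'b \<Rightarrow>\<^sub>L real) \<Rightarrow> bool" where
  "tail_entropy_condition M \<eta> \<eta>' H X e e' \<longleftrightarrow>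
     (let \<delta> = phys_dep M \<eta> \<eta>' H 2; \<G> = tail_class e e'; T = basis_tail e e' in
      \<exists>D>0. (\<forall>k\<ge>1. \<forall>n\<ge>1. \<forall>f\<in>\<G> k. array_norm M X n f \<le> ennreal D) \<and>
      (let V = array_V M X \<delta> D; N = (\<lambda>n k \<epsilon>. bracketing_number (V n) (\<G> k) \<epsilon>) in
       \<exists>\<sigma> :: nat \<Rightarrow> real.
         (\<forall>k\<ge>1. 0 < \<sigma> k \<and> (\<forall>n\<ge>1. \<forall>f\<in>\<G> k. V n f \<le> ennreal (\<sigma> k))) \<and>
         (let I = (\<lambda>k. limsup (\<lambda>n. \<integral>\<^sup>+\<epsilon>\<in>{0..\<sigma> k}. entropy_integrand (N n k \<epsilon>) \<partial>lborel)) in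
            (\<forall>k\<ge>1. I k < \<infinity>) \<and> I \<longlonglongrightarrow> 0) \<and>
         (\<exists>c :: nat \<Rightarrow> real. c \<longlonglongrightarrow> 0 \<and>
            (\<forall>k\<ge>1. \<forall>n\<ge>1.
               (\<Sum>i=1..n. \<integral>\<^sup>+\<omega>.
                  (if norm (T k (X i n \<omega>)) > m_trunc \<delta> D n (\<sigma> k) (N n k (\<sigma> k / 2)) / 4
                   then ennreal (norm (T k (X i n \<omega>))) else 0) \<partial>M) / ennreal (sqrt (real n))
               \<le> ennreal (c k)))))"

definition block_length_condition ::
    "'w measure \<Rightarrow> (int \<Rightarrow> 'w \<Rightarrow> 'e) \<Rightarrow> (int \<Rightarrow> 'w \<Rightarrow> 'e) \<Rightarrow>
     (real \<Rightarrow> (nat \<Rightarrow> 'e) \<Rightarrow> 'b::real_normed_vector) \<Rightarrow> real \<Rightarrow> bool" where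
  "block_length_condition M \<eta> \<eta>' H \<kappa> \<longleftrightarrow>
     (\<exists>l s :: nat \<Rightarrow> nat.
        filterlim l at_top sequentially \<and> filterlim s at_top sequentially \<and>
        (\<lambda>n. real (s n)) \<in> o(\<lambda>n. real (l n)) \<and>
        (\<lambda>n. ennreal (sqrt (real n)) * dep_tail M \<eta> \<eta>' H (2 + \<kappa>) (s n)) \<longlonglongrightarrow> 0 \<and>
        (\<lambda>n. real (l n) powr (2 + 2 / \<kappa>)) \<in> o(\<lambda>n. real n))"

definition partial_mean ::
    "(nat \<Rightarrow> nat \<Rightarrow> 'w \<Rightarrow> 'b::real_vector) \<Rightarrow> nat \<Rightarrow> real \<Rightarrow> 'w \<Rightarrow> 'b" where
  "partial_mean X n t \<omega> = (1 / real n) *\<^sub>R (\<Sum>i=1..nat \<lfloor>t * real n\<rfloor>. X i n \<omega>)"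

definition partial_sum_process ::
    "'w measure \<Rightarrow> (nat \<Rightarrow> nat \<Rightarrow> 'w \<Rightarrow> 'b::{banach, second_countable_topology}) \<Rightarrow>
     nat \<Rightarrow> real \<Rightarrow> 'w \<Rightarrow> 'b" where
  "partial_sum_process M X n t \<omega> =
     sqrt (real n) *\<^sub>R (partial_mean X n t \<omega> - (\<integral>\<omega>'. partial_mean X n t \<omega>' \<partial>M))"

text \<open>
  Elements of \<open>D([0,1], B)\<close> are represented by functions on \<open>real\<close>, whose values outside \<open>[0,1]\<close>
  are ignored by all of the following notions.
\<close>

definition cadlag :: "(real \<Rightarrow> 'b::topological_space) \<Rightarrow> bool" where
  "cadlag x \<longleftrightarrow>
     (\<forall>t\<in>{0..<1}. (x \<longlongrightarrow> x t) (at_right t)) \<and> (\<forall>t\<in>{0<..1}. \<exists>l. (x \<longlongrightarrow> l) (at_left t))"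

definition skorokhod_dist :: "(real \<Rightarrow> 'b::real_normed_vector) \<Rightarrow> (real \<Rightarrow> 'b) \<Rightarrow> real" where
  "skorokhod_dist x y = Inf {r. 0 \<le> r \<and>
     (\<exists>\<phi>. strict_mono_on {0..1} \<phi> \<and> \<phi> ` {0..1} = {0..1} \<and>
        (\<forall>t\<in>{0..1}. \<bar>\<phi> t - t\<bar> \<le> r \<and> norm (x t - y (\<phi> t)) \<le> r))}"

definition skorokhod_continuous :: "((real \<Rightarrow> 'b::real_normed_vector) \<Rightarrow> real) \<Rightarrow> bool" where
  "skorokhod_continuous F \<longleftrightarrow>
     (\<forall>x. cadlag x \<longrightarrow> (\<forall>e>0. \<exists>d>0. \<forall>y. cadlag y \<and> skorokhod_dist x y < d \<longrightarrow> \<bar>F y - F x\<bar> < e))"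

text \<open>
  For separable \<open>B\<close> the Borel \<open>\<sigma>\<close>-algebra of \<open>D([0,1], B)\<close> is generated by the evaluations, so
  that the functions integrated here are measurable when the processes consist of random variables
  and have cadlag paths.
\<close>

definition weak_limit_D ::
    "'w measure \<Rightarrow> (nat \<Rightarrow> real \<Rightarrow> 'w \<Rightarrow> 'b::real_normed_vector) \<Rightarrow>
     'g measure \<Rightarrow> (real \<Rightarrow> 'g \<Rightarrow> 'b) \<Rightarrow> bool" where
  "weak_limit_D M Y N G \<longleftrightarrow>
     (\<forall>n. \<forall>\<omega>\<in>space M. cadlag (\<lambda>t. Y n t \<omega>)) \<and> (\<forall>\<omega>\<in>space N. cadlag (\<lambda>t. G t \<omega>)) \<and>
     (\<forall>F. skorokhod_continuous F \<and> (\<exists>K. \<forall>x. cadlag x \<longrightarrow> \<bar>F x\<bar> \<le> K) \<longrightarrow>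
        (\<lambda>n. \<integral>\<omega>. F (\<lambda>t. Y n t \<omega>) \<partial>M) \<longlonglongrightarrow> (\<integral>\<omega>. F (\<lambda>t. G t \<omega>) \<partial>N))"

text \<open>Degenerate normal laws are included.\<close>

definition centered_normal :: "'w measure \<Rightarrow> ('w \<Rightarrow> real) \<Rightarrow> bool" where
  "centered_normal M Z \<longleftrightarrow> Z \<in> borel_measurable M \<and>
     ((AE \<omega> in M. Z \<omega> = 0) \<or> (\<exists>s>0. distributed M lborel Z (normal_density 0 s)))"

definition centered_gaussian_family :: "'w measure \<Rightarrow> 'i set \<Rightarrow> ('i \<Rightarrow> 'w \<Rightarrow> real) \<Rightarrow> bool" where
  "centered_gaussian_family M J Z \<longleftrightarrow>
     (\<forall>K c. finite K \<and> K \<subseteq> J \<longrightarrow> centered_normal M (\<lambda>\<omega>. \<Sum>j\<in>K. c j * Z j \<omega>))"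

text \<open>
  Square integrability follows from Gaussianity by Fernique's theorem; it is listed because
  \<open>tensor_cov\<close> is the covariance only for square-integrable random variables.
\<close>

definition centered_gaussian_process ::
    "'g measure \<Rightarrow> (real \<Rightarrow> 'g \<Rightarrow> 'b::real_normed_vector) \<Rightarrow> bool" where
  "centered_gaussian_process N G \<longleftrightarrow>
     (\<forall>t\<in>{0..1}. square_integrable N (G t)) \<and>
     centered_gaussian_family N ({0..1} \<times> (UNIV :: ('b \<Rightarrow>\<^sub>L real) set))
       (\<lambda>(t, b) \<omega>. blinfun_apply b (G t \<omega>))"

definition cylindrical_brownian_motion ::
    "'p measure \<Rightarrow> (real \<Rightarrow> 'h::{real_inner, complete_space} \<Rightarrow> 'p \<Rightarrow> real) \<Rightarrow> bool" where
  "cylindrical_brownian_motion P W \<longleftrightarrow>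
     (\<forall>t\<in>{0..1}. \<forall>a g h. AE \<omega> in P. W t (a *\<^sub>R g + h) \<omega> = a * W t g \<omega> + W t h \<omega>) \<and>
     centered_gaussian_family P ({0..1} \<times> UNIV) (\<lambda>(t, h). W t h) \<and>
     (\<forall>s\<in>{0..1}. \<forall>t\<in>{0..1}. \<forall>g h. (\<integral>\<omega>. W s g \<omega> * W t h \<omega> \<partial>P) = min s t * (g \<bullet> h)) \<and>
     (\<forall>h. AE \<omega> in P. continuous_on {0..1} (\<lambda>t. W t h \<omega>))"

text \<open>
  A list of triples \<open>(a, b, h)\<close> encodes the step function \<open>\<Sum> 1_(a,b] h\<close>, whose integral is
  \<open>\<Sum> W(b)h - W(a)h\<close>; the integral extends to \<open>L\<^sup>2([0,t], H)\<close> as an isometry.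
\<close>

definition step_value :: "(real \<times> real \<times> 'h::real_vector) list \<Rightarrow> real \<Rightarrow> 'h" where
  "step_value p u = (\<Sum>(a, b, h)\<leftarrow>p. if a < u \<and> u \<le> b then h else 0)"

definition step_integral ::
    "(real \<Rightarrow> 'h \<Rightarrow> 'p \<Rightarrow> real) \<Rightarrow> (real \<times> real \<times> 'h) list \<Rightarrow> 'p \<Rightarrow> real" where
  "step_integral W p \<omega> = (\<Sum>(a, b, h)\<leftarrow>p. W b h \<omega> - W a h \<omega>)"

definition has_wiener_integral ::
    "'p measure \<Rightarrow> (real \<Rightarrow> 'h::{real_inner, complete_space} \<Rightarrow> 'p \<Rightarrow> real) \<Rightarrow>
     (real \<Rightarrow> 'h) \<Rightarrow> real \<Rightarrow> ('p \<Rightarrow> real) \<Rightarrow> bool" where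
  "has_wiener_integral P W f t Z \<longleftrightarrow>
     set_borel_measurable lborel {0..t} f \<and> Z \<in> borel_measurable P \<and>
     (\<exists>p :: nat \<Rightarrow> (real \<times> real \<times> 'h) list.
        (\<forall>n. \<forall>(a, b, h)\<in>set (p n). 0 \<le> a \<and> a \<le> b \<and> b \<le> t) \<and>
        (\<lambda>n. \<integral>\<^sup>+u\<in>{0..t}. ennreal ((norm (f u - step_value (p n) u))\<^sup>2) \<partial>lborel) \<longlonglongrightarrow> 0 \<and>
        (\<lambda>n. \<integral>\<^sup>+\<omega>. ennreal ((Z \<omega> - step_integral W (p n) \<omega>)\<^sup>2) \<partial>P) \<longlonglongrightarrow> 0)"

text \<open>The Hilbert space is identified with its dual.\<close>

definition is_adjoint ::
    "('h::real_inner \<Rightarrow>\<^sub>L 'b::real_normed_vector) \<Rightarrow> (('b \<Rightarrow>\<^sub>L real) \<Rightarrow>\<^sub>L 'h) \<Rightarrow> bool" where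
  "is_adjoint S S' \<longleftrightarrow> (\<forall>b h. blinfun_apply S' b \<bullet> h = blinfun_apply b (blinfun_apply S h))"

text \<open>\<open>Z\<close> is (a version of) the integral over \<open>[0,t]\<close> of the operator function with adjoints \<open>\<sigma>'\<close>.\<close>

definition has_operator_integral ::
    "'p measure \<Rightarrow> (real \<Rightarrow> 'h::{real_inner, complete_space} \<Rightarrow> 'p \<Rightarrow> real) \<Rightarrow>
     (real \<Rightarrow> ('b::real_normed_vector \<Rightarrow>\<^sub>L real) \<Rightarrow>\<^sub>L 'h) \<Rightarrow> real \<Rightarrow> ('p \<Rightarrow> 'b) \<Rightarrow> bool" where
  "has_operator_integral P W \<sigma>' t Z \<longleftrightarrow>
     Z \<in> borel_measurable P \<and>
     (\<forall>b. has_wiener_integral P W (\<lambda>u. blinfun_apply (\<sigma>' u) b) t (\<lambda>\<omega>. blinfun_apply b (Z \<omega>)))"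

text \<open>
  The product \<open>\<sigma>\<close>-algebra on paths restricts to the Borel \<open>\<sigma>\<close>-algebra of \<open>D([0,1], B)\<close>; for
  processes with cadlag paths this is equality in law on \<open>D([0,1], B)\<close>.
\<close>

definition equal_in_law ::
    "'p measure \<Rightarrow> (real \<Rightarrow> 'p \<Rightarrow> 'b::topological_space) \<Rightarrow> 'g measure \<Rightarrow> (real \<Rightarrow> 'g \<Rightarrow> 'b) \<Rightarrow> bool" where
  "equal_in_law P Y N G \<longleftrightarrow>
     distr P (PiM {0..1} (\<lambda>_. borel)) (\<lambda>\<omega>. \<lambda>t\<in>{0..1}. Y t \<omega>) =
     distr N (PiM {0..1} (\<lambda>_. borel)) (\<lambda>\<omega>. \<lambda>t\<in>{0..1}. G t \<omega>)"

end

theory Submission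
  imports Defs
begin

text \<open>
  Write \<open>U\<close> for the local long-run variance. Replacing the innovations up to time \<open>0\<close> one at a
  time by fresh ones shows that the series defining \<open>U u\<close> converges absolutely, and comparison with
  the variances of partial sums shows that \<open>U u\<close> is a symmetric nonnegative tensor. Pivoted Cholesky
  elimination along the coordinate functionals then factors \<open>\<Phi>(U u) = \<sigma>(u) \<sigma>\<^sup>*(u)\<close> through \<open>\<ell>\<^sup>2\<close>,
  measurably in \<open>u\<close>; approximability of \<open>U u\<close> by elementary tensors makes the elimination exhaust
  \<open>U u\<close>.

  The covariance of \<open>G\<close> says that \<open>b(G t)\<close> and \<open>1\<^bsub>[0,t]\<^esub> \<sigma>\<^sup>* b \<in> L\<^sup>2([0,1], \<ell>\<^sup>2)\<close> have the
  same inner products. This isometry need not be defined on all of \<open>L\<^sup>2([0,1], \<ell>\<^sup>2)\<close>, but with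
  independent standard normals adjoined it extends to the functions \<open>1\<^bsub>[0,t]\<^esub> h\<close>, whose images
  are the values \<open>W(t)h\<close>. So \<open>G\<close> itself, on the enlarged probability space, is the integral of \<open>\<sigma>\<close>
  with respect to \<open>W\<close>.
\<close>

section \<open>Norming functionals and uniform boundedness\<close>

text \<open>The basis enters through its coordinate functionals: finite combinations of the
  \<open>e' k\<close> approximate every functional weak-star with bounded norms, so one list of
  pivots serves all tensors \<open>U u\<close>. Since this list does not depend on \<open>u\<close>,
  each entry of the Cholesky factor is an arithmetic expression with a square root in finitely many
  values of \<open>tensor_form (U u)\<close>, and measurability in \<open>u\<close> needs no
  selection argument.

  The same elimination is run again on the Gram kernel of functions in L^2((0,1], l^2). The
  functionals of \<open>G\<close> and the wanted values of \<open>W\<close> are the two halves of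
  one index set, so neither closed subspaces nor projections have to be formed: the residual
  \<open>klim R v\<close> left by the pivots of the left half is the Gram kernel of the components
  orthogonal to that half. It need not vanish on the right half, because the values of the adjoints
  need not span l^2; a second elimination, of this residual, tells which combinations of the
  adjoined normals carry it.

  Identities in \<open>B\<close> are reduced to scalar ones by norming functionals; uniform
  boundedness bounds the basis projections of a functional.\<close>

definition sublinear :: "('a::real_vector \<Rightarrow> real) \<Rightarrow> bool" where
  "sublinear p \<longleftrightarrow> (\<forall>x y. p (x + y) \<le> p x + p y) \<and> (\<forall>c\<ge>0. \<forall>x. p (c *\<^sub>R x) = c * p x)"

lemma sublinear_add: "sublinear p \<Longrightarrow> p (x + y) \<le> p x + p y"
  and sublinear_scale: "sublinear p \<Longrightarrow> 0 \<le> c \<Longrightarrow> p (c *\<^sub>R x) = c * p x"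
  by (auto simp: sublinear_def)

lemma sublinear_zero: "sublinear p \<Longrightarrow> p 0 = 0"
  using sublinear_scale[of p 0 0] by simp

lemma sublinear_neg: "sublinear p \<Longrightarrow> - p (- x) \<le> p x"
  using sublinear_add[of p x "- x"] sublinear_zero[of p] by simp

text \<open>One inequality for positive \<open>c\<close> suffices: applied to
  \<open>inverse c\<close> and \<open>c *\<^sub>R x\<close> it gives the reverse one.\<close>

lemma sublinearI:
  assumes "\<And>x y. p (x + y) \<le> p x + p y" "\<And>c x. 0 < c \<Longrightarrow> p (c *\<^sub>R x) \<le> c * p x" "p 0 = 0"
  shows "sublinear p"
proof -
  have "p (c *\<^sub>R x) = c * p x" if "0 \<le> c" for c x
  proof (cases "c = 0")
    case False
    then have c: "0 < c" using that by simp
    have "p x \<le> inverse c * p (c *\<^sub>R x)" using assms(2)[of "inverse c" "c *\<^sub>R x"] c by simp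
    then have "c * p x \<le> p (c *\<^sub>R x)" using c by (simp add: field_simps)
    with assms(2)[OF c, of x] show ?thesis by simp
  qed (simp add: assms)
  then show ?thesis using assms by (auto simp: sublinear_def)
qed

text \<open>Decreasing \<open>p\<close> along the ray through \<open>- a\<close> until it is linear there.\<close>

definition sublinear_shrink :: "('a::real_vector \<Rightarrow> real) \<Rightarrow> 'a \<Rightarrow> 'a \<Rightarrow> real" where
  "sublinear_shrink p a x = (INF t\<in>{0..}. p (x + t *\<^sub>R a) - t * p a)"

text \<open>Subadditivity bounds all competitors below by \<open>- p (- x)\<close>, so the infimum
  is finite. The competitor \<open>t = 1\<close> at \<open>- a\<close> gives the last claim, which
  forces \<open>q (- a) = - q a\<close> for every \<open>q\<close> that shrinking along
  \<open>a\<close> leaves unchanged.\<close>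

lemma sublinear_shrink:
  assumes p: "sublinear p"
  shows "sublinear (sublinear_shrink p a)" "sublinear_shrink p a x \<le> p x"
    "sublinear_shrink p a (- a) \<le> - p a"
proof -
  have bound: "- p (- x) \<le> p (x + t *\<^sub>R a) - t * p a" if "0 \<le> t" for t x
    using sublinear_add[OF p, of "x + t *\<^sub>R a" "- x"] sublinear_scale[OF p that, of a] by simp
  then have bdd: "bdd_below ((\<lambda>t. p (x + t *\<^sub>R a) - t * p a) ` {0..})" for x
    by (intro bdd_belowI2[of _ "- p (- x)"]) auto
  have le: "sublinear_shrink p a x \<le> p (x + t *\<^sub>R a) - t * p a" if "0 \<le> t" for t x
    unfolding sublinear_shrink_def by (rule cINF_lower[OF bdd]) (use that in auto)
  have ge: "c \<le> sublinear_shrink p a x" if "\<And>t. 0 \<le> t \<Longrightarrow> c \<le> p (x + t *\<^sub>R a) - t * p a" for c x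
    unfolding sublinear_shrink_def by (rule cINF_greatest) (use that in auto)
  show "sublinear_shrink p a x \<le> p x" for x using le[of 0 x] by simp
  show "sublinear_shrink p a (- a) \<le> - p a" using le[of 1 "- a"] sublinear_zero[OF p] by simp
  show "sublinear (sublinear_shrink p a)"
  proof (rule sublinearI)
    fix x y
    \<comment> \<open>The competitors \<open>t\<close> for \<open>x\<close> and \<open>s\<close> for
      \<open>y\<close> combine to the competitor \<open>s + t\<close> for \<open>x + y\<close>; the
      two infima are then taken one after the other.\<close>
    have "sublinear_shrink p a (x + y) - (p (y + s *\<^sub>R a) - s * p a) \<le> p (x + t *\<^sub>R a) - t * p a"
      if "0 \<le> s" "0 \<le> t" for s t
      using le[of "s + t" "x + y"] sublinear_add[OF p, of "x + t *\<^sub>R a" "y + s *\<^sub>R a"] that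
      by (simp add: algebra_simps)
    then have "sublinear_shrink p a (x + y) - (p (y + s *\<^sub>R a) - s * p a) \<le> sublinear_shrink p a x"
      if "0 \<le> s" for s
      using ge that by blast
    then have "sublinear_shrink p a (x + y) - sublinear_shrink p a x \<le> p (y + s *\<^sub>R a) - s * p a"
      if "0 \<le> s" for s
      using that[THEN \<open>\<And>s. 0 \<le> s \<Longrightarrow> sublinear_shrink p a (x + y) - (p (y + s *\<^sub>R a) - s * p a) \<le> sublinear_shrink p a x\<close>] by simp
    then show "sublinear_shrink p a (x + y) \<le> sublinear_shrink p a x + sublinear_shrink p a y"
      using ge[of "sublinear_shrink p a (x + y) - sublinear_shrink p a x" y] by simp
  next
    fix c :: real and x assume c: "0 < c"
    have "sublinear_shrink p a (c *\<^sub>R x) / c \<le> p (x + t *\<^sub>R a) - t * p a" if "0 \<le> t" for t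
      using le[of "c * t" "c *\<^sub>R x"] c that sublinear_scale[OF p, of c "x + t *\<^sub>R a"]
      by (simp add: field_simps scaleR_add_right)
    then show "sublinear_shrink p a (c *\<^sub>R x) \<le> c * sublinear_shrink p a x"
      using ge[of "sublinear_shrink p a (c *\<^sub>R x) / c" x] c by (simp add: field_simps)
  next
    show "sublinear_shrink p a 0 = 0"
      by (rule antisym) (use le[of 0 0] ge[of 0 0] sublinear_scale[OF p] sublinear_zero[OF p] in auto)
  qed
qed

text \<open>Zorn's lemma for the reversed order, so that upper bounds of chains are pointwise
  infima. They are finite because members of the chain stay above \<open>- p (- x)\<close>, and
  subadditive because of two members \<open>f\<close> and \<open>g\<close> the smaller one can
  replace the other in \<open>f x + g y\<close>.\<close>

lemma minimal_sublinear_exists: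
  fixes p :: "'a::real_vector \<Rightarrow> real"
  assumes p: "sublinear p"
  obtains q where "sublinear q" "q \<le> p" "\<And>r. sublinear r \<Longrightarrow> r \<le> q \<Longrightarrow> r = q"
proof -
  define A where "A = {q. sublinear q \<and> q \<le> p}"
  define r where "r = {(f, g). f \<in> A \<and> g \<in> A \<and> g \<le> f}"
  have Field: "Field r = A" by (auto simp: r_def Field_def)
  have po: "Partial_order r"
    unfolding partial_order_on_def preorder_on_def Field
    by (auto simp: refl_on_def trans_def antisym_def r_def intro: order_trans)
  have "\<exists>u\<in>Field r. \<forall>a\<in>C. (a, u) \<in> r" if C: "C \<in> Chains r" for C
  proof (cases "C = {}")
    case True
    then show ?thesis using p unfolding Field A_def by blast
  next
    case False
    have CA: "C \<subseteq> A" using C by (auto simp: Chains_def r_def)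
    have tot: "f \<le> g \<or> g \<le> f" if "f \<in> C" "g \<in> C" for f g using C that by (auto simp: Chains_def r_def)
    have sl: "sublinear f" "f \<le> p" if "f \<in> C" for f using CA that by (auto simp: A_def)
    define u where "u x = (INF f\<in>C. f x)" for x
    have lb: "- p (- x) \<le> f x" if "f \<in> C" for f x
      using sublinear_neg[OF sl(1)[OF that], of x] sl(2)[OF that] le_funD[of f p "- x"] by simp
    have bdd: "bdd_below ((\<lambda>f. f x) ` C)" for x by (intro bdd_belowI2[of _ "- p (- x)"] lb)
    have ule: "u x \<le> f x" if "f \<in> C" for f x unfolding u_def by (rule cINF_lower[OF bdd that])
    have uge: "c \<le> u x" if "\<And>f. f \<in> C \<Longrightarrow> c \<le> f x" for c x
      unfolding u_def by (rule cINF_greatest[OF False that])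
    have "sublinear u"
    proof (rule sublinearI)
      fix x y
      have "u (x + y) \<le> f x + g y" if fg: "f \<in> C" "g \<in> C" for f g
        using tot[OF fg]
      proof
        assume "f \<le> g"
        then show ?thesis
          using ule[OF fg(1), of "x + y"] sublinear_add[OF sl(1)[OF fg(1)], of x y] le_funD[of f g y] by simp
      next
        assume "g \<le> f"
        then show ?thesis
          using ule[OF fg(2), of "x + y"] sublinear_add[OF sl(1)[OF fg(2)], of x y] le_funD[of g f x] by simp
      qed
      then have "u (x + y) - g y \<le> u x" if "g \<in> C" for g
        using that by (intro uge) (simp add: diff_le_eq)
      then have "u (x + y) - u x \<le> u y" by (intro uge) (simp add: algebra_simps)
      then show "u (x + y) \<le> u x + u y" by simp
    next
      fix c :: real and x assume c: "0 < c"
      have "u (c *\<^sub>R x) / c \<le> f x" if "f \<in> C" for f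
        using ule[OF that, of "c *\<^sub>R x"] sublinear_scale[OF sl(1)[OF that], of c x] c by (simp add: field_simps)
      then have "u (c *\<^sub>R x) / c \<le> u x" by (rule uge)
      then show "u (c *\<^sub>R x) \<le> c * u x" using c by (simp add: field_simps)
    next
      obtain f where "f \<in> C" using False by blast
      then show "u 0 = 0" using ule[of f 0] uge[of 0 0] sl sublinear_zero by (metis antisym order_refl)
    qed
    moreover obtain f where "f \<in> C" using False by blast
    moreover have "u \<le> p" using ule[OF \<open>f \<in> C\<close>] sl(2)[OF \<open>f \<in> C\<close>] by (meson le_funI le_funD order_trans)
    ultimately have "u \<in> A" unfolding A_def by blast
    then show ?thesis unfolding Field
      by (intro bexI[of _ u]) (use CA ule in \<open>auto simp: r_def le_fun_def\<close>)
  qed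
  from Zorns_po_lemma[OF po this] obtain q where q: "q \<in> A" "\<forall>f\<in>A. (q, f) \<in> r \<longrightarrow> f = q"
    unfolding Field by blast
  show ?thesis
  proof (rule that[of q])
    show "f = q" if "sublinear f" "f \<le> q" for f
    proof -
      have "f \<in> A" using q(1) that unfolding A_def by (auto intro: order_trans)
      then show ?thesis using q that by (auto simp: r_def)
    qed
  qed (use q in \<open>auto simp: A_def\<close>)
qed

text \<open>Hahn-Banach by minimality: a minimal sublinear functional is unchanged by shrinking
  along any vector, hence odd, hence linear. Starting below the norm already shrunk along
  \<open>a\<close> forces the value \<open>norm a\<close> at \<open>a\<close>.\<close>

theorem norming_functional:
  fixes a :: "'a::real_normed_vector"
  obtains f :: "'a \<Rightarrow>\<^sub>L real" where "norm f \<le> 1" "blinfun_apply f a = norm a"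
proof -
  have norm: "sublinear (norm :: 'a \<Rightarrow> real)" by (auto simp: sublinear_def norm_triangle_ineq)
  define p where "p = sublinear_shrink norm a"
  note p = sublinear_shrink[OF norm, of a, folded p_def]
  obtain q where q: "sublinear q" "q \<le> p" "\<And>r. sublinear r \<Longrightarrow> r \<le> q \<Longrightarrow> r = q"
    using minimal_sublinear_exists[OF p(1)] by blast
  have neg: "q (- x) = - q x" for x
  proof -
    have "sublinear_shrink q x = q"
      by (rule q(3)) (use sublinear_shrink[OF q(1), of x] in \<open>auto simp: le_fun_def\<close>)
    then have "q (- x) \<le> - q x" using sublinear_shrink(3)[OF q(1), of x] by simp
    with sublinear_neg[OF q(1), of "x"] show ?thesis by simp
  qed
  have qn: "q x \<le> norm x" for x using q(2) p(2) by (meson le_funD order_trans)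
  have "linear q"
  proof
    fix x y and c :: real
    have "q (- x + - y) \<le> q (- x) + q (- y)" by (rule sublinear_add[OF q(1)])
    then have "q x + q y \<le> q (x + y)" using neg[of "x + y"] by (simp add: neg)
    then show "q (x + y) = q x + q y" using sublinear_add[OF q(1), of x y] by simp
    show "q (c *\<^sub>R x) = c *\<^sub>R q x"
    proof (cases "0 \<le> c")
      case False
      then have "q ((- c) *\<^sub>R x) = - c * q x" by (intro sublinear_scale[OF q(1)]) simp
      then show ?thesis using neg[of "c *\<^sub>R x"] by simp
    qed (simp add: sublinear_scale[OF q(1)])
  qed
  moreover have abs: "\<bar>q x\<bar> \<le> norm x" for x using qn[of x] qn[of "- x"] neg[of x] by simp
  ultimately have bl: "bounded_linear q"
    by (intro bounded_linear.intro bounded_linear_axioms.intro exI[of _ 1]) auto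
  show ?thesis
  proof (rule that[of "Blinfun q"])
    show "norm (Blinfun q) \<le> 1"
      by (rule norm_blinfun_bound) (auto simp: bounded_linear_Blinfun_apply[OF bl] abs)
    have "q (- a) \<le> - norm a" using le_funD[OF q(2), of "- a"] p(3) by simp
    then show "blinfun_apply (Blinfun q) a = norm a"
      using neg[of a] qn[of a] by (simp add: bounded_linear_Blinfun_apply[OF bl])
  qed
qed

lemma norm_le_functional:
  fixes a :: "'a::real_normed_vector"
  assumes "\<And>f :: 'a \<Rightarrow>\<^sub>L real. norm f \<le> 1 \<Longrightarrow> blinfun_apply f a \<le> C"
  shows "norm a \<le> C"
  using norming_functional[of a] assms by metis

lemma eq_by_functionals:
  fixes a b :: "'a::real_normed_vector"
  assumes "\<And>f :: 'a \<Rightarrow>\<^sub>L real. blinfun_apply f a = blinfun_apply f b"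
  shows "a = b"
  using norm_le_functional[of "a - b" 0] assms by (simp add: blinfun.diff_right)

text \<open>Baire: the open sets \<open>U m\<close>, where some \<open>F n\<close> exceeds
  \<open>m\<close>, have empty intersection and so are not all dense. On a ball missing some
  \<open>U m\<close> all \<open>F n\<close> are bounded by \<open>m\<close>, and differences of
  points of this ball reach every direction.\<close>

theorem uniform_boundedness:
  fixes F :: "nat \<Rightarrow> 'a::banach \<Rightarrow>\<^sub>L real"
  assumes "\<And>x. bounded (range (\<lambda>n. blinfun_apply (F n) x))"
  obtains C where "\<And>n. norm (F n) \<le> C"
proof -
  define U where "U m = (\<Union>n. {x. real m < \<bar>F n x\<bar>})" for m :: nat
  have open_U: "open (U m)" for m
    unfolding U_def by (intro open_UN ballI open_Collect_less continuous_intros)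
  have "\<exists>m. closure (U m) \<noteq> UNIV"
  proof (rule ccontr)
    assume "\<not> ?thesis"
    then have "Met_TC.mtopology closure_of \<Inter>(range U) = (UNIV :: 'a set)"
      by (intro Met_TC.metric_Baire_category) (auto simp: open_U complete_UNIV)
    then have "\<Inter>(range U) \<noteq> {}" by auto
    then obtain x where x: "\<And>m. x \<in> U m" by auto
    obtain B where B: "\<And>n. \<bar>F n x\<bar> \<le> B" using assms[of x] by (auto simp: bounded_iff)
    obtain m :: nat where "B \<le> real m" using real_arch_simple by blast
    moreover obtain n where "real m < \<bar>F n x\<bar>" using x[of m] unfolding U_def by blast
    ultimately show False using B[of n] by simp
  qed
  then obtain m where "\<exists>x. x \<notin> closure (U m)" by blast
  then obtain x where "x \<in> - closure (U m)" by blast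
  then obtain r where r: "0 < r" "ball x r \<subseteq> - closure (U m)"
    using open_contains_ball[of "- closure (U m)"] by (auto simp: open_Compl)
  have b: "\<bar>F n y\<bar> \<le> real m" if "dist x y < r" for n y
  proof -
    have "y \<notin> U m" using r(2) that closure_subset[of "U m"] by auto
    then show ?thesis by (auto simp: U_def not_less)
  qed
  show ?thesis
  proof (rule that)
    fix n
    show "norm (F n) \<le> 4 * real m / r"
    proof (rule norm_blinfun_bound)
      show "0 \<le> 4 * real m / r" using r by simp
      fix y :: 'a
      show "norm (F n y) \<le> 4 * real m / r * norm y"
      proof (cases "y = 0")
        case False
        define c where "c = r / (2 * norm y)"
        have c: "0 < c" using False r by (simp add: c_def)
        have "dist x (x + c *\<^sub>R y) < r" using False r by (simp add: c_def dist_norm)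
        from b[OF this, of n] b[of x n] r have "\<bar>F n (c *\<^sub>R y)\<bar> \<le> 2 * real m"
          by (simp add: blinfun.add_right)
        then have "\<bar>F n y\<bar> \<le> 2 * real m / c" using c by (simp add: blinfun.scaleR_right abs_mult field_simps)
        then show ?thesis using False r by (simp add: c_def)
      qed simp
    qed
  qed
qed

section \<open>Pivoted Cholesky decomposition of kernels\<close>

text \<open>The indices are listed by a function and may repeat, so that bordering a list by one
  more index is a function update.\<close>

definition kernel_form :: "('i \<Rightarrow> 'i \<Rightarrow> real) \<Rightarrow> nat \<Rightarrow> (nat \<Rightarrow> 'i) \<Rightarrow> (nat \<Rightarrow> real) \<Rightarrow> real" where
  "kernel_form R n x c = (\<Sum>k<n. \<Sum>l<n. c k * c l * R (x k) (x l))"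

definition psd_kernel :: "('i \<Rightarrow> 'i \<Rightarrow> real) \<Rightarrow> bool" where
  "psd_kernel R \<longleftrightarrow> (\<forall>i j. R i j = R j i) \<and> (\<forall>n x c. 0 \<le> kernel_form R n x c)"

lemma psd_kernel_sym: "psd_kernel R \<Longrightarrow> R i j = R j i"
  and psd_kernel_nonneg: "psd_kernel R \<Longrightarrow> 0 \<le> kernel_form R n x c"
  by (auto simp: psd_kernel_def)

lemma psd_kernel_diag:
  assumes "psd_kernel R"
  shows "0 \<le> R i i"
  using psd_kernel_nonneg[OF assms, of 1 "\<lambda>_. i" "\<lambda>_. 1"] by (simp add: kernel_form_def)

text \<open>The form as a quadratic polynomial in the last coefficient: completing the square in it
  gives the Schur complement.\<close>

lemma kernel_form_Suc:
  assumes "\<And>i j. R i j = R j i"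
  shows "kernel_form R (Suc n) x c =
    kernel_form R n x c + 2 * c n * (\<Sum>k<n. c k * R (x k) (x n)) + (c n)\<^sup>2 * R (x n) (x n)"
proof -
  have "(\<Sum>l<n. c n * c l * R (x n) (x l)) = c n * (\<Sum>k<n. c k * R (x k) (x n))"
    by (simp add: sum_distrib_left mult.assoc assms[of "x n"])
  moreover have "(\<Sum>k<n. c k * c n * R (x k) (x n)) = c n * (\<Sum>k<n. c k * R (x k) (x n))"
    by (simp add: sum_distrib_left mult.assoc mult.left_commute)
  ultimately show ?thesis
    unfolding kernel_form_def by (simp add: sum.distrib power2_eq_square algebra_simps)
qed

lemma kernel_form_minus_rank_one:
  "kernel_form (\<lambda>i j. R i j - f i * f j) n x c = kernel_form R n x c - (\<Sum>k<n. c k * f (x k))\<^sup>2"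
proof -
  have "kernel_form (\<lambda>i j. R i j - f i * f j) n x c =
      (\<Sum>k<n. \<Sum>l<n. c k * c l * R (x k) (x l) - (c k * f (x k)) * (c l * f (x l)))"
    unfolding kernel_form_def by (intro sum.cong refl) (simp add: algebra_simps)
  then show ?thesis
    by (simp add: kernel_form_def sum_subtractf power2_eq_square sum_product)
qed

text \<open>On the pair \<open>(i, j)\<close> the form is affine in the coefficient \<open>t\<close>
  of \<open>i\<close>, so a nonzero slope would make it negative. The chosen \<open>t\<close> gives
  it the value -1.\<close>

lemma psd_kernel_null:
  assumes R: "psd_kernel R" and i: "R i i = 0"
  shows "R i j = 0"
proof (rule ccontr)
  assume ne: "R i j \<noteq> 0"
  define t where "t = - (R j j + 1) / (2 * R i j)"
  have "kernel_form R 2 (case_nat i (\<lambda>_. j)) (case_nat t (\<lambda>_. 1)) = 2 * t * R i j + R j j"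
    using i by (simp add: kernel_form_def numeral_2_eq_2 psd_kernel_sym[OF R, of j i])
  also have "\<dots> = -1" using ne by (simp add: t_def field_simps)
  finally show False using psd_kernel_nonneg[OF R, of 2 "case_nat i (\<lambda>_. j)" "case_nat t (\<lambda>_. 1)"] by simp
qed

text \<open>Schur complement. Where \<open>R v v = 0\<close>, division by zero makes the correction vanish.\<close>

lemma psd_kernel_deflate:
  assumes R: "psd_kernel R"
  shows "psd_kernel (\<lambda>i j. R i j - R i v * R j v / R v v)"
proof (cases "R v v = 0")
  case True
  then show ?thesis using R by simp
next
  case False
  then have pos: "0 < R v v" using psd_kernel_diag[OF R, of v] by simp
  define f where "f i = R i v / sqrt (R v v)" for i
  have R': "R i j - R i v * R j v / R v v = R i j - f i * f j" for i j
    using pos by (simp add: f_def real_sqrt_mult[symmetric])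
  have "0 \<le> kernel_form (\<lambda>i j. R i j - f i * f j) n x c" for n x c
  proof -
    define S where "S = (\<Sum>k<n. c k * R (x k) v)"
    \<comment> \<open>Bordering by \<open>v\<close> with the minimising coefficient
      \<open>- S / R v v\<close>: the form of the residual kernel is the minimum of the form of
      \<open>R\<close> over this coefficient.\<close>
    have "kernel_form R (Suc n) (x(n := v)) (c(n := - S / R v v))
        = kernel_form R n x c + 2 * (- S / R v v) * S + (- S / R v v)\<^sup>2 * R v v"
      unfolding kernel_form_Suc[of R, OF psd_kernel_sym[OF R]]
      by (simp add: S_def kernel_form_def)
    also have "\<dots> = kernel_form R n x c - S\<^sup>2 / R v v"
      using pos by (simp add: power2_eq_square field_simps)
    also have "S\<^sup>2 / R v v = (\<Sum>k<n. c k * f (x k))\<^sup>2"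
      using pos by (simp add: S_def f_def power_divide flip: sum_divide_distrib)
    finally show ?thesis
      unfolding kernel_form_minus_rank_one using psd_kernel_nonneg[OF R] by metis
  qed
  then show ?thesis
    unfolding R' psd_kernel_def using psd_kernel_sym[OF R] by (auto simp: mult.commute)
qed

text \<open>
  Pivoted Cholesky decomposition: eliminating the indices \<open>v 0\<close>, \<open>v 1\<close>, \<open>\<dots>\<close> in turn leaves the
  residual kernels \<open>kres\<close>; \<open>kcol\<close> are the columns of the Cholesky factor. This is
  Gram--Schmidt orthogonalisation without the vectors.
\<close>

primrec kres :: "('i \<Rightarrow> 'i \<Rightarrow> real) \<Rightarrow> (nat \<Rightarrow> 'i) \<Rightarrow> nat \<Rightarrow> 'i \<Rightarrow> 'i \<Rightarrow> real" where
  "kres R v 0 = R"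
| "kres R v (Suc k) =
     (\<lambda>i j. kres R v k i j - kres R v k i (v k) * kres R v k j (v k) / kres R v k (v k) (v k))"

definition kcol :: "('i \<Rightarrow> 'i \<Rightarrow> real) \<Rightarrow> (nat \<Rightarrow> 'i) \<Rightarrow> nat \<Rightarrow> 'i \<Rightarrow> real" where
  "kcol R v k i = kres R v k i (v k) / sqrt (kres R v k (v k) (v k))"

text \<open>The limit of the residual kernels (\<open>kres_LIMSEQ\<close>), that is, the Gram kernel
  of the components orthogonal to all pivots.\<close>

definition klim :: "('i \<Rightarrow> 'i \<Rightarrow> real) \<Rightarrow> (nat \<Rightarrow> 'i) \<Rightarrow> 'i \<Rightarrow> 'i \<Rightarrow> real" where
  "klim R v i j = R i j - (\<Sum>k. kcol R v k i * kcol R v k j)"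

context
  fixes R :: "'i \<Rightarrow> 'i \<Rightarrow> real" and v :: "nat \<Rightarrow> 'i"
  assumes R: "psd_kernel R"
begin

lemma psd_kres: "psd_kernel (kres R v k)"
  by (induction k) (auto intro: R psd_kernel_deflate simp del: kres.simps(2) simp: kres.simps(2)[abs_def])

lemma kres_Suc: "kres R v (Suc k) i j = kres R v k i j - kcol R v k i * kcol R v k j"
  using psd_kernel_diag[OF psd_kres, of k "v k"]
  by (simp add: kcol_def real_sqrt_mult[symmetric])

lemma kres_eq: "kres R v k i j = R i j - (\<Sum>l<k. kcol R v l i * kcol R v l j)"
  by (induction k) (simp_all add: kres_Suc del: kres.simps(2))

text \<open>Only the diagonal entry of an eliminated pivot is followed through the later steps;
  nonnegativity then clears its whole row.\<close>

lemma kres_pivot: "l < k \<Longrightarrow> kres R v k (v l) j = 0"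
proof (induction k arbitrary: j)
  case (Suc k)
  have "kres R v (Suc k) (v l) (v l) = 0"
  proof (cases "l = k")
    case True
    then show ?thesis by simp
  next
    case False
    then show ?thesis using Suc by simp
  qed
  then show ?case by (rule psd_kernel_null[OF psd_kres])
qed simp

lemma kcol_eq_0: "kres R v k (v k) (v k) = 0 \<Longrightarrow> kcol R v k i = 0"
  by (simp add: kcol_def)

text \<open>Bessel's inequality, read off from the nonnegative diagonal of the residual.\<close>

lemma kcol_sum_le: "(\<Sum>l<k. (kcol R v l i)\<^sup>2) \<le> R i i"
  using psd_kernel_diag[OF psd_kres, of k i] by (simp add: kres_eq power2_eq_square)

lemma summable_kcol: "summable (\<lambda>k. (kcol R v k i)\<^sup>2)"
  by (rule summableI_nonneg_bounded[of _ "R i i"]) (auto intro: kcol_sum_le)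

lemma summable_kcol_mult: "summable (\<lambda>k. kcol R v k i * kcol R v k j)"
  by (intro summable_mult_ell2 summable_kcol)

lemma kres_LIMSEQ: "(\<lambda>k. kres R v k i j) \<longlonglongrightarrow> klim R v i j"
  unfolding kres_eq klim_def by (intro tendsto_intros summable_LIMSEQ summable_kcol_mult)

lemma psd_klim: "psd_kernel (klim R v)"
  unfolding psd_kernel_def
proof (intro conjI allI)
  show "klim R v i j = klim R v j i" for i j
    unfolding klim_def using psd_kernel_sym[OF R, of i j] by (simp add: mult.commute)
  fix n x c
  have "(\<lambda>k. kernel_form (kres R v k) n x c) \<longlonglongrightarrow> kernel_form (klim R v) n x c"
    unfolding kernel_form_def by (intro tendsto_intros kres_LIMSEQ)
  then show "0 \<le> kernel_form (klim R v) n x c"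
    by (rule LIMSEQ_le_const) (use psd_kernel_nonneg[OF psd_kres] in blast)
qed

text \<open>Every elimination step subtracts a square from the form.\<close>

lemma kernel_form_klim_le: "kernel_form (klim R v) n x c \<le> kernel_form R n x c"
proof (rule LIMSEQ_le_const2)
  show "(\<lambda>k. kernel_form (kres R v k) n x c) \<longlonglongrightarrow> kernel_form (klim R v) n x c"
    unfolding kernel_form_def by (intro tendsto_intros kres_LIMSEQ)
  have "kernel_form (kres R v k) n x c \<le> kernel_form R n x c" for k
  proof (induction k)
    case (Suc k)
    have "kernel_form (kres R v (Suc k)) n x c \<le> kernel_form (kres R v k) n x c"
      using kernel_form_minus_rank_one[of "kres R v k" "kcol R v k" n x c]
      by (simp add: kres_Suc[abs_def] del: kres.simps(2))
    with Suc show ?case by linarith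
  qed simp
  then show "\<exists>N. \<forall>k\<ge>N. kernel_form (kres R v k) n x c \<le> kernel_form R n x c" by blast
qed

lemma klim_pivot: "klim R v (v l) (v l) = 0"
proof (rule LIMSEQ_unique[OF kres_LIMSEQ])
  show "(\<lambda>k. kres R v k (v l) (v l)) \<longlonglongrightarrow> 0"
    by (rule tendsto_eventually) (rule eventually_mono[OF eventually_gt_at_top[of l]], rule kres_pivot)
qed

text \<open>If combinations of null indices approximate \<open>i\<close>, then \<open>i\<close> is
  null: in the form of \<open>klim R v\<close> the null indices drop out and leave
  \<open>klim R v i i\<close>, because \<open>i\<close> carries the coefficient 1, while the form of
  \<open>R\<close> dominates and is small. This lets the elimination reach indices that are limits
  of pivots without being pivots.\<close>

lemma klim_null_closure:
  assumes "\<And>\<epsilon>. 0 < \<epsilon> \<Longrightarrow> \<exists>n x c. (\<forall>l<n. klim R v (x l) (x l) = 0) \<and>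
    kernel_form R (Suc n) (x(n := i)) (c(n := 1)) < \<epsilon>"
  shows "klim R v i i = 0"
proof -
  have "klim R v i i \<le> \<epsilon>" if pos: "0 < \<epsilon>" for \<epsilon>
  proof -
    obtain n x c where n: "\<And>l. l < n \<Longrightarrow> klim R v (x l) (x l) = 0"
      and e: "kernel_form R (Suc n) (x(n := i)) (c(n := 1)) < \<epsilon>"
      using assms[OF pos] by blast
    have z: "klim R v (x l) j = 0" if "l < n" for l j
      by (rule psd_kernel_null[OF psd_klim n[OF that]])
    have "kernel_form (klim R v) (Suc n) (x(n := i)) (c(n := 1)) = klim R v i i"
      unfolding kernel_form_Suc[of "klim R v", OF psd_kernel_sym[OF psd_klim]]
      by (simp add: kernel_form_def z)
    with kernel_form_klim_le[of "Suc n" "x(n := i)" "c(n := 1)"] e show ?thesis by linarith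
  qed
  then show ?thesis
    using psd_kernel_diag[OF psd_klim, of i] field_le_epsilon[of "klim R v i i" 0] by auto
qed

text \<open>A null diagonal entry at \<open>i\<close> clears the row of \<open>i\<close> in the
  residual, so \<open>j\<close> may be arbitrary.\<close>

lemma kernel_Parseval:
  assumes "klim R v i i = 0"
  shows "(\<lambda>k. kcol R v k i * kcol R v k j) sums R i j"
  using psd_kernel_null[OF psd_klim assms, of j] summable_sums[OF summable_kcol_mult[of i j]]
  by (simp add: klim_def)

end

section \<open>Square-integrable and Gaussian random variables\<close>

definition L2 :: "'p measure \<Rightarrow> ('p \<Rightarrow> real) set" where
  "L2 P = {X. X \<in> borel_measurable P \<and> integrable P (\<lambda>\<omega>. (X \<omega>)\<^sup>2)}"

text \<open>Meaningful for members of \<open>L2\<close>: the integral of a non-integrable square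
  would be 0 by default, so membership is assumed alongside where it matters.\<close>

definition L2_lim :: "'p measure \<Rightarrow> (nat \<Rightarrow> 'p \<Rightarrow> real) \<Rightarrow> ('p \<Rightarrow> real) \<Rightarrow> bool" where
  "L2_lim P Xn X \<longleftrightarrow> (\<lambda>n. \<integral>\<omega>. (Xn n \<omega> - X \<omega>)\<^sup>2 \<partial>P) \<longlonglongrightarrow> 0"

lemma L2D: "X \<in> L2 P \<Longrightarrow> X \<in> borel_measurable P" "X \<in> L2 P \<Longrightarrow> integrable P (\<lambda>\<omega>. (X \<omega>)\<^sup>2)"
  by (auto simp: L2_def)

lemma sum_squares_ge: "(a + b)\<^sup>2 \<le> 2 * a\<^sup>2 + 2 * (b::real)\<^sup>2"
  using zero_le_power2[of "a - b"] by (simp add: power2_eq_square algebra_simps)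

lemma L2_mult_integrable:
  assumes "X \<in> L2 P" "Y \<in> L2 P"
  shows "integrable P (\<lambda>\<omega>. X \<omega> * Y \<omega>)"
proof (rule Bochner_Integration.integrable_bound)
  show "integrable P (\<lambda>\<omega>. (X \<omega>)\<^sup>2 + (Y \<omega>)\<^sup>2)" using assms by (auto simp: L2_def)
  show "(\<lambda>\<omega>. X \<omega> * Y \<omega>) \<in> borel_measurable P" using assms by (auto simp: L2_def)
  have "\<bar>a * b\<bar> \<le> a\<^sup>2 + b\<^sup>2" for a b :: real
  proof -
    have "2 * (\<bar>a\<bar> * \<bar>b\<bar>) \<le> a\<^sup>2 + b\<^sup>2" "0 \<le> \<bar>a\<bar> * \<bar>b\<bar>"
      using sum_squares_bound[of "\<bar>a\<bar>" "\<bar>b\<bar>"] by (simp_all add: mult.assoc)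
    then show ?thesis unfolding abs_mult by linarith
  qed
  then show "AE \<omega> in P. norm (X \<omega> * Y \<omega>) \<le> norm ((X \<omega>)\<^sup>2 + (Y \<omega>)\<^sup>2)" by simp
qed

lemma L2_add: "X \<in> L2 P \<Longrightarrow> Y \<in> L2 P \<Longrightarrow> (\<lambda>\<omega>. X \<omega> + Y \<omega>) \<in> L2 P"
  using L2_mult_integrable[of X P Y] by (auto simp: L2_def power2_sum mult.assoc)

lemma L2_scale: "X \<in> L2 P \<Longrightarrow> (\<lambda>\<omega>. c * X \<omega>) \<in> L2 P"
  by (auto simp: L2_def power_mult_distrib)

lemma L2_diff: "X \<in> L2 P \<Longrightarrow> Y \<in> L2 P \<Longrightarrow> (\<lambda>\<omega>. X \<omega> - Y \<omega>) \<in> L2 P"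
  using L2_add[of X P "\<lambda>\<omega>. - 1 * Y \<omega>"] L2_scale[of Y P "- 1"] by simp

lemma L2_zero: "(\<lambda>_. 0) \<in> L2 P" by (simp add: L2_def)

lemma L2_sum: "(\<And>i. i \<in> I \<Longrightarrow> X i \<in> L2 P) \<Longrightarrow> (\<lambda>\<omega>. \<Sum>i\<in>I. X i \<omega>) \<in> L2 P"
  by (induction I rule: infinite_finite_induct) (auto intro: L2_add simp: L2_zero)

lemma quadratic_nonneg_discriminant:
  fixes a b c :: real
  assumes "\<And>t. 0 \<le> a + 2 * t * b + t\<^sup>2 * c" "0 \<le> c"
  shows "b\<^sup>2 \<le> a * c"
proof (cases "c = 0")
  case True
  have "b = 0"
  proof (rule ccontr)
    assume "b \<noteq> 0"
    then show False using assms(1)[of "- (a + 1) / (2 * b)"] True by (simp add: field_simps)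
  qed
  then show ?thesis using True by simp
next
  case False
  with assms(2) have c: "0 < c" by simp
  have "0 \<le> a + 2 * (- b / c) * b + (- b / c)\<^sup>2 * c" by (rule assms)
  also have "\<dots> = a - b\<^sup>2 / c" using c by (simp add: power2_eq_square field_simps)
  finally show ?thesis using c by (simp add: field_simps)
qed

lemma L2_Cauchy_Schwarz:
  assumes X: "X \<in> L2 P" and Y: "Y \<in> L2 P"
  shows "\<bar>\<integral>\<omega>. X \<omega> * Y \<omega> \<partial>P\<bar> \<le> sqrt (\<integral>\<omega>. (X \<omega>)\<^sup>2 \<partial>P) * sqrt (\<integral>\<omega>. (Y \<omega>)\<^sup>2 \<partial>P)"
proof -
  note [simp] = L2D(2)[OF X] L2D(2)[OF Y] L2_mult_integrable[OF X Y]
  have "0 \<le> (\<integral>\<omega>. (X \<omega>)\<^sup>2 \<partial>P) + 2 * t * (\<integral>\<omega>. X \<omega> * Y \<omega> \<partial>P) + t\<^sup>2 * (\<integral>\<omega>. (Y \<omega>)\<^sup>2 \<partial>P)" for t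
  proof -
    have "0 \<le> (\<integral>\<omega>. (X \<omega> + t * Y \<omega>)\<^sup>2 \<partial>P)" by simp
    also have "(\<lambda>\<omega>. (X \<omega> + t * Y \<omega>)\<^sup>2) = (\<lambda>\<omega>. (X \<omega>)\<^sup>2 + 2 * t * (X \<omega> * Y \<omega>) + t\<^sup>2 * (Y \<omega>)\<^sup>2)"
      by (simp add: power2_eq_square algebra_simps fun_eq_iff)
    finally show ?thesis by simp
  qed
  then have "(\<integral>\<omega>. X \<omega> * Y \<omega> \<partial>P)\<^sup>2 \<le> (\<integral>\<omega>. (X \<omega>)\<^sup>2 \<partial>P) * (\<integral>\<omega>. (Y \<omega>)\<^sup>2 \<partial>P)"
    by (rule quadratic_nonneg_discriminant) simp
  from real_sqrt_le_mono[OF this] show ?thesis by (simp add: real_sqrt_mult)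
qed

lemma L2_lim_add:
  assumes X: "L2_lim P Xn X" and Y: "L2_lim P Yn Y"
    and L: "\<And>n. Xn n \<in> L2 P" "X \<in> L2 P" "\<And>n. Yn n \<in> L2 P" "Y \<in> L2 P"
  shows "L2_lim P (\<lambda>n \<omega>. Xn n \<omega> + Yn n \<omega>) (\<lambda>\<omega>. X \<omega> + Y \<omega>)"
  unfolding L2_lim_def
proof (rule tendsto_zero_le)
  show "(\<lambda>n. 2 * (\<integral>\<omega>. (Xn n \<omega> - X \<omega>)\<^sup>2 \<partial>P) + 2 * (\<integral>\<omega>. (Yn n \<omega> - Y \<omega>)\<^sup>2 \<partial>P)) \<longlonglongrightarrow> 0"
    using tendsto_add[OF tendsto_mult_right_zero[OF X[unfolded L2_lim_def], of 2] tendsto_mult_right_zero[OF Y[unfolded L2_lim_def], of 2]] by simp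
  fix n
  have i: "integrable P (\<lambda>\<omega>. (Xn n \<omega> - X \<omega>)\<^sup>2)" "integrable P (\<lambda>\<omega>. (Yn n \<omega> - Y \<omega>)\<^sup>2)"
    by (intro L2D(2) L2_diff L)+
  have "(\<integral>\<omega>. (Xn n \<omega> + Yn n \<omega> - (X \<omega> + Y \<omega>))\<^sup>2 \<partial>P)
      \<le> (\<integral>\<omega>. 2 * (Xn n \<omega> - X \<omega>)\<^sup>2 + 2 * (Yn n \<omega> - Y \<omega>)\<^sup>2 \<partial>P)"
  proof (rule integral_mono)
    show "integrable P (\<lambda>\<omega>. (Xn n \<omega> + Yn n \<omega> - (X \<omega> + Y \<omega>))\<^sup>2)"
      by (intro L2D(2) L2_diff L2_add L)
    show "(Xn n \<omega> + Yn n \<omega> - (X \<omega> + Y \<omega>))\<^sup>2 \<le> 2 * (Xn n \<omega> - X \<omega>)\<^sup>2 + 2 * (Yn n \<omega> - Y \<omega>)\<^sup>2" for \<omega>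
      using sum_squares_ge[of "Xn n \<omega> - X \<omega>" "Yn n \<omega> - Y \<omega>"] by (simp add: algebra_simps)
  qed (use i in auto)
  then show "(\<integral>\<omega>. (Xn n \<omega> + Yn n \<omega> - (X \<omega> + Y \<omega>))\<^sup>2 \<partial>P)
      \<le> 2 * (\<integral>\<omega>. (Xn n \<omega> - X \<omega>)\<^sup>2 \<partial>P) + 2 * (\<integral>\<omega>. (Yn n \<omega> - Y \<omega>)\<^sup>2 \<partial>P)"
    using i by simp
qed simp

lemma L2_lim_scale:
  assumes X: "L2_lim P Xn X"
  shows "L2_lim P (\<lambda>n \<omega>. c * Xn n \<omega>) (\<lambda>\<omega>. c * X \<omega>)"
proof -
  have "(\<integral>\<omega>. (c * Xn n \<omega> - c * X \<omega>)\<^sup>2 \<partial>P) = c\<^sup>2 * (\<integral>\<omega>. (Xn n \<omega> - X \<omega>)\<^sup>2 \<partial>P)" for n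
    by (simp add: power_mult_distrib flip: right_diff_distrib)
  then show ?thesis
    using tendsto_mult_right_zero[OF X[unfolded L2_lim_def], of "c\<^sup>2"] by (simp add: L2_lim_def)
qed

lemma L2_lim_inner:
  assumes X: "L2_lim P Xn X" and Y: "L2_lim P Yn Y"
    and L: "\<And>n. Xn n \<in> L2 P" "X \<in> L2 P" "\<And>n. Yn n \<in> L2 P" "Y \<in> L2 P"
  shows "(\<lambda>n. \<integral>\<omega>. Xn n \<omega> * Yn n \<omega> \<partial>P) \<longlonglongrightarrow> (\<integral>\<omega>. X \<omega> * Y \<omega> \<partial>P)"
proof -
  define a where "a n = sqrt (\<integral>\<omega>. (Xn n \<omega> - X \<omega>)\<^sup>2 \<partial>P)" for n
  define b where "b n = sqrt (\<integral>\<omega>. (Yn n \<omega> - Y \<omega>)\<^sup>2 \<partial>P)" for n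
  define A where "A = sqrt (\<integral>\<omega>. (X \<omega>)\<^sup>2 \<partial>P)"
  define B where "B = sqrt (\<integral>\<omega>. (Y \<omega>)\<^sup>2 \<partial>P)"
  have a: "a \<longlonglongrightarrow> 0" using tendsto_real_sqrt[OF X[unfolded L2_lim_def]] by (simp add: a_def[abs_def])
  have b: "b \<longlonglongrightarrow> 0" using tendsto_real_sqrt[OF Y[unfolded L2_lim_def]] by (simp add: b_def[abs_def])
  have "\<bar>(\<integral>\<omega>. Xn n \<omega> * Yn n \<omega> \<partial>P) - (\<integral>\<omega>. X \<omega> * Y \<omega> \<partial>P)\<bar> \<le> a n * b n + a n * B + A * b n" for n
  proof -
    have dX: "(\<lambda>\<omega>. Xn n \<omega> - X \<omega>) \<in> L2 P" and dY: "(\<lambda>\<omega>. Yn n \<omega> - Y \<omega>) \<in> L2 P"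
      by (intro L2_diff L)+
    have "(\<integral>\<omega>. (Xn n \<omega> - X \<omega>) * (Yn n \<omega> - Y \<omega>) \<partial>P) + (\<integral>\<omega>. (Xn n \<omega> - X \<omega>) * Y \<omega> \<partial>P) + (\<integral>\<omega>. X \<omega> * (Yn n \<omega> - Y \<omega>) \<partial>P)
      = (\<integral>\<omega>. (Xn n \<omega> - X \<omega>) * (Yn n \<omega> - Y \<omega>) + (Xn n \<omega> - X \<omega>) * Y \<omega> + X \<omega> * (Yn n \<omega> - Y \<omega>) \<partial>P)"
      by (simp add: L2_mult_integrable[OF dX dY] L2_mult_integrable[OF dX L(4)] L2_mult_integrable[OF L(2) dY])
    also have "\<dots> = (\<integral>\<omega>. Xn n \<omega> * Yn n \<omega> - X \<omega> * Y \<omega> \<partial>P)"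
      by (rule Bochner_Integration.integral_cong) (auto simp: algebra_simps)
    also have "\<dots> = (\<integral>\<omega>. Xn n \<omega> * Yn n \<omega> \<partial>P) - (\<integral>\<omega>. X \<omega> * Y \<omega> \<partial>P)"
      by (intro Bochner_Integration.integral_diff L2_mult_integrable L)
    finally show ?thesis
      using L2_Cauchy_Schwarz[OF dX dY] L2_Cauchy_Schwarz[OF dX L(4)] L2_Cauchy_Schwarz[OF L(2) dY]
      unfolding a_def b_def A_def B_def by linarith
  qed
  note bound = this
  have "(\<lambda>n. a n * b n + a n * B + A * b n) \<longlonglongrightarrow> 0 * 0 + 0 * B + A * 0"
    by (rule tendsto_add[OF tendsto_add[OF tendsto_mult[OF a b] tendsto_mult_right[OF a]] tendsto_mult_left[OF b]])
  then have "(\<lambda>n. a n * b n + a n * B + A * b n) \<longlonglongrightarrow> 0" by simp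
  then have "(\<lambda>n. (\<integral>\<omega>. Xn n \<omega> * Yn n \<omega> \<partial>P) - (\<integral>\<omega>. X \<omega> * Y \<omega> \<partial>P)) \<longlonglongrightarrow> 0"
    by (rule Lim_null_comparison[rotated]) (intro always_eventually allI, unfold real_norm_def, rule bound)
  then show ?thesis by (simp add: LIM_zero_iff)
qed

lemma L2_lim_const: "L2_lim P (\<lambda>_. X) X" by (simp add: L2_lim_def)

lemma L2_integral_zero_AE: "X \<in> L2 P \<Longrightarrow> (\<integral>\<omega>. (X \<omega>)\<^sup>2 \<partial>P) = 0 \<Longrightarrow> AE \<omega> in P. X \<omega> = 0"
  using integral_nonneg_eq_0_iff_AE[of P "\<lambda>\<omega>. (X \<omega>)\<^sup>2"] by (simp add: L2_def)

context prob_space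
begin

lemma L2_integrable:
  assumes "X \<in> L2 M" shows "integrable M X"
  by (rule square_integrable_imp_integrable) (use assms in \<open>auto simp: L2_def\<close>)

lemma L2_abs_integral_le:
  assumes X: "X \<in> L2 M"
  shows "(\<integral>\<omega>. \<bar>X \<omega>\<bar> \<partial>M) \<le> sqrt (\<integral>\<omega>. (X \<omega>)\<^sup>2 \<partial>M)"
proof -
  have "(\<lambda>\<omega>. \<bar>X \<omega>\<bar>) \<in> L2 M" "(\<lambda>_. 1) \<in> L2 M" using X by (auto simp: L2_def)
  from L2_Cauchy_Schwarz[OF this] show ?thesis by (simp add: prob_space)
qed

text \<open>A Cauchy sequence in L^2 is Cauchy in L^1 and so has an almost everywhere convergent
  subsequence; Fatou's lemma along it bounds the L^2 distance of the whole sequence to the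
  limit.\<close>

lemma L2_complete:
  assumes L: "\<And>n. X n \<in> L2 M"
    and C: "\<And>e. 0 < e \<Longrightarrow> \<exists>N. \<forall>m\<ge>N. \<forall>n\<ge>N. (\<integral>\<omega>. (X m \<omega> - X n \<omega>)\<^sup>2 \<partial>M) < e"
  obtains Y where "Y \<in> L2 M" "L2_lim M X Y"
proof -
  have m[measurable]: "X n \<in> borel_measurable M" for n using L by (rule L2D)
  have L1: "\<exists>N. \<forall>i\<ge>N. \<forall>j\<ge>N. (LINT x|M. norm (X i x - X j x)) < e" if "0 < e" for e
  proof -
    have "0 < e\<^sup>2" using that by simp
    then obtain N where N: "\<And>m n. m \<ge> N \<Longrightarrow> n \<ge> N \<Longrightarrow> (\<integral>\<omega>. (X m \<omega> - X n \<omega>)\<^sup>2 \<partial>M) < e\<^sup>2" using C by meson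
    have "(LINT x|M. norm (X i x - X j x)) < e" if ij: "i \<ge> N" "j \<ge> N" for i j
    proof -
      have "(LINT x|M. norm (X i x - X j x)) \<le> sqrt (\<integral>\<omega>. (X i \<omega> - X j \<omega>)\<^sup>2 \<partial>M)"
        using L2_abs_integral_le[OF L2_diff[OF L[of i] L[of j]]] by simp
      also have "\<dots> < sqrt (e\<^sup>2)" by (intro real_sqrt_less_mono N ij)
      finally show ?thesis using \<open>0 < e\<close> by simp
    qed
    then show ?thesis by blast
  qed
  obtain r where r: "strict_mono r" "AE x in M. Cauchy (\<lambda>i. X (r i) x)"
    using cauchy_L1_AE_cauchy_subseq[OF L2_integrable[OF L] L1] by blast
  define Y where "Y x = lim (\<lambda>i. X (r i) x)" for x
  have Ym[measurable]: "Y \<in> borel_measurable M" unfolding Y_def by measurable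
  have lim: "AE x in M. (\<lambda>i. X (r i) x) \<longlonglongrightarrow> Y x"
    using r(2) by eventually_elim (auto simp: Y_def Cauchy_convergent_iff convergent_LIMSEQ_iff)
  have fatou: "(\<integral>\<^sup>+x. ennreal ((X n x - Y x)\<^sup>2) \<partial>M) \<le> ennreal e"
    if e: "0 < e" and N: "\<And>m n. m \<ge> N \<Longrightarrow> n \<ge> N \<Longrightarrow> (\<integral>\<omega>. (X m \<omega> - X n \<omega>)\<^sup>2 \<partial>M) < e" and n: "n \<ge> N" for n e N
  proof -
    have "(\<integral>\<^sup>+x. ennreal ((X n x - Y x)\<^sup>2) \<partial>M) = (\<integral>\<^sup>+x. liminf (\<lambda>i. ennreal ((X n x - X (r i) x)\<^sup>2)) \<partial>M)"
    proof (rule nn_integral_cong_AE)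
      show "AE x in M. ennreal ((X n x - Y x)\<^sup>2) = liminf (\<lambda>i. ennreal ((X n x - X (r i) x)\<^sup>2))"
        using lim
      proof eventually_elim
        case (elim x)
        have "(\<lambda>i. ennreal ((X n x - X (r i) x)\<^sup>2)) \<longlonglongrightarrow> ennreal ((X n x - Y x)\<^sup>2)"
          by (intro tendsto_ennrealI tendsto_intros elim)
        from lim_imp_Liminf[OF _ this] show ?case by simp
      qed
    qed
    also have "\<dots> \<le> liminf (\<lambda>i. \<integral>\<^sup>+x. ennreal ((X n x - X (r i) x)\<^sup>2) \<partial>M)"
      by (rule nn_integral_liminf) measurable
    also have "\<dots> \<le> ennreal e"
    proof -
      have "\<forall>\<^sub>F i in sequentially. (\<integral>\<^sup>+x. ennreal ((X n x - X (r i) x)\<^sup>2) \<partial>M) \<le> ennreal e"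
        using eventually_ge_at_top[of N]
      proof eventually_elim
        case (elim i)
        then have "r i \<ge> N" using seq_suble[OF r(1), of i] by simp
        have "(\<integral>\<^sup>+x. ennreal ((X n x - X (r i) x)\<^sup>2) \<partial>M) = ennreal (\<integral>x. (X n x - X (r i) x)\<^sup>2 \<partial>M)"
          by (intro nn_integral_eq_integral L2D(2) L2_diff L) auto
        then show ?case using N[OF n \<open>r i \<ge> N\<close>] by (simp add: ennreal_leI)
      qed
      from Liminf_mono[OF this] show ?thesis by (simp add: Liminf_const)
    qed
    finally show ?thesis .
  qed
  obtain N1 where N1: "\<And>m n. m \<ge> N1 \<Longrightarrow> n \<ge> N1 \<Longrightarrow> (\<integral>\<omega>. (X m \<omega> - X n \<omega>)\<^sup>2 \<partial>M) < 1"
    using C[of 1] by auto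
  have "(\<lambda>\<omega>. X N1 \<omega> - Y \<omega>) \<in> L2 M"
    unfolding L2_def using le_less_trans[OF fatou[of 1 N1 N1, OF _ N1] ennreal_less_top]
    by (auto intro!: integrableI_nonneg)
  from L2_diff[OF L[of N1] this] have Y: "Y \<in> L2 M" by simp
  have "L2_lim M X Y"
    unfolding L2_lim_def
  proof (rule LIMSEQ_I)
    fix e :: real assume "0 < e"
    then have e2: "0 < e / 2" by simp
    obtain N where N: "\<And>m n. m \<ge> N \<Longrightarrow> n \<ge> N \<Longrightarrow> (\<integral>\<omega>. (X m \<omega> - X n \<omega>)\<^sup>2 \<partial>M) < e / 2"
      using C[OF e2] by meson
    have "(\<integral>\<omega>. (X n \<omega> - Y \<omega>)\<^sup>2 \<partial>M) \<le> e / 2" if "n \<ge> N" for n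
    proof -
      have "ennreal (\<integral>\<omega>. (X n \<omega> - Y \<omega>)\<^sup>2 \<partial>M) = (\<integral>\<^sup>+x. ennreal ((X n x - Y x)\<^sup>2) \<partial>M)"
        by (intro nn_integral_eq_integral[symmetric] L2D(2) L2_diff L Y) auto
      also have "\<dots> \<le> ennreal (e / 2)" by (rule fatou[OF e2 N that])
      finally show ?thesis using e2 by simp
    qed
    then show "\<exists>N. \<forall>n\<ge>N. norm ((\<integral>\<omega>. (X n \<omega> - Y \<omega>)\<^sup>2 \<partial>M) - 0) < e"
      using \<open>0 < e\<close> by (intro exI[of _ N]) (fastforce intro: le_less_trans)
  qed
  with Y that show ?thesis by blast
qed

lemma char_distr:
  assumes [measurable]: "X \<in> borel_measurable M"
  shows "char (distr M borel X) t = (CLINT \<omega>|M. iexp (t * X \<omega>))"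
  by (simp add: char_def integral_distr)

text \<open>The degenerate and the nondegenerate case lead to the same formulas in terms of the
  second moment. The characteristic function is what \<open>centered_normal_char\<close> inverts;
  the fourth moment is used for the continuity of paths.\<close>

lemma centered_normal_moments:
  assumes "centered_normal M X"
  shows "X \<in> L2 M" "char (distr M borel X) t = exp (- (t\<^sup>2 * (\<integral>\<omega>. (X \<omega>)\<^sup>2 \<partial>M)) / 2)"
    "integrable M (\<lambda>\<omega>. (X \<omega>) ^ 4)" "(\<integral>\<omega>. (X \<omega>) ^ 4 \<partial>M) = 3 * (\<integral>\<omega>. (X \<omega>)\<^sup>2 \<partial>M)\<^sup>2"
proof -
  have [measurable]: "X \<in> borel_measurable M" using assms by (simp add: centered_normal_def)
  have "X \<in> L2 M \<and> char (distr M borel X) t = exp (- (t\<^sup>2 * (\<integral>\<omega>. (X \<omega>)\<^sup>2 \<partial>M)) / 2) \<and>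
    integrable M (\<lambda>\<omega>. (X \<omega>) ^ 4) \<and> (\<integral>\<omega>. (X \<omega>) ^ 4 \<partial>M) = 3 * (\<integral>\<omega>. (X \<omega>)\<^sup>2 \<partial>M)\<^sup>2"
  proof (cases "AE \<omega> in M. X \<omega> = 0")
    case True
    have "(\<integral>\<omega>. (X \<omega>)\<^sup>2 \<partial>M) = (\<integral>\<omega>. 0 \<partial>M)"
      by (rule integral_cong_AE) (use True in auto)
    moreover have "(\<integral>\<omega>. (X \<omega>)^4 \<partial>M) = (\<integral>\<omega>. 0 \<partial>M)"
      by (rule integral_cong_AE) (use True in auto)
    moreover have "(CLINT \<omega>|M. iexp (t * X \<omega>)) = (CLINT \<omega>|M. 1)"
    proof (rule integral_cong_AE)
      show "AE \<omega> in M. iexp (t * X \<omega>) = 1" using True by eventually_elim simp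
    qed auto
    moreover have "integrable M (\<lambda>\<omega>. (X \<omega>)\<^sup>2)" "integrable M (\<lambda>\<omega>. (X \<omega>)^4)"
      using True by (auto intro!: integrable_cong_AE_imp[OF integrable_zero])
    ultimately show ?thesis by (simp add: L2_def char_distr prob_space)
  next
    case False
    then obtain s where s: "0 < s" "distributed M lborel X (normal_density 0 s)"
      using assms by (auto simp: centered_normal_def)
    have int: "integrable M (\<lambda>\<omega>. (X \<omega>) ^ (2 * k))"
      "(\<integral>\<omega>. (X \<omega>) ^ (2 * k) \<partial>M) = fact (2 * k) / ((2 / s\<^sup>2)^k * fact k)" for k
    proof -
      show "integrable M (\<lambda>\<omega>. (X \<omega>) ^ (2 * k))"
        using distributed_integrable[OF s(2), of "\<lambda>x. x ^ (2 * k)"] integrable_normal_moment[OF s(1), of 0 "2 * k"] by simp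
      show "(\<integral>\<omega>. (X \<omega>) ^ (2 * k) \<partial>M) = fact (2 * k) / ((2 / s\<^sup>2)^k * fact k)"
        using distributed_integral[OF s(2), of "\<lambda>x. x ^ (2 * k)"] integral_normal_moment_even[OF s(1), of 0 k] by simp
    qed
    have v: "(\<integral>\<omega>. (X \<omega>)\<^sup>2 \<partial>M) = s\<^sup>2" using int(2)[of 1] by simp
    have v4: "(\<integral>\<omega>. (X \<omega>)^4 \<partial>M) = 3 * (s\<^sup>2)\<^sup>2" using int(2)[of 2] s(1)
      by (simp add: fact_numeral power2_eq_square field_simps)
    have "distributed M lborel (\<lambda>x. (X x - 0) / s) std_normal_density"
      using normal_standard_normal_convert[OF s(1), of X 0] s(2) by simp
    then have "distr M lborel (\<lambda>\<omega>. X \<omega> / s) = std_normal_distribution" by (simp add: distributed_def)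
    then have "distr M borel (\<lambda>\<omega>. X \<omega> / s) = std_normal_distribution"
      by (subst distr_cong[of M M borel lborel "\<lambda>\<omega>. X \<omega> / s" "\<lambda>\<omega>. X \<omega> / s"]) auto
    from fun_cong[OF char_std_normal_distribution, of "t * s", folded this]
    have "(CLINT \<omega>|M. iexp (t * X \<omega>)) = exp (- ((t * s)\<^sup>2) / 2)"
      using s(1) by (simp add: char_distr)
    then show ?thesis using int(1)[of 1] int(1)[of 2] v v4
      by (simp add: L2_def char_distr power_mult_distrib)
  qed
  then show "X \<in> L2 M" "char (distr M borel X) t = exp (- (t\<^sup>2 * (\<integral>\<omega>. (X \<omega>)\<^sup>2 \<partial>M)) / 2)"
    "integrable M (\<lambda>\<omega>. (X \<omega>) ^ 4)" "(\<integral>\<omega>. (X \<omega>) ^ 4 \<partial>M) = 3 * (\<integral>\<omega>. (X \<omega>)\<^sup>2 \<partial>M)\<^sup>2" by auto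
qed

text \<open>Levy's uniqueness theorem after rescaling to variance 1; variance 0 is the degenerate
  normal law.\<close>

lemma centered_normal_char:
  assumes X: "X \<in> L2 M"
    and char: "\<And>t. char (distr M borel X) t = exp (- (t\<^sup>2 * (\<integral>\<omega>. (X \<omega>)\<^sup>2 \<partial>M)) / 2)"
  shows "centered_normal M X"
proof (cases "(\<integral>\<omega>. (X \<omega>)\<^sup>2 \<partial>M) = 0")
  case True
  then show ?thesis using L2_integral_zero_AE[OF X] X by (auto simp: centered_normal_def L2_def)
next
  case False
  have [measurable]: "X \<in> borel_measurable M" using X by (rule L2D)
  define s where "s = sqrt (\<integral>\<omega>. (X \<omega>)\<^sup>2 \<partial>M)"
  have "0 \<le> (\<integral>\<omega>. (X \<omega>)\<^sup>2 \<partial>M)" by simp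
  with False have s: "0 < s" "s\<^sup>2 = (\<integral>\<omega>. (X \<omega>)\<^sup>2 \<partial>M)" by (auto simp: s_def less_le)
  have "char (distr M borel (\<lambda>\<omega>. X \<omega> / s)) t = char std_normal_distribution t" for t
  proof -
    have "char (distr M borel (\<lambda>\<omega>. X \<omega> / s)) t = char (distr M borel X) (t / s)"
      by (simp add: char_distr)
    then show ?thesis using s(1) by (simp add: char s(2)[symmetric] char_std_normal_distribution power_divide)
  qed
  then have "distr M borel (\<lambda>\<omega>. X \<omega> / s) = std_normal_distribution"
    by (intro Levy_uniqueness real_dist_normal_dist ext) auto
  then have "distr M lborel (\<lambda>\<omega>. X \<omega> / s) = std_normal_distribution"
    by (subst distr_cong[of M M lborel borel "\<lambda>\<omega>. X \<omega> / s" "\<lambda>\<omega>. X \<omega> / s"]) auto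
  then have "distributed M lborel (\<lambda>x. (X x - 0) / s) std_normal_density"
    by (simp add: distributed_def)
  then have "distributed M lborel X (normal_density 0 s)"
    by (subst normal_standard_normal_convert[OF s(1)])
  then show ?thesis using s(1) by (auto simp: centered_normal_def)
qed

text \<open>The function \<open>iexp\<close> is 1-Lipschitz, so the characteristic functions
  converge along with the variances, and the limit has the characteristic function of a normal
  law.\<close>

lemma centered_normal_L2_lim:
  assumes n: "\<And>n. centered_normal M (Xn n)" and X: "X \<in> L2 M" and lim: "L2_lim M Xn X"
  shows "centered_normal M X"
proof (rule centered_normal_char[OF X])
  fix t
  have L: "Xn n \<in> L2 M" for n using n by (rule centered_normal_moments)
  have m[measurable]: "Xn n \<in> borel_measurable M" "X \<in> borel_measurable M" for n using L X by (auto dest: L2D)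
  have "(\<lambda>n. char (distr M borel (Xn n)) t) \<longlonglongrightarrow> char (distr M borel X) t"
  proof (rule LIM_zero_cancel, rule Lim_null_comparison)
    have b: "norm (iexp x - iexp y) \<le> \<bar>x - y\<bar>" for x y :: real
    proof -
      have "iexp x - iexp y = iexp y * (iexp (x - y) - 1)"
        by (simp add: algebra_simps flip: exp_add)
      also have "norm \<dots> \<le> \<bar>x - y\<bar>" using iexp_approx1[of "x - y" 0] by (simp add: norm_mult)
      finally show ?thesis .
    qed
    show "\<forall>\<^sub>F n in sequentially. norm (char (distr M borel (Xn n)) t - char (distr M borel X) t)
        \<le> \<bar>t\<bar> * sqrt (\<integral>\<omega>. (Xn n \<omega> - X \<omega>)\<^sup>2 \<partial>M)"
    proof (intro always_eventually allI)
      fix n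
      have d: "(\<lambda>\<omega>. Xn n \<omega> - X \<omega>) \<in> L2 M" by (intro L2_diff L X)
      have i: "integrable M (\<lambda>\<omega>. iexp (t * Xn n \<omega>))" "integrable M (\<lambda>\<omega>. iexp (t * X \<omega>))"
        by (auto intro!: integrable_iexp)
      have "char (distr M borel (Xn n)) t - char (distr M borel X) t = (CLINT \<omega>|M. iexp (t * Xn n \<omega>) - iexp (t * X \<omega>))"
        unfolding char_distr[OF m(1)] char_distr[OF m(2)]
        by (rule Bochner_Integration.integral_diff[symmetric]) (use i in auto)
      also have "norm \<dots> \<le> (\<integral>\<omega>. norm (iexp (t * Xn n \<omega>) - iexp (t * X \<omega>)) \<partial>M)"
        by (rule integral_norm_bound)
      also have "\<dots> \<le> (\<integral>\<omega>. \<bar>t\<bar> * \<bar>Xn n \<omega> - X \<omega>\<bar> \<partial>M)"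
      proof (rule integral_mono)
        show "integrable M (\<lambda>\<omega>. norm (iexp (t * Xn n \<omega>) - iexp (t * X \<omega>)))"
          using i by (intro integrable_norm Bochner_Integration.integrable_diff)
        show "integrable M (\<lambda>\<omega>. \<bar>t\<bar> * \<bar>Xn n \<omega> - X \<omega>\<bar>)" using L2_integrable[OF d] by simp
        show "norm (iexp (t * Xn n \<omega>) - iexp (t * X \<omega>)) \<le> \<bar>t\<bar> * \<bar>Xn n \<omega> - X \<omega>\<bar>" for \<omega>
          using b[of "t * Xn n \<omega>" "t * X \<omega>"] by (simp add: abs_mult[symmetric] right_diff_distrib)
      qed
      also have "\<dots> \<le> \<bar>t\<bar> * sqrt (\<integral>\<omega>. (Xn n \<omega> - X \<omega>)\<^sup>2 \<partial>M)"
        using L2_abs_integral_le[OF d] by (simp add: mult_left_mono)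
      finally show "norm (char (distr M borel (Xn n)) t - char (distr M borel X) t)
        \<le> \<bar>t\<bar> * sqrt (\<integral>\<omega>. (Xn n \<omega> - X \<omega>)\<^sup>2 \<partial>M)" .
    qed
    show "(\<lambda>n. \<bar>t\<bar> * sqrt (\<integral>\<omega>. (Xn n \<omega> - X \<omega>)\<^sup>2 \<partial>M)) \<longlonglongrightarrow> 0"
      using tendsto_mult_right_zero[OF tendsto_real_sqrt[OF lim[unfolded L2_lim_def], simplified], of "\<bar>t\<bar>"] by simp
  qed
  moreover have "(\<lambda>n. char (distr M borel (Xn n)) t) \<longlonglongrightarrow> exp (- (t\<^sup>2 * (\<integral>\<omega>. (X \<omega>)\<^sup>2 \<partial>M)) / 2)"
  proof -
    have "(\<lambda>n. \<integral>\<omega>. (Xn n \<omega>)\<^sup>2 \<partial>M) \<longlonglongrightarrow> (\<integral>\<omega>. (X \<omega>)\<^sup>2 \<partial>M)"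
      using L2_lim_inner[OF lim lim L X L X] by (simp add: power2_eq_square)
    then show ?thesis unfolding centered_normal_moments(2)[OF n] by (intro tendsto_intros) auto
  qed
  ultimately show "char (distr M borel X) t = exp (- (t\<^sup>2 * (\<integral>\<omega>. (X \<omega>)\<^sup>2 \<partial>M)) / 2)"
    by (rule LIMSEQ_unique)
qed

text \<open>A constant sequence converges in L^2 to every version of its value.\<close>

lemma centered_normal_AE:
  assumes X: "centered_normal M X" and [measurable]: "Y \<in> borel_measurable M" and eq: "AE \<omega> in M. X \<omega> = Y \<omega>"
  shows "centered_normal M Y"
proof (rule centered_normal_L2_lim[of "\<lambda>_. X"])
  have [measurable]: "X \<in> borel_measurable M" using X by (simp add: centered_normal_def)
  have "integrable M (\<lambda>\<omega>. (X \<omega>)\<^sup>2)" using centered_normal_moments(1)[OF X] by (rule L2D)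
  then have "integrable M (\<lambda>\<omega>. (Y \<omega>)\<^sup>2)"
    by (rule integrable_cong_AE_imp) (use eq in auto)
  then show "Y \<in> L2 M" by (simp add: L2_def)
  have "(\<integral>\<omega>. (X \<omega> - Y \<omega>)\<^sup>2 \<partial>M) = (\<integral>\<omega>. 0 \<partial>M)" by (rule integral_cong_AE) (use eq in auto)
  then show "L2_lim M (\<lambda>_. X) Y" by (simp add: L2_lim_def)
qed (rule X)

end

text \<open>Closure under linear combinations turns joint normality of a family into mere membership
  of its members.\<close>

definition gaussian_space :: "'p measure \<Rightarrow> ('p \<Rightarrow> real) set \<Rightarrow> bool" where
  "gaussian_space P S \<longleftrightarrow> (\<forall>X\<in>S. centered_normal P X) \<and> (\<lambda>_. 0) \<in> S \<and>
     (\<forall>X\<in>S. \<forall>Y\<in>S. (\<lambda>\<omega>. X \<omega> + Y \<omega>) \<in> S) \<and> (\<forall>c. \<forall>X\<in>S. (\<lambda>\<omega>. c * X \<omega>) \<in> S)"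

lemma gaussian_spaceD:
  assumes "gaussian_space P S"
  shows "X \<in> S \<Longrightarrow> centered_normal P X" "(\<lambda>_. 0) \<in> S"
    "X \<in> S \<Longrightarrow> Y \<in> S \<Longrightarrow> (\<lambda>\<omega>. X \<omega> + Y \<omega>) \<in> S" "X \<in> S \<Longrightarrow> (\<lambda>\<omega>. c * X \<omega>) \<in> S"
  using assms by (auto simp: gaussian_space_def)

lemma gaussian_space_sum:
  assumes "gaussian_space P S" "\<And>k. k \<in> K \<Longrightarrow> X k \<in> S"
  shows "(\<lambda>\<omega>. \<Sum>k\<in>K. c k * X k \<omega>) \<in> S"
  using assms(2)
proof (induction K rule: infinite_finite_induct)
  case (insert x F)
  have "(\<lambda>\<omega>. c x * X x \<omega> + (\<Sum>k\<in>F. c k * X k \<omega>)) \<in> S"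
    by (rule gaussian_spaceD(3)[OF assms(1) gaussian_spaceD(4)[OF assms(1)]])
      (use insert.IH insert.prems in blast)+
  then show ?case by (simp only: sum.insert[OF insert.hyps])
qed (auto simp: gaussian_spaceD(2)[OF assms(1)])

lemma gaussian_space_diff:
  assumes "gaussian_space P S" "X \<in> S" "Y \<in> S"
  shows "(\<lambda>\<omega>. X \<omega> - Y \<omega>) \<in> S"
proof -
  have "(\<lambda>\<omega>. X \<omega> + (- 1) * Y \<omega>) \<in> S"
    by (rule gaussian_spaceD(3)[OF assms(1,2) gaussian_spaceD(4)[OF assms(1,3)]])
  then show ?thesis by simp
qed

definition gaussian_span :: "'i set \<Rightarrow> ('i \<Rightarrow> 'p \<Rightarrow> real) \<Rightarrow> ('p \<Rightarrow> real) set" where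
  "gaussian_span J Z = {\<lambda>\<omega>. \<Sum>j\<in>K. c j * Z j \<omega> | K c. finite K \<and> K \<subseteq> J}"

lemma gaussian_span_mem: "j \<in> J \<Longrightarrow> Z j \<in> gaussian_span J Z"
  unfolding gaussian_span_def by (rule CollectI, rule exI[of _ "{j}"], rule exI[of _ "\<lambda>_. 1"]) auto

lemma gaussian_space_span:
  assumes "centered_gaussian_family P J Z"
  shows "gaussian_space P (gaussian_span J Z)"
  unfolding gaussian_space_def
proof (intro conjI ballI allI)
  show "centered_normal P X" if "X \<in> gaussian_span J Z" for X
    using that assms by (auto simp: gaussian_span_def centered_gaussian_family_def)
  show "(\<lambda>_. 0) \<in> gaussian_span J Z"
    unfolding gaussian_span_def by (rule CollectI, rule exI[of _ "{}"]) auto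
  show "(\<lambda>\<omega>. a * X \<omega>) \<in> gaussian_span J Z" if X: "X \<in> gaussian_span J Z" for a X
  proof -
    obtain K c where K: "finite K" "K \<subseteq> J" "X = (\<lambda>\<omega>. \<Sum>j\<in>K. c j * Z j \<omega>)"
      using X by (auto simp: gaussian_span_def)
    then show ?thesis
      unfolding gaussian_span_def
      by (intro CollectI exI[of _ K] exI[of _ "\<lambda>j. a * c j"]) (auto simp: sum_distrib_left mult.assoc)
  qed
  show "(\<lambda>\<omega>. X \<omega> + Y \<omega>) \<in> gaussian_span J Z"
    if X: "X \<in> gaussian_span J Z" and Y: "Y \<in> gaussian_span J Z" for X Y
  proof -
    obtain K c where K: "finite K" "K \<subseteq> J" "X = (\<lambda>\<omega>. \<Sum>j\<in>K. c j * Z j \<omega>)"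
      using X by (auto simp: gaussian_span_def)
    obtain L d where L: "finite L" "L \<subseteq> J" "Y = (\<lambda>\<omega>. \<Sum>j\<in>L. d j * Z j \<omega>)"
      using Y by (auto simp: gaussian_span_def)
    define c' where "c' j = (if j \<in> K then c j else 0)" for j
    define d' where "d' j = (if j \<in> L then d j else 0)" for j
    have "X = (\<lambda>\<omega>. \<Sum>j\<in>K \<union> L. c' j * Z j \<omega>)"
      unfolding K(3) c'_def using K(1) L(1) by (intro ext sum.mono_neutral_cong_left) auto
    moreover have "Y = (\<lambda>\<omega>. \<Sum>j\<in>K \<union> L. d' j * Z j \<omega>)"
      unfolding L(3) d'_def using K(1) L(1) by (intro ext sum.mono_neutral_cong_left) auto
    ultimately have "(\<lambda>\<omega>. X \<omega> + Y \<omega>) = (\<lambda>\<omega>. \<Sum>j\<in>K \<union> L. (c' j + d' j) * Z j \<omega>)"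
      by (simp add: sum.distrib distrib_right)
    then show ?thesis
      unfolding gaussian_span_def using K L
      by (intro CollectI exI[of _ "K \<union> L"] exI[of _ "\<lambda>j. c' j + d' j"]) auto
  qed
qed

definition gaussian_closure :: "'p measure \<Rightarrow> ('p \<Rightarrow> real) set \<Rightarrow> ('p \<Rightarrow> real) set" where
  "gaussian_closure P S = {X \<in> L2 P. \<exists>Xn. (\<forall>n. Xn n \<in> S) \<and> L2_lim P Xn X}"

context prob_space
begin

lemma gaussian_space_L2: "gaussian_space M S \<Longrightarrow> X \<in> S \<Longrightarrow> X \<in> L2 M"
  using gaussian_spaceD(1) centered_normal_moments(1) by blast

lemma gaussian_space_closure:
  assumes S: "gaussian_space M S"
  shows "gaussian_space M (gaussian_closure M S)"
  unfolding gaussian_space_def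
proof (intro conjI ballI allI)
  note L = gaussian_space_L2[OF S]
  fix X assume "X \<in> gaussian_closure M S"
  then obtain Xn where X: "X \<in> L2 M" "\<And>n. Xn n \<in> S" "L2_lim M Xn X" by (auto simp: gaussian_closure_def)
  show "centered_normal M X"
    using centered_normal_L2_lim[OF _ X(1,3)] gaussian_spaceD(1)[OF S] X(2) by blast
  show "(\<lambda>\<omega>. c * X \<omega>) \<in> gaussian_closure M S" for c
    unfolding gaussian_closure_def
    by (intro CollectI conjI exI[of _ "\<lambda>n \<omega>. c * Xn n \<omega>"] allI L2_lim_scale X L2_scale gaussian_spaceD(4)[OF S])
  fix Y assume "Y \<in> gaussian_closure M S"
  then obtain Yn where Y: "Y \<in> L2 M" "\<And>n. Yn n \<in> S" "L2_lim M Yn Y" by (auto simp: gaussian_closure_def)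
  show "(\<lambda>\<omega>. X \<omega> + Y \<omega>) \<in> gaussian_closure M S"
    unfolding gaussian_closure_def
    by (intro CollectI conjI exI[of _ "\<lambda>n \<omega>. Xn n \<omega> + Yn n \<omega>"] allI L2_lim_add X Y L L2_add gaussian_spaceD(3)[OF S])
next
  show "(\<lambda>_. 0) \<in> gaussian_closure M S"
    unfolding gaussian_closure_def
    by (intro CollectI conjI L2_zero exI[of _ "\<lambda>_ _. 0"]) (auto simp: gaussian_spaceD(2)[OF S] L2_lim_const)
qed

lemma centered_normal_mean:
  assumes "centered_normal M X"
  shows "(\<integral>\<omega>. X \<omega> \<partial>M) = 0"
proof (cases "AE \<omega> in M. X \<omega> = 0")
  case True
  then have "(\<integral>\<omega>. X \<omega> \<partial>M) = (\<integral>\<omega>. 0 \<partial>M)"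
    using assms by (intro integral_cong_AE) (auto simp: centered_normal_def)
  then show ?thesis by simp
next
  case False
  then show ?thesis using assms normal_distributed_expectation by (auto simp: centered_normal_def)
qed

section \<open>Elimination in a space of random variables\<close>

text \<open>A choice among the versions of the L^2 limit, which is determined only almost
  everywhere.\<close>

definition orthogonal_series :: "(nat \<Rightarrow> 'a \<Rightarrow> real) \<Rightarrow> (nat \<Rightarrow> real) \<Rightarrow> 'a \<Rightarrow> real" where
  "orthogonal_series \<Gamma> a = (SOME X. X \<in> L2 M \<and> L2_lim M (\<lambda>n \<omega>. \<Sum>k<n. a k * \<Gamma> k \<omega>) X)"

text \<open>
  The \<open>\<Gamma> k\<close> may vanish instead of having norm one; then the corresponding coefficients are
  required to vanish too.
\<close>

context
  fixes \<Gamma> :: "nat \<Rightarrow> 'a \<Rightarrow> real"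
  assumes \<Gamma>: "\<And>k. \<Gamma> k \<in> L2 M" and orth: "\<And>k l. k \<noteq> l \<Longrightarrow> (\<integral>\<omega>. \<Gamma> k \<omega> * \<Gamma> l \<omega> \<partial>M) = 0"
begin

text \<open>The condition on one of the two coefficient sequences suffices: unless
  \<open>\<Gamma> k\<close> has norm one, \<open>a k\<close> vanishes and so does the product
  \<open>a k * b k\<close>.\<close>

lemma orthogonal_inner:
  assumes a: "\<And>k. a k * (\<integral>\<omega>. \<Gamma> k \<omega> * \<Gamma> k \<omega> \<partial>M) = a k" and K: "finite K"
  shows "(\<integral>\<omega>. (\<Sum>k\<in>K. a k * \<Gamma> k \<omega>) * (\<Sum>k\<in>K. b k * \<Gamma> k \<omega>) \<partial>M) = (\<Sum>k\<in>K. a k * b k)"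
proof -
  have i[simp]: "integrable M (\<lambda>\<omega>. \<Gamma> k \<omega> * \<Gamma> l \<omega>)" for k l by (intro L2_mult_integrable \<Gamma>)
  have "(\<integral>\<omega>. (\<Sum>k\<in>K. a k * \<Gamma> k \<omega>) * (\<Sum>k\<in>K. b k * \<Gamma> k \<omega>) \<partial>M)
      = (\<integral>\<omega>. (\<Sum>k\<in>K. \<Sum>l\<in>K. (a k * b l) * (\<Gamma> k \<omega> * \<Gamma> l \<omega>)) \<partial>M)"
    by (simp add: sum_product mult.assoc mult.left_commute)
  also have "\<dots> = (\<Sum>k\<in>K. \<Sum>l\<in>K. (a k * b l) * (\<integral>\<omega>. \<Gamma> k \<omega> * \<Gamma> l \<omega> \<partial>M))"
    by (subst Bochner_Integration.integral_sum)
      (auto intro!: sum.cong Bochner_Integration.integrable_sum)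
  also have "\<dots> = (\<Sum>k\<in>K. \<Sum>l\<in>K. if l = k then a k * b k else 0)"
  proof (intro sum.cong refl)
    fix k l
    show "(a k * b l) * (\<integral>\<omega>. \<Gamma> k \<omega> * \<Gamma> l \<omega> \<partial>M) = (if l = k then a k * b k else 0)"
    proof (cases "l = k")
      case True
      have "(a k * b k) * (\<integral>\<omega>. \<Gamma> k \<omega> * \<Gamma> k \<omega> \<partial>M) = b k * (a k * (\<integral>\<omega>. \<Gamma> k \<omega> * \<Gamma> k \<omega> \<partial>M))" by simp
      also have "\<dots> = a k * b k" unfolding a by simp
      finally show ?thesis using True by simp
    next
      case False
      then show ?thesis using orth[of k l] by simp
    qed
  qed
  also have "\<dots> = (\<Sum>k\<in>K. a k * b k)" using K by simp
  finally show ?thesis .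
qed

text \<open>By orthogonality the squared distance of two partial sums is a block of the convergent
  series of the squares of \<open>a\<close>, so \<open>L2_complete\<close> applies.\<close>

lemma orthogonal_series:
  assumes a: "\<And>k. a k * (\<integral>\<omega>. \<Gamma> k \<omega> * \<Gamma> k \<omega> \<partial>M) = a k" and s: "summable (\<lambda>k. (a k)\<^sup>2)"
  shows "orthogonal_series \<Gamma> a \<in> L2 M" "L2_lim M (\<lambda>n \<omega>. \<Sum>k<n. a k * \<Gamma> k \<omega>) (orthogonal_series \<Gamma> a)"
proof -
  define X where "X n \<omega> = (\<Sum>k<n. a k * \<Gamma> k \<omega>)" for n :: nat and \<omega>
  have L: "X n \<in> L2 M" for n unfolding X_def by (intro L2_sum L2_scale \<Gamma>)
  have "\<exists>Y. Y \<in> L2 M \<and> L2_lim M X Y"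
  proof (rule L2_complete[OF L])
    fix e :: real assume e: "0 < e"
    obtain N where N: "\<And>m n. m \<ge> N \<Longrightarrow> norm (\<Sum>k\<in>{m..<n}. (a k)\<^sup>2) < e"
      using s e unfolding summable_Cauchy by meson
    have d: "(\<integral>\<omega>. (X n \<omega> - X m \<omega>)\<^sup>2 \<partial>M) = (\<Sum>k\<in>{m..<n}. (a k)\<^sup>2)" if "m \<le> n" for m n
    proof -
      have "X n \<omega> - X m \<omega> = (\<Sum>k\<in>{m..<n}. a k * \<Gamma> k \<omega>)" for \<omega>
        unfolding X_def lessThan_atLeast0 using that by (subst sum_diff_nat_ivl) auto
      then show ?thesis using orthogonal_inner[OF a, of "{m..<n}" a] by (simp add: power2_eq_square)
    qed
    have "(\<integral>\<omega>. (X m \<omega> - X n \<omega>)\<^sup>2 \<partial>M) < e" if "m \<ge> N" "n \<ge> N" for m n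
    proof (cases "m \<le> n")
      case True
      have "(\<integral>\<omega>. (X m \<omega> - X n \<omega>)\<^sup>2 \<partial>M) = (\<integral>\<omega>. (X n \<omega> - X m \<omega>)\<^sup>2 \<partial>M)" by (simp add: power2_commute)
      then show ?thesis using N[OF that(1), of n] d[OF True] by simp
    next
      case False
      then show ?thesis using N[OF that(2), of m] d[of n m] by simp
    qed
    then show "\<exists>N. \<forall>m\<ge>N. \<forall>n\<ge>N. (\<integral>\<omega>. (X m \<omega> - X n \<omega>)\<^sup>2 \<partial>M) < e" by blast
  qed blast
  from someI_ex[OF this] show "orthogonal_series \<Gamma> a \<in> L2 M"
    "L2_lim M (\<lambda>n \<omega>. \<Sum>k<n. a k * \<Gamma> k \<omega>) (orthogonal_series \<Gamma> a)"
    unfolding orthogonal_series_def X_def[abs_def] by auto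
qed

lemma orthogonal_series_inner:
  assumes a: "\<And>k. a k * (\<integral>\<omega>. \<Gamma> k \<omega> * \<Gamma> k \<omega> \<partial>M) = a k" "summable (\<lambda>k. (a k)\<^sup>2)"
    and b: "\<And>k. b k * (\<integral>\<omega>. \<Gamma> k \<omega> * \<Gamma> k \<omega> \<partial>M) = b k" "summable (\<lambda>k. (b k)\<^sup>2)"
  shows "(\<integral>\<omega>. orthogonal_series \<Gamma> a \<omega> * orthogonal_series \<Gamma> b \<omega> \<partial>M) = (\<Sum>k. a k * b k)"
proof (rule LIMSEQ_unique)
  show "(\<lambda>n. \<integral>\<omega>. (\<Sum>k<n. a k * \<Gamma> k \<omega>) * (\<Sum>k<n. b k * \<Gamma> k \<omega>) \<partial>M)
      \<longlonglongrightarrow> (\<integral>\<omega>. orthogonal_series \<Gamma> a \<omega> * orthogonal_series \<Gamma> b \<omega> \<partial>M)"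
    by (intro L2_lim_inner orthogonal_series a b L2_sum L2_scale \<Gamma>)
  show "(\<lambda>n. \<integral>\<omega>. (\<Sum>k<n. a k * \<Gamma> k \<omega>) * (\<Sum>k<n. b k * \<Gamma> k \<omega>) \<partial>M) \<longlonglongrightarrow> (\<Sum>k. a k * b k)"
    using summable_LIMSEQ[OF summable_mult_ell2[OF a(2) b(2)]] by (simp add: orthogonal_inner[OF a(1)])
qed

lemma orthogonal_series_closure:
  assumes S: "gaussian_space M S" "\<And>k. \<Gamma> k \<in> S"
    and a: "\<And>k. a k * (\<integral>\<omega>. \<Gamma> k \<omega> * \<Gamma> k \<omega> \<partial>M) = a k" "summable (\<lambda>k. (a k)\<^sup>2)"
  shows "orthogonal_series \<Gamma> a \<in> gaussian_closure M S"
  unfolding gaussian_closure_def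
  by (intro CollectI conjI orthogonal_series a exI[of _ "\<lambda>n \<omega>. \<Sum>k<n. a k * \<Gamma> k \<omega>"] allI gaussian_space_sum[OF S(1)] S(2))

end

end

text \<open>The elimination of \<open>kres\<close>, performed on vectors \<open>T i\<close> indexed like the kernel.\<close>

primrec vres :: "('i \<Rightarrow> 'i \<Rightarrow> real) \<Rightarrow> (nat \<Rightarrow> 'i) \<Rightarrow> ('i \<Rightarrow> 'v::real_vector) \<Rightarrow> nat \<Rightarrow> 'i \<Rightarrow> 'v" where
  "vres R v T 0 = T"
| "vres R v T (Suc k) = (\<lambda>i. vres R v T k i -
     kcol R v k i *\<^sub>R (vres R v T k (v k) /\<^sub>R sqrt (kres R v k (v k) (v k))))"

text \<open>The Gram-Schmidt vector of the \<open>k\<close>-th pivot, which is 0 where the pivot has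
  residual norm 0, since \<open>inverse 0 = 0\<close>. The vector type is kept general: it is used
  for values of random variables and for vectors of the Banach space.\<close>

definition vcol :: "('i \<Rightarrow> 'i \<Rightarrow> real) \<Rightarrow> (nat \<Rightarrow> 'i) \<Rightarrow> ('i \<Rightarrow> 'v::real_vector) \<Rightarrow> nat \<Rightarrow> 'v" where
  "vcol R v T k = vres R v T k (v k) /\<^sub>R sqrt (kres R v k (v k) (v k))"

lemma vres_Suc: "vres R v T (Suc k) i = vres R v T k i - kcol R v k i *\<^sub>R vcol R v T k"
  by (simp add: vcol_def)

lemma vres_eq: "vres R v T k i = T i - (\<Sum>l<k. kcol R v l i *\<^sub>R vcol R v T l)"
  by (induction k) (simp_all add: vres_Suc del: vres.simps(2))

context prob_space
begin

context
  fixes R :: "'i \<Rightarrow> 'i \<Rightarrow> real" and v :: "nat \<Rightarrow> 'i" and I :: "'i set" and Z :: "'i \<Rightarrow> 'a \<Rightarrow> real"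
  assumes R: "psd_kernel R"
    and Z: "\<And>i. i \<in> I \<Longrightarrow> Z i \<in> L2 M"
    and cov: "\<And>i j. i \<in> I \<Longrightarrow> j \<in> I \<Longrightarrow> (\<integral>\<omega>. Z i \<omega> * Z j \<omega> \<partial>M) = R i j"
    and v: "\<And>k. v k \<in> I"
begin

abbreviation "zres k i \<omega> \<equiv> vres R v (\<lambda>i. Z i \<omega>) k i"
abbreviation "zcol k \<omega> \<equiv> vcol R v (\<lambda>i. Z i \<omega>) k"

lemma zcol_scaled: "zcol k \<omega> = inverse (sqrt (kres R v k (v k) (v k))) * zres k (v k) \<omega>"
  by (simp add: vcol_def)

lemma zres_Suc: "zres (Suc k) i \<omega> = zres k i \<omega> - kcol R v k i * zcol k \<omega>"
  by (simp add: vcol_def)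

lemma zres_L2: "i \<in> I \<Longrightarrow> (\<lambda>\<omega>. zres k i \<omega>) \<in> L2 M"
proof (induction k arbitrary: i)
  case (Suc k)
  have "(\<lambda>\<omega>. zcol k \<omega>) \<in> L2 M" unfolding zcol_scaled by (intro L2_scale Suc.IH v)
  then show ?case unfolding zres_Suc by (intro L2_diff L2_scale Suc.IH Suc.prems)
qed (simp add: Z)

lemma zcol_L2: "(\<lambda>\<omega>. zcol k \<omega>) \<in> L2 M"
  unfolding zcol_scaled by (intro L2_scale zres_L2 v)

text \<open>The assumption is the induction hypothesis of \<open>zres_inner\<close>, whose induction
  step already needs the norm of the \<open>k\<close>-th column. That norm is 1 or 0, and in the
  latter case \<open>kcol\<close> vanishes.\<close>

lemma zcol_norm_aux:
  assumes "\<And>i j. i \<in> I \<Longrightarrow> j \<in> I \<Longrightarrow> (\<integral>\<omega>. zres k i \<omega> * zres k j \<omega> \<partial>M) = kres R v k i j"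
  shows "i \<in> I \<Longrightarrow> (\<integral>\<omega>. zres k i \<omega> * zcol k \<omega> \<partial>M) = kcol R v k i"
    "kcol R v k i * (\<integral>\<omega>. zcol k \<omega> * zcol k \<omega> \<partial>M) = kcol R v k i"
proof -
  define r where "r = kres R v k (v k) (v k)"
  have r: "0 \<le> r" unfolding r_def by (rule psd_kernel_diag[OF psd_kres[OF R]])
  show "(\<integral>\<omega>. zres k i \<omega> * zcol k \<omega> \<partial>M) = kcol R v k i" if "i \<in> I"
  proof -
    have "(\<integral>\<omega>. zres k i \<omega> * zcol k \<omega> \<partial>M) = (\<integral>\<omega>. inverse (sqrt r) * (zres k i \<omega> * zres k (v k) \<omega>) \<partial>M)"
      unfolding zcol_scaled r_def by (simp add: mult.left_commute)
    then show ?thesis using assms[OF that v] by (simp add: kcol_def r_def field_simps)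
  qed
  have "(\<integral>\<omega>. zcol k \<omega> * zcol k \<omega> \<partial>M) = (\<integral>\<omega>. (inverse (sqrt r) * inverse (sqrt r)) * (zres k (v k) \<omega> * zres k (v k) \<omega>) \<partial>M)"
    unfolding zcol_scaled r_def by (simp add: mult.left_commute mult.assoc)
  also have "\<dots> = (inverse (sqrt r) * inverse (sqrt r)) * (\<integral>\<omega>. zres k (v k) \<omega> * zres k (v k) \<omega> \<partial>M)"
    by (rule integral_mult_right_zero)
  also have "(\<integral>\<omega>. zres k (v k) \<omega> * zres k (v k) \<omega> \<partial>M) = r"
    unfolding r_def by (rule assms[OF v v])
  also have "inverse (sqrt r) * inverse (sqrt r) = inverse r"
    using r by (simp flip: inverse_mult_distrib)
  finally show "kcol R v k i * (\<integral>\<omega>. zcol k \<omega> * zcol k \<omega> \<partial>M) = kcol R v k i"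
    using kcol_eq_0[OF R, of v k i] by (cases "r = 0") (simp_all add: r_def)
qed

text \<open>The Gram-Schmidt invariant: subtracting \<open>kcol R v k i\<close> times the
  \<open>k\<close>-th column projects onto its orthogonal complement, so the inner products obey the
  recursion of \<open>kres\<close>, and orthogonality to the earlier columns is inherited.\<close>

lemma zres_inner:
  "(\<forall>i\<in>I. \<forall>j\<in>I. (\<integral>\<omega>. zres k i \<omega> * zres k j \<omega> \<partial>M) = kres R v k i j) \<and>
   (\<forall>i\<in>I. \<forall>l<k. (\<integral>\<omega>. zcol l \<omega> * zres k i \<omega> \<partial>M) = 0)"
proof (induction k)
  case 0
  then show ?case using cov by simp
next
  case (Suc k)
  then have IH: "\<And>i j. i \<in> I \<Longrightarrow> j \<in> I \<Longrightarrow> (\<integral>\<omega>. zres k i \<omega> * zres k j \<omega> \<partial>M) = kres R v k i j"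
    and orth: "\<And>i l. i \<in> I \<Longrightarrow> l < k \<Longrightarrow> (\<integral>\<omega>. zcol l \<omega> * zres k i \<omega> \<partial>M) = 0" by auto
  have aux: "(\<integral>\<omega>. zres k i \<omega> * zcol k \<omega> \<partial>M) = kcol R v k i" if "i \<in> I" for i
    using zcol_norm_aux(1)[of k i] IH that by blast
  have unit: "kcol R v k i * (\<integral>\<omega>. zcol k \<omega> * zcol k \<omega> \<partial>M) = kcol R v k i" for i
    using zcol_norm_aux(2)[of k i] IH by blast
  have aux': "(\<integral>\<omega>. zcol k \<omega> * zres k i \<omega> \<partial>M) = kcol R v k i" if "i \<in> I" for i
    using aux[OF that] by (simp add: mult.commute)
  note int = L2_mult_integrable[OF zres_L2 zres_L2] L2_mult_integrable[OF zres_L2 zcol_L2]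
    L2_mult_integrable[OF zcol_L2 zres_L2] L2_mult_integrable[OF zcol_L2 zcol_L2]
  show ?case
  proof (intro conjI ballI allI impI)
    fix i j assume i: "i \<in> I" and j: "j \<in> I"
    have "(\<integral>\<omega>. zres (Suc k) i \<omega> * zres (Suc k) j \<omega> \<partial>M) =
      (\<integral>\<omega>. zres k i \<omega> * zres k j \<omega> - kcol R v k j * (zres k i \<omega> * zcol k \<omega>) - kcol R v k i * (zcol k \<omega> * zres k j \<omega>)
         + kcol R v k i * kcol R v k j * (zcol k \<omega> * zcol k \<omega>) \<partial>M)"
      unfolding zres_Suc by (simp add: algebra_simps)
    also have "\<dots> = kres R v k i j - kcol R v k j * kcol R v k i - kcol R v k i * kcol R v k j
        + kcol R v k j * (kcol R v k i * (\<integral>\<omega>. zcol k \<omega> * zcol k \<omega> \<partial>M))"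
      using i j by (simp add: int IH aux aux')
    also have "\<dots> = kres R v (Suc k) i j"
      unfolding unit kres_Suc[OF R] by simp
    finally show "(\<integral>\<omega>. zres (Suc k) i \<omega> * zres (Suc k) j \<omega> \<partial>M) = kres R v (Suc k) i j" .
  next
    fix i l assume i: "i \<in> I" and l: "l < Suc k"
    have "(\<integral>\<omega>. zcol l \<omega> * zres (Suc k) i \<omega> \<partial>M) =
        (\<integral>\<omega>. zcol l \<omega> * zres k i \<omega> - kcol R v k i * (zcol l \<omega> * zcol k \<omega>) \<partial>M)"
      unfolding zres_Suc by (simp add: algebra_simps)
    also have "\<dots> = (\<integral>\<omega>. zcol l \<omega> * zres k i \<omega> \<partial>M) - kcol R v k i * (\<integral>\<omega>. zcol l \<omega> * zcol k \<omega> \<partial>M)"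
      using i by (simp add: int)
    also have "\<dots> = 0"
    proof (cases "l = k")
      case True
      then show ?thesis using aux'[OF i] unit[of i] by simp
    next
      case False
      then have lk: "l < k" using l by simp
      have "(\<integral>\<omega>. zcol l \<omega> * zcol k \<omega> \<partial>M) = (\<integral>\<omega>. inverse (sqrt (kres R v k (v k) (v k))) * (zcol l \<omega> * zres k (v k) \<omega>) \<partial>M)"
        unfolding zcol_scaled[where k=k] by (simp add: mult.left_commute)
      then show ?thesis using orth[OF v lk] orth[OF i lk] by simp
    qed
    finally show "(\<integral>\<omega>. zcol l \<omega> * zres (Suc k) i \<omega> \<partial>M) = 0" .
  qed
qed

lemma zcol_orth:
  assumes "k \<noteq> l" shows "(\<integral>\<omega>. zcol k \<omega> * zcol l \<omega> \<partial>M) = 0"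
proof -
  have "(\<integral>\<omega>. zcol k \<omega> * zcol l \<omega> \<partial>M) = 0" if "k < l" for k l
  proof -
    have "(\<integral>\<omega>. zcol k \<omega> * zcol l \<omega> \<partial>M) = (\<integral>\<omega>. inverse (sqrt (kres R v l (v l) (v l))) * (zcol k \<omega> * zres l (v l) \<omega>) \<partial>M)"
      unfolding zcol_scaled[where k=l] by (simp add: mult.left_commute)
    then show ?thesis using zres_inner[of l] v that by simp
  qed
  from this[of k l] this[of l k] show ?thesis using assms by (auto simp: mult.commute neq_iff)
qed

lemma zcol_unit: "kcol R v k i * (\<integral>\<omega>. zcol k \<omega> * zcol k \<omega> \<partial>M) = kcol R v k i"
  using zcol_norm_aux(2) zres_inner by blast

lemma zcol_space:
  assumes S: "gaussian_space M S" and ZS: "\<And>i. i \<in> I \<Longrightarrow> Z i \<in> S"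
  shows "(\<lambda>\<omega>. zcol k \<omega>) \<in> S"
proof -
  have "(\<lambda>\<omega>. zres k i \<omega>) \<in> S" if "i \<in> I" for i
    using that
  proof (induction k arbitrary: i)
    case (Suc k)
    have "(\<lambda>\<omega>. zcol k \<omega>) \<in> S" unfolding zcol_scaled by (intro gaussian_spaceD(4)[OF S] Suc.IH v)
    then show ?case unfolding zres_Suc by (intro gaussian_space_diff[OF S] gaussian_spaceD(4)[OF S] Suc.IH Suc.prems)
  qed (simp add: ZS)
  then show ?thesis unfolding zcol_scaled by (intro gaussian_spaceD(4)[OF S]) (use v in blast)
qed

text \<open>The squared error of the \<open>n\<close>-th partial sum is the diagonal residual
  \<open>kres R v n i i\<close>.\<close>

lemma Z_series:
  assumes i: "i \<in> I" and null: "klim R v i i = 0"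
  shows "L2_lim M (\<lambda>n \<omega>. \<Sum>k<n. kcol R v k i * zcol k \<omega>) (Z i)"
proof -
  have "(\<integral>\<omega>. ((\<Sum>k<n. kcol R v k i * zcol k \<omega>) - Z i \<omega>)\<^sup>2 \<partial>M) = kres R v n i i" for n
  proof -
    have "((\<Sum>k<n. kcol R v k i * zcol k \<omega>) - Z i \<omega>)\<^sup>2 = zres n i \<omega> * zres n i \<omega>" for \<omega>
      unfolding vres_eq by (simp add: power2_eq_square algebra_simps)
    then show ?thesis using zres_inner[of n] i by simp
  qed
  then show ?thesis using kres_LIMSEQ[OF R, of v i i] null by (simp add: L2_lim_def)
qed

text \<open>Here \<open>y\<close> need not belong to \<open>I\<close>: its row of the Cholesky
  factor defines a variable in the closed span of the \<open>Z i\<close> that has the inner products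
  prescribed by \<open>R\<close> with them, although no variable indexed by \<open>y\<close> is
  given. It plays the part of the orthogonal projection of such a variable.\<close>

lemma Z_series_inner:
  assumes i: "i \<in> I" and null: "klim R v i i = 0"
  shows "(\<integral>\<omega>. Z i \<omega> * orthogonal_series (\<lambda>k \<omega>. zcol k \<omega>) (\<lambda>k. kcol R v k y) \<omega> \<partial>M) = R i y"
proof (rule LIMSEQ_unique)
  note os = orthogonal_series[of "\<lambda>k \<omega>. zcol k \<omega>", OF zcol_L2 zcol_orth zcol_unit summable_kcol[OF R]]
  show "(\<lambda>n. \<integral>\<omega>. (\<Sum>k<n. kcol R v k i * zcol k \<omega>) * (\<Sum>k<n. kcol R v k y * zcol k \<omega>) \<partial>M)
      \<longlonglongrightarrow> (\<integral>\<omega>. Z i \<omega> * orthogonal_series (\<lambda>k \<omega>. zcol k \<omega>) (\<lambda>k. kcol R v k y) \<omega> \<partial>M)"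
    by (intro L2_lim_inner Z_series assms os Z L2_sum L2_scale zcol_L2)
  show "(\<lambda>n. \<integral>\<omega>. (\<Sum>k<n. kcol R v k i * zcol k \<omega>) * (\<Sum>k<n. kcol R v k y * zcol k \<omega>) \<partial>M) \<longlonglongrightarrow> R i y"
    using kernel_Parseval[OF R null, of y]
    by (simp add: sums_def orthogonal_inner[of "\<lambda>k \<omega>. zcol k \<omega>", OF zcol_L2 zcol_orth zcol_unit])
qed

end

end

section \<open>Adjoining independent standard normals\<close>

lemma (in prob_space) indep_vars_pair:
  assumes "indep_vars (\<lambda>_. N) X I" "i \<in> I" "j \<in> I" "i \<noteq> j"
  shows "indep_var N (X i) N (X j)"
proof -
  have "indep_var N ((\<lambda>f. f i) \<circ> (\<lambda>\<omega>. \<lambda>k\<in>{i}. X k \<omega>)) N ((\<lambda>f. f j) \<circ> (\<lambda>\<omega>. \<lambda>k\<in>{j}. X k \<omega>))"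
    by (rule indep_var_compose[OF indep_var_restrict[OF assms(1)]]) (use assms in auto)
  then show ?thesis by (simp add: comp_def)
qed

definition noise_measure :: "(nat \<Rightarrow> real) measure" where
  "noise_measure = PiM UNIV (\<lambda>_. std_normal_distribution)"

interpretation std_normal: prob_space std_normal_distribution
  by (rule prob_space_normal_density) simp

interpretation noise: prob_space noise_measure
  unfolding noise_measure_def by (intro prob_space_PiM std_normal.prob_space_axioms)

lemma measurable_std_normal: "measurable A std_normal_distribution = measurable A borel"
  by (rule measurable_cong_sets) auto

lemma noise_component: "distr noise_measure std_normal_distribution (\<lambda>\<omega>. \<omega> k) = std_normal_distribution"
  unfolding noise_measure_def by (rule distr_PiM_component) (auto intro: std_normal.prob_space_axioms)

lemma noise_measurable [measurable]: "(\<lambda>\<omega>. \<omega> k) \<in> borel_measurable noise_measure"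
proof -
  have "(\<lambda>\<omega>. \<omega> k) \<in> measurable noise_measure std_normal_distribution"
    unfolding noise_measure_def by (rule measurable_component_singleton) simp
  then show ?thesis by (simp only: measurable_std_normal)
qed

declare restrict_UNIV [simp]

lemma noise_indep: "noise.indep_vars (\<lambda>_. borel) (\<lambda>k \<omega>. \<omega> k) UNIV"
proof -
  have "noise.indep_vars (\<lambda>_. std_normal_distribution) (\<lambda>k \<omega>. \<omega> k) UNIV"
  proof (subst noise.indep_vars_iff_distr_eq_PiM')
    show "(\<lambda>\<omega>. \<omega> i) \<in> measurable noise_measure std_normal_distribution" for i
      unfolding measurable_std_normal by (rule noise_measurable)
    have "distr noise_measure (PiM UNIV (\<lambda>_. std_normal_distribution)) (\<lambda>x. \<lambda>i\<in>UNIV. x i) = noise_measure"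
      unfolding noise_measure_def restrict_UNIV by (rule distr_id2) simp
    then show "distr noise_measure (PiM UNIV (\<lambda>_. std_normal_distribution)) (\<lambda>x. \<lambda>i\<in>UNIV. x i) =
      PiM UNIV (\<lambda>i. distr noise_measure std_normal_distribution (\<lambda>\<omega>. \<omega> i))"
      unfolding noise_component by (simp add: noise_measure_def)
  qed auto
  from noise.indep_vars_compose2[OF this, of "\<lambda>_ x. x" "\<lambda>_. borel"] show ?thesis by simp
qed

lemma noise_normal: "centered_normal noise_measure (\<lambda>\<omega>. \<omega> k)"
proof -
  have "distr noise_measure lborel (\<lambda>\<omega>. \<omega> k) = distr noise_measure std_normal_distribution (\<lambda>\<omega>. \<omega> k)"
    by (rule distr_cong) auto
  then have "distributed noise_measure lborel (\<lambda>\<omega>. \<omega> k) std_normal_density"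
    by (simp add: distributed_def noise_component)
  then show ?thesis unfolding centered_normal_def by (auto intro!: exI[of _ 1])
qed

lemma noise_L2: "(\<lambda>\<omega>. \<omega> k) \<in> L2 noise_measure"
  by (rule noise.centered_normal_moments[OF noise_normal])

lemma noise_orth: "k \<noteq> l \<Longrightarrow> (\<integral>\<omega>. \<omega> k * \<omega> l \<partial>noise_measure) = 0"
proof -
  assume "k \<noteq> l"
  then have "noise.indep_var borel (\<lambda>\<omega>. \<omega> k) borel (\<lambda>\<omega>. \<omega> l)"
    using noise.indep_vars_pair[OF noise_indep] by simp
  then show ?thesis
    using noise.indep_var_lebesgue_integral[of "\<lambda>\<omega>. \<omega> k" "\<lambda>\<omega>. \<omega> l"]
      noise.L2_integrable[OF noise_L2] noise.centered_normal_mean[OF noise_normal] by simp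
qed

lemma noise_unit: "(\<integral>\<omega>. \<omega> k * \<omega> k \<partial>noise_measure) = 1"
proof -
  have "(\<integral>\<omega>. \<omega> k * \<omega> k \<partial>noise_measure) = (\<integral>x. x ^ (2 * 1) \<partial>distr noise_measure std_normal_distribution (\<lambda>\<omega>. \<omega> k))"
    by (subst integral_distr) (auto simp: power2_eq_square simp: measurable_std_normal)
  then show ?thesis unfolding noise_component std_normal_distribution_even_moments(1) by simp
qed

text \<open>Characteristic functions multiply under independence, and the variances of the summands
  add up in the exponent.\<close>

lemma noise_family: "centered_gaussian_family noise_measure UNIV (\<lambda>k \<omega>. \<omega> k)"
  unfolding centered_gaussian_family_def
proof (intro allI impI)
  fix K :: "nat set" and c :: "nat \<Rightarrow> real" assume "finite K \<and> K \<subseteq> UNIV"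
  then have K: "finite K" by simp
  have L: "(\<lambda>\<omega>. \<Sum>j\<in>K. c j * \<omega> j) \<in> L2 noise_measure" by (intro L2_sum L2_scale noise_L2)
  have ind: "noise.indep_vars (\<lambda>_. borel) (\<lambda>k \<omega>. c k * \<omega> k) K"
    by (rule noise.indep_vars_compose2[OF noise.indep_vars_subset[OF noise_indep]]) auto
  have var: "(\<integral>\<omega>. (\<Sum>j\<in>K. c j * \<omega> j)\<^sup>2 \<partial>noise_measure) = (\<Sum>j\<in>K. (c j)\<^sup>2)"
    using noise.orthogonal_inner[of "\<lambda>k \<omega>. \<omega> k" c K c, OF noise_L2 noise_orth _ K]
    by (simp add: noise_unit power2_eq_square)
  show "centered_normal noise_measure (\<lambda>\<omega>. \<Sum>j\<in>K. c j * \<omega> j)"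
  proof (rule noise.centered_normal_char[OF L])
    fix t
    have "char (distr noise_measure borel (\<lambda>\<omega>. c k * \<omega> k)) t = exp (- (t\<^sup>2 * (c k)\<^sup>2) / 2)" for k
    proof -
      have "char (distr noise_measure borel (\<lambda>\<omega>. c k * \<omega> k)) t = char (distr noise_measure borel (\<lambda>\<omega>. \<omega> k)) (t * c k)"
        by (simp add: noise.char_distr mult.assoc)
      then show ?thesis
        using noise.centered_normal_moments(2)[OF noise_normal, of k "t * c k"] noise_unit[of k]
        by (simp add: power2_eq_square algebra_simps)
    qed
    then show "char (distr noise_measure borel (\<lambda>\<omega>. \<Sum>j\<in>K. c j * \<omega> j)) t =
        exp (- (t\<^sup>2 * (\<integral>\<omega>. (\<Sum>j\<in>K. c j * \<omega> j)\<^sup>2 \<partial>noise_measure)) / 2)"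
      unfolding noise.char_distr_sum[OF ind] var
      using K by (simp add: sum_distrib_left sum_negf sum_divide_distrib flip: of_real_prod exp_sum)
  qed
qed

declare noise_measurable [measurable del]

section \<open>Sums of independent normal variables on a product space\<close>

context pair_prob_space
begin

lemma distr_pair_snd: "distr (M1 \<Otimes>\<^sub>M M2) M2 snd = M2"
proof -
  have "distr (M1 \<Otimes>\<^sub>M M2) M2 snd = distr (distr (M2 \<Otimes>\<^sub>M M1) (M1 \<Otimes>\<^sub>M M2) (\<lambda>(x, y). (y, x))) M2 snd"
    by (subst distr_pair_swap) simp
  also have "\<dots> = distr (M2 \<Otimes>\<^sub>M M1) M2 fst"
    by (subst distr_distr) (auto simp: comp_def case_prod_beta)
  also have "\<dots> = M2" by (rule M1.distr_pair_fst)
  finally show ?thesis .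
qed

lemma indep_fst_snd:
  assumes [measurable]: "f \<in> borel_measurable M1" "g \<in> borel_measurable M2"
  shows "indep_var borel (\<lambda>\<omega>. f (fst \<omega>)) borel (\<lambda>\<omega>. g (snd \<omega>))"
proof -
  have "distr (distr (M1 \<Otimes>\<^sub>M M2) M2 snd) borel g = distr M2 borel g"
    by (simp add: distr_pair_snd)
  then have g: "distr (M1 \<Otimes>\<^sub>M M2) borel (\<lambda>\<omega>. g (snd \<omega>)) = distr M2 borel g"
    by (subst (asm) distr_distr) (auto simp: comp_def)
  have "distr (distr (M1 \<Otimes>\<^sub>M M2) M1 fst) borel f = distr M1 borel f"
    by (simp add: M2.distr_pair_fst)
  then have f: "distr (M1 \<Otimes>\<^sub>M M2) borel (\<lambda>\<omega>. f (fst \<omega>)) = distr M1 borel f"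
    by (subst (asm) distr_distr) (auto simp: comp_def)
  interpret g: prob_space "distr M2 borel g" by (rule M2.prob_space_distr) simp
  show ?thesis
    unfolding indep_var_distribution_eq f g
    by (subst pair_measure_distr) (auto simp: case_prod_unfold g.sigma_finite_measure_axioms)
qed

lemma integral_fst_only:
  fixes f :: "_ \<Rightarrow> _::{banach, second_countable_topology}"
  assumes [measurable]: "f \<in> borel_measurable M1"
  shows "(\<integral>\<omega>. f (fst \<omega>) \<partial>(M1 \<Otimes>\<^sub>M M2)) = (\<integral>\<omega>. f \<omega> \<partial>M1)"
    "integrable (M1 \<Otimes>\<^sub>M M2) (\<lambda>\<omega>. f (fst \<omega>)) \<longleftrightarrow> integrable M1 f"
  using integral_distr[of fst "M1 \<Otimes>\<^sub>M M2" M1 f] integrable_distr_eq[of fst "M1 \<Otimes>\<^sub>M M2" M1 f]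
  by (simp_all add: M2.distr_pair_fst)

lemma integral_snd_only:
  fixes f :: "_ \<Rightarrow> _::{banach, second_countable_topology}"
  assumes [measurable]: "f \<in> borel_measurable M2"
  shows "(\<integral>\<omega>. f (snd \<omega>) \<partial>(M1 \<Otimes>\<^sub>M M2)) = (\<integral>\<omega>. f \<omega> \<partial>M2)"
    "integrable (M1 \<Otimes>\<^sub>M M2) (\<lambda>\<omega>. f (snd \<omega>)) \<longleftrightarrow> integrable M2 f"
  using integral_distr[of snd "M1 \<Otimes>\<^sub>M M2" M2 f] integrable_distr_eq[of snd "M1 \<Otimes>\<^sub>M M2" M2 f]
  by (simp_all add: distr_pair_snd)

lemma L2_fst: "f \<in> L2 M1 \<Longrightarrow> (\<lambda>\<omega>. f (fst \<omega>)) \<in> L2 (M1 \<Otimes>\<^sub>M M2)"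
  using integral_fst_only(2)[of "\<lambda>x. (f x)\<^sup>2"] by (auto simp: L2_def)

lemma L2_snd: "g \<in> L2 M2 \<Longrightarrow> (\<lambda>\<omega>. g (snd \<omega>)) \<in> L2 (M1 \<Otimes>\<^sub>M M2)"
  using integral_snd_only(2)[of "\<lambda>x. (g x)\<^sup>2"] by (auto simp: L2_def)

lemma integral_indep_mult:
  assumes f: "f \<in> L2 M1" "centered_normal M1 f" and g: "g \<in> L2 M2"
  shows "(\<integral>\<omega>. f (fst \<omega>) * g (snd \<omega>) \<partial>(M1 \<Otimes>\<^sub>M M2)) = 0"
proof -
  have m[measurable]: "f \<in> borel_measurable M1" "g \<in> borel_measurable M2" using f(1) g by (auto dest: L2D)
  show ?thesis
    using indep_var_lebesgue_integral[OF indep_fst_snd[OF m] L2_integrable[OF L2_fst[OF f(1)]] L2_integrable[OF L2_snd[OF g]]]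
    by (simp add: integral_fst_only M1.centered_normal_mean[OF f(2)])
qed

lemma integral_pair_sum:
  assumes f: "f \<in> L2 M1" "centered_normal M1 f" "f' \<in> L2 M1" "centered_normal M1 f'"
    and g: "g \<in> L2 M2" "g' \<in> L2 M2"
  shows "(\<integral>\<omega>. (f (fst \<omega>) + g (snd \<omega>)) * (f' (fst \<omega>) + g' (snd \<omega>)) \<partial>(M1 \<Otimes>\<^sub>M M2)) =
    (\<integral>\<omega>. f \<omega> * f' \<omega> \<partial>M1) + (\<integral>\<omega>. g \<omega> * g' \<omega> \<partial>M2)"
proof -
  have m[measurable]: "f \<in> borel_measurable M1" "g \<in> borel_measurable M2"
    "f' \<in> borel_measurable M1" "g' \<in> borel_measurable M2" using f g by (auto dest: L2D)
  note [simp] = L2_mult_integrable[OF L2_fst[OF f(1)] L2_fst[OF f(3)]] L2_mult_integrable[OF L2_fst[OF f(1)] L2_snd[OF g(2)]]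
    L2_mult_integrable[OF L2_fst[OF f(3)] L2_snd[OF g(1)]] L2_mult_integrable[OF L2_snd[OF g(1)] L2_snd[OF g(2)]]
  have "(\<integral>\<omega>. (f (fst \<omega>) + g (snd \<omega>)) * (f' (fst \<omega>) + g' (snd \<omega>)) \<partial>(M1 \<Otimes>\<^sub>M M2)) =
    (\<integral>\<omega>. f (fst \<omega>) * f' (fst \<omega>) + f (fst \<omega>) * g' (snd \<omega>) + f' (fst \<omega>) * g (snd \<omega>) + g (snd \<omega>) * g' (snd \<omega>) \<partial>(M1 \<Otimes>\<^sub>M M2))"
    by (simp add: algebra_simps)
  also have "\<dots> = (\<integral>\<omega>. f \<omega> * f' \<omega> \<partial>M1) + (\<integral>\<omega>. g \<omega> * g' \<omega> \<partial>M2)"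
    using integral_fst_only(1)[of "\<lambda>x. f x * f' x"] integral_snd_only(1)[of "\<lambda>x. g x * g' x"]
    by (simp add: integral_indep_mult f g)
  finally show ?thesis .
qed

lemma centered_normal_pair_sum:
  assumes f: "centered_normal M1 f" and g: "centered_normal M2 g"
  shows "centered_normal (M1 \<Otimes>\<^sub>M M2) (\<lambda>\<omega>. f (fst \<omega>) + g (snd \<omega>))"
proof (rule centered_normal_char)
  note Lf = M1.centered_normal_moments(1)[OF f] and Lg = M2.centered_normal_moments(1)[OF g]
  have m[measurable]: "f \<in> borel_measurable M1" "g \<in> borel_measurable M2" using Lf Lg by (auto dest: L2D)
  show "(\<lambda>\<omega>. f (fst \<omega>) + g (snd \<omega>)) \<in> L2 (M1 \<Otimes>\<^sub>M M2)" by (intro L2_add L2_fst L2_snd Lf Lg)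
  fix t
  have var: "(\<integral>\<omega>. (f (fst \<omega>) + g (snd \<omega>))\<^sup>2 \<partial>(M1 \<Otimes>\<^sub>M M2)) = (\<integral>\<omega>. (f \<omega>)\<^sup>2 \<partial>M1) + (\<integral>\<omega>. (g \<omega>)\<^sup>2 \<partial>M2)"
    using integral_pair_sum[OF Lf f Lf f Lg Lg] by (simp add: power2_eq_square)
  have "char (distr (M1 \<Otimes>\<^sub>M M2) borel (\<lambda>\<omega>. f (fst \<omega>))) t = char (distr M1 borel f) t"
    "char (distr (M1 \<Otimes>\<^sub>M M2) borel (\<lambda>\<omega>. g (snd \<omega>))) t = char (distr M2 borel g) t"
    using integral_fst_only(1)[of "\<lambda>x. iexp (t * f x)"] integral_snd_only(1)[of "\<lambda>x. iexp (t * g x)"]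
    by (simp_all add: char_distr M1.char_distr M2.char_distr)
  then show "char (distr (M1 \<Otimes>\<^sub>M M2) borel (\<lambda>\<omega>. f (fst \<omega>) + g (snd \<omega>))) t =
      exp (- (t\<^sup>2 * (\<integral>\<omega>. (f (fst \<omega>) + g (snd \<omega>))\<^sup>2 \<partial>(M1 \<Otimes>\<^sub>M M2))) / 2)"
    unfolding char_distr_add[OF indep_fst_snd[OF m]] var
      M1.centered_normal_moments(2)[OF f] M2.centered_normal_moments(2)[OF g]
    by (simp add: M1.centered_normal_moments(2)[OF f] M2.centered_normal_moments(2)[OF g]
        algebra_simps add_divide_distrib flip: of_real_mult exp_add)
qed

lemma gaussian_space_pair:
  assumes S: "gaussian_space M1 S" and T: "gaussian_space M2 T"
  shows "gaussian_space (M1 \<Otimes>\<^sub>M M2) {\<lambda>\<omega>. f (fst \<omega>) + g (snd \<omega>) | f g. f \<in> S \<and> g \<in> T}"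
  unfolding gaussian_space_def
proof (intro conjI ballI allI)
  let ?U = "{\<lambda>\<omega>. f (fst \<omega>) + g (snd \<omega>) | f g. f \<in> S \<and> g \<in> T}"
  show "(\<lambda>_. 0) \<in> ?U" using gaussian_spaceD(2)[OF S] gaussian_spaceD(2)[OF T] by force
  fix X assume "X \<in> ?U"
  then obtain f g where X: "X = (\<lambda>\<omega>. f (fst \<omega>) + g (snd \<omega>))" "f \<in> S" "g \<in> T" by blast
  show "centered_normal (M1 \<Otimes>\<^sub>M M2) X"
    unfolding X by (intro centered_normal_pair_sum gaussian_spaceD(1)[OF S] gaussian_spaceD(1)[OF T] X)
  show "(\<lambda>\<omega>. c * X \<omega>) \<in> ?U" for c
    by (rule CollectI, rule exI[of _ "\<lambda>x. c * f x"], rule exI[of _ "\<lambda>x. c * g x"])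
      (auto simp: X(1) algebra_simps intro: gaussian_spaceD(4)[OF S] gaussian_spaceD(4)[OF T] X)
  fix Y assume "Y \<in> ?U"
  then obtain f' g' where Y: "Y = (\<lambda>\<omega>. f' (fst \<omega>) + g' (snd \<omega>))" "f' \<in> S" "g' \<in> T" by blast
  show "(\<lambda>\<omega>. X \<omega> + Y \<omega>) \<in> ?U"
    by (rule CollectI, rule exI[of _ "\<lambda>x. f x + f' x"], rule exI[of _ "\<lambda>x. g x + g' x"])
      (auto simp: X(1) Y(1) algebra_simps intro: gaussian_spaceD(3)[OF S] gaussian_spaceD(3)[OF T] X Y)
qed

end

text \<open>\<open>W j\<close> is a sum of two independent parts. \<open>W1 j\<close> lies in the
  closed span of the \<open>Z i\<close>; its coefficients are the row of \<open>j\<close> in the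
  elimination of \<open>R\<close>, so its covariances are \<open>R\<close> minus the residual
  \<open>klim R v\<close>. \<open>W2 j\<close> is built from the noise with the row of
  \<open>j\<close> in the elimination of that residual, and supplies what is missing; this is where
  exhaustion on \<open>J\<close> by the pivots \<open>w\<close> enters. Independence removes
  \<open>W2 j\<close> from the covariances with the \<open>Z i\<close>.\<close>

theorem isonormal_extension:
  fixes N :: "'g measure" and R :: "'i \<Rightarrow> 'i \<Rightarrow> real" and Z :: "'i \<Rightarrow> 'g \<Rightarrow> real"
  assumes "prob_space N" and R: "psd_kernel R" and Z: "centered_gaussian_family N I Z"
    and cov: "\<And>i j. i \<in> I \<Longrightarrow> j \<in> I \<Longrightarrow> (\<integral>\<omega>. Z i \<omega> * Z j \<omega> \<partial>N) = R i j"
    and v: "\<And>k. v k \<in> I" "\<And>i. i \<in> I \<Longrightarrow> klim R v i i = 0"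
    and w: "\<And>j. j \<in> J \<Longrightarrow> klim (klim R v) w j j = 0"
  obtains W :: "'i \<Rightarrow> 'g \<times> (nat \<Rightarrow> real) \<Rightarrow> real" and S
  where "gaussian_space (N \<Otimes>\<^sub>M noise_measure) S" "\<And>j. W j \<in> S"
    "\<And>j k. j \<in> J \<Longrightarrow> k \<in> J \<Longrightarrow> (\<integral>\<omega>. W j \<omega> * W k \<omega> \<partial>(N \<Otimes>\<^sub>M noise_measure)) = R j k"
    "\<And>i j. i \<in> I \<Longrightarrow> j \<in> J \<Longrightarrow> (\<integral>\<omega>. Z i (fst \<omega>) * W j \<omega> \<partial>(N \<Otimes>\<^sub>M noise_measure)) = R i j"
proof -
  interpret N: prob_space N by fact
  interpret P: pair_prob_space N noise_measure ..
  have span: "gaussian_space N (gaussian_span I Z)" by (rule gaussian_space_span[OF Z])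
  have ZS: "Z i \<in> gaussian_span I Z" if "i \<in> I" for i by (rule gaussian_span_mem[OF that])
  have ZL: "Z i \<in> L2 N" if "i \<in> I" for i by (rule N.gaussian_space_L2[OF span ZS[OF that]])
  define \<Gamma> where "\<Gamma> k \<omega> = vcol R v (\<lambda>i. Z i \<omega>) k" for k \<omega>
  have \<Gamma>L: "\<Gamma> k \<in> L2 N" for k unfolding \<Gamma>_def by (rule N.zcol_L2[OF R ZL cov v(1)])
  have \<Gamma>o: "(\<integral>\<omega>. \<Gamma> k \<omega> * \<Gamma> l \<omega> \<partial>N) = 0" if "k \<noteq> l" for k l
    unfolding \<Gamma>_def by (rule N.zcol_orth[OF R ZL cov v(1) that])
  have \<Gamma>u: "kcol R v k i * (\<integral>\<omega>. \<Gamma> k \<omega> * \<Gamma> k \<omega> \<partial>N) = kcol R v k i" for k i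
    unfolding \<Gamma>_def by (rule N.zcol_unit[OF R ZL cov v(1)])
  have \<Gamma>S: "\<Gamma> k \<in> gaussian_span I Z" for k
    unfolding \<Gamma>_def by (rule N.zcol_space[OF R ZL cov v(1) span ZS])
  define R' where "R' = klim R v"
  have R': "psd_kernel R'" unfolding R'_def by (rule psd_klim[OF R])
  define W1 where "W1 j = N.orthogonal_series \<Gamma> (\<lambda>k. kcol R v k j)" for j
  define W2 where "W2 j = noise.orthogonal_series (\<lambda>k \<omega>. \<omega> k) (\<lambda>k. kcol R' w k j)" for j
  define S1 where "S1 = gaussian_closure N (gaussian_span I Z)"
  define S2 where "S2 = gaussian_closure noise_measure (gaussian_span UNIV (\<lambda>k \<omega>. \<omega> k))"
  have S1: "gaussian_space N S1" unfolding S1_def by (rule N.gaussian_space_closure[OF span])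
  have span2: "gaussian_space noise_measure (gaussian_span UNIV (\<lambda>k \<omega>. \<omega> k))"
    by (rule gaussian_space_span[OF noise_family])
  have S2: "gaussian_space noise_measure S2" unfolding S2_def by (rule noise.gaussian_space_closure[OF span2])
  have W1: "W1 j \<in> S1" for j
    unfolding W1_def S1_def
    by (rule N.orthogonal_series_closure[OF \<Gamma>L \<Gamma>o span \<Gamma>S \<Gamma>u summable_kcol[OF R]])
  have W2: "W2 j \<in> S2" for j
    unfolding W2_def S2_def
    by (rule noise.orthogonal_series_closure[OF noise_L2 noise_orth span2 gaussian_span_mem _ summable_kcol[OF R']])
      (auto simp: noise_unit)
  have L1: "W1 j \<in> L2 N" and L2: "W2 j \<in> L2 noise_measure" for j
    using N.gaussian_space_L2[OF S1 W1] noise.gaussian_space_L2[OF S2 W2] by auto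
  have c1: "(\<integral>\<omega>. W1 j \<omega> * W1 k \<omega> \<partial>N) = R j k - R' j k" for j k
  proof -
    have "(\<integral>\<omega>. W1 j \<omega> * W1 k \<omega> \<partial>N) = (\<Sum>l. kcol R v l j * kcol R v l k)"
      unfolding W1_def
      by (rule N.orthogonal_series_inner[OF \<Gamma>L \<Gamma>o \<Gamma>u summable_kcol[OF R] \<Gamma>u summable_kcol[OF R]])
    then show ?thesis by (simp add: R'_def klim_def)
  qed
  have c2: "(\<integral>\<omega>. W2 j \<omega> * W2 k \<omega> \<partial>noise_measure) = R' j k" if "j \<in> J" for j k
  proof -
    have "(\<integral>\<omega>. W2 j \<omega> * W2 k \<omega> \<partial>noise_measure) = (\<Sum>l. kcol R' w l j * kcol R' w l k)"
      unfolding W2_def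
      by (rule noise.orthogonal_series_inner[OF noise_L2 noise_orth _ summable_kcol[OF R'] _ summable_kcol[OF R']])
        (auto simp: noise_unit)
    also have "\<dots> = R' j k" using kernel_Parseval[OF R', of w j k] w[OF that] by (simp add: R'_def sums_iff)
    finally show ?thesis .
  qed
  define W where "W j \<omega> = W1 j (fst \<omega>) + W2 j (snd \<omega>)" for j and \<omega> :: "'g \<times> (nat \<Rightarrow> real)"
  show ?thesis
  proof (rule that[OF P.gaussian_space_pair[OF S1 S2]])
    show "W j \<in> {\<lambda>\<omega>. f (fst \<omega>) + g (snd \<omega>) | f g. f \<in> S1 \<and> g \<in> S2}" for j
      unfolding W_def[abs_def] using W1[of j] W2[of j] by blast
    show "(\<integral>\<omega>. W j \<omega> * W k \<omega> \<partial>(N \<Otimes>\<^sub>M noise_measure)) = R j k" if "j \<in> J" "k \<in> J" for j k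
      unfolding W_def
      by (subst P.integral_pair_sum) (auto simp: L1 L2 c1 c2 that gaussian_spaceD(1)[OF S1 W1])
    show "(\<integral>\<omega>. Z i (fst \<omega>) * W j \<omega> \<partial>(N \<Otimes>\<^sub>M noise_measure)) = R i j" if i: "i \<in> I" and "j \<in> J" for i j
    proof -
      have "(\<integral>\<omega>. Z i (fst \<omega>) * W j \<omega> \<partial>(N \<Otimes>\<^sub>M noise_measure)) = (\<integral>\<omega>. Z i \<omega> * W1 j \<omega> \<partial>N)"
        using P.integral_pair_sum[of "Z i" "W1 j" "\<lambda>_. 0" "W2 j"]
        by (simp add: W_def ZL[OF i] L1 L2 L2_zero gaussian_spaceD(1)[OF S1 W1] gaussian_spaceD(1)[OF span ZS[OF i]])
      also have "\<dots> = R i j"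
        unfolding W1_def \<Gamma>_def[abs_def] by (rule N.Z_series_inner[OF R ZL cov v(1) i v(2)[OF i]])
      finally show ?thesis .
    qed
  qed
qed

section \<open>Continuous modification\<close>

definition hat :: "real \<Rightarrow> real" where
  "hat x = max 0 (1 - \<bar>x\<bar>)"

text \<open>Piecewise linear interpolation: the only tents that meet the inside of the cell
  \<open>[m, m + 1]\<close> are those at its ends.\<close>

lemma hat_sum:
  assumes m: "m < K" "real m \<le> x" "x \<le> real m + 1"
  shows "(\<Sum>k\<le>K. a k * hat (x - real k)) = a m * (real m + 1 - x) + a (Suc m) * (x - real m)"
proof -
  have "(\<Sum>k\<le>K. a k * hat (x - real k)) = (\<Sum>k\<in>{m, Suc m}. a k * hat (x - real k))"
  proof (rule sum.mono_neutral_right)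
    show "\<forall>k\<in>{..K} - {m, Suc m}. a k * hat (x - real k) = 0"
    proof
      fix k assume "k \<in> {..K} - {m, Suc m}"
      then have "k < m \<or> Suc m < k" by auto
      then have "real k + 1 \<le> real m \<or> real m + 2 \<le> real k" by linarith
      then show "a k * hat (x - real k) = 0" using m by (auto simp: hat_def)
    qed
  qed (use m in auto)
  also have "\<dots> = a m * (real m + 1 - x) + a (Suc m) * (x - real m)"
    using m by (simp add: hat_def)
  finally show ?thesis .
qed

text \<open>The cells are closed, so that \<open>t = 1\<close> belongs to the last one,
  \<open>m = 2 ^ n - 1\<close>.\<close>

lemma unit_interval_cell:
  assumes "0 \<le> t" "t \<le> 1"
  obtains m :: nat where "m < 2 ^ n" "real m \<le> 2 ^ n * t" "2 ^ n * t \<le> real m + 1"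
proof (cases "t = 1")
  case True
  show ?thesis
    by (rule that[of "2 ^ n - 1"]) (use True in \<open>auto simp: of_nat_diff\<close>)
next
  case False
  then have "2 ^ n * t < 2 ^ n" using assms by simp
  then show ?thesis
    using that[of "nat \<lfloor>2 ^ n * t\<rfloor>"] assms by (auto simp: nat_less_iff floor_less_iff)
qed

text \<open>Fatou's lemma bounds the mean square of \<open>Y - X\<close> by the limit of the L^2
  errors.\<close>

lemma (in prob_space) L2_lim_AE_unique:
  assumes L: "\<And>n. Xn n \<in> L2 M" "X \<in> L2 M" and lim: "L2_lim M Xn X"
    and [measurable]: "Y \<in> borel_measurable M" and AE: "AE \<omega> in M. (\<lambda>n. Xn n \<omega>) \<longlonglongrightarrow> Y \<omega>"
  shows "AE \<omega> in M. Y \<omega> = X \<omega>"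
proof -
  have [measurable]: "Xn n \<in> borel_measurable M" "X \<in> borel_measurable M" for n using L by (auto dest: L2D)
  have "(\<integral>\<^sup>+\<omega>. ennreal ((Y \<omega> - X \<omega>)\<^sup>2) \<partial>M) = (\<integral>\<^sup>+\<omega>. liminf (\<lambda>n. ennreal ((Xn n \<omega> - X \<omega>)\<^sup>2)) \<partial>M)"
  proof (rule nn_integral_cong_AE)
    show "AE \<omega> in M. ennreal ((Y \<omega> - X \<omega>)\<^sup>2) = liminf (\<lambda>n. ennreal ((Xn n \<omega> - X \<omega>)\<^sup>2))"
      using AE
    proof eventually_elim
      case (elim \<omega>)
      have "(\<lambda>n. ennreal ((Xn n \<omega> - X \<omega>)\<^sup>2)) \<longlonglongrightarrow> ennreal ((Y \<omega> - X \<omega>)\<^sup>2)"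
        by (intro tendsto_ennrealI tendsto_intros elim)
      from lim_imp_Liminf[OF _ this] show ?case by simp
    qed
  qed
  also have "\<dots> \<le> liminf (\<lambda>n. \<integral>\<^sup>+\<omega>. ennreal ((Xn n \<omega> - X \<omega>)\<^sup>2) \<partial>M)"
    by (rule nn_integral_liminf) measurable
  also have "(\<lambda>n. \<integral>\<^sup>+\<omega>. ennreal ((Xn n \<omega> - X \<omega>)\<^sup>2) \<partial>M) = (\<lambda>n. ennreal (\<integral>\<omega>. (Xn n \<omega> - X \<omega>)\<^sup>2 \<partial>M))"
    by (intro ext nn_integral_eq_integral L2D(2) L2_diff L) auto
  also have "liminf \<dots> = ennreal 0"
    using lim by (intro lim_imp_Liminf tendsto_ennrealI) (auto simp: L2_lim_def)
  finally have "AE \<omega> in M. ennreal ((Y \<omega> - X \<omega>)\<^sup>2) = 0"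
    by (subst (asm) ennreal_0, subst (asm) le_zero_eq, subst (asm) nn_integral_0_iff_AE) auto
  then show ?thesis by eventually_elim (simp add: ennreal_eq_0_iff)
qed

text \<open>
  The continuous modification is the uniform limit of the piecewise linear interpolations on the
  dyadic grids; fourth moments make the increments between successive levels summable.
\<close>

lemma (in prob_space) continuous_modification:
  fixes X :: "real \<Rightarrow> 'a \<Rightarrow> real"
  assumes S: "gaussian_space M S" and X: "\<And>t. t \<in> {0..1} \<Longrightarrow> X t \<in> S"
    and inc: "\<And>s t. s \<in> {0..1} \<Longrightarrow> t \<in> {0..1} \<Longrightarrow> (\<integral>\<omega>. (X t \<omega> - X s \<omega>)\<^sup>2 \<partial>M) = c * \<bar>t - s\<bar>"
  obtains Y where "\<And>t. t \<in> {0..1} \<Longrightarrow> Y t \<in> borel_measurable M"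
    "\<And>t. t \<in> {0..1} \<Longrightarrow> AE \<omega> in M. Y t \<omega> = X t \<omega>" "AE \<omega> in M. continuous_on {0..1} (\<lambda>t. Y t \<omega>)"
proof -
  define d where "d n k = real k / 2 ^ n" for n k :: nat
  define L where "L n t \<omega> = (\<Sum>k\<le>2 ^ n. X (d n k) \<omega> * hat (2 ^ n * t - real k))" for n t \<omega>
  \<comment> \<open>The value at the new midpoint minus the average of its two neighbours. On the
    cell \<open>m\<close> the difference of two successive interpolations is a tent: it vanishes at
    the ends, equals \<open>D n m\<close> at the midpoint and is linear in between.\<close>
  define D where "D n m \<omega> = X (d (Suc n) (2 * m + 1)) \<omega> - (X (d n m) \<omega> + X (d n (Suc m)) \<omega>) / 2" for n m \<omega>
  have L2S: "Z \<in> L2 M" if "Z \<in> S" for Z by (rule gaussian_space_L2[OF S that])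
  have d01: "d n k \<in> {0..1}" if "k \<le> 2 ^ n" for n k
    using that by (auto simp: d_def divide_le_eq_1)
  have Xm[measurable]: "X t \<in> borel_measurable M" if "t \<in> {0..1}" for t
    using L2S[OF X[OF that]] by (rule L2D)
  have Lm: "L n t \<in> borel_measurable M" for n t
    unfolding L_def by (intro borel_measurable_sum borel_measurable_times Xm d01) auto
  have "0 \<le> (\<integral>\<omega>. (X 1 \<omega> - X 0 \<omega>)\<^sup>2 \<partial>M)" by simp
  then have c: "0 \<le> c" using inc[of 0 1] by simp
  have step: "\<exists>m<2 ^ n. \<bar>L (Suc n) t \<omega> - L n t \<omega>\<bar> \<le> \<bar>D n m \<omega>\<bar>" if t: "t \<in> {0..1}" for n t \<omega>
  proof -
    obtain m :: nat where m: "m < 2 ^ n" "real m \<le> 2 ^ n * t" "2 ^ n * t \<le> real m + 1"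
      using unit_interval_cell[of t n] t by auto
    define x where "x = 2 ^ n * t"
    note m = m[folded x_def]
    have dA: "d (Suc n) (2 * m) = d n m" "d (Suc n) (Suc (Suc (2 * m))) = d n (Suc m)"
      by (simp_all add: d_def field_simps)
    have Ln: "L n t \<omega> = X (d n m) \<omega> * (real m + 1 - x) + X (d n (Suc m)) \<omega> * (x - real m)"
      unfolding L_def x_def[symmetric] by (rule hat_sum[OF m])
    have x2: "2 ^ Suc n * t = 2 * x" by (simp add: x_def)
    have "\<bar>L (Suc n) t \<omega> - L n t \<omega>\<bar> \<le> \<bar>D n m \<omega>\<bar>"
    proof (cases "2 * x \<le> 2 * real m + 1")
      case True
      have "L (Suc n) t \<omega> = X (d (Suc n) (2 * m)) \<omega> * (real (2 * m) + 1 - 2 * x)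
          + X (d (Suc n) (Suc (2 * m))) \<omega> * (2 * x - real (2 * m))"
        unfolding L_def x2 by (rule hat_sum) (use m True in auto)
      then have "L (Suc n) t \<omega> - L n t \<omega> = 2 * (x - real m) * D n m \<omega>"
        unfolding Ln dA by (simp add: D_def field_simps)
      moreover have "\<bar>2 * (x - real m)\<bar> \<le> 1" using m True by simp
      ultimately show ?thesis by (simp add: abs_mult mult_left_le_one_le)
    next
      case False
      have "L (Suc n) t \<omega> = X (d (Suc n) (Suc (2 * m))) \<omega> * (real (Suc (2 * m)) + 1 - 2 * x)
          + X (d (Suc n) (Suc (Suc (2 * m)))) \<omega> * (2 * x - real (Suc (2 * m)))"
        unfolding L_def x2 by (rule hat_sum) (use m False in auto)
      then have "L (Suc n) t \<omega> - L n t \<omega> = 2 * (real m + 1 - x) * D n m \<omega>"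
        unfolding Ln dA by (simp add: D_def field_simps)
      moreover have "\<bar>2 * (real m + 1 - x)\<bar> \<le> 1" using m False by simp
      ultimately show ?thesis by (simp add: abs_mult mult_left_le_one_le)
    qed
    with m(1) show ?thesis by blast
  qed
  have DS: "D n m \<in> S" if "m < 2 ^ n" for n m
  proof -
    have "(\<lambda>\<omega>. X (d (Suc n) (2 * m + 1)) \<omega> + ((- 1 / 2) * X (d n m) \<omega> + (- 1 / 2) * X (d n (Suc m)) \<omega>)) \<in> S"
      by (intro gaussian_spaceD(3)[OF S] gaussian_spaceD(4)[OF S] X d01) (use that in auto)
    then show ?thesis by (simp add: D_def[abs_def] field_simps)
  qed
  \<comment> \<open>\<open>D n m\<close> is the average of two increments of \<open>X\<close> over
    times of length \<open>1 / 2 ^ Suc n\<close>.\<close>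
  have D2: "(\<integral>\<omega>. (D n m \<omega>)\<^sup>2 \<partial>M) \<le> c / 2 ^ Suc n" if m: "m < 2 ^ n" for n m
  proof -
    define A where "A \<omega> = X (d (Suc n) (2 * m + 1)) \<omega> - X (d n m) \<omega>" for \<omega>
    define B where "B \<omega> = X (d (Suc n) (2 * m + 1)) \<omega> - X (d n (Suc m)) \<omega>" for \<omega>
    have in01: "d (Suc n) (2 * m + 1) \<in> {0..1}" "d n m \<in> {0..1}" "d n (Suc m) \<in> {0..1}"
      using m by (intro d01; simp)+
    have AL: "A \<in> L2 M" "B \<in> L2 M" unfolding A_def[abs_def] B_def[abs_def]
      by (intro L2_diff L2S X in01)+
    have "(\<integral>\<omega>. (D n m \<omega>)\<^sup>2 \<partial>M) \<le> (\<integral>\<omega>. (1 / 2) * ((A \<omega>)\<^sup>2 + (B \<omega>)\<^sup>2) \<partial>M)"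
    proof (rule integral_mono)
      show "integrable M (\<lambda>\<omega>. (D n m \<omega>)\<^sup>2)" by (rule L2D(2)[OF L2S[OF DS[OF m]]])
      show "integrable M (\<lambda>\<omega>. (1 / 2) * ((A \<omega>)\<^sup>2 + (B \<omega>)\<^sup>2))"
        by (intro integrable_mult_right Bochner_Integration.integrable_add L2D(2) AL)
      fix \<omega>
      have D: "D n m \<omega> = (A \<omega> + B \<omega>) / 2" by (simp add: D_def A_def B_def field_simps)
      have "(D n m \<omega>)\<^sup>2 = (A \<omega> + B \<omega>)\<^sup>2 / 4" unfolding D power_divide by simp
      then show "(D n m \<omega>)\<^sup>2 \<le> (1 / 2) * ((A \<omega>)\<^sup>2 + (B \<omega>)\<^sup>2)"
        using sum_squares_ge[of "A \<omega>" "B \<omega>"] by simp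
    qed
    also have "\<dots> = (1 / 2) * ((\<integral>\<omega>. (A \<omega>)\<^sup>2 \<partial>M) + (\<integral>\<omega>. (B \<omega>)\<^sup>2 \<partial>M))"
      using AL by (simp add: L2D)
    also have "(\<integral>\<omega>. (A \<omega>)\<^sup>2 \<partial>M) = c * \<bar>d (Suc n) (2 * m + 1) - d n m\<bar>"
      unfolding A_def by (rule inc[OF in01(2,1)])
    also have "(\<integral>\<omega>. (B \<omega>)\<^sup>2 \<partial>M) = c * \<bar>d (Suc n) (2 * m + 1) - d n (Suc m)\<bar>"
      unfolding B_def by (rule inc[OF in01(3,1)])
    also have "d (Suc n) (2 * m + 1) - d n m = 1 / 2 ^ Suc n" by (simp add: d_def field_simps)
    also have "d (Suc n) (2 * m + 1) - d n (Suc m) = - 1 / 2 ^ Suc n" by (simp add: d_def field_simps)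
    finally show ?thesis by simp
  qed
  \<comment> \<open>Bounds the fourth power of the largest \<open>D n m\<close> of a level. Its
    expectation is at most \<open>2 ^ n\<close> times \<open>3 * (c / 2 ^ Suc n)\<^sup>2\<close>,
    which decays like \<open>(1 / 2) ^ n\<close>; the corresponding bound with squares would not
    decay at all.\<close>
  define Q where "Q n \<omega> = (\<Sum>m<2 ^ n. (D n m \<omega>) ^ 4)" for n \<omega>
  have Qm[measurable]: "Q n \<in> borel_measurable M" for n
    unfolding Q_def using DS L2S L2D(1) by (intro borel_measurable_sum borel_measurable_power) blast
  have Q0: "0 \<le> Q n \<omega>" for n \<omega> unfolding Q_def by (intro sum_nonneg) simp
  have EQ: "(\<integral>\<^sup>+\<omega>. ennreal (Q n \<omega>) \<partial>M) \<le> ennreal (c\<^sup>2 * (1 / 2) ^ n)" for n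
  proof -
    have D4: "integrable M (\<lambda>\<omega>. (D n m \<omega>) ^ 4)" "(\<integral>\<omega>. (D n m \<omega>) ^ 4 \<partial>M) \<le> 3 * (c / 2 ^ Suc n)\<^sup>2" if "m < 2 ^ n" for m
    proof -
      note N = gaussian_spaceD(1)[OF S DS[OF that]]
      show "integrable M (\<lambda>\<omega>. (D n m \<omega>) ^ 4)" by (rule centered_normal_moments[OF N])
      show "(\<integral>\<omega>. (D n m \<omega>) ^ 4 \<partial>M) \<le> 3 * (c / 2 ^ Suc n)\<^sup>2"
        unfolding centered_normal_moments(4)[OF N] by (intro mult_left_mono power_mono D2 that) auto
    qed
    have "(\<integral>\<^sup>+\<omega>. ennreal (Q n \<omega>) \<partial>M) = ennreal (\<integral>\<omega>. Q n \<omega> \<partial>M)"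
      using D4 Q0 by (intro nn_integral_eq_integral) (auto simp: Q_def)
    also have "(\<integral>\<omega>. Q n \<omega> \<partial>M) = (\<Sum>m<2 ^ n. \<integral>\<omega>. (D n m \<omega>) ^ 4 \<partial>M)"
      unfolding Q_def by (rule Bochner_Integration.integral_sum) (use D4 in auto)
    also have "\<dots> \<le> (\<Sum>m<(2::nat) ^ n. 3 * (c / 2 ^ Suc n)\<^sup>2)" by (rule sum_mono) (use D4 in auto)
    also have "\<dots> = (3 / 4) * (c\<^sup>2 * (1 / 2) ^ n)"
      by (simp add: power_divide power2_eq_square)
    also have "\<dots> \<le> c\<^sup>2 * (1 / 2) ^ n" by simp
    finally show ?thesis by (simp add: ennreal_leI)
  qed
  \<comment> \<open>Below 1, so that increments of order \<open>\<rho> ^ n\<close> are summable, but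
    with \<open>\<rho> ^ 4 > 1 / 2\<close>, so that the expectations of
    \<open>Q n / \<rho> ^ (4 * n)\<close> are summable too.\<close>
  define \<rho> :: real where "\<rho> = 9 / 10"
  have \<rho>: "0 < \<rho>" "0 \<le> \<rho>" by (simp_all add: \<rho>_def)
  have "AE \<omega> in M. (\<Sum>n. ennreal (Q n \<omega> / \<rho> ^ (4 * n))) \<noteq> \<infinity>"
  proof (rule nn_integral_PInf_AE)
    have "(\<integral>\<^sup>+\<omega>. (\<Sum>n. ennreal (Q n \<omega> / \<rho> ^ (4 * n))) \<partial>M) = (\<Sum>n. \<integral>\<^sup>+\<omega>. ennreal (Q n \<omega> / \<rho> ^ (4 * n)) \<partial>M)"
      by (rule nn_integral_suminf) measurable
    also have "\<dots> \<le> (\<Sum>n. ennreal (c\<^sup>2 * (1 / (2 * \<rho> ^ 4)) ^ n))"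
    proof (rule suminf_le)
      fix n
      have "(\<integral>\<^sup>+\<omega>. ennreal (Q n \<omega> / \<rho> ^ (4 * n)) \<partial>M) = (\<integral>\<^sup>+\<omega>. ennreal (Q n \<omega>) \<partial>M) * ennreal (1 / \<rho> ^ (4 * n))"
        by (subst nn_integral_multc[symmetric]) (auto simp: ennreal_mult''[symmetric] \<rho>_def)
      also have "\<dots> \<le> ennreal (c\<^sup>2 * (1 / 2) ^ n) * ennreal (1 / \<rho> ^ (4 * n))"
        by (intro mult_right_mono EQ) auto
      also have "\<dots> = ennreal (c\<^sup>2 * (1 / (2 * \<rho> ^ 4)) ^ n)"
        using \<rho> by (simp add: ennreal_mult''[symmetric] power_divide power_mult_distrib power_mult)
      finally show "(\<integral>\<^sup>+\<omega>. ennreal (Q n \<omega> / \<rho> ^ (4 * n)) \<partial>M) \<le> ennreal (c\<^sup>2 * (1 / (2 * \<rho> ^ 4)) ^ n)" .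
    qed auto
    also have "\<dots> = ennreal (\<Sum>n. c\<^sup>2 * (1 / (2 * \<rho> ^ 4)) ^ n)"
    proof (rule suminf_ennreal2)
      show "summable (\<lambda>n. c\<^sup>2 * (1 / (2 * \<rho> ^ 4)) ^ n)"
        by (rule summable_mult, rule summable_geometric) (simp add: \<rho>_def power_divide)
    qed (use \<rho> in simp)
    also have "\<dots> < \<infinity>" by simp
    finally show "(\<integral>\<^sup>+\<omega>. (\<Sum>n. ennreal (Q n \<omega> / \<rho> ^ (4 * n))) \<partial>M) \<noteq> \<infinity>" by simp
  qed measurable
  then have unif: "AE \<omega> in M. continuous_on {0..1} (\<lambda>t. lim (\<lambda>n. L n t \<omega>)) \<and>
      (\<forall>t\<in>{0..1}. (\<lambda>n. L n t \<omega>) \<longlonglongrightarrow> lim (\<lambda>n. L n t \<omega>))"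
  proof eventually_elim
    case (elim \<omega>)
    obtain K where K: "(\<Sum>n. ennreal (Q n \<omega> / \<rho> ^ (4 * n))) = ennreal K" "0 \<le> K"
      using elim by (cases "\<Sum>n. ennreal (Q n \<omega> / \<rho> ^ (4 * n))") auto
    \<comment> \<open>At least 1, hence \<open>K \<le> K' ^ 4\<close>: the bound on
      \<open>Q n\<close> becomes a fourth power, whose root is
      \<open>K' * \<rho> ^ n\<close>.\<close>
    define K' where "K' = max 1 K"
    have Qb: "Q n \<omega> \<le> (K' * \<rho> ^ n) ^ 4" for n
    proof -
      have "ennreal (Q n \<omega> / \<rho> ^ (4 * n)) \<le> ennreal K"
        using sum_le_suminf[OF summableI, of "{n}" "\<lambda>n. ennreal (Q n \<omega> / \<rho> ^ (4 * n))"] K(1) by simp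
      then have "Q n \<omega> / \<rho> ^ (4 * n) \<le> K" using K(2) by simp
      also have "K \<le> K' ^ 1" by (simp add: K'_def)
      also have "\<dots> \<le> K' ^ 4" by (rule power_increasing) (auto simp: K'_def)
      finally have "Q n \<omega> \<le> K' ^ 4 * \<rho> ^ (4 * n)" using \<rho> by (simp add: pos_divide_le_eq)
      also have "\<dots> = (K' * \<rho> ^ n) ^ 4" by (simp add: power_mult_distrib mult.commute flip: power_mult)
      finally show ?thesis .
    qed
    have bound: "\<bar>L (Suc n) t \<omega> - L n t \<omega>\<bar> \<le> K' * \<rho> ^ n" if t: "t \<in> {0..1}" for n t
    proof -
      obtain m where m: "m < 2 ^ n" "\<bar>L (Suc n) t \<omega> - L n t \<omega>\<bar> \<le> \<bar>D n m \<omega>\<bar>" using step[OF t] by blast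
      have "\<bar>D n m \<omega>\<bar> ^ 4 = (D n m \<omega>) ^ 4" by (rule power_even_abs) simp
      also have "\<dots> \<le> Q n \<omega>" unfolding Q_def by (rule member_le_sum) (use m in auto)
      also have "\<dots> \<le> (K' * \<rho> ^ n) ^ 4" by (rule Qb)
      finally have "\<bar>D n m \<omega>\<bar> \<le> K' * \<rho> ^ n"
        by (rule power_le_imp_le_base[of _ 3, simplified]) (auto simp: K'_def \<rho>_def)
      with m(2) show ?thesis by simp
    qed
    have "summable (\<lambda>n. K' * \<rho> ^ n)" by (intro summable_mult summable_geometric) (auto simp: \<rho>_def)
    then have ul: "uniform_limit {0..1} (\<lambda>n t. \<Sum>i<n. L (Suc i) t \<omega> - L i t \<omega>)
        (\<lambda>t. \<Sum>i. L (Suc i) t \<omega> - L i t \<omega>) sequentially"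
      by (intro Weierstrass_m_test[of _ _ "\<lambda>n. K' * \<rho> ^ n"]) (use bound in auto)
    define F where "F t = (\<Sum>i. L (Suc i) t \<omega> - L i t \<omega>)" for t
    have tele: "(\<Sum>i<n. L (Suc i) t \<omega> - L i t \<omega>) = L n t \<omega> - L 0 t \<omega>" for n t
      by (rule sum_lessThan_telescope)
    have cont: "continuous_on {0..1} (\<lambda>t. L n t \<omega>)" for n
      unfolding L_def hat_def by (intro continuous_intros)
    have "continuous_on {0..1} F"
      unfolding F_def
      by (rule uniform_limit_theorem[OF _ ul]) (auto simp: tele intro!: always_eventually continuous_intros cont)
    then have c0: "continuous_on {0..1} (\<lambda>t. F t + L 0 t \<omega>)" by (intro continuous_intros cont)
    have lim: "(\<lambda>n. L n t \<omega>) \<longlonglongrightarrow> F t + L 0 t \<omega>" if "t \<in> {0..1}" for t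
      using tendsto_add[OF tendsto_uniform_limitI[OF ul that] tendsto_const[of "L 0 t \<omega>"]]
      by (simp add: tele F_def)
    then have "continuous_on {0..1} (\<lambda>t. lim (\<lambda>n. L n t \<omega>))"
      by (subst continuous_on_cong[OF refl limI[OF lim]]) (use c0 in auto)
    then show ?case using lim limI by (metis (no_types, lifting))
  qed
  show ?thesis
  proof (rule that[of "\<lambda>t \<omega>. lim (\<lambda>n. L n t \<omega>)"])
    show meas: "(\<lambda>\<omega>. lim (\<lambda>n. L n t \<omega>)) \<in> borel_measurable M" for t
      by (intro borel_measurable_lim_metric Lm)
    show "AE \<omega> in M. continuous_on {0..1} (\<lambda>t. lim (\<lambda>n. L n t \<omega>))"
      using unif by eventually_elim simp
    fix t :: real assume t: "t \<in> {0..1}"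
    have LL: "L n t \<in> L2 M" for n
    proof -
      have "(\<lambda>\<omega>. \<Sum>k\<le>2 ^ n. hat (2 ^ n * t - real k) * X (d n k) \<omega>) \<in> L2 M"
        by (intro L2_sum L2_scale L2S X d01) auto
      then show ?thesis by (simp add: L_def[abs_def] mult.commute)
    qed
    \<comment> \<open>Both grid points around \<open>t\<close> lie within \<open>(1 / 2) ^ n\<close>
      of it, and the square of a convex combination is at most the convex combination of the
      squares.\<close>
    have lim: "L2_lim M (\<lambda>n. L n t) (X t)"
      unfolding L2_lim_def
    proof (rule tendsto_zero_le)
      show "(\<lambda>n. c * (1 / 2) ^ n) \<longlonglongrightarrow> 0" by (intro tendsto_mult_right_zero LIMSEQ_power_zero) simp
      fix n
      obtain m :: nat where m: "m < 2 ^ n" "real m \<le> 2 ^ n * t" "2 ^ n * t \<le> real m + 1"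
        using unit_interval_cell[of t n] t by auto
      define l where "l = 2 ^ n * t - real m"
      have l: "0 \<le> l" "l \<le> 1" using m by (auto simp: l_def)
      define A where "A \<omega> = X (d n m) \<omega> - X t \<omega>" for \<omega>
      define B where "B \<omega> = X (d n (Suc m)) \<omega> - X t \<omega>" for \<omega>
      have in01: "d n m \<in> {0..1}" "d n (Suc m) \<in> {0..1}" using m by (intro d01; simp)+
      have AL: "A \<in> L2 M" "B \<in> L2 M" unfolding A_def[abs_def] B_def[abs_def]
        by (intro L2_diff L2S X in01 t)+
      have "(\<integral>\<omega>. (L n t \<omega> - X t \<omega>)\<^sup>2 \<partial>M) \<le> (\<integral>\<omega>. (1 - l) * (A \<omega>)\<^sup>2 + l * (B \<omega>)\<^sup>2 \<partial>M)"
      proof (rule integral_mono)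
        show "integrable M (\<lambda>\<omega>. (L n t \<omega> - X t \<omega>)\<^sup>2)" by (intro L2D(2) L2_diff LL L2S X t)
        show "integrable M (\<lambda>\<omega>. (1 - l) * (A \<omega>)\<^sup>2 + l * (B \<omega>)\<^sup>2)"
          by (intro integrable_mult_right Bochner_Integration.integrable_add L2D(2) AL)
        fix \<omega>
        have "L n t \<omega> = X (d n m) \<omega> * (1 - l) + X (d n (Suc m)) \<omega> * l"
          unfolding L_def hat_sum[OF m] by (simp add: l_def algebra_simps)
        then have "L n t \<omega> - X t \<omega> = (1 - l) * A \<omega> + l * B \<omega>" by (simp add: A_def B_def algebra_simps)
        moreover have "((1 - l) * A \<omega> + l * B \<omega>)\<^sup>2 = (1 - l) * (A \<omega>)\<^sup>2 + l * (B \<omega>)\<^sup>2 - l * (1 - l) * (A \<omega> - B \<omega>)\<^sup>2"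
          by (simp add: power2_eq_square algebra_simps)
        moreover have "0 \<le> l * (1 - l) * (A \<omega> - B \<omega>)\<^sup>2" using l by simp
        ultimately show "(L n t \<omega> - X t \<omega>)\<^sup>2 \<le> (1 - l) * (A \<omega>)\<^sup>2 + l * (B \<omega>)\<^sup>2" by simp
      qed
      also have "\<dots> = (1 - l) * (\<integral>\<omega>. (A \<omega>)\<^sup>2 \<partial>M) + l * (\<integral>\<omega>. (B \<omega>)\<^sup>2 \<partial>M)"
        using AL by (simp add: L2D)
      also have "\<dots> = (1 - l) * (c * \<bar>d n m - t\<bar>) + l * (c * \<bar>d n (Suc m) - t\<bar>)"
        unfolding A_def B_def using inc[OF t in01(1)] inc[OF t in01(2)] by simp
      also have "\<dots> \<le> (1 - l) * (c * (1 / 2) ^ n) + l * (c * (1 / 2) ^ n)"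
      proof (intro add_mono mult_left_mono)
        have "d n m \<le> t" "t \<le> (real m + 1) / 2 ^ n" using m by (simp_all add: d_def field_simps)
        moreover have "(real m + 1) / 2 ^ n = d n m + (1 / 2) ^ n" "d n (Suc m) = d n m + (1 / 2) ^ n"
          by (simp_all add: d_def add_divide_distrib power_divide)
        ultimately show "\<bar>d n m - t\<bar> \<le> (1 / 2) ^ n" "\<bar>d n (Suc m) - t\<bar> \<le> (1 / 2) ^ n"
          by (auto simp: abs_le_iff)
      qed (use l c in auto)
      also have "\<dots> = c * (1 / 2) ^ n" by (simp add: algebra_simps)
      finally show "(\<integral>\<omega>. (L n t \<omega> - X t \<omega>)\<^sup>2 \<partial>M) \<le> c * (1 / 2) ^ n" .
    qed simp
    show "AE \<omega> in M. lim (\<lambda>n. L n t \<omega>) = X t \<omega>"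
      by (rule L2_lim_AE_unique[OF LL L2S[OF X[OF t]] lim meas]) (use unif t in \<open>auto elim: eventually_mono\<close>)
  qed
qed

section \<open>Step functions with values in \<open>\<ell>\<^sup>2\<close>\<close>

lemma second_countable_from_dense:
  fixes S :: "'a::metric_space set"
  assumes S: "countable S" "closure S = UNIV"
  shows "\<exists>B::'a set set. countable B \<and> open = generate_topology B"
proof -
  define \<B> where "\<B> = (\<lambda>(s, q). ball s (real_of_rat q)) ` (S \<times> (UNIV :: rat set))"
  have "countable \<B>" unfolding \<B>_def using S(1) by (intro countable_image countable_SIGMA) auto
  moreover have "topological_basis \<B>"
  proof (rule topological_basisI)
    show "open B'" if "B' \<in> \<B>" for B' using that by (auto simp: \<B>_def)
    fix O' and x :: 'a assume "open O'" "x \<in> O'"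
    then obtain e where e: "0 < e" "ball x e \<subseteq> O'" by (auto simp: open_contains_ball)
    obtain q where q: "0 < real_of_rat q" "real_of_rat q < e / 2"
      using of_rat_dense[of 0 "e / 2"] e(1) by auto
    have "x \<in> closure S" by (simp add: S(2))
    then obtain s where s: "s \<in> S" "dist s x < real_of_rat q"
      using q(1) unfolding closure_approachable by blast
    have "ball s (real_of_rat q) \<subseteq> ball x e"
    proof
      fix z assume "z \<in> ball s (real_of_rat q)"
      then have "dist x z < real_of_rat q + real_of_rat q"
        using s(2) dist_triangle[of x z s] by (simp add: dist_commute)
      with q(2) show "z \<in> ball x e" by simp
    qed
    then show "\<exists>B'\<in>\<B>. x \<in> B' \<and> B' \<subseteq> O'"
      using s e(2) unfolding \<B>_def by (intro bexI[of _ "ball s (real_of_rat q)"]) force+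
  qed
  ultimately show ?thesis
    by (intro exI[of _ \<B>] conjI ext) (simp_all add: topological_basis_imp_subbasis)
qed

definition eunit :: "nat \<Rightarrow> ell2" where
  "eunit k = Abs_ell2 (\<lambda>n. if n = k then 1 else 0)"

lemma Rep_eunit: "Rep_ell2 (eunit k) n = (if n = k then 1 else 0)"
proof -
  have "(\<lambda>n. (if n = k then 1 else 0 :: real)\<^sup>2) = (\<lambda>n. if n = k then 1 else 0)" by auto
  then have "summable (\<lambda>n. (if n = k then 1 else 0 :: real)\<^sup>2)"
    using summable_single[of k "\<lambda>_. 1::real"] by simp
  then show ?thesis by (simp add: eunit_def Abs_ell2_inverse)
qed

lemma Rep_ell2_add: "Rep_ell2 (x + y) n = Rep_ell2 x n + Rep_ell2 y n"
  and Rep_ell2_scaleR: "Rep_ell2 (c *\<^sub>R x) n = c * Rep_ell2 x n"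
  and Rep_ell2_zero: "Rep_ell2 0 n = 0"
  by (transfer; simp)+

lemma Rep_ell2_sum: "Rep_ell2 (\<Sum>i\<in>A. f i) n = (\<Sum>i\<in>A. Rep_ell2 (f i) n)"
  by (induction A rule: infinite_finite_induct) (auto simp: Rep_ell2_zero Rep_ell2_add)

lemma summable_Rep_ell2: "summable (\<lambda>k. (Rep_ell2 x k)\<^sup>2)"
  using Rep_ell2[of x] by simp

lemma inner_ell2_sums: "(\<lambda>k. Rep_ell2 x k * Rep_ell2 y k) sums (x \<bullet> y)"
  using summable_sums[OF summable_mult_ell2[OF summable_Rep_ell2 summable_Rep_ell2], of x y]
  by (simp add: inner_ell2.rep_eq)

definition etrunc :: "nat \<Rightarrow> ell2 \<Rightarrow> ell2" where
  "etrunc n x = (\<Sum>k<n. Rep_ell2 x k *\<^sub>R eunit k)"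

lemma Rep_etrunc: "Rep_ell2 (etrunc n x) k = (if k < n then Rep_ell2 x k else 0)"
  unfolding etrunc_def Rep_ell2_sum
  by (simp add: Rep_ell2_scaleR Rep_eunit if_distrib[of "\<lambda>z. _ * z"] sum.delta' cong: if_cong)

lemma norm_sub_etrunc: "(norm (x - etrunc n x))\<^sup>2 = (norm x)\<^sup>2 - (\<Sum>k<n. (Rep_ell2 x k)\<^sup>2)"
proof -
  have "(norm (x - etrunc n x))\<^sup>2 = (\<Sum>k. (Rep_ell2 (x - etrunc n x) k)\<^sup>2)" by (rule norm_ell2_square)
  also have "\<dots> = (\<Sum>k. (Rep_ell2 (x - etrunc n x) (k + n))\<^sup>2) + (\<Sum>k<n. (Rep_ell2 (x - etrunc n x) k)\<^sup>2)"
    by (rule suminf_split_initial_segment[OF summable_Rep_ell2])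
  also have "\<dots> = (\<Sum>k. (Rep_ell2 x (k + n))\<^sup>2)" by (simp add: Rep_ell2_diff Rep_etrunc)
  also have "\<dots> = (norm x)\<^sup>2 - (\<Sum>k<n. (Rep_ell2 x k)\<^sup>2)"
    unfolding norm_ell2_square using suminf_split_initial_segment[OF summable_Rep_ell2, of x n] by simp
  finally show ?thesis .
qed

lemma etrunc_tendsto: "(\<lambda>n. etrunc n x) \<longlonglongrightarrow> x"
proof -
  have "(\<lambda>n. (norm x)\<^sup>2 - (\<Sum>k<n. (Rep_ell2 x k)\<^sup>2)) \<longlonglongrightarrow> (norm x)\<^sup>2 - (norm x)\<^sup>2"
    unfolding norm_ell2_square by (intro tendsto_intros summable_LIMSEQ summable_Rep_ell2)
  then have "(\<lambda>n. (norm (x - etrunc n x))\<^sup>2) \<longlonglongrightarrow> 0" by (simp add: norm_sub_etrunc)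
  from tendsto_real_sqrt[OF this] have "(\<lambda>n. norm (etrunc n x - x)) \<longlonglongrightarrow> 0" by (simp add: norm_minus_commute)
  then show ?thesis by (rule LIM_zero_cancel[OF tendsto_norm_zero_cancel])
qed

instance ell2 :: second_countable_topology
proof
  define S where "S = (\<lambda>qs. \<Sum>k<length qs. real_of_rat (qs ! k) *\<^sub>R eunit k) ` (UNIV :: rat list set)"
  have "countable S" unfolding S_def by (intro countable_image) auto
  moreover have "x \<in> closure S" for x
  proof -
    have "etrunc n x \<in> closure S" for n
    proof -
      have "\<exists>q. \<forall>m. \<bar>real_of_rat (q m) - Rep_ell2 x k\<bar> < inverse (Suc m)" for k
      proof -
        have "\<exists>r. \<bar>real_of_rat r - Rep_ell2 x k\<bar> < inverse (Suc m)" for m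
        proof -
          have "Rep_ell2 x k < Rep_ell2 x k + inverse (real (Suc m))" by simp
          from of_rat_dense[OF this] obtain r
            where "Rep_ell2 x k < real_of_rat r" "real_of_rat r < Rep_ell2 x k + inverse (Suc m)" by auto
          then show ?thesis by (intro exI[of _ r]) linarith
        qed
        then show ?thesis by metis
      qed
      then obtain q where q: "\<And>k m. \<bar>real_of_rat (q k m) - Rep_ell2 x k\<bar> < inverse (Suc m)" by metis
      have "(\<lambda>m. real_of_rat (q k m)) \<longlonglongrightarrow> Rep_ell2 x k" for k
        by (rule LIM_zero_cancel, rule Lim_null_comparison[OF _ LIMSEQ_inverse_real_of_nat])
          (use q in \<open>auto intro!: always_eventually less_imp_le\<close>)
      then have "(\<lambda>m. \<Sum>k<n. real_of_rat (q k m) *\<^sub>R eunit k) \<longlonglongrightarrow> etrunc n x"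
        unfolding etrunc_def by (intro tendsto_intros)
      moreover have "(\<Sum>k<n. real_of_rat (q k m) *\<^sub>R eunit k) \<in> S" for m
        unfolding S_def by (rule image_eqI[of _ _ "map (\<lambda>k. q k m) [0..<n]"]) auto
      ultimately show ?thesis
        unfolding closure_sequential
        by (intro exI[of _ "\<lambda>m. \<Sum>k<n. real_of_rat (q k m) *\<^sub>R eunit k"] conjI allI)
    qed
    then show ?thesis
      using Lim_in_closed_set[OF closed_closure _ _ etrunc_tendsto[of x], of S] by simp
  qed
  ultimately show "\<exists>B::ell2 set set. countable B \<and> open = generate_topology B"
    by (intro second_countable_from_dense[of S]) auto
qed

text \<open>The truncations are finite sums of measurable coordinates and converge
  pointwise.\<close>

lemma borel_measurable_ell2I:
  assumes "\<And>k. (\<lambda>u. Rep_ell2 (f u) k) \<in> borel_measurable M"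
  shows "f \<in> borel_measurable M"
proof (rule borel_measurable_LIMSEQ_metric)
  show "(\<lambda>u. etrunc n (f u)) \<in> borel_measurable M" for n
    unfolding etrunc_def by (intro borel_measurable_sum borel_measurable_scaleR assms borel_measurable_const)
  show "(\<lambda>n. etrunc n (f u)) \<longlonglongrightarrow> f u" for u by (rule etrunc_tendsto)
qed

section \<open>Approximation of square-integrable functions by step functions\<close>

definition valid_step :: "real \<Rightarrow> (real \<times> real \<times> 'h) list \<Rightarrow> bool" where
  "valid_step t p \<longleftrightarrow> (\<forall>(a, b, h)\<in>set p. 0 \<le> a \<and> a \<le> b \<and> b \<le> t)"

lemma step_value_append: "step_value (p @ q) u = step_value p u + step_value q u"
  by (simp add: step_value_def)

lemma step_value_map:
  "step_value (map (\<lambda>(a, b, h). (a, b, c *\<^sub>R h)) p) u = c *\<^sub>R step_value p u"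
  by (induction p) (auto simp: step_value_def scaleR_add_right)

lemma measurable_step_value [measurable]:
  "step_value p \<in> borel_measurable (borel :: real measure)" for p :: "(real \<times> real \<times> ell2) list"
proof (induction p)
  case Nil
  then show ?case by (simp add: step_value_def[abs_def])
next
  case (Cons x p)
  obtain a b h where x: "x = (a, b, h)" by (cases x)
  have "step_value (x # p) = (\<lambda>u. (if a < u \<and> u \<le> b then h else 0) + step_value p u)"
    by (auto simp: x step_value_def)
  also have "\<dots> \<in> borel_measurable borel" using Cons by measurable
  finally show ?case .
qed

text \<open>Half-open like the steps \<open>(a, b]\<close> of \<open>step_value\<close>, which for
  valid lists never contain 0. The missing point is a null set
  (\<open>nn_integral_cell\<close>).\<close>

abbreviation "cell t \<equiv> restrict_space lborel {0<..t::real}"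

lemma finite_cell: "finite_measure (cell t)"
proof
  show "emeasure (cell t) (space (cell t)) \<noteq> \<infinity>"
    by (cases "0 \<le> t") (auto simp: emeasure_restrict_space space_restrict_space)
qed

text \<open>Membership in the L^2 closure of the step functions. Its closure under sums, multiples
  and limits is what the measure-theoretic inductions below run on.\<close>

definition step_approx :: "real \<Rightarrow> (real \<Rightarrow> ell2) \<Rightarrow> bool" where
  "step_approx t f \<longleftrightarrow> f \<in> borel_measurable (cell t) \<and>
     (\<forall>e>0. \<exists>p. valid_step t p \<and> (\<integral>\<^sup>+u. ennreal ((norm (f u - step_value p u))\<^sup>2) \<partial>cell t) < ennreal e)"

lemma norm_sum_squares_ge: "(norm (a + b))\<^sup>2 \<le> 2 * (norm a)\<^sup>2 + 2 * (norm (b::'a::real_normed_vector))\<^sup>2"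
proof -
  have "(norm (a + b))\<^sup>2 \<le> (norm a + norm b)\<^sup>2" by (intro power_mono norm_triangle_ineq) simp
  also have "\<dots> \<le> 2 * (norm a)\<^sup>2 + 2 * (norm b)\<^sup>2"
    using zero_le_power2[of "norm a - norm b"] by (simp add: power2_eq_square algebra_simps)
  finally show ?thesis .
qed

lemma nn_norm_square_add:
  fixes f g :: "'x \<Rightarrow> 'a::{real_normed_vector, second_countable_topology}"
  assumes [measurable]: "f \<in> borel_measurable M" "g \<in> borel_measurable M"
  shows "(\<integral>\<^sup>+u. ennreal ((norm (f u + g u))\<^sup>2) \<partial>M)
    \<le> 2 * (\<integral>\<^sup>+u. ennreal ((norm (f u))\<^sup>2) \<partial>M) + 2 * (\<integral>\<^sup>+u. ennreal ((norm (g u))\<^sup>2) \<partial>M)"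
proof -
  have "(\<integral>\<^sup>+u. ennreal ((norm (f u + g u))\<^sup>2) \<partial>M)
      \<le> (\<integral>\<^sup>+u. 2 * ennreal ((norm (f u))\<^sup>2) + 2 * ennreal ((norm (g u))\<^sup>2) \<partial>M)"
  proof (rule nn_integral_mono)
    fix u
    have "ennreal ((norm (f u + g u))\<^sup>2) \<le> ennreal (2 * (norm (f u))\<^sup>2 + 2 * (norm (g u))\<^sup>2)"
      by (intro ennreal_leI norm_sum_squares_ge)
    then show "ennreal ((norm (f u + g u))\<^sup>2) \<le> 2 * ennreal ((norm (f u))\<^sup>2) + 2 * ennreal ((norm (g u))\<^sup>2)"
      by (simp add: ennreal_mult')
  qed
  then show ?thesis by (simp add: nn_integral_add nn_integral_cmult)
qed

lemma step_approx_add: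
  assumes f: "step_approx t f" and g: "step_approx t g"
  shows "step_approx t (\<lambda>u. f u + g u)"
  unfolding step_approx_def
proof (intro conjI allI impI)
  have [measurable]: "f \<in> borel_measurable (cell t)" "g \<in> borel_measurable (cell t)"
    using f g by (auto simp: step_approx_def)
  show "(\<lambda>u. f u + g u) \<in> borel_measurable (cell t)" by measurable
  have [measurable]: "step_value p \<in> borel_measurable (cell t)" for p :: "(real \<times> real \<times> ell2) list"
    by (intro measurable_restrict_space1) (simp add: measurable_step_value)
  fix e :: real assume "0 < e"
  then have e4: "0 < e / 4" by simp
  obtain p where p: "valid_step t p" "(\<integral>\<^sup>+u. ennreal ((norm (f u - step_value p u))\<^sup>2) \<partial>cell t) < ennreal (e / 4)"
    using f e4 unfolding step_approx_def by blast
  obtain q where q: "valid_step t q" "(\<integral>\<^sup>+u. ennreal ((norm (g u - step_value q u))\<^sup>2) \<partial>cell t) < ennreal (e / 4)"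
    using g e4 unfolding step_approx_def by blast
  have "(\<integral>\<^sup>+u. ennreal ((norm (f u + g u - step_value (p @ q) u))\<^sup>2) \<partial>cell t)
      = (\<integral>\<^sup>+u. ennreal ((norm ((f u - step_value p u) + (g u - step_value q u)))\<^sup>2) \<partial>cell t)"
    by (simp add: step_value_append algebra_simps)
  also have "\<dots> \<le> 2 * (\<integral>\<^sup>+u. ennreal ((norm (f u - step_value p u))\<^sup>2) \<partial>cell t) + 2 * (\<integral>\<^sup>+u. ennreal ((norm (g u - step_value q u))\<^sup>2) \<partial>cell t)"
    by (rule nn_norm_square_add) measurable
  also have "\<dots> < 2 * ennreal (e / 4) + 2 * ennreal (e / 4)"
    by (intro add_strict_mono ennreal_mult_strict_left_mono p q) auto
  also have "\<dots> = ennreal e" using \<open>0 < e\<close> by (simp flip: ennreal_plus ennreal_mult' ennreal_numeral)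
  finally show "\<exists>p. valid_step t p \<and> (\<integral>\<^sup>+u. ennreal ((norm (f u + g u - step_value p u))\<^sup>2) \<partial>cell t) < ennreal e"
    using p(1) q(1) by (intro exI[of _ "p @ q"]) (auto simp: valid_step_def)
qed

lemma step_approx_scale:
  assumes f: "step_approx t f"
  shows "step_approx t (\<lambda>u. c *\<^sub>R f u)"
  unfolding step_approx_def
proof (intro conjI allI impI)
  have [measurable]: "f \<in> borel_measurable (cell t)"
    using f by (auto simp: step_approx_def)
  show "(\<lambda>u. c *\<^sub>R f u) \<in> borel_measurable (cell t)" by measurable
  have [measurable]: "step_value p \<in> borel_measurable (cell t)" for p :: "(real \<times> real \<times> ell2) list"
    by (intro measurable_restrict_space1) (simp add: measurable_step_value)
  fix e :: real assume "0 < e"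
  moreover have c1: "0 < c\<^sup>2 + 1" by (rule add_nonneg_pos) simp_all
  ultimately have e': "0 < e / (c\<^sup>2 + 1)" by (rule divide_pos_pos)
  obtain p where p: "valid_step t p" "(\<integral>\<^sup>+u. ennreal ((norm (f u - step_value p u))\<^sup>2) \<partial>cell t) < ennreal (e / (c\<^sup>2 + 1))"
    using f e' unfolding step_approx_def by blast
  let ?q = "map (\<lambda>(a, b, h). (a, b, c *\<^sub>R h)) p"
  have "(\<integral>\<^sup>+u. ennreal ((norm (c *\<^sub>R f u - step_value ?q u))\<^sup>2) \<partial>cell t)
      = (\<integral>\<^sup>+u. ennreal (c\<^sup>2) * ennreal ((norm (f u - step_value p u))\<^sup>2) \<partial>cell t)"
    by (simp add: step_value_map power_mult_distrib ennreal_mult'' flip: scaleR_diff_right)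
  also have "\<dots> = ennreal (c\<^sup>2) * (\<integral>\<^sup>+u. ennreal ((norm (f u - step_value p u))\<^sup>2) \<partial>cell t)"
    by (rule nn_integral_cmult) measurable
  also have "\<dots> \<le> ennreal (c\<^sup>2) * ennreal (e / (c\<^sup>2 + 1))"
    by (rule mult_left_mono[OF less_imp_le[OF p(2)]]) simp
  also have "\<dots> = ennreal (c\<^sup>2 * (e / (c\<^sup>2 + 1)))" by (rule ennreal_mult''[symmetric, OF less_imp_le[OF e']])
  also have "\<dots> < ennreal e"
  proof (rule ennreal_lessI[OF \<open>0 < e\<close>])
    have "c\<^sup>2 * (e / (c\<^sup>2 + 1)) + e / (c\<^sup>2 + 1) = e"
    proof -
      have "(c\<^sup>2 + 1) * (e / (c\<^sup>2 + 1)) = e" using c1 by simp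
      then show ?thesis by (simp only: distrib_right mult_1)
    qed
    then show "c\<^sup>2 * (e / (c\<^sup>2 + 1)) < e" using e' by linarith
  qed
  finally show "\<exists>p. valid_step t p \<and> (\<integral>\<^sup>+u. ennreal ((norm (c *\<^sub>R f u - step_value p u))\<^sup>2) \<partial>cell t) < ennreal e"
    using p(1) by (intro exI[of _ ?q]) (auto simp: valid_step_def)
qed

lemma step_approx_limit:
  assumes f: "\<And>n. step_approx t (f n)" and [measurable]: "g \<in> borel_measurable (cell t)"
    and lim: "(\<lambda>n. \<integral>\<^sup>+u. ennreal ((norm (g u - f n u))\<^sup>2) \<partial>cell t) \<longlonglongrightarrow> 0"
  shows "step_approx t g"
  unfolding step_approx_def
proof (intro conjI allI impI)
  show "g \<in> borel_measurable (cell t)" by fact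
  have [measurable]: "f n \<in> borel_measurable (cell t)" for n
    using f by (auto simp: step_approx_def)
  have [measurable]: "step_value p \<in> borel_measurable (cell t)" for p :: "(real \<times> real \<times> ell2) list"
    by (intro measurable_restrict_space1) (simp add: measurable_step_value)
  fix e :: real assume "0 < e"
  then have e4: "0 < e / 4" by simp
  have "\<forall>\<^sub>F n in sequentially. (\<integral>\<^sup>+u. ennreal ((norm (g u - f n u))\<^sup>2) \<partial>cell t) < ennreal (e / 4)"
    by (rule order_tendstoD(2)[OF lim]) (use e4 in simp)
  then obtain n where n: "(\<integral>\<^sup>+u. ennreal ((norm (g u - f n u))\<^sup>2) \<partial>cell t) < ennreal (e / 4)"
    by (auto simp: eventually_sequentially)
  obtain p where p: "valid_step t p" "(\<integral>\<^sup>+u. ennreal ((norm (f n u - step_value p u))\<^sup>2) \<partial>cell t) < ennreal (e / 4)"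
    using f[of n] e4 unfolding step_approx_def by blast
  have "(\<integral>\<^sup>+u. ennreal ((norm (g u - step_value p u))\<^sup>2) \<partial>cell t)
      = (\<integral>\<^sup>+u. ennreal ((norm ((g u - f n u) + (f n u - step_value p u)))\<^sup>2) \<partial>cell t)"
    by simp
  also have "\<dots> \<le> 2 * (\<integral>\<^sup>+u. ennreal ((norm (g u - f n u))\<^sup>2) \<partial>cell t) + 2 * (\<integral>\<^sup>+u. ennreal ((norm (f n u - step_value p u))\<^sup>2) \<partial>cell t)"
    by (rule nn_norm_square_add) measurable
  also have "\<dots> < 2 * ennreal (e / 4) + 2 * ennreal (e / 4)"
    by (intro add_strict_mono ennreal_mult_strict_left_mono p n) auto
  also have "\<dots> = ennreal e" using \<open>0 < e\<close> by (simp flip: ennreal_plus ennreal_mult' ennreal_numeral)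
  finally show "\<exists>p. valid_step t p \<and> (\<integral>\<^sup>+u. ennreal ((norm (g u - step_value p u))\<^sup>2) \<partial>cell t) < ennreal e"
    using p(1) by blast
qed

lemma step_approx_dominated:
  assumes f: "\<And>n. step_approx t (f n)" and [measurable]: "g \<in> borel_measurable (cell t)"
    and lim: "\<And>u. (\<lambda>n. f n u) \<longlonglongrightarrow> g u" and bound: "\<And>n u. norm (g u - f n u) \<le> K"
  shows "step_approx t g"
proof (rule step_approx_limit[OF f])
  interpret finite_measure "cell t" by (rule finite_cell)
  have [measurable]: "f n \<in> borel_measurable (cell t)" for n
    using f by (auto simp: step_approx_def)
  have "(\<lambda>n. \<integral>\<^sup>+u. ennreal ((norm (g u - f n u))\<^sup>2) \<partial>cell t) \<longlonglongrightarrow> (\<integral>\<^sup>+u. 0 \<partial>cell t)"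
  proof (rule nn_integral_dominated_convergence[where w="\<lambda>_. ennreal (K\<^sup>2)"])
    show "AE u in cell t. ennreal ((norm (g u - f n u))\<^sup>2) \<le> ennreal (K\<^sup>2)" for n
      using bound by (auto intro!: AE_I2 ennreal_leI power_mono)
    show "(\<integral>\<^sup>+u. ennreal (K\<^sup>2) \<partial>cell t) < \<infinity>" 
    proof -
      have "emeasure (cell t) {0<..t} < \<top>" using emeasure_finite[of "{0<..t}"] by (simp add: less_top[symmetric])
      then show ?thesis by (simp add: ennreal_mult_less_top space_restrict_space)
    qed
    show "AE u in cell t. (\<lambda>n. ennreal ((norm (g u - f n u))\<^sup>2)) \<longlonglongrightarrow> 0"
    proof (rule AE_I2)
      fix u
      have "(\<lambda>n. ennreal ((norm (g u - f n u))\<^sup>2)) \<longlonglongrightarrow> ennreal ((norm (g u - g u))\<^sup>2)"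
        by (intro tendsto_ennrealI tendsto_intros lim)
      then show "(\<lambda>n. ennreal ((norm (g u - f n u))\<^sup>2)) \<longlonglongrightarrow> 0" by simp
    qed
  qed measurable
  then show "(\<lambda>n. \<integral>\<^sup>+u. ennreal ((norm (g u - f n u))\<^sup>2) \<partial>cell t) \<longlonglongrightarrow> 0" by simp
qed fact

lemma step_approx_step:
  assumes "0 \<le> a" "a \<le> b" "b \<le> t"
  shows "step_approx t (\<lambda>u. if a < u \<and> u \<le> b then h else 0)"
proof -
  have sv: "step_value [(a, b, h)] u = (if a < u \<and> u \<le> b then h else 0)" for u
    by (simp add: step_value_def)
  have "step_value [(a, b, h)] \<in> borel_measurable (cell t)"
    by (intro measurable_restrict_space1) (simp add: measurable_step_value)
  then have "(\<lambda>u. if a < u \<and> u \<le> b then h else 0) \<in> borel_measurable (cell t)"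
    unfolding sv[abs_def] .
  then show ?thesis
    unfolding step_approx_def using assms
    by (auto intro!: exI[of _ "[(a, b, h)]"] simp: sv valid_step_def simp del: step_value_def)
qed

lemma step_approx_cong:
  assumes f: "step_approx t f" and eq: "\<And>u. 0 < u \<Longrightarrow> u \<le> t \<Longrightarrow> f u = g u"
  shows "step_approx t g"
proof -
  have sp: "f u = g u" if "u \<in> space (cell t)" for u using that eq by (auto simp: space_restrict_space)
  have "g \<in> borel_measurable (cell t)"
  proof -
    have "g \<in> borel_measurable (cell t) \<longleftrightarrow> f \<in> borel_measurable (cell t)"
      by (rule measurable_cong) (simp add: sp)
    then show ?thesis using f by (simp add: step_approx_def)
  qed
  moreover have "(\<integral>\<^sup>+u. ennreal ((norm (g u - step_value p u))\<^sup>2) \<partial>cell t) =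
      (\<integral>\<^sup>+u. ennreal ((norm (f u - step_value p u))\<^sup>2) \<partial>cell t)" for p
    by (rule nn_integral_cong) (simp add: sp)
  ultimately show ?thesis using f by (simp add: step_approx_def)
qed

lemma step_approx_sum:
  assumes "0 \<le> t" "\<And>i. i \<in> I \<Longrightarrow> step_approx t (f i)"
  shows "step_approx t (\<lambda>u. \<Sum>i\<in>I. f i u)"
proof -
  have "step_approx t (\<lambda>_. 0)"
    by (rule step_approx_cong[OF step_approx_step[of 0 t t 0]]) (use assms in auto)
  then show ?thesis
    using assms(2) by (induction I rule: infinite_finite_induct) (auto intro: step_approx_add)
qed

text \<open>Dynkin's argument from the half-lines, which generate the Borel sets: complements are
  differences from the constant \<open>h\<close>, and disjoint unions are bounded pointwise limits
  of finite sums.\<close>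

lemma step_approx_indicator:
  assumes t: "0 \<le> t" and A: "A \<in> sets borel"
  shows "step_approx t (\<lambda>u. indicator A u *\<^sub>R h)"
proof -
  have A': "A \<in> sigma_sets UNIV (range (\<lambda>x. {..x}))" using A unfolding borel_eq_atMost by (simp add: sets_measure_of)
  have meas: "B \<in> sets borel" if "B \<in> sigma_sets UNIV (range (\<lambda>x::real. {..x}))" for B
    using that unfolding borel_eq_atMost by (simp add: sets_measure_of)
  have const: "step_approx t (\<lambda>_. h)"
    by (rule step_approx_cong[OF step_approx_step[of 0 t t h]]) (use t in auto)
  have "Int_stable (range (\<lambda>x::real. {..x}))" by (auto simp: Int_stable_def)
  moreover have "range (\<lambda>x::real. {..x}) \<subseteq> Pow UNIV" by simp
  ultimately show ?thesis using A'
  proof (induction rule: sigma_sets_induct_disjoint)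
    case (basic B)
    then obtain x where B: "B = {..x}" by auto
    \<comment> \<open>Within \<open>(0, t]\<close> the half-line is the single step from 0 to
      \<open>x\<close>, where \<open>x\<close> is clipped to \<open>[0, t]\<close>.\<close>
    show ?case
      by (rule step_approx_cong[OF step_approx_step[of 0 "max 0 (min x t)" t h]]) (use t in \<open>auto simp: B\<close>)
  next
    case empty
    show ?case using step_approx_sum[OF t, of "{}"] by simp
  next
    case (compl B)
    show ?case
      by (rule step_approx_cong[OF step_approx_add[OF const step_approx_scale[OF compl(2), of "- 1"]]])
        (auto simp: indicator_def)
  next
    case (union B)
    have B: "B i \<in> sets borel" for i using union(2) meas by auto
    show ?case
    proof (rule step_approx_dominated)
      show "step_approx t (\<lambda>u. \<Sum>i<n. indicator (B i) u *\<^sub>R h)" for n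
        by (rule step_approx_sum[OF t union(3)])
      have "(\<lambda>u. indicat_real (\<Union>i. B i) u *\<^sub>R h) \<in> borel_measurable lborel" using B by measurable
      then show "(\<lambda>u. indicat_real (\<Union>i. B i) u *\<^sub>R h) \<in> borel_measurable (cell t)"
        by (rule measurable_restrict_space1)
      have eq: "(\<Sum>i<n. indicator (B i) u *\<^sub>R h) = indicat_real (\<Union>i<n. B i) u *\<^sub>R h" for n u
        using union(1) by (subst indicator_UN_disjoint) (auto simp: scaleR_sum_left disjoint_family_on_def)
      show "(\<lambda>n. \<Sum>i<n. indicator (B i) u *\<^sub>R h) \<longlonglongrightarrow> indicat_real (\<Union>i. B i) u *\<^sub>R h" for u
        unfolding eq by (intro tendsto_scaleR tendsto_const LIMSEQ_indicator_UN)
      show "norm (indicat_real (\<Union>i. B i) u *\<^sub>R h - (\<Sum>i<n. indicator (B i) u *\<^sub>R h)) \<le> norm h" for n u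
        unfolding eq by (auto simp: indicator_def)
    qed
  qed
qed

text \<open>Simple functions approximate \<open>g\<close> pointwise with at most twice its norm, so
  the errors stay below \<open>3 * K\<close> and dominated convergence applies.\<close>

theorem step_functions_dense:
  fixes g :: "real \<Rightarrow> ell2"
  assumes t: "0 \<le> t" and [measurable]: "g \<in> borel_measurable borel" and K: "\<And>u. norm (g u) \<le> K"
  shows "step_approx t g"
proof -
  obtain s where s: "\<And>i. simple_function borel (s i)" "\<And>u. (\<lambda>i. s i u) \<longlonglongrightarrow> g u"
    "\<And>i u. dist (s i u) 0 \<le> 2 * dist (g u) 0"
    using borel_measurable_implies_sequence_metric[of g borel 0] by auto
  show ?thesis
  proof (rule step_approx_dominated)
    show "step_approx t (s n)" for n
    proof -
      have fin: "finite (range (s n))" using simple_functionD(1)[OF s(1), of n] by simp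
      have "step_approx t (\<lambda>u. \<Sum>y\<in>range (s n). indicator (s n -` {y}) u *\<^sub>R y)"
        using simple_functionD(2)[OF s(1), of n] by (intro step_approx_sum[OF t] step_approx_indicator[OF t]) auto
      moreover have "(\<Sum>y\<in>range (s n). indicator (s n -` {y}) u *\<^sub>R y) = s n u" for u
      proof -
        have "(\<Sum>y\<in>range (s n). indicat_real (s n -` {y}) u *\<^sub>R y) = (\<Sum>y\<in>range (s n). if y = s n u then y else 0)"
          by (intro sum.cong) (auto simp: indicator_def)
        then show ?thesis using fin by simp
      qed
      ultimately show ?thesis by simp
    qed
    show "g \<in> borel_measurable (cell t)" by (intro measurable_restrict_space1) simp
    show "norm (g u - s n u) \<le> 3 * K" for n u
      using norm_triangle_ineq4[of "g u" "s n u"] s(3)[of n u] K[of u] by simp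
  qed (rule s(2))
qed

lemma nn_integral_cell:
  assumes "f \<in> borel_measurable borel"
  shows "(\<integral>\<^sup>+u\<in>{0..t}. f u \<partial>lborel) = (\<integral>\<^sup>+u. f u \<partial>cell t)"
proof -
  have "(\<integral>\<^sup>+u. f u \<partial>cell t) = (\<integral>\<^sup>+u\<in>{0<..t}. f u \<partial>lborel)"
    by (rule nn_integral_restrict_space) auto
  also have "\<dots> = (\<integral>\<^sup>+u\<in>{0..t}. f u \<partial>lborel)"
  proof (rule nn_integral_cong_AE)
    show "AE u in lborel. f u * indicator {0<..t} u = f u * indicator {0..t} u"
      using AE_lborel_singleton[of "0::real"] by eventually_elim (auto simp: indicator_def)
  qed
  finally show ?thesis by simp
qed

corollary step_sequence:
  fixes g :: "real \<Rightarrow> ell2"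
  assumes t: "0 \<le> t" and g[measurable]: "g \<in> borel_measurable borel" and K: "\<And>u. norm (g u) \<le> K"
  obtains p where "\<And>n. valid_step t (p n)"
    "(\<lambda>n. \<integral>\<^sup>+u\<in>{0..t}. ennreal ((norm (g u - step_value (p n) u))\<^sup>2) \<partial>lborel) \<longlonglongrightarrow> 0"
proof -
  have "\<exists>p. valid_step t p \<and> (\<integral>\<^sup>+u. ennreal ((norm (g u - step_value p u))\<^sup>2) \<partial>cell t) < ennreal (inverse (Suc n))" for n
    using step_functions_dense[OF assms] unfolding step_approx_def by simp
  then obtain p where p: "\<And>n. valid_step t (p n)"
    "\<And>n. (\<integral>\<^sup>+u. ennreal ((norm (g u - step_value (p n) u))\<^sup>2) \<partial>cell t) < ennreal (inverse (Suc n))" by metis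
  have eq: "(\<integral>\<^sup>+u\<in>{0..t}. ennreal ((norm (g u - step_value (p n) u))\<^sup>2) \<partial>lborel) =
     (\<integral>\<^sup>+u. ennreal ((norm (g u - step_value (p n) u))\<^sup>2) \<partial>cell t)" for n
    by (rule nn_integral_cell) measurable
  have "(\<lambda>n. \<integral>\<^sup>+u\<in>{0..t}. ennreal ((norm (g u - step_value (p n) u))\<^sup>2) \<partial>lborel) \<longlonglongrightarrow> 0"
  proof (rule tendsto_sandwich[OF _ _ tendsto_const])
    show "(\<lambda>n. ennreal (inverse (real (Suc n)))) \<longlonglongrightarrow> 0"
      using tendsto_ennrealI[OF LIMSEQ_inverse_real_of_nat] by (simp only: ennreal_0)
    show "\<forall>\<^sub>F n in sequentially. (\<integral>\<^sup>+u\<in>{0..t}. ennreal ((norm (g u - step_value (p n) u))\<^sup>2) \<partial>lborel)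
        \<le> ennreal (inverse (real (Suc n)))"
      unfolding eq by (intro always_eventually allI less_imp_le p(2))
  qed simp
  with p(1) that show ?thesis by blast
qed

section \<open>Factorisation of covariance tensors\<close>

definition tensor_form :: "'b::banach ptensor \<Rightarrow> ('b \<Rightarrow>\<^sub>L real) \<Rightarrow> ('b \<Rightarrow>\<^sub>L real) \<Rightarrow> real" where
  "tensor_form U b c = blinfun_apply b (blinfun_apply (canonical_map U) c)"

lemma tensor_form_ptensor: "tensor_form (x \<otimes>\<^sub>\<pi> y) b c = blinfun_apply b x * blinfun_apply c y"
  by (simp add: tensor_form_def canonical_map(2) blinfun.scaleR_right mult.commute)

lemma bounded_linear_tensor_form: "bounded_linear (\<lambda>U. tensor_form U b c)"
proof -
  have "bounded_linear (\<lambda>U. blinfun_apply (canonical_map U) c)"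
    by (rule bounded_linear_compose[OF blinfun.bounded_linear_left canonical_map(1)])
  from bounded_linear_compose[OF blinfun.bounded_linear_right this] show ?thesis
    by (simp add: tensor_form_def[abs_def])
qed

lemma canonical_map_bound: "\<exists>K>0. \<forall>U::'b::banach ptensor. norm (canonical_map U) \<le> norm U * K"
  using bounded_linear.pos_bounded[OF canonical_map(1)] by blast

lemma tensor_form_le: "\<bar>tensor_form U b c\<bar> \<le> norm b * norm (canonical_map U) * norm c"
proof -
  have "\<bar>tensor_form U b c\<bar> \<le> norm b * norm (blinfun_apply (canonical_map U) c)"
    unfolding tensor_form_def using norm_blinfun[of b] by simp
  also have "\<dots> \<le> norm b * (norm (canonical_map U) * norm c)"
    by (intro mult_left_mono norm_blinfun) simp
  finally show ?thesis by (simp add: mult.assoc)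
qed

definition cov_tensor :: "'b::banach ptensor \<Rightarrow> bool" where
  "cov_tensor U \<longleftrightarrow> (\<forall>b c. tensor_form U b c = tensor_form U c b) \<and> (\<forall>b. 0 \<le> tensor_form U b b)"

lemma kernel_form_tensor:
  "kernel_form (tensor_form U) n x c = tensor_form U (\<Sum>k<n. c k *\<^sub>R x k) (\<Sum>k<n. c k *\<^sub>R x k)"
  unfolding kernel_form_def tensor_form_def
  by (simp add: blinfun.sum_left blinfun.sum_right blinfun.scaleR_left blinfun.scaleR_right sum_distrib_left mult.assoc
      mult.left_commute)
    (subst sum.swap, simp add: mult.left_commute)

lemma psd_tensor_form: "cov_tensor U \<Longrightarrow> psd_kernel (tensor_form U)"
  unfolding psd_kernel_def kernel_form_tensor by (auto simp: cov_tensor_def)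

text \<open>By approximation of \<open>U\<close> by finite sums of elementary tensors.\<close>

lemma tensor_form_weak_star:
  fixes U :: "'b::banach ptensor" and b :: "nat \<Rightarrow> 'b \<Rightarrow>\<^sub>L real"
  assumes C: "\<And>n. norm (b n) \<le> C" and b: "\<And>x. (\<lambda>n. blinfun_apply (b n) x) \<longlonglongrightarrow> 0"
  shows "(\<lambda>n. tensor_form U (b n) (b n)) \<longlonglongrightarrow> 0"
proof (rule LIMSEQ_I)
  fix \<epsilon> :: real assume \<epsilon>: "0 < \<epsilon>"
  obtain K where K: "0 < K" "\<And>U::'b ptensor. norm (canonical_map U) \<le> norm U * K"
    using canonical_map_bound by blast
  have C0: "0 \<le> C" using C[of 0] norm_ge_zero[of "b 0"] by linarith
  \<comment> \<open>Small enough for replacing \<open>U\<close> by an element of the algebraic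
    tensor product to cost at most \<open>\<epsilon> / 2\<close> on all functionals of norm at most
    \<open>C\<close>; the summand 1 only keeps the denominator positive.\<close>
  define d where "d = \<epsilon> / (2 * (C * C * K + 1))"
  have CK: "0 \<le> C * C * K" using C0 K(1) by simp
  have d: "0 < d" using \<epsilon> CK by (simp add: d_def add_nonneg_pos)
  obtain u where u: "norm (U - ptensor_of u) < d" using ptensor_approx[OF d] by blast
  obtain zs where zs: "u = formal_eval atensor zs" using atensor_representation by blast
  \<comment> \<open>On an elementary tensor the form is the product of two scalars, each of which
    tends to 0.\<close>
  have "(\<lambda>n. tensor_form (formal_eval (\<otimes>\<^sub>\<pi>) zs) (b n) (b n)) \<longlonglongrightarrow> 0" for zs :: "('b \<times> 'b) list"
  proof (induction zs)
    case Nil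
    have "tensor_form 0 c c = 0" for c :: "'b \<Rightarrow>\<^sub>L real"
      by (rule linear_0[OF bounded_linear.linear[OF bounded_linear_tensor_form]])
    then show ?case by simp
  next
    case (Cons p zs)
    obtain x y where p: "p = (x, y)" by (cases p)
    have "tensor_form (formal_eval (\<otimes>\<^sub>\<pi>) (p # zs)) (b n) (b n) =
        b n x * b n y + tensor_form (formal_eval (\<otimes>\<^sub>\<pi>) zs) (b n) (b n)" for n
      by (simp add: p linear_add[OF bounded_linear.linear[OF bounded_linear_tensor_form]] tensor_form_ptensor)
    then show ?case using tendsto_add[OF tendsto_mult[OF b[of x] b[of y]] Cons] by simp
  qed
  then have "(\<lambda>n. tensor_form (ptensor_of u) (b n) (b n)) \<longlonglongrightarrow> 0"
    unfolding zs linear_formal_eval[OF linear_ptensor_of] ptensor_def .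
  from LIMSEQ_D[OF this, of "\<epsilon> / 2"] \<epsilon> obtain n0
    where n0: "\<And>n. n \<ge> n0 \<Longrightarrow> \<bar>tensor_form (ptensor_of u) (b n) (b n)\<bar> < \<epsilon> / 2" by auto
  have "\<bar>tensor_form U (b n) (b n)\<bar> < \<epsilon>" if n: "n \<ge> n0" for n
  proof -
    have "tensor_form U (b n) (b n) = tensor_form (U - ptensor_of u) (b n) (b n) + tensor_form (ptensor_of u) (b n) (b n)"
      by (simp add: linear_diff[OF bounded_linear.linear[OF bounded_linear_tensor_form]])
    moreover have "\<bar>tensor_form (U - ptensor_of u) (b n) (b n)\<bar> \<le> norm (b n) * norm (canonical_map (U - ptensor_of u)) * norm (b n)"
      by (rule tensor_form_le)
    moreover have "\<dots> \<le> C * (d * K) * C"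
    proof (intro mult_mono C)
      show "norm (canonical_map (U - ptensor_of u)) \<le> d * K"
        using K(2)[of "U - ptensor_of u"] u K(1) by (meson less_imp_le mult_right_mono order_trans)
    qed (use C0 d K in auto)
    moreover have "C * (d * K) * C \<le> \<epsilon> / 2"
    proof -
      have "C * (d * K) * C = (C * C * K) * d" by simp
      also have "\<dots> \<le> (C * C * K + 1) * d" using d by (intro mult_right_mono) auto
      also have "\<dots> = \<epsilon> / 2"
      proof -
        have "x * (\<epsilon> / (2 * x)) = \<epsilon> / 2" if "0 < x" for x using that by simp
        from this[of "C * C * K + 1"] CK show ?thesis unfolding d_def by linarith
      qed
      finally show ?thesis .
    qed
    ultimately show ?thesis using n0[OF n] by linarith
  qed
  then show "\<exists>n0. \<forall>n\<ge>n0. norm (tensor_form U (b n) (b n) - 0) < \<epsilon>" by auto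
qed

text \<open>The adjoint of the basis projection: \<open>b\<close> composed with the map sending
  \<open>x\<close> to the \<open>n\<close>-th partial sum of its expansion. It tends to
  \<open>b\<close> weak-star, though in general not in norm.\<close>

definition bproj :: "(nat \<Rightarrow> 'b::real_normed_vector) \<Rightarrow> (nat \<Rightarrow> 'b \<Rightarrow>\<^sub>L real) \<Rightarrow> nat \<Rightarrow> ('b \<Rightarrow>\<^sub>L real) \<Rightarrow> ('b \<Rightarrow>\<^sub>L real)" where
  "bproj e e' n b = (\<Sum>k<n. blinfun_apply b (e k) *\<^sub>R e' k)"

lemma bproj_tendsto:
  assumes "schauder_basis e e'"
  shows "(\<lambda>n. blinfun_apply (b - bproj e e' n b) x) \<longlonglongrightarrow> 0"
proof -
  have "(\<lambda>n. \<Sum>k<n. e' k x *\<^sub>R e k) \<longlonglongrightarrow> x"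
    using assms by (simp add: schauder_basis_def sums_def)
  then have "(\<lambda>n. b x - b (\<Sum>k<n. e' k x *\<^sub>R e k)) \<longlonglongrightarrow> b x - b x"
    by (intro tendsto_intros)
  then show ?thesis
    by (simp add: bproj_def blinfun.diff_left blinfun.sum_left blinfun.sum_right blinfun.scaleR_left blinfun.scaleR_right mult.commute)
qed

text \<open>Weak-star convergent sequences are bounded. The bound may depend on \<open>b\<close>,
  which suffices for \<open>tensor_form_weak_star\<close>.\<close>

lemma bproj_bounded:
  fixes e :: "nat \<Rightarrow> 'b::banach"
  assumes "schauder_basis e e'"
  obtains C where "\<And>n. norm (b - bproj e e' n b) \<le> C"
proof (rule uniform_boundedness)
  show "bounded (range (\<lambda>n. blinfun_apply (b - bproj e e' n b) x))" for x
    by (rule convergent_imp_bounded[OF bproj_tendsto[OF assms]])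
qed (rule that)

context
  fixes U :: "'b::banach ptensor" and e :: "nat \<Rightarrow> 'b" and e' :: "nat \<Rightarrow> 'b \<Rightarrow>\<^sub>L real"
  assumes U: "cov_tensor U"
begin

text \<open>The elimination can be performed in the Banach space itself, on the vectors
  \<open>canonical_map U b\<close>. Its columns are vectors that represent \<open>kcol\<close> as a
  functional of \<open>c\<close>; hence \<open>kcol\<close> is linear in \<open>c\<close>, and the
  factor built from these columns takes values in the space and not merely in its bidual.\<close>

lemma kcol_functional:
  "blinfun_apply c (vres (tensor_form U) e' (blinfun_apply (canonical_map U)) k b) = kres (tensor_form U) e' k c b"
  "blinfun_apply c (vcol (tensor_form U) e' (blinfun_apply (canonical_map U)) k) = kcol (tensor_form U) e' k c"
proof -
  have "blinfun_apply c (vres (tensor_form U) e' (blinfun_apply (canonical_map U)) k b) = kres (tensor_form U) e' k c b" for b c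
  proof (induction k arbitrary: b c)
    case 0
    show ?case by (simp add: tensor_form_def)
  next
    case (Suc k)
    have "blinfun_apply c (vcol (tensor_form U) e' (blinfun_apply (canonical_map U)) k) = kcol (tensor_form U) e' k c"
      by (simp add: vcol_def kcol_def blinfun.scaleR_right Suc divide_inverse mult.commute)
    then show ?case
      unfolding vres_Suc kres_Suc[OF psd_tensor_form[OF U]]
      by (simp add: blinfun.diff_right blinfun.scaleR_right Suc mult.commute)
  qed
  then show "blinfun_apply c (vres (tensor_form U) e' (blinfun_apply (canonical_map U)) k b) = kres (tensor_form U) e' k c b"
    "blinfun_apply c (vcol (tensor_form U) e' (blinfun_apply (canonical_map U)) k) = kcol (tensor_form U) e' k c"
    by (simp_all add: vcol_def kcol_def blinfun.scaleR_right divide_inverse mult.commute)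
qed

text \<open>The pivots \<open>e' k\<close> are null for the residual, and \<open>b\<close> minus its
  basis projection has arbitrarily small form by weak-star convergence. The coefficients
  \<open>- b (e k)\<close> turn this difference into a combination of pivots and
  \<open>b\<close>.\<close>

lemma klim_tensor_null:
  assumes "schauder_basis e e'"
  shows "klim (tensor_form U) e' b b = 0"
proof (rule klim_null_closure[OF psd_tensor_form[OF U]])
  fix \<epsilon> :: real assume \<epsilon>: "0 < \<epsilon>"
  obtain C where C: "\<And>n. norm (b - bproj e e' n b) \<le> C" using bproj_bounded[OF assms] by blast
  have "(\<lambda>n. tensor_form U (b - bproj e e' n b) (b - bproj e e' n b)) \<longlonglongrightarrow> 0"
    by (rule tensor_form_weak_star[OF C bproj_tendsto[OF assms]])
  from LIMSEQ_D[OF this \<epsilon>] obtain n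
    where "norm (tensor_form U (b - bproj e e' n b) (b - bproj e e' n b) - 0) < \<epsilon>" by blast
  then have n: "tensor_form U (b - bproj e e' n b) (b - bproj e e' n b) < \<epsilon>" by simp
  have "(\<Sum>k<Suc n. ((\<lambda>k. - b (e k))(n := 1)) k *\<^sub>R (e'(n := b)) k) = b - bproj e e' n b"
    by (simp add: bproj_def sum_negf)
  then show "\<exists>n x c. (\<forall>l<n. klim (tensor_form U) e' (x l) (x l) = 0) \<and>
      kernel_form (tensor_form U) (Suc n) (x(n := b)) (c(n := 1)) < \<epsilon>"
    using n by (intro exI[of _ n] exI[of _ e'] exI[of _ "\<lambda>k. - b (e k)"])
      (simp add: kernel_form_tensor klim_pivot[OF psd_tensor_form[OF U]])
qed

end

definition cov_factor_adj :: "(nat \<Rightarrow> 'b \<Rightarrow>\<^sub>L real) \<Rightarrow> 'b::banach ptensor \<Rightarrow> ('b \<Rightarrow>\<^sub>L real) \<Rightarrow>\<^sub>L ell2" where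
  "cov_factor_adj e' U = Blinfun (\<lambda>b. Abs_ell2 (\<lambda>k. kcol (tensor_form U) e' k b))"

definition cov_factor :: "(nat \<Rightarrow> 'b \<Rightarrow>\<^sub>L real) \<Rightarrow> 'b::banach ptensor \<Rightarrow> ell2 \<Rightarrow>\<^sub>L 'b" where
  "cov_factor e' U = Blinfun (\<lambda>h. \<Sum>k. Rep_ell2 h k *\<^sub>R vcol (tensor_form U) e' (blinfun_apply (canonical_map U)) k)"

context
  fixes U :: "'b::banach ptensor" and e' :: "nat \<Rightarrow> 'b \<Rightarrow>\<^sub>L real"
  assumes U: "cov_tensor U"
begin

text \<open>What gives \<open>Blinfun\<close> its intended meaning here is linearity, from
  \<open>kcol_functional\<close>, and boundedness, from Bessel's inequality
  \<open>kcol_sum_le\<close>.\<close>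

lemma Rep_cov_factor_adj: "Rep_ell2 (blinfun_apply (cov_factor_adj e' U) b) k = kcol (tensor_form U) e' k b"
proof -
  note psd = psd_tensor_form[OF U]
  define f where "f b = Abs_ell2 (\<lambda>k. kcol (tensor_form U) e' k b)" for b
  have Rep: "Rep_ell2 (f b) k = kcol (tensor_form U) e' k b" for b k
    unfolding f_def using summable_kcol[OF psd] by (simp add: Abs_ell2_inverse)
  have "bounded_linear f"
  proof (rule bounded_linear_intro)
    show "f (b + c) = f b + f c" for b c
      by (rule Rep_ell2_inject[THEN iffD1])
        (simp add: fun_eq_iff Rep Rep_ell2_add blinfun.add_left flip: kcol_functional(2)[OF U])
    show "f (r *\<^sub>R b) = r *\<^sub>R f b" for r b
      by (rule Rep_ell2_inject[THEN iffD1])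
        (simp add: fun_eq_iff Rep Rep_ell2_scaleR blinfun.scaleR_left flip: kcol_functional(2)[OF U])
    show "norm (f b) \<le> norm b * sqrt (norm (canonical_map U))" for b
    proof -
      have "(norm (f b))\<^sup>2 = (\<Sum>k. (kcol (tensor_form U) e' k b)\<^sup>2)" unfolding norm_ell2_square Rep ..
      also have "\<dots> \<le> tensor_form U b b"
        by (rule suminf_le_const[OF summable_kcol[OF psd] kcol_sum_le[OF psd]])
      also have "\<dots> \<le> norm b * norm (canonical_map U) * norm b" using tensor_form_le[of U b b] by simp
      also have "\<dots> = (norm b * sqrt (norm (canonical_map U)))\<^sup>2" by (simp add: power2_eq_square)
      finally show ?thesis by (rule power2_le_imp_le) simp
    qed
  qed
  then show ?thesis
    unfolding cov_factor_adj_def f_def[symmetric] by (simp add: bounded_linear_Blinfun_apply Rep)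
qed

lemma kcol_square_suminf_le: "(\<Sum>k\<in>{m..<n}. (kcol (tensor_form U) e' k b)\<^sup>2) \<le> tensor_form U b b"
proof -
  have "(\<Sum>k\<in>{m..<n}. (kcol (tensor_form U) e' k b)\<^sup>2) \<le> (\<Sum>k<n. (kcol (tensor_form U) e' k b)\<^sup>2)"
    by (rule sum_mono2) auto
  also have "\<dots> \<le> tensor_form U b b" by (rule kcol_sum_le[OF psd_tensor_form[OF U]])
  finally show ?thesis .
qed

text \<open>Tested against a functional of norm at most 1, a block of the series is bounded by
  Cauchy-Schwarz and Bessel's inequality, uniformly in the functional. So the tails of
  \<open>h\<close> in l^2 control the norms of the tails.\<close>

lemma cov_factor_sums:
  "(\<lambda>k. Rep_ell2 h k *\<^sub>R vcol (tensor_form U) e' (blinfun_apply (canonical_map U)) k) sums blinfun_apply (cov_factor e' U) h"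
proof -
  define s where "s = vcol (tensor_form U) e' (blinfun_apply (canonical_map U))"
  have bs: "blinfun_apply b (s k) = kcol (tensor_form U) e' k b" for b k
    unfolding s_def by (rule kcol_functional(2)[OF U])
  define q where "q = norm (canonical_map U)"
  have part: "norm (\<Sum>k\<in>{m..<n}. Rep_ell2 h k *\<^sub>R s k) \<le> sqrt (\<Sum>k\<in>{m..<n}. (Rep_ell2 h k)\<^sup>2) * sqrt q" for h m n
  proof (rule norm_le_functional)
    fix b :: "'b \<Rightarrow>\<^sub>L real" assume b: "norm b \<le> 1"
    have "tensor_form U b b \<le> norm b * q * norm b" using tensor_form_le[of U b b] by (simp add: q_def)
    also have "\<dots> \<le> 1 * q * 1" using b by (intro mult_mono) (auto simp: q_def)
    finally have Ub: "tensor_form U b b \<le> q" by simp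
    have "(\<Sum>k\<in>{m..<n}. Rep_ell2 h k * kcol (tensor_form U) e' k b)\<^sup>2 \<le>
        (\<Sum>k\<in>{m..<n}. (Rep_ell2 h k)\<^sup>2) * (\<Sum>k\<in>{m..<n}. (kcol (tensor_form U) e' k b)\<^sup>2)"
      by (rule Cauchy_Schwarz_ineq_sum)
    also have "\<dots> \<le> (\<Sum>k\<in>{m..<n}. (Rep_ell2 h k)\<^sup>2) * q"
      by (intro mult_left_mono order_trans[OF kcol_square_suminf_le Ub] sum_nonneg) simp
    finally have "\<bar>\<Sum>k\<in>{m..<n}. Rep_ell2 h k * kcol (tensor_form U) e' k b\<bar> \<le> sqrt ((\<Sum>k\<in>{m..<n}. (Rep_ell2 h k)\<^sup>2) * q)"
      by (rule real_le_rsqrt[of "\<bar>_\<bar>", unfolded power2_abs])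
    then show "blinfun_apply b (\<Sum>k\<in>{m..<n}. Rep_ell2 h k *\<^sub>R s k) \<le> sqrt (\<Sum>k\<in>{m..<n}. (Rep_ell2 h k)\<^sup>2) * sqrt q"
      by (simp add: blinfun.sum_right blinfun.scaleR_right bs real_sqrt_mult)
  qed
  have sm: "summable (\<lambda>k. Rep_ell2 h k *\<^sub>R s k)" for h
    unfolding summable_Cauchy
  proof (intro allI impI)
    fix \<epsilon> :: real assume \<epsilon>: "0 < \<epsilon>"
    define \<delta> where "\<delta> = (\<epsilon> / (sqrt q + 1))\<^sup>2"
    have sq: "0 < sqrt q + 1" by (simp add: q_def add_nonneg_pos)
    have "0 < \<delta>" using \<epsilon> sq by (simp add: \<delta>_def)
    then obtain N where N: "\<And>m n. m \<ge> N \<Longrightarrow> norm (\<Sum>k\<in>{m..<n}. (Rep_ell2 h k)\<^sup>2) < \<delta>"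
      using summable_Rep_ell2[of h] unfolding summable_Cauchy by meson
    have "norm (\<Sum>k\<in>{m..<n}. Rep_ell2 h k *\<^sub>R s k) < \<epsilon>" if m: "m \<ge> N" for m n
    proof -
      have "sqrt (\<Sum>k\<in>{m..<n}. (Rep_ell2 h k)\<^sup>2) \<le> sqrt \<delta>"
        using N[OF m, of n] by simp
      also have "sqrt \<delta> = \<epsilon> / (sqrt q + 1)" using \<epsilon> sq by (simp add: \<delta>_def)
      finally have "sqrt (\<Sum>k\<in>{m..<n}. (Rep_ell2 h k)\<^sup>2) * sqrt q \<le> \<epsilon> / (sqrt q + 1) * sqrt q"
        by (rule mult_right_mono) (simp add: q_def)
      also have "\<dots> < \<epsilon>" using \<epsilon> sq by (simp add: field_simps)
      finally show ?thesis using part[of h m n] by simp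
    qed
    then show "\<exists>N. \<forall>m\<ge>N. \<forall>n. norm (\<Sum>k\<in>{m..<n}. Rep_ell2 h k *\<^sub>R s k) < \<epsilon>" by blast
  qed
  have "bounded_linear (\<lambda>h. \<Sum>k. Rep_ell2 h k *\<^sub>R s k)"
  proof (rule bounded_linear_intro)
    show "(\<Sum>k. Rep_ell2 (g + h) k *\<^sub>R s k) = (\<Sum>k. Rep_ell2 g k *\<^sub>R s k) + (\<Sum>k. Rep_ell2 h k *\<^sub>R s k)" for g h
      by (simp add: Rep_ell2_add scaleR_add_left suminf_add[OF sm sm])
    show "(\<Sum>k. Rep_ell2 (r *\<^sub>R h) k *\<^sub>R s k) = r *\<^sub>R (\<Sum>k. Rep_ell2 h k *\<^sub>R s k)" for r h
      by (simp add: Rep_ell2_scaleR suminf_scaleR_right[OF sm] flip: scaleR_scaleR)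
    show "norm (\<Sum>k. Rep_ell2 h k *\<^sub>R s k) \<le> norm h * sqrt q" for h
    proof (rule LIMSEQ_le_const2[OF tendsto_norm[OF summable_LIMSEQ[OF sm]]], intro exI[of _ 0] allI impI)
      fix n
      have "norm (\<Sum>k<n. Rep_ell2 h k *\<^sub>R s k) \<le> sqrt (\<Sum>k<n. (Rep_ell2 h k)\<^sup>2) * sqrt q"
        using part[of h 0 n] by (simp add: lessThan_atLeast0)
      also have "\<dots> \<le> norm h * sqrt q"
        using sum_le_norm_ell2[of h n] by (intro mult_right_mono) (auto simp: q_def real_le_lsqrt intro!: real_le_lsqrt sum_nonneg)
      finally show "norm (\<Sum>k<n. Rep_ell2 h k *\<^sub>R s k) \<le> norm h * sqrt q" .
    qed
  qed
  then show ?thesis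
    unfolding cov_factor_def s_def[symmetric] using summable_sums[OF sm, of h]
    by (simp add: bounded_linear_Blinfun_apply)
qed

lemma cov_factor_adjoint: "is_adjoint (cov_factor e' U) (cov_factor_adj e' U)"
  unfolding is_adjoint_def
proof (intro allI)
  fix b :: "'b \<Rightarrow>\<^sub>L real" and h
  have "(\<lambda>k. b (Rep_ell2 h k *\<^sub>R vcol (tensor_form U) e' (blinfun_apply (canonical_map U)) k)) sums b (cov_factor e' U h)"
    by (rule bounded_linear.sums[OF blinfun.bounded_linear_right cov_factor_sums])
  then have "(\<lambda>k. Rep_ell2 (cov_factor_adj e' U b) k * Rep_ell2 h k) sums b (cov_factor e' U h)"
    by (simp add: blinfun.scaleR_right kcol_functional(2)[OF U] Rep_cov_factor_adj mult.commute)
  then show "cov_factor_adj e' U b \<bullet> h = b (cov_factor e' U h)"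
    by (rule sums_unique2[OF inner_ell2_sums])
qed

lemma cov_factor_adj_inner:
  assumes "schauder_basis e e'"
  shows "cov_factor_adj e' U b \<bullet> cov_factor_adj e' U c = tensor_form U b c"
  using sums_unique2[OF inner_ell2_sums[of "cov_factor_adj e' U b" "cov_factor_adj e' U c"]]
    kernel_Parseval[OF psd_tensor_form[OF U] klim_tensor_null[OF U assms], of b c]
  by (simp add: Rep_cov_factor_adj)

text \<open>Functionals separate points; pulled back through the adjoint, the claim becomes the
  Parseval identity for the rows of the Cholesky factor.\<close>

lemma cov_factor_compose:
  assumes "schauder_basis e e'"
  shows "canonical_map U = cov_factor e' U o\<^sub>L cov_factor_adj e' U"
proof (rule blinfun_eqI, rule eq_by_functionals)
  fix b c :: "'b \<Rightarrow>\<^sub>L real"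
  have "c ((cov_factor e' U o\<^sub>L cov_factor_adj e' U) b) = cov_factor_adj e' U c \<bullet> cov_factor_adj e' U b"
    using cov_factor_adjoint by (simp add: is_adjoint_def)
  then show "c (canonical_map U b) = c ((cov_factor e' U o\<^sub>L cov_factor_adj e' U) b)"
    by (simp add: cov_factor_adj_inner[OF assms] tensor_form_def)
qed

end

text \<open>With pivots that are the same for all \<open>x\<close>, every coordinate comes from
  finitely many values of the form by arithmetic and a square root; the division is measurable also
  where it divides by 0.\<close>

lemma measurable_cov_factor_adj:
  fixes U :: "'x \<Rightarrow> 'b::{banach, second_countable_topology} ptensor"
  assumes [measurable]: "U \<in> borel_measurable M" and U: "\<And>x. cov_tensor (U x)"
  shows "(\<lambda>x. blinfun_apply (cov_factor_adj e' (U x)) b) \<in> borel_measurable M"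
proof -
  have tf: "(\<lambda>x. tensor_form (U x) b c) \<in> borel_measurable M" for b c
    by (rule borel_measurable_continuous_on[OF _ assms(1)])
      (intro linear_continuous_on bounded_linear_tensor_form)
  have [measurable]: "(\<lambda>x. kres (tensor_form (U x)) e' k b c) \<in> borel_measurable M" for k b c
  proof (induction k arbitrary: b c)
    case (Suc k)
    note [measurable] = Suc
    show ?case by simp
  qed (simp add: tf)
  show ?thesis
    by (rule borel_measurable_ell2I) (simp add: Rep_cov_factor_adj[OF U] kcol_def)
qed

section \<open>Representation of Gaussian processes as stochastic integrals\<close>

lemma L2_kernel:
  fixes F :: "'i \<Rightarrow> 'x \<Rightarrow> 'h::{real_inner, second_countable_topology}"
  assumes "finite_measure \<mu>" and F[measurable]: "\<And>i. F i \<in> borel_measurable \<mu>" and B: "\<And>i u. norm (F i u) \<le> B i"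
  shows "kernel_form (\<lambda>i j. \<integral>u. F i u \<bullet> F j u \<partial>\<mu>) n x c = (\<integral>u. (norm (\<Sum>k<n. c k *\<^sub>R F (x k) u))\<^sup>2 \<partial>\<mu>)"
    "psd_kernel (\<lambda>i j. \<integral>u. F i u \<bullet> F j u \<partial>\<mu>)"
proof -
  interpret finite_measure \<mu> by fact
  have int[simp]: "integrable \<mu> (\<lambda>u. F i u \<bullet> F j u)" for i j
  proof (rule integrable_const_bound[where B="B i * B j"])
    have B0: "0 \<le> B i" using B[of i] norm_ge_zero order_trans by blast
    show "AE u in \<mu>. norm (F i u \<bullet> F j u) \<le> B i * B j"
      using Cauchy_Schwarz_ineq2[of "F i _" "F j _"] mult_mono[OF B B B0 norm_ge_zero]
      by (intro AE_I2) (metis order_trans real_norm_def)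
  qed measurable
  show form: "kernel_form (\<lambda>i j. \<integral>u. F i u \<bullet> F j u \<partial>\<mu>) n x c = (\<integral>u. (norm (\<Sum>k<n. c k *\<^sub>R F (x k) u))\<^sup>2 \<partial>\<mu>)" for n x c
  proof -
    have "(norm (\<Sum>k<n. c k *\<^sub>R F (x k) u))\<^sup>2 = (\<Sum>k<n. \<Sum>l<n. c k * c l * (F (x k) u \<bullet> F (x l) u))" for u
      unfolding power2_norm_eq_inner
      by (subst inner_sum_left, subst inner_sum_right) (simp add: mult.assoc mult.left_commute)
    then have "(\<integral>u. (norm (\<Sum>k<n. c k *\<^sub>R F (x k) u))\<^sup>2 \<partial>\<mu>) =
        (\<integral>u. (\<Sum>k<n. \<Sum>l<n. c k * c l * (F (x k) u \<bullet> F (x l) u)) \<partial>\<mu>)" by simp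
    also have "\<dots> = (\<Sum>k<n. \<integral>u. (\<Sum>l<n. c k * c l * (F (x k) u \<bullet> F (x l) u)) \<partial>\<mu>)"
      by (rule Bochner_Integration.integral_sum) simp
    also have "\<dots> = (\<Sum>k<n. \<Sum>l<n. c k * c l * (\<integral>u. F (x k) u \<bullet> F (x l) u \<partial>\<mu>))"
      by (intro sum.cong refl) (subst Bochner_Integration.integral_sum, simp_all)
    finally show ?thesis by (simp add: kernel_form_def)
  qed
  show "psd_kernel (\<lambda>i j. \<integral>u. F i u \<bullet> F j u \<partial>\<mu>)"
    unfolding psd_kernel_def form by (auto simp: inner_commute)
qed

lemma dense_sequence_unit_interval:
  obtains r :: "nat \<Rightarrow> real" where "\<And>i. r i \<in> {0..1}" "\<And>t d. t \<in> {0..1} \<Longrightarrow> 0 < d \<Longrightarrow> \<exists>i. \<bar>t - r i\<bar> < d"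
proof
  define r where "r i = max 0 (min 1 (real_of_rat (nat_to_rat_surj i)))" for i
  show "r i \<in> {0..1}" for i by (auto simp: r_def)
  fix t d :: real assume t: "t \<in> {0..1}" and d: "0 < d"
  have "t < t + d" using d by simp
  from of_rat_dense[OF this] obtain q where q: "t < real_of_rat q" "real_of_rat q < t + d" by auto
  obtain i where "q = nat_to_rat_surj i" using surj_nat_to_rat_surj by (metis surjD)
  with q t show "\<exists>i. \<bar>t - r i\<bar> < d" by (intro exI[of _ i]) (auto simp: r_def)
qed

lemma measure_cell: "0 \<le> s \<Longrightarrow> s \<le> t \<Longrightarrow> t \<le> 1 \<Longrightarrow> measure (cell 1) {s<..t} = t - s"
  by (subst measure_restrict_space) auto

text \<open>The two cuts differ only between \<open>s\<close> and \<open>t\<close>. This is how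
  arbitrary times are approximated by pivot times.\<close>

lemma cell_cut_integral:
  fixes g :: "real \<Rightarrow> ell2"
  assumes [measurable]: "g \<in> borel_measurable borel" and B: "\<And>u. norm (g u) \<le> B" and st: "s \<in> {0..1}" "t \<in> {0..1}"
  shows "(\<integral>u. (norm ((if 0 < u \<and> u \<le> t then g u else 0) - (if 0 < u \<and> u \<le> s then g u else 0)))\<^sup>2 \<partial>cell 1) \<le> B\<^sup>2 * \<bar>t - s\<bar>"
proof -
  interpret finite_measure "cell 1" by (rule finite_cell)
  have [measurable]: "g \<in> borel_measurable (cell 1)" by (intro measurable_restrict_space1) simp
  have [measurable]: "(\<lambda>u. u) \<in> borel_measurable (cell 1)" by (intro measurable_restrict_space1) simp
  have S: "{min s t<..max s t} \<in> sets (cell 1)"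
    using st by (subst sets_restrict_space) (auto intro!: image_eqI[of _ _ "{min s t<..max s t}"])
  have B0: "0 \<le> B" using B[of 0] norm_ge_zero order_trans by blast
  have le: "(norm ((if 0 < u \<and> u \<le> t then g u else 0) - (if 0 < u \<and> u \<le> s then g u else 0)))\<^sup>2
      \<le> B\<^sup>2 * indicator {min s t<..max s t} u" for u
    using power_mono[OF B[of u], of 2] st by (auto simp: indicator_def)
  have "(\<integral>u. (norm ((if 0 < u \<and> u \<le> t then g u else 0) - (if 0 < u \<and> u \<le> s then g u else 0)))\<^sup>2 \<partial>cell 1)
      \<le> (\<integral>u. B\<^sup>2 * indicator {min s t<..max s t} u \<partial>cell 1)"
  proof (rule integral_mono)
    show i: "integrable (cell 1) (\<lambda>u. B\<^sup>2 * indicator {min s t<..max s t} u)"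
      using S by (intro integrable_mult_right integrable_real_indicator) (auto simp: less_top[symmetric])
    show "integrable (cell 1) (\<lambda>u. (norm ((if 0 < u \<and> u \<le> t then g u else 0) - (if 0 < u \<and> u \<le> s then g u else 0)))\<^sup>2)"
      by (rule Bochner_Integration.integrable_bound[OF i]) (use le in auto)
  qed (rule le)
  also have "\<dots> = B\<^sup>2 * measure (cell 1) {min s t<..max s t}"
    by (simp only: integral_mult_right_zero Bochner_Integration.integral_indicator sets.Int_space_eq2[OF S])
  also have "\<dots> = B\<^sup>2 * \<bar>t - s\<bar>" using st by (subst measure_cell) auto
  finally show ?thesis .
qed

lemma cell_integral_set:
  fixes f :: "real \<Rightarrow> real"
  assumes t: "t \<in> {0..1}" and [measurable]: "f \<in> borel_measurable borel"
  shows "(\<integral>u. (if 0 < u \<and> u \<le> t then f u else 0) \<partial>cell 1) = (LINT u:{0..t}|lborel. f u)"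
proof -
  have "(\<integral>u. (if 0 < u \<and> u \<le> t then f u else 0) \<partial>cell 1) = (\<integral>u. indicator {0<..1} u *\<^sub>R (if 0 < u \<and> u \<le> t then f u else 0) \<partial>lborel)"
    by (subst integral_restrict_space) (auto simp: set_lebesgue_integral_def)
  also have "\<dots> = (\<integral>u. indicator {0<..t} u *\<^sub>R f u \<partial>lborel)"
    using t by (intro Bochner_Integration.integral_cong) (auto simp: indicator_def)
  also have "\<dots> = (LINT u:{0..t}|lborel. f u)"
    unfolding set_lebesgue_integral_def
  proof (rule integral_cong_AE)
    show "AE u in lborel. indicator {0<..t} u *\<^sub>R f u = indicator {0..t} u *\<^sub>R f u"
      using AE_lborel_singleton[of "0::real"] by eventually_elim (auto simp: indicator_def)
  qed measurable
  finally show ?thesis .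
qed

text \<open>Turns L^2 approximation into null residuals by \<open>klim_null_closure\<close>. The
  kernel \<open>R'\<close> may be any one dominated by the Gram kernel, because the second
  elimination starts from the residual of the first.\<close>

lemma klim_L2_null:
  fixes F :: "'i \<Rightarrow> 'x \<Rightarrow> 'h::{real_inner, second_countable_topology}"
  assumes "finite_measure \<mu>" "\<And>i. F i \<in> borel_measurable \<mu>" "\<And>i u. norm (F i u) \<le> B i"
    and R': "psd_kernel R'" "\<And>n x c. kernel_form R' n x c \<le> kernel_form (\<lambda>i j. \<integral>u. F i u \<bullet> F j u \<partial>\<mu>) n x c"
    and approx: "\<And>\<epsilon>. 0 < \<epsilon> \<Longrightarrow> \<exists>(n::nat) x c. (\<forall>l<n. klim R' w (x l) (x l) = 0) \<and>
      (\<integral>u. (norm (F i u - (\<Sum>l<n. c l *\<^sub>R F (x l) u)))\<^sup>2 \<partial>\<mu>) < \<epsilon>"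
  shows "klim R' w i i = 0"
proof (rule klim_null_closure[OF R'(1)])
  fix \<epsilon> :: real assume "0 < \<epsilon>"
  from approx[OF this]
  show "\<exists>(n::nat) x c. (\<forall>l<n. klim R' w (x l) (x l) = 0) \<and> kernel_form R' (Suc n) (x(n := i)) (c(n := 1)) < \<epsilon>"
  proof (elim exE conjE)
    fix n :: nat and x and c :: "nat \<Rightarrow> real"
    assume n: "\<forall>l<n. klim R' w (x l) (x l) = 0"
      and e: "(\<integral>u. (norm (F i u - (\<Sum>l<n. c l *\<^sub>R F (x l) u)))\<^sup>2 \<partial>\<mu>) < \<epsilon>"
    have eq: "(\<Sum>l<Suc n. ((\<lambda>l. - c l)(n := 1)) l *\<^sub>R F ((x(n := i)) l) u) = F i u - (\<Sum>l<n. c l *\<^sub>R F (x l) u)" for u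
      by (simp add: sum_negf)
    have "kernel_form R' (Suc n) (x(n := i)) ((\<lambda>l. - c l)(n := 1)) < \<epsilon>"
      using R'(2)[of "Suc n" "x(n := i)" "(\<lambda>l. - c l)(n := 1)"] e
      unfolding L2_kernel(1)[OF assms(1-3)] eq by linarith
    with n show ?thesis by (intro exI conjI)
  qed
qed

text \<open>The functions whose integrals are the functionals of \<open>G t\<close> (left) and the values \<open>W t h\<close> (right).\<close>

definition path_fun ::
    "(real \<Rightarrow> 'c \<Rightarrow> ell2) \<Rightarrow> (real \<times> 'c) + (real \<times> ell2) \<Rightarrow> real \<Rightarrow> ell2" where
  "path_fun f i u = (case i of Inl (t, b) \<Rightarrow> if 0 < u \<and> u \<le> t then f u b else 0
     | Inr (t, h) \<Rightarrow> if 0 < u \<and> u \<le> t then h else 0)"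

lemma path_fun_simps [simp]:
  "path_fun f (Inl (t, b)) u = (if 0 < u \<and> u \<le> t then f u b else 0)"
  "path_fun f (Inr (t, h)) u = (if 0 < u \<and> u \<le> t then h else 0)"
  by (simp_all add: path_fun_def)

definition path_kernel :: "(real \<Rightarrow> 'c \<Rightarrow> ell2) \<Rightarrow> (real \<times> 'c) + (real \<times> ell2) \<Rightarrow> (real \<times> 'c) + (real \<times> ell2) \<Rightarrow> real" where
  "path_kernel f i j = (\<integral>u. path_fun f i u \<bullet> path_fun f j u \<partial>cell 1)"

lemma path_kernel_right:
  assumes "s \<in> {0..1}" "t \<in> {0..1}"
  shows "path_kernel f (Inr (s, g)) (Inr (t, h)) = min s t * (g \<bullet> h)"
proof -
  have "path_kernel f (Inr (s, g)) (Inr (t, h)) = (\<integral>u. (if 0 < u \<and> u \<le> min s t then g \<bullet> h else 0) \<partial>cell 1)"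
    unfolding path_kernel_def by (intro Bochner_Integration.integral_cong) auto
  also have "\<dots> = (LINT u:{0..min s t}|lborel. g \<bullet> h)" using assms by (intro cell_integral_set) auto
  also have "\<dots> = min s t * (g \<bullet> h)" using assms by (simp add: set_lebesgue_integral_def)
  finally show ?thesis .
qed

lemma measurable_tensor_form:
  fixes U :: "'x \<Rightarrow> 'b::{banach, second_countable_topology} ptensor"
  assumes "U \<in> borel_measurable M"
  shows "(\<lambda>x. tensor_form (U x) b c) \<in> borel_measurable M"
  by (rule borel_measurable_continuous_on[OF _ assms])
    (intro linear_continuous_on bounded_linear_tensor_form)

text \<open>Pivots for the eliminations: rational times, and basis vectors on either side.\<close>

definition left_pivot :: "(nat \<Rightarrow> 'c) \<Rightarrow> (nat \<Rightarrow> real) \<Rightarrow> nat \<Rightarrow> (real \<times> 'c) + (real \<times> ell2)" where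
  "left_pivot e' r n = (case prod_decode n of (i, k) \<Rightarrow> Inl (r i, e' k))"

definition right_pivot :: "(nat \<Rightarrow> real) \<Rightarrow> nat \<Rightarrow> (real \<times> 'c) + (real \<times> ell2)" where
  "right_pivot r n = (case prod_decode n of (i, k) \<Rightarrow> Inr (r i, eunit k))"

lemma left_pivot_range: "(\<And>i. r i \<in> T) \<Longrightarrow> left_pivot e' r n \<in> Inl ` (T \<times> UNIV)"
  by (simp add: left_pivot_def split: prod.split)

lemma small_time:
  fixes B \<epsilon> :: real
  assumes r: "\<And>t d. t \<in> {0..1} \<Longrightarrow> 0 < d \<Longrightarrow> \<exists>i. \<bar>t - r i\<bar> < d" "t \<in> {0..1}" and "0 < \<epsilon>"
  obtains i where "B\<^sup>2 * \<bar>t - r i\<bar> < \<epsilon>"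
proof -
  have "0 < \<epsilon> / (B\<^sup>2 + 1)" using \<open>0 < \<epsilon>\<close> by (intro divide_pos_pos add_nonneg_pos) simp_all
  then obtain i where i: "\<bar>t - r i\<bar> < \<epsilon> / (B\<^sup>2 + 1)" using r by blast
  have pos: "0 < B\<^sup>2 + 1" by (rule add_nonneg_pos) simp_all
  have "B\<^sup>2 * \<bar>t - r i\<bar> \<le> (B\<^sup>2 + 1) * \<bar>t - r i\<bar>" by (intro mult_right_mono) simp_all
  also have "\<dots> < \<epsilon>" using i pos by (simp add: pos_less_divide_eq mult.commute)
  finally show ?thesis by (rule that)
qed

context
  fixes e :: "nat \<Rightarrow> 'b::{banach, second_countable_topology}" and e' :: "nat \<Rightarrow> 'b \<Rightarrow>\<^sub>L real"
    and U :: "real \<Rightarrow> 'b ptensor" and K :: real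
  assumes basis: "schauder_basis e e'"
    and U: "\<And>u. cov_tensor (U u)" and Um: "U \<in> borel_measurable borel" and UK: "\<And>u. norm (canonical_map (U u)) \<le> K"
begin

abbreviation "factor_fun \<equiv> \<lambda>u. blinfun_apply (cov_factor_adj e' (U u))"

lemma K_nonneg: "0 \<le> K"
  using UK[of 0] norm_ge_zero order_trans by blast

lemma factor_fun_norm: "(norm (factor_fun u b))\<^sup>2 = tensor_form (U u) b b"
  unfolding power2_norm_eq_inner by (rule cov_factor_adj_inner[OF U basis])

lemma factor_fun_bound: "norm (factor_fun u b) \<le> norm b * sqrt K"
proof (rule power2_le_imp_le)
  have "tensor_form (U u) b b \<le> norm b * norm (canonical_map (U u)) * norm b"
    using tensor_form_le[of "U u" b b] by simp
  also have "\<dots> \<le> norm b * K * norm b" by (intro mult_mono UK) (auto simp: K_nonneg)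
  also have "\<dots> = (norm b * sqrt K)\<^sup>2" using K_nonneg by (simp add: power_mult_distrib power2_eq_square)
  finally show "(norm (factor_fun u b))\<^sup>2 \<le> (norm b * sqrt K)\<^sup>2" unfolding factor_fun_norm .
qed (simp add: K_nonneg)

lemma factor_fun_measurable [measurable]: "(\<lambda>u. factor_fun u b) \<in> borel_measurable borel"
  by (rule measurable_cov_factor_adj[OF Um U])

definition path_bound :: "(real \<times> ('b \<Rightarrow>\<^sub>L real)) + (real \<times> ell2) \<Rightarrow> real" where
  "path_bound i = (case i of Inl (t, b) \<Rightarrow> norm b * sqrt K | Inr (t, h) \<Rightarrow> norm h)"

lemma path_fun_bound: "norm (path_fun factor_fun i u) \<le> path_bound i"
  using factor_fun_bound K_nonneg by (auto simp: path_fun_def path_bound_def split: sum.split)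

lemma path_fun_measurable: "path_fun factor_fun i \<in> borel_measurable (cell 1)"
proof (intro measurable_restrict_space1, cases i)
  case (Inl p)
  obtain t b where "p = (t, b)" by (cases p)
  then have "path_fun factor_fun i = (\<lambda>u. if 0 < u \<and> u \<le> t then factor_fun u b else 0)" using Inl by (simp add: fun_eq_iff)
  then show "path_fun factor_fun i \<in> borel_measurable lborel" by simp
next
  case (Inr p)
  obtain t h where "p = (t, h)" by (cases p)
  then have "path_fun factor_fun i = (\<lambda>u. if 0 < u \<and> u \<le> t then h else 0)" using Inr by (simp add: fun_eq_iff)
  then show "path_fun factor_fun i \<in> borel_measurable lborel" by simp
qed

lemma psd_path_kernel: "psd_kernel (path_kernel factor_fun)"
  unfolding path_kernel_def[abs_def]
  by (rule L2_kernel(2)[OF finite_cell path_fun_measurable path_fun_bound])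

lemma path_kernel_form:
  "kernel_form (path_kernel factor_fun) n x c = (\<integral>u. (norm (\<Sum>k<n. c k *\<^sub>R path_fun factor_fun (x k) u))\<^sup>2 \<partial>cell 1)"
  unfolding path_kernel_def[abs_def]
  by (rule L2_kernel(1)[OF finite_cell path_fun_measurable path_fun_bound])

lemmas path_null = klim_L2_null[OF finite_cell path_fun_measurable path_fun_bound, folded path_kernel_def]

lemma path_kernel_left:
  assumes "s \<in> {0..1}" "t \<in> {0..1}"
  shows "path_kernel factor_fun (Inl (t, b)) (Inl (s, c)) = (LINT u:{0..min t s}|lborel. tensor_form (U u) b c)"
proof -
  have "path_kernel factor_fun (Inl (t, b)) (Inl (s, c)) = (\<integral>u. (if 0 < u \<and> u \<le> min t s then tensor_form (U u) b c else 0) \<partial>cell 1)"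
    unfolding path_kernel_def by (intro Bochner_Integration.integral_cong) (auto simp: cov_factor_adj_inner[OF U basis])
  also have "\<dots> = (LINT u:{0..min t s}|lborel. tensor_form (U u) b c)"
    using assms by (intro cell_integral_set measurable_tensor_form Um) auto
  finally show ?thesis .
qed

text \<open>Two approximations: a basis functional at any time by the same functional at pivot
  times, and then any \<open>b\<close> by its basis projections at the same time. In the second the
  integrand is \<open>tensor_form (U u)\<close> on a bounded weak-star null sequence, so it tends to
  0 pointwise and dominated convergence applies.\<close>

lemma left_pivot_null:
  assumes r: "\<And>i. r i \<in> {0..1}" "\<And>t d. t \<in> {0..1} \<Longrightarrow> 0 < d \<Longrightarrow> \<exists>i. \<bar>t - r i\<bar> < d" and t: "t \<in> {0..1}"
  shows "klim (path_kernel factor_fun) (left_pivot e' r) (Inl (t, b)) (Inl (t, b)) = 0"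
proof -
  note null = path_null[OF psd_path_kernel order_refl, of "left_pivot e' r"]
  have piv: "klim (path_kernel factor_fun) (left_pivot e' r) (Inl (r i, e' k)) (Inl (r i, e' k)) = 0" for i k
    using klim_pivot[OF psd_path_kernel, of "left_pivot e' r" "prod_encode (i, k)"] by (simp add: left_pivot_def)
  have basis_null: "klim (path_kernel factor_fun) (left_pivot e' r) (Inl (t, e' k)) (Inl (t, e' k)) = 0" for k
  proof (rule null)
    fix \<epsilon> :: real assume "0 < \<epsilon>"
    then obtain i where i: "(norm (e' k) * sqrt K)\<^sup>2 * \<bar>t - r i\<bar> < \<epsilon>" using small_time[OF r(2) t] by blast
    have "(\<integral>u. (norm (path_fun factor_fun (Inl (t, e' k)) u - (\<Sum>l<Suc 0. 1 *\<^sub>R path_fun factor_fun (Inl (r i, e' k)) u)))\<^sup>2 \<partial>cell 1) < \<epsilon>"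
      using le_less_trans[OF cell_cut_integral[OF factor_fun_measurable factor_fun_bound r(1) t] i] by simp
    then show "\<exists>(n::nat) x c. (\<forall>l<n. klim (path_kernel factor_fun) (left_pivot e' r) (x l) (x l) = 0) \<and>
      (\<integral>u. (norm (path_fun factor_fun (Inl (t, e' k)) u - (\<Sum>l<n. c l *\<^sub>R path_fun factor_fun (x l) u)))\<^sup>2 \<partial>cell 1) < \<epsilon>"
      by (intro exI[of _ "Suc 0"] exI[of _ "\<lambda>_. Inl (r i, e' k)"] exI[of _ "\<lambda>_. 1::real"] conjI) (auto simp: piv)
  qed
  show ?thesis
  proof (rule null)
    fix \<epsilon> :: real assume \<epsilon>: "0 < \<epsilon>"
    interpret finite_measure "cell 1" by (rule finite_cell)
    obtain C where C: "\<And>n. norm (b - bproj e e' n b) \<le> C" using bproj_bounded[OF basis] by blast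
    have C0: "0 \<le> C" using C[of 0] norm_ge_zero order_trans by blast
    define D where "D n u = path_fun factor_fun (Inl (t, b - bproj e e' n b)) u" for n u
    have D: "D n u = path_fun factor_fun (Inl (t, b)) u - (\<Sum>k<n. b (e k) *\<^sub>R path_fun factor_fun (Inl (t, e' k)) u)" for n u
      by (cases "0 < u"; cases "u \<le> t") (simp_all add: D_def bproj_def blinfun.diff_right blinfun.sum_right blinfun.scaleR_right)
    have "(\<lambda>n. \<integral>u. (norm (D n u))\<^sup>2 \<partial>cell 1) \<longlonglongrightarrow> (\<integral>u. 0 \<partial>cell 1)"
    proof (rule integral_dominated_convergence[where w="\<lambda>_. (C * sqrt K)\<^sup>2"])
      show "(\<lambda>u. (norm (D n u))\<^sup>2) \<in> borel_measurable (cell 1)" for n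
        using path_fun_measurable unfolding D_def by measurable
      show "AE u in cell 1. (\<lambda>n. (norm (D n u))\<^sup>2) \<longlonglongrightarrow> 0"
      proof (rule AE_I2)
        fix u
        show "(\<lambda>n. (norm (D n u))\<^sup>2) \<longlonglongrightarrow> 0"
          using tensor_form_weak_star[OF C bproj_tendsto[OF basis], where U="U u"]
          by (cases "0 < u"; cases "u \<le> t") (simp_all add: D_def factor_fun_norm)
      qed
      show "AE u in cell 1. norm ((norm (D n u))\<^sup>2) \<le> (C * sqrt K)\<^sup>2" for n
      proof (rule AE_I2)
        fix u
        have "norm (D n u) \<le> norm (b - bproj e e' n b) * sqrt K"
          using factor_fun_bound[of u "b - bproj e e' n b"] K_nonneg by (simp add: D_def)
        also have "\<dots> \<le> C * sqrt K" by (intro mult_right_mono C) (simp add: K_nonneg)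
        finally show "norm ((norm (D n u))\<^sup>2) \<le> (C * sqrt K)\<^sup>2" by (simp add: power_mono)
      qed
    qed auto
    then have "(\<lambda>n. \<integral>u. (norm (D n u))\<^sup>2 \<partial>cell 1) \<longlonglongrightarrow> 0" by simp
    from order_tendstoD(2)[OF this \<epsilon>] obtain n where "(\<integral>u. (norm (D n u))\<^sup>2 \<partial>cell 1) < \<epsilon>"
      by (auto simp: eventually_sequentially)
    then show "\<exists>(n::nat) x c. (\<forall>l<n. klim (path_kernel factor_fun) (left_pivot e' r) (x l) (x l) = 0) \<and>
      (\<integral>u. (norm (path_fun factor_fun (Inl (t, b)) u - (\<Sum>l<n. c l *\<^sub>R path_fun factor_fun (x l) u)))\<^sup>2 \<partial>cell 1) < \<epsilon>"
      unfolding D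
      by (intro exI[of _ n] exI[of _ "\<lambda>k. Inl (t, e' k)"] exI[of _ "\<lambda>k. b (e k)"] conjI) (auto simp: basis_null)
  qed
qed

text \<open>Unit vectors at any time are approximated through pivot times, and then \<open>h\<close>
  by its truncations.\<close>

lemma right_pivot_null:
  assumes r: "\<And>i. r i \<in> {0..1}" "\<And>t d. t \<in> {0..1} \<Longrightarrow> 0 < d \<Longrightarrow> \<exists>i. \<bar>t - r i\<bar> < d" and t: "t \<in> {0..1}"
    and R': "psd_kernel R'" "\<And>n x c. kernel_form R' n x c \<le> kernel_form (path_kernel factor_fun) n x c"
  shows "klim R' (right_pivot r) (Inr (t, h)) (Inr (t, h)) = 0"
proof -
  note null = path_null[OF R'(1) R'(2), of "right_pivot r"]
  have piv: "klim R' (right_pivot r) (Inr (r i, eunit k)) (Inr (r i, eunit k)) = 0" for i k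
    using klim_pivot[OF R'(1), of "right_pivot r" "prod_encode (i, k)"] by (simp add: right_pivot_def)
  have unit_null: "klim R' (right_pivot r) (Inr (t, eunit k)) (Inr (t, eunit k)) = 0" for k
  proof (rule null)
    fix \<epsilon> :: real assume "0 < \<epsilon>"
    then obtain i where i: "(norm (eunit k))\<^sup>2 * \<bar>t - r i\<bar> < \<epsilon>" using small_time[OF r(2) t] by blast
    have "(\<integral>u. (norm (path_fun factor_fun (Inr (t, eunit k)) u - (\<Sum>l<Suc 0. 1 *\<^sub>R path_fun factor_fun (Inr (r i, eunit k)) u)))\<^sup>2 \<partial>cell 1) < \<epsilon>"
      using le_less_trans[OF cell_cut_integral[of "\<lambda>_. eunit k", OF _ order_refl r(1) t] i] by simp
    then show "\<exists>(n::nat) x c. (\<forall>l<n. klim R' (right_pivot r) (x l) (x l) = 0) \<and>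
      (\<integral>u. (norm (path_fun factor_fun (Inr (t, eunit k)) u - (\<Sum>l<n. c l *\<^sub>R path_fun factor_fun (x l) u)))\<^sup>2 \<partial>cell 1) < \<epsilon>"
      by (intro exI[of _ "Suc 0"] exI[of _ "\<lambda>_. Inr (r i, eunit k)"] exI[of _ "\<lambda>_. 1::real"] conjI) (auto simp: piv)
  qed
  show ?thesis
  proof (rule null)
    fix \<epsilon> :: real assume \<epsilon>: "0 < \<epsilon>"
    interpret finite_measure "cell 1" by (rule finite_cell)
    have "(\<lambda>n. (norm (h - etrunc n h))\<^sup>2) \<longlonglongrightarrow> (norm (h - h))\<^sup>2"
      by (intro tendsto_intros etrunc_tendsto)
    then have "(\<lambda>n. (norm (h - etrunc n h))\<^sup>2) \<longlonglongrightarrow> 0" by simp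
    from order_tendstoD(2)[OF this \<epsilon>] obtain n where n: "(norm (h - etrunc n h))\<^sup>2 < \<epsilon>"
      by (auto simp: eventually_sequentially)
    \<comment> \<open>The subtracted cut at time 0 vanishes identically; it brings the difference
      into the shape of \<open>cell_cut_integral\<close> with \<open>s = 0\<close>.\<close>
    have eq: "path_fun factor_fun (Inr (t, h)) u - (\<Sum>k<n. Rep_ell2 h k *\<^sub>R path_fun factor_fun (Inr (t, eunit k)) u) =
        (if 0 < u \<and> u \<le> t then h - etrunc n h else 0) - (if 0 < u \<and> u \<le> 0 then h - etrunc n h else 0)" for u
      by (cases "0 < u"; cases "u \<le> t") (simp_all add: etrunc_def)
    have "(norm (h - etrunc n h))\<^sup>2 * \<bar>t - 0\<bar> \<le> (norm (h - etrunc n h))\<^sup>2 * 1" using t by (intro mult_left_mono) auto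
    with n have "(\<integral>u. (norm (path_fun factor_fun (Inr (t, h)) u - (\<Sum>k<n. Rep_ell2 h k *\<^sub>R path_fun factor_fun (Inr (t, eunit k)) u)))\<^sup>2 \<partial>cell 1) < \<epsilon>"
      unfolding eq using cell_cut_integral[of "\<lambda>_. h - etrunc n h", OF _ order_refl, of 0 t] t by simp
    then show "\<exists>(n::nat) x c. (\<forall>l<n. klim R' (right_pivot r) (x l) (x l) = 0) \<and>
      (\<integral>u. (norm (path_fun factor_fun (Inr (t, h)) u - (\<Sum>l<n. c l *\<^sub>R path_fun factor_fun (x l) u)))\<^sup>2 \<partial>cell 1) < \<epsilon>"
      by (intro exI[of _ n] exI[of _ "\<lambda>k. Inr (t, eunit k)"] exI[of _ "Rep_ell2 h"] conjI) (auto simp: unit_null)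
  qed
qed

end

text \<open>Combinations are given as lists of weighted indices, repetitions allowed, which is the
  shape in which step integrals arise.\<close>

lemma (in prob_space) L2_list_isometry:
  fixes V :: "'i \<Rightarrow> 'a \<Rightarrow> real"
  assumes V: "\<And>i. i \<in> A \<Longrightarrow> V i \<in> L2 M"
    and R: "\<And>i j. i \<in> A \<Longrightarrow> j \<in> A \<Longrightarrow> (\<integral>\<omega>. V i \<omega> * V j \<omega> \<partial>M) = R i j"
    and L: "\<And>c i. (c, i) \<in> set L \<Longrightarrow> i \<in> A"
  shows "(\<integral>\<omega>. (\<Sum>(c, i)\<leftarrow>L. c * V i \<omega>)\<^sup>2 \<partial>M) = kernel_form R (length L) (\<lambda>k. snd (L ! k)) (\<lambda>k. fst (L ! k))"
proof -
  define n where "n = length L"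
  define x where "x k = snd (L ! k)" for k
  define c where "c k = fst (L ! k)" for k
  have x: "x k \<in> A" if "k < n" for k
    unfolding x_def by (rule L[of "fst (L ! k)"]) (use that in \<open>auto simp: n_def\<close>)
  have "(\<Sum>(c, i)\<leftarrow>L. c * V i \<omega>) = (\<Sum>k<n. c k * V (x k) \<omega>)" for \<omega>
    unfolding n_def c_def x_def by (simp add: sum_list_sum_nth case_prod_beta lessThan_atLeast0)
  then have "(\<Sum>(c, i)\<leftarrow>L. c * V i \<omega>)\<^sup>2 = (\<Sum>k<n. \<Sum>l<n. c k * c l * (V (x k) \<omega> * V (x l) \<omega>))" for \<omega>
    by (simp add: power2_eq_square sum_product mult_ac)
  then have "(\<integral>\<omega>. (\<Sum>(c, i)\<leftarrow>L. c * V i \<omega>)\<^sup>2 \<partial>M) = (\<integral>\<omega>. (\<Sum>k<n. \<Sum>l<n. c k * c l * (V (x k) \<omega> * V (x l) \<omega>)) \<partial>M)"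
    by simp
  also have "\<dots> = (\<Sum>k<n. \<integral>\<omega>. (\<Sum>l<n. c k * c l * (V (x k) \<omega> * V (x l) \<omega>)) \<partial>M)"
    by (rule Bochner_Integration.integral_sum)
      (auto intro!: Bochner_Integration.integrable_sum integrable_mult_right L2_mult_integrable V x)
  also have "\<dots> = (\<Sum>k<n. \<Sum>l<n. c k * c l * R (x k) (x l))"
  proof (intro sum.cong refl)
    fix k assume k: "k \<in> {..<n}"
    have "(\<integral>\<omega>. (\<Sum>l<n. c k * c l * (V (x k) \<omega> * V (x l) \<omega>)) \<partial>M) = (\<Sum>l<n. \<integral>\<omega>. c k * c l * (V (x k) \<omega> * V (x l) \<omega>) \<partial>M)"
      by (rule Bochner_Integration.integral_sum) (use k in \<open>auto intro!: integrable_mult_right L2_mult_integrable V x\<close>)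
    also have "\<dots> = (\<Sum>l<n. c k * c l * R (x k) (x l))"
      using k by (intro sum.cong refl) (simp add: R x)
    finally show "(\<integral>\<omega>. (\<Sum>l<n. c k * c l * (V (x k) \<omega> * V (x l) \<omega>)) \<partial>M) = (\<Sum>l<n. c k * c l * R (x k) (x l))" .
  qed
  finally show ?thesis by (simp add: kernel_form_def n_def x_def c_def)
qed

text \<open>One list of weighted indices with two readings: on the random variables it is a
  functional of \<open>G t\<close> minus a step integral, on \<open>path_fun\<close> it is the
  integrand minus the step function. A single isometry therefore carries the approximation error
  from one side to the other.\<close>

definition step_terms :: "real \<times> 'c \<Rightarrow> (real \<times> real \<times> ell2) list \<Rightarrow> (real \<times> ((real \<times> 'c) + (real \<times> ell2))) list" where
  "step_terms q p = (1, Inl q) # concat (map (\<lambda>(a, b, h). [(- 1, Inr (b, h)), (1, Inr (a, h))]) p)"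

lemma step_terms_index:
  "valid_step t p \<Longrightarrow> t \<in> {0..1} \<Longrightarrow> (c, i) \<in> set (step_terms (t, b) p) \<Longrightarrow>
    i \<in> Inl ` ({0..1} \<times> UNIV) \<union> Inr ` ({0..1} \<times> UNIV)"
  by (fastforce simp: step_terms_def valid_step_def)

lemma step_terms_sum:
  "(\<Sum>(c, i)\<leftarrow>step_terms q p. c * V i \<omega>) = V (Inl q) \<omega> - step_integral (\<lambda>t h. V (Inr (t, h))) p \<omega>"
proof -
  have "(\<Sum>(c, i)\<leftarrow>concat (map (\<lambda>(a, b, h). [(- 1, Inr (b, h)), (1, Inr (a, h))]) p). c * V i \<omega>) =
      - step_integral (\<lambda>t h. V (Inr (t, h))) p \<omega>"
    by (induction p) (auto simp: step_integral_def)
  then show ?thesis by (simp add: step_terms_def)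
qed

text \<open>For \<open>0 \<le> a \<le> b\<close> the cuts at \<open>b\<close> and \<open>a\<close>
  differ by the step \<open>(a, b]\<close>. The restriction to positive \<open>u\<close> matches the
  integration over \<open>(0, 1]\<close>.\<close>

lemma step_terms_path:
  assumes "valid_step t p" "0 < u"
  shows "(\<Sum>(c, i)\<leftarrow>step_terms q p. c *\<^sub>R path_fun f i u) = path_fun f (Inl q) u - step_value p u"
proof -
  have "(\<Sum>(c, i)\<leftarrow>concat (map (\<lambda>(a, b, h). [(- 1, Inr (b, h)), (1, Inr (a, h))]) p). c *\<^sub>R path_fun f i u) = - step_value p u"
    using assms(1)
  proof (induction p)
    case (Cons x p)
    obtain a b h where x: "x = (a, b, h)" by (cases x)
    have v: "valid_step t p" "0 \<le> a" "a \<le> b" using Cons.prems by (auto simp: valid_step_def x)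
    show ?case using Cons.IH[OF v(1)] v(2,3) assms(2) by (auto simp: x step_value_def)
  qed (simp add: step_value_def)
  then show ?thesis by (simp add: step_terms_def)
qed

lemma norm_step_value_le: "norm (step_value p u) \<le> (\<Sum>(a, b, h)\<leftarrow>p. norm h)"
  for p :: "(real \<times> real \<times> 'h::real_normed_vector) list"
proof (induction p)
  case (Cons x p)
  obtain a b h where x: "x = (a, b, h)" by (cases x)
  have "norm (step_value (x # p) u) \<le> norm (if a < u \<and> u \<le> b then h else 0) + norm (step_value p u)"
    by (auto simp: x step_value_def intro: norm_triangle_ineq)
  also have "norm (if a < u \<and> u \<le> b then h else 0) \<le> norm h" by simp
  finally show ?case using Cons by (simp add: x)
qed (simp add: step_value_def)

lemma cell_nn_integral_set:
  assumes t: "t \<in> {0..1}"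
  shows "(\<integral>\<^sup>+u. (if 0 < u \<and> u \<le> t then f u else 0) \<partial>cell 1) = (\<integral>\<^sup>+u\<in>{0..t}. f u \<partial>lborel)"
proof -
  have "(\<integral>\<^sup>+u. (if 0 < u \<and> u \<le> t then f u else 0) \<partial>cell 1) = (\<integral>\<^sup>+u\<in>{0<..1}. (if 0 < u \<and> u \<le> t then f u else 0) \<partial>lborel)"
    by (rule nn_integral_restrict_space) auto
  also have "\<dots> = (\<integral>\<^sup>+u\<in>{0..t}. f u \<partial>lborel)"
  proof (rule nn_integral_cong_AE)
    show "AE u in lborel. (if 0 < u \<and> u \<le> t then f u else 0) * indicator {0<..1} u = f u * indicator {0..t} u"
      using AE_lborel_singleton[of "0::real"] by eventually_elim (use t in \<open>auto simp: indicator_def\<close>)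
  qed
  finally show ?thesis .
qed

text \<open>Since \<open>I\<close> is \<open>G\<close> composed with the first projection, its law
  and its paths need no work. Everything rests on one covariance identity: the functionals of
  \<open>G\<close> and the values of \<open>W\<close> together have the Gram kernel of
  \<open>path_fun\<close>. It yields linearity of \<open>W\<close> in \<open>h\<close>, the
  covariance of \<open>W\<close>, and the Wiener integrals.\<close>

theorem cylindrical_representation:
  fixes e :: "nat \<Rightarrow> 'b::{banach, second_countable_topology}" and e' :: "nat \<Rightarrow> 'b \<Rightarrow>\<^sub>L real"
    and U :: "real \<Rightarrow> 'b ptensor" and N :: "'g measure" and G :: "real \<Rightarrow> 'g \<Rightarrow> 'b"
  assumes basis: "schauder_basis e e'"
    and U: "\<And>u. cov_tensor (U u)" and Um: "U \<in> borel_measurable borel" and UK: "\<And>u. norm (canonical_map (U u)) \<le> K"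
    and "prob_space N" and G: "centered_gaussian_process N G"
    and cov: "\<And>s t b c. s \<in> {0..1} \<Longrightarrow> t \<in> {0..1} \<Longrightarrow>
      (\<integral>\<omega>. blinfun_apply b (G t \<omega>) * blinfun_apply c (G s \<omega>) \<partial>N) = (LINT u:{0..min t s}|lborel. tensor_form (U u) b c)"
    and cadlag: "\<And>\<omega>. \<omega> \<in> space N \<Longrightarrow> cadlag (\<lambda>t. G t \<omega>)"
  shows "\<exists>(P :: ('g \<times> (nat \<Rightarrow> real)) measure) (W :: real \<Rightarrow> ell2 \<Rightarrow> 'g \<times> (nat \<Rightarrow> real) \<Rightarrow> real)
           (I :: real \<Rightarrow> 'g \<times> (nat \<Rightarrow> real) \<Rightarrow> 'b).
           prob_space P \<and> cylindrical_brownian_motion P W \<and>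
           (\<forall>t\<in>{0..1}. has_operator_integral P W (\<lambda>u. cov_factor_adj e' (U u)) t (I t)) \<and>
           (\<forall>\<omega>\<in>space P. cadlag (\<lambda>t. I t \<omega>)) \<and> equal_in_law P I N G"
proof -
  interpret N: prob_space N by fact
  interpret PP: pair_prob_space N noise_measure ..
  define P where "P = N \<Otimes>\<^sub>M noise_measure"
  interpret P: prob_space P unfolding P_def by (rule PP.prob_space_axioms)
  define f where "f = (\<lambda>u. blinfun_apply (cov_factor_adj e' (U u)))"
  define R where "R = path_kernel f"
  define II :: "((real \<times> ('b \<Rightarrow>\<^sub>L real)) + (real \<times> ell2)) set" where "II = Inl ` ({0..1} \<times> UNIV)"
  define JJ :: "((real \<times> ('b \<Rightarrow>\<^sub>L real)) + (real \<times> ell2)) set" where "JJ = Inr ` ({0..1} \<times> UNIV)"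
  define Z :: "(real \<times> ('b \<Rightarrow>\<^sub>L real)) + (real \<times> ell2) \<Rightarrow> 'g \<Rightarrow> real"
    where "Z i = (case i of Inl (t, b) \<Rightarrow> \<lambda>\<omega>. blinfun_apply b (G t \<omega>) | Inr _ \<Rightarrow> \<lambda>_. 0)" for i
  note ctx = basis U Um UK
  have R: "psd_kernel R" unfolding R_def f_def by (rule psd_path_kernel[OF ctx])
  have form: "kernel_form R n x c = (\<integral>u. (norm (\<Sum>k<n. c k *\<^sub>R path_fun f (x k) u))\<^sup>2 \<partial>cell 1)" for n x c
    unfolding R_def f_def by (rule path_kernel_form[OF ctx])
  have Gm: "G t \<in> borel_measurable N" if "t \<in> {0..1}" for t
    using G that by (auto simp: centered_gaussian_process_def square_integrable_def)
  have Zfam: "centered_gaussian_family N II Z"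
    unfolding centered_gaussian_family_def
  proof (intro allI impI)
    fix L :: "((real \<times> ('b \<Rightarrow>\<^sub>L real)) + (real \<times> ell2)) set" and c :: "(real \<times> ('b \<Rightarrow>\<^sub>L real)) + (real \<times> ell2) \<Rightarrow> real"
    assume L: "finite L \<and> L \<subseteq> II"
    define L' where "L' = Inl -` L"
    have LL: "L = Inl ` L'" using L by (auto simp: L'_def II_def)
    have "finite L'" unfolding L'_def using L by (intro finite_vimageI) auto
    moreover have "L' \<subseteq> {0..1} \<times> UNIV" using L by (auto simp: L'_def II_def)
    ultimately have "centered_normal N (\<lambda>\<omega>. \<Sum>j\<in>L'. c (Inl j) * (case j of (t, b) \<Rightarrow> \<lambda>\<omega>. blinfun_apply b (G t \<omega>)) \<omega>)"
      using G unfolding centered_gaussian_process_def centered_gaussian_family_def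
      by (elim conjE allE[of _ L'] allE[of _ "\<lambda>j. c (Inl j)"] impE) auto
    then show "centered_normal N (\<lambda>\<omega>. \<Sum>j\<in>L. c j * Z j \<omega>)"
      unfolding LL by (subst sum.reindex) (auto simp: Z_def)
  qed
  have Zcov: "(\<integral>\<omega>. Z i \<omega> * Z j \<omega> \<partial>N) = R i j" if "i \<in> II" "j \<in> II" for i j
    using that cov by (auto simp: II_def Z_def R_def f_def path_kernel_left[OF ctx])
  obtain r :: "nat \<Rightarrow> real" where r: "\<And>i. r i \<in> {0..1}" "\<And>t d. t \<in> {0..1} \<Longrightarrow> 0 < d \<Longrightarrow> \<exists>i. \<bar>t - r i\<bar> < d"
    using dense_sequence_unit_interval by blast
  define v where "v = left_pivot e' r"
  define w where "w = (right_pivot r :: nat \<Rightarrow> (real \<times> ('b \<Rightarrow>\<^sub>L real)) + (real \<times> ell2))"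
  have v1: "v k \<in> II" for k
    unfolding v_def II_def by (rule left_pivot_range[OF r(1)])
  have v2: "klim R v i i = 0" if iI: "i \<in> II" for i
  proof -
    obtain t b where i: "i = Inl (t, b)" "t \<in> {0..1}" using iI by (auto simp: II_def)
    show ?thesis unfolding i v_def R_def f_def
    proof (rule left_pivot_null[OF ctx r(1) _ i(2)])
      show "\<exists>i. \<bar>t - r i\<bar> < d" if "t \<in> {0..1}" "0 < d" for t d using that by (rule r(2))
    qed
  qed
  have w: "klim (klim R v) w j j = 0" if jJ: "j \<in> JJ" for j
  proof -
    obtain t h where j: "j = Inr (t, h)" "t \<in> {0..1}" using jJ by (auto simp: JJ_def)
    show ?thesis unfolding j w_def
    proof (rule right_pivot_null[OF ctx r(1) _ j(2) psd_klim[OF R]])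
      show "\<exists>i. \<bar>t - r i\<bar> < d" if "t \<in> {0..1}" "0 < d" for t d using that by (rule r(2))
      show "kernel_form (klim R v) n x c \<le> kernel_form (path_kernel (\<lambda>u. blinfun_apply (cov_factor_adj e' (U u)))) n x c" for n x c
        by (fold f_def, fold R_def, rule kernel_form_klim_le[OF R])
    qed
  qed
  obtain W0 S where S: "gaussian_space P S" and W0S: "\<And>j. W0 j \<in> S"
    and WW: "\<And>j k. j \<in> JJ \<Longrightarrow> k \<in> JJ \<Longrightarrow> (\<integral>\<omega>. W0 j \<omega> * W0 k \<omega> \<partial>P) = R j k"
    and ZW: "\<And>i j. i \<in> II \<Longrightarrow> j \<in> JJ \<Longrightarrow> (\<integral>\<omega>. Z i (fst \<omega>) * W0 j \<omega> \<partial>P) = R i j"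
  proof (rule isonormal_extension[OF \<open>prob_space N\<close> R Zfam, where J=JJ and v=v and w=w])
    fix W0 S
    assume a: "gaussian_space (N \<Otimes>\<^sub>M noise_measure) S" "\<And>j. W0 j \<in> S"
      "\<And>j k. j \<in> JJ \<Longrightarrow> k \<in> JJ \<Longrightarrow> (\<integral>\<omega>. W0 j \<omega> * W0 k \<omega> \<partial>(N \<Otimes>\<^sub>M noise_measure)) = R j k"
      "\<And>i j. i \<in> II \<Longrightarrow> j \<in> JJ \<Longrightarrow> (\<integral>\<omega>. Z i (fst \<omega>) * W0 j \<omega> \<partial>(N \<Otimes>\<^sub>M noise_measure)) = R i j"
    show thesis by (rule that[of S W0]) (simp_all add: a P_def)
  qed (simp_all add: Zcov v1 v2 w)
  \<comment> \<open>Both halves of the index set as variables on the enlarged space. That all their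
    inner products are given by \<open>R\<close> is the isometry in full.\<close>
  define V where "V i = (case i of Inl _ \<Rightarrow> \<lambda>\<omega>. Z i (fst \<omega>) | Inr _ \<Rightarrow> W0 i)" for i
  have ZL: "Z i \<in> L2 N" if "i \<in> II" for i
    by (rule N.gaussian_space_L2[OF gaussian_space_span[OF Zfam] gaussian_span_mem[OF that]])
  have VL: "V i \<in> L2 P" if "i \<in> II \<union> JJ" for i
    using that PP.L2_fst[OF ZL[of i]] P.gaussian_space_L2[OF S W0S]
    by (auto simp: V_def II_def JJ_def P_def)
  have ZZ: "(\<integral>\<omega>. Z i (fst \<omega>) * Z j (fst \<omega>) \<partial>P) = R i j" if "i \<in> II" "j \<in> II" for i j
    using PP.integral_fst_only(1)[of "\<lambda>\<omega>. Z i \<omega> * Z j \<omega>"] Zcov[OF that] L2D(1)[OF ZL[OF that(1)]] L2D(1)[OF ZL[OF that(2)]]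
    by (simp add: P_def)
  have VR: "(\<integral>\<omega>. V i \<omega> * V j \<omega> \<partial>P) = R i j" if ij: "i \<in> II \<union> JJ" "j \<in> II \<union> JJ" for i j
  proof -
    have V: "V i = (\<lambda>\<omega>. Z i (fst \<omega>))" if "i \<in> II" for i using that by (auto simp: V_def II_def)
    have V': "V j = W0 j" if "j \<in> JJ" for j using that by (auto simp: V_def JJ_def)
    have ZW': "(\<integral>\<omega>. W0 j \<omega> * Z i (fst \<omega>) \<partial>P) = R j i" if "i \<in> II" "j \<in> JJ" for i j
      using ZW[OF that] psd_kernel_sym[OF R, of i j] by (simp add: mult.commute)
    from ij show ?thesis
      by (elim UnE) (simp_all add: V V' ZZ ZW ZW' WW)
  qed
  have JJ: "Inr (t, h) \<in> JJ" if "t \<in> {0..1}" for t h using that by (auto simp: JJ_def)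
  have RJ: "R (Inr (s, g)) (Inr (t, h)) = min s t * (g \<bullet> h)" if "s \<in> {0..1}" "t \<in> {0..1}" for s t g h
    unfolding R_def by (rule path_kernel_right[OF that])
  have W0L: "W0 j \<in> L2 P" for j by (rule P.gaussian_space_L2[OF S W0S])
  \<comment> \<open>\<open>W0\<close> comes from choices of L^2 limits and has no path regularity.
    It is replaced by a continuous version for each \<open>h\<close> separately; as this changes
    each variable only on a null set, linearity, normality and covariances survive at fixed
    times.\<close>
  define version where "version h Y \<longleftrightarrow> (\<forall>t\<in>{0..1}. Y t \<in> borel_measurable P) \<and>
      (\<forall>t\<in>{0..1}. AE \<omega> in P. Y t \<omega> = W0 (Inr (t, h)) \<omega>) \<and> (AE \<omega> in P. continuous_on {0..1} (\<lambda>t. Y t \<omega>))" for h Y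
  have "\<exists>Y. version h Y" for h
  proof (rule P.continuous_modification[OF S, of "\<lambda>t. W0 (Inr (t, h))" "h \<bullet> h"])
    fix s t :: real assume st: "s \<in> {0..1}" "t \<in> {0..1}"
    have "(\<integral>\<omega>. (W0 (Inr (t, h)) \<omega> - W0 (Inr (s, h)) \<omega>)\<^sup>2 \<partial>P) =
        (\<integral>\<omega>. W0 (Inr (t, h)) \<omega> * W0 (Inr (t, h)) \<omega> - 2 * (W0 (Inr (t, h)) \<omega> * W0 (Inr (s, h)) \<omega>) + W0 (Inr (s, h)) \<omega> * W0 (Inr (s, h)) \<omega> \<partial>P)"
      by (simp add: power2_eq_square algebra_simps)
    also have "\<dots> = R (Inr (t, h)) (Inr (t, h)) - 2 * R (Inr (t, h)) (Inr (s, h)) + R (Inr (s, h)) (Inr (s, h))"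
      by (simp add: L2_mult_integrable W0L WW[OF JJ[OF st(2)] JJ[OF st(2)]] WW[OF JJ[OF st(2)] JJ[OF st(1)]]
          WW[OF JJ[OF st(1)] JJ[OF st(1)]])
    also have "\<dots> = (h \<bullet> h) * \<bar>t - s\<bar>" unfolding RJ[OF st(2,2)] RJ[OF st(2,1)] RJ[OF st(1,1)] by (simp add: min_def abs_if algebra_simps)
    finally show "(\<integral>\<omega>. (W0 (Inr (t, h)) \<omega> - W0 (Inr (s, h)) \<omega>)\<^sup>2 \<partial>P) = (h \<bullet> h) * \<bar>t - s\<bar>" .
  next
    fix Y
    assume "\<And>t. t \<in> {0..1} \<Longrightarrow> Y t \<in> borel_measurable P"
      "\<And>t. t \<in> {0..1} \<Longrightarrow> AE \<omega> in P. Y t \<omega> = W0 (Inr (t, h)) \<omega>" "AE \<omega> in P. continuous_on {0..1} (\<lambda>t. Y t \<omega>)"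
    then show "\<exists>Y. version h Y"
      unfolding version_def by (intro exI[of _ Y] conjI ballI)
  qed (rule W0S)
  then obtain Y where Y: "\<And>h. version h (Y h)" by metis
  have Ym: "Y h t \<in> borel_measurable P" and YW: "AE \<omega> in P. Y h t \<omega> = W0 (Inr (t, h)) \<omega>" if "t \<in> {0..1}" for h t
    using Y[of h] that by (auto simp: version_def)
  have Yc: "AE \<omega> in P. continuous_on {0..1} (\<lambda>t. Y h t \<omega>)" for h
    using Y[of h] by (auto simp: version_def)
  define W where "W t h = Y h t" for t h
  have W0m: "W0 j \<in> borel_measurable P" for j by (rule L2D(1)[OF W0L])
  have iso: "(\<integral>\<omega>. (\<Sum>(c, i)\<leftarrow>L. c * V i \<omega>)\<^sup>2 \<partial>P) = (\<integral>u. (norm (\<Sum>(c, i)\<leftarrow>L. c *\<^sub>R path_fun f i u))\<^sup>2 \<partial>cell 1)"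
    if "\<And>c i. (c, i) \<in> set L \<Longrightarrow> i \<in> II \<union> JJ" for L
  proof -
    have "(\<Sum>(c, i)\<leftarrow>L. c *\<^sub>R path_fun f i u) = (\<Sum>k<length L. fst (L ! k) *\<^sub>R path_fun f (snd (L ! k)) u)" for u
      by (simp add: sum_list_sum_nth case_prod_beta lessThan_atLeast0)
    then show ?thesis
      using P.L2_list_isometry[of "II \<union> JJ" V R L, OF VL VR that] form by simp
  qed
  have lin: "AE \<omega> in P. W t (a *\<^sub>R g + h) \<omega> = a * W t g \<omega> + W t h \<omega>" if t: "t \<in> {0..1}" for t a g h
  proof -
    \<comment> \<open>The same combination of path functions vanishes identically, so by the
      isometry the variable has norm 0.\<close>
    let ?L = "[(1, Inr (t, a *\<^sub>R g + h)), (- a, Inr (t, g)), (- 1, Inr (t, h))] :: (real \<times> ((real \<times> ('b \<Rightarrow>\<^sub>L real)) + (real \<times> ell2))) list"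
    have "(\<integral>\<omega>. (\<Sum>(c, i)\<leftarrow>?L. c * V i \<omega>)\<^sup>2 \<partial>P) = (\<integral>u. (norm (\<Sum>(c, i)\<leftarrow>?L. c *\<^sub>R path_fun f i u))\<^sup>2 \<partial>cell 1)"
      by (rule iso) (use JJ[OF t] in auto)
    also have "\<dots> = (\<integral>u. 0 \<partial>cell 1)" by (intro Bochner_Integration.integral_cong) auto
    finally have "(\<integral>\<omega>. (W0 (Inr (t, a *\<^sub>R g + h)) \<omega> - a * W0 (Inr (t, g)) \<omega> - W0 (Inr (t, h)) \<omega>)\<^sup>2 \<partial>P) = 0"
      by (simp add: V_def algebra_simps)
    from L2_integral_zero_AE[OF _ this] have "AE \<omega> in P. W0 (Inr (t, a *\<^sub>R g + h)) \<omega> - a * W0 (Inr (t, g)) \<omega> - W0 (Inr (t, h)) \<omega> = 0"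
      by (simp add: L2_diff L2_scale W0L)
    with YW[OF t, of "a *\<^sub>R g + h"] YW[OF t, of g] YW[OF t, of h] show ?thesis
      unfolding W_def by eventually_elim simp
  qed
  have bm: "cylindrical_brownian_motion P W"
    unfolding cylindrical_brownian_motion_def
  proof (intro conjI ballI allI)
    show "AE \<omega> in P. W t (a *\<^sub>R g + h) \<omega> = a * W t g \<omega> + W t h \<omega>" if "t \<in> {0..1}" for t a g h
      by (rule lin[OF that])
    show "AE \<omega> in P. continuous_on {0..1} (\<lambda>t. W t h \<omega>)" for h unfolding W_def by (rule Yc)
    show "(\<integral>\<omega>. W s g \<omega> * W t h \<omega> \<partial>P) = min s t * (g \<bullet> h)" if st: "s \<in> {0..1}" "t \<in> {0..1}" for s t g h
    proof -
      have "(\<integral>\<omega>. W s g \<omega> * W t h \<omega> \<partial>P) = (\<integral>\<omega>. W0 (Inr (s, g)) \<omega> * W0 (Inr (t, h)) \<omega> \<partial>P)"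
      proof (rule integral_cong_AE)
        show "AE \<omega> in P. W s g \<omega> * W t h \<omega> = W0 (Inr (s, g)) \<omega> * W0 (Inr (t, h)) \<omega>"
          using YW[OF st(1), of g] YW[OF st(2), of h] unfolding W_def by eventually_elim simp
      qed (auto simp: W_def intro!: borel_measurable_times Ym st W0m)
      then show ?thesis unfolding WW[OF JJ[OF st(1)] JJ[OF st(2)]] RJ[OF st] .
    qed
    show "centered_gaussian_family P ({0..1} \<times> UNIV) (\<lambda>(t, h). W t h)"
      unfolding centered_gaussian_family_def
    proof (intro allI impI)
      fix L :: "(real \<times> ell2) set" and c :: "real \<times> ell2 \<Rightarrow> real"
      assume L: "finite L \<and> L \<subseteq> {0..1} \<times> UNIV"
      show "centered_normal P (\<lambda>\<omega>. \<Sum>j\<in>L. c j * (case j of (t, h) \<Rightarrow> W t h) \<omega>)"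
      proof (rule P.centered_normal_AE)
        show "centered_normal P (\<lambda>\<omega>. \<Sum>j\<in>L. c j * W0 (Inr j) \<omega>)"
          by (rule gaussian_spaceD(1)[OF S gaussian_space_sum[OF S W0S]])
        show "(\<lambda>\<omega>. \<Sum>j\<in>L. c j * (case j of (t, h) \<Rightarrow> W t h) \<omega>) \<in> borel_measurable P"
          using L by (intro borel_measurable_sum borel_measurable_times) (auto simp: W_def intro!: Ym)
        have "AE \<omega> in P. \<forall>j\<in>L. (case j of (t, h) \<Rightarrow> W t h) \<omega> = W0 (Inr j) \<omega>"
          using L YW by (intro AE_finite_allI) (auto simp: W_def)
        then show "AE \<omega> in P. (\<Sum>j\<in>L. c j * W0 (Inr j) \<omega>) = (\<Sum>j\<in>L. c j * (case j of (t, h) \<Rightarrow> W t h) \<omega>)"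
          by eventually_elim simp
      qed
    qed
  qed
  define I where "I t \<omega> = G t (fst \<omega>)" for t and \<omega> :: "'g \<times> (nat \<Rightarrow> real)"
  have Im: "I t \<in> borel_measurable P" if "t \<in> {0..1}" for t
    unfolding I_def P_def using Gm[OF that] by measurable
  have fm: "(\<lambda>u. f u b) \<in> borel_measurable borel" for b
    unfolding f_def by (rule factor_fun_measurable[OF ctx])
  have fb: "norm (f u b) \<le> norm b * sqrt K" for u b
    unfolding f_def by (rule factor_fun_bound[OF ctx])
  have opint: "has_operator_integral P W (\<lambda>u. cov_factor_adj e' (U u)) t (I t)" if t: "t \<in> {0..1}" for t
    unfolding has_operator_integral_def
  proof (intro conjI allI)
    show "I t \<in> borel_measurable P" by (rule Im[OF t])
    fix b
    have t0: "0 \<le> t" using t by simp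
    obtain p where p: "\<And>n. valid_step t (p n)"
      and lim: "(\<lambda>n. \<integral>\<^sup>+u\<in>{0..t}. ennreal ((norm (f u b - step_value (p n) u))\<^sup>2) \<partial>lborel) \<longlonglongrightarrow> 0"
      using step_sequence[OF t0 fm[of b] fb[of _ b]] by blast
    \<comment> \<open>The error of the step integrals in mean square equals, exactly and for every
      \<open>n\<close>, the L^2 error of the step functions.\<close>
    have eq: "(\<integral>\<^sup>+\<omega>. ennreal ((b (I t \<omega>) - step_integral W (p n) \<omega>)\<^sup>2) \<partial>P) =
        (\<integral>\<^sup>+u\<in>{0..t}. ennreal ((norm (f u b - step_value (p n) u))\<^sup>2) \<partial>lborel)" for n
    proof -
      let ?L = "step_terms (t, b) (p n)"
      have idx: "i \<in> II \<union> JJ" if "(c, i) \<in> set ?L" for c i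
        using step_terms_index[OF p t that] by (simp add: II_def JJ_def)
      have in01: "a \<in> {0..1} \<and> a' \<in> {0..1}" if "(a, a', h) \<in> set (p n)" for a a' h
        using p[of n] that t by (fastforce simp: valid_step_def)
      have sumV: "(\<Sum>(c, i)\<leftarrow>?L. c * V i \<omega>) = b (I t \<omega>) - step_integral (\<lambda>t h. W0 (Inr (t, h))) (p n) \<omega>" for \<omega>
        unfolding step_terms_sum[of V] by (simp add: V_def Z_def I_def)
      have "AE \<omega> in P. \<forall>q\<in>set (p n). case q of (a, a', h) \<Rightarrow> W a h \<omega> = W0 (Inr (a, h)) \<omega> \<and> W a' h \<omega> = W0 (Inr (a', h)) \<omega>"
        using YW in01 by (intro AE_finite_allI) (auto simp: W_def case_prod_beta AE_conj_iff)
      then have ae: "AE \<omega> in P. step_integral W (p n) \<omega> = step_integral (\<lambda>t h. W0 (Inr (t, h))) (p n) \<omega>"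
        by eventually_elim (auto simp: step_integral_def intro!: arg_cong[where f=sum_list] map_cong)
      have "(\<integral>\<^sup>+\<omega>. ennreal ((b (I t \<omega>) - step_integral W (p n) \<omega>)\<^sup>2) \<partial>P) =
          (\<integral>\<^sup>+\<omega>. ennreal ((\<Sum>(c, i)\<leftarrow>?L. c * V i \<omega>)\<^sup>2) \<partial>P)"
      proof (rule nn_integral_cong_AE)
        show "AE \<omega> in P. ennreal ((b (I t \<omega>) - step_integral W (p n) \<omega>)\<^sup>2) = ennreal ((\<Sum>(c, i)\<leftarrow>?L. c * V i \<omega>)\<^sup>2)"
          using ae by eventually_elim (simp add: sumV)
      qed
      also have "\<dots> = ennreal (\<integral>\<omega>. (\<Sum>(c, i)\<leftarrow>?L. c * V i \<omega>)\<^sup>2 \<partial>P)"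
      proof (rule nn_integral_eq_integral)
        have "(\<lambda>\<omega>. \<Sum>k<length ?L. fst (?L ! k) * V (snd (?L ! k)) \<omega>) \<in> L2 P"
        proof (intro L2_sum L2_scale VL)
          fix k assume "k \<in> {..<length ?L}"
          then show "snd (?L ! k) \<in> II \<union> JJ" by (intro idx[of "fst (?L ! k)"]) simp
        qed
        moreover have "(\<Sum>(c, i)\<leftarrow>?L. c * V i \<omega>) = (\<Sum>k<length ?L. fst (?L ! k) * V (snd (?L ! k)) \<omega>)" for \<omega>
          by (simp add: sum_list_sum_nth case_prod_beta lessThan_atLeast0)
        ultimately show "integrable P (\<lambda>\<omega>. (\<Sum>(c, i)\<leftarrow>?L. c * V i \<omega>)\<^sup>2)" by (simp add: L2D)
      qed simp
      also have "(\<integral>\<omega>. (\<Sum>(c, i)\<leftarrow>?L. c * V i \<omega>)\<^sup>2 \<partial>P) = (\<integral>u. (norm (\<Sum>(c, i)\<leftarrow>?L. c *\<^sub>R path_fun f i u))\<^sup>2 \<partial>cell 1)"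
        by (rule iso[OF idx])
      also have "\<dots> = (\<integral>u. (if 0 < u \<and> u \<le> t then (norm (f u b - step_value (p n) u))\<^sup>2 else 0) \<partial>cell 1)"
      proof (rule Bochner_Integration.integral_cong[OF refl])
        fix u assume "u \<in> space (cell 1)"
        then have u: "0 < u" by (simp add: space_restrict_space)
        \<comment> \<open>Beyond \<open>t\<close> the path function of \<open>(t, b)\<close> is cut
          off; the steps end by \<open>t\<close> as well, so nothing is left of the integral over
          \<open>(t, 1]\<close>.\<close>
        have "step_value (p n) u = 0" if "t < u"
        proof -
          have "step_value q u = 0" if "valid_step t q" for q :: "(real \<times> real \<times> ell2) list"
            using that \<open>t < u\<close> by (induction q) (auto simp: step_value_def valid_step_def)
          then show ?thesis using p by blast
        qed
        then show "(norm (\<Sum>(c, i)\<leftarrow>?L. c *\<^sub>R path_fun f i u))\<^sup>2 = (if 0 < u \<and> u \<le> t then (norm (f u b - step_value (p n) u))\<^sup>2 else 0)"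
          using u by (simp add: step_terms_path[OF p u])
      qed
      also have "ennreal \<dots> = (\<integral>\<^sup>+u. ennreal (if 0 < u \<and> u \<le> t then (norm (f u b - step_value (p n) u))\<^sup>2 else 0) \<partial>cell 1)"
      proof (rule nn_integral_eq_integral[symmetric])
        interpret C: finite_measure "cell 1" by (rule finite_cell)
        have [measurable]: "(\<lambda>u. f u b) \<in> borel_measurable borel" by (rule fm)
        show "integrable (cell 1) (\<lambda>u. if 0 < u \<and> u \<le> t then (norm (f u b - step_value (p n) u))\<^sup>2 else 0)"
        proof (rule C.integrable_const_bound[where B="(norm b * sqrt K + (\<Sum>(a, b, h)\<leftarrow>p n. norm h))\<^sup>2"])
          show "AE u in cell 1. norm (if 0 < u \<and> u \<le> t then (norm (f u b - step_value (p n) u))\<^sup>2 else 0)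
              \<le> (norm b * sqrt K + (\<Sum>(a, b, h)\<leftarrow>p n. norm h))\<^sup>2"
          proof (rule AE_I2)
            fix u
            have "norm (f u b - step_value (p n) u) \<le> norm b * sqrt K + (\<Sum>(a, b, h)\<leftarrow>p n. norm h)"
              by (rule order_trans[OF norm_triangle_ineq4 add_mono[OF fb norm_step_value_le]])
            from power_mono[OF this norm_ge_zero, of 2]
            show "norm (if 0 < u \<and> u \<le> t then (norm (f u b - step_value (p n) u))\<^sup>2 else 0)
              \<le> (norm b * sqrt K + (\<Sum>(a, b, h)\<leftarrow>p n. norm h))\<^sup>2" by simp
          qed
          show "(\<lambda>u. if 0 < u \<and> u \<le> t then (norm (f u b - step_value (p n) u))\<^sup>2 else 0) \<in> borel_measurable (cell 1)"
            by (intro measurable_restrict_space1) measurable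
        qed
      qed simp
      also have "\<dots> = (\<integral>\<^sup>+u. (if 0 < u \<and> u \<le> t then ennreal ((norm (f u b - step_value (p n) u))\<^sup>2) else 0) \<partial>cell 1)"
        by (intro nn_integral_cong) simp
      also have "\<dots> = (\<integral>\<^sup>+u\<in>{0..t}. ennreal ((norm (f u b - step_value (p n) u))\<^sup>2) \<partial>lborel)"
        by (rule cell_nn_integral_set[OF t])
      finally show ?thesis .
    qed
    show "has_wiener_integral P W (\<lambda>u. cov_factor_adj e' (U u) b) t (\<lambda>\<omega>. b (I t \<omega>))"
      unfolding has_wiener_integral_def
    proof (intro conjI exI[of _ p] allI)
      show "set_borel_measurable lborel {0..t} (\<lambda>u. cov_factor_adj e' (U u) b)"
        using fm[of b] unfolding set_borel_measurable_def f_def by measurable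
      show "(\<lambda>\<omega>. b (I t \<omega>)) \<in> borel_measurable P"
        by (rule borel_measurable_continuous_on[OF _ Im[OF t]]) (intro continuous_intros)
      show "\<forall>(a, b, h)\<in>set (p n). 0 \<le> a \<and> a \<le> b \<and> b \<le> t" for n
        using p[of n] by (simp add: valid_step_def)
      show "(\<lambda>n. \<integral>\<^sup>+u\<in>{0..t}. ennreal ((norm (cov_factor_adj e' (U u) b - step_value (p n) u))\<^sup>2) \<partial>lborel) \<longlonglongrightarrow> 0"
        using lim by (simp add: f_def)
      show "(\<lambda>n. \<integral>\<^sup>+\<omega>. ennreal ((b (I t \<omega>) - step_integral W (p n) \<omega>)\<^sup>2) \<partial>P) \<longlonglongrightarrow> 0"
        unfolding eq by (rule lim)
    qed
  qed
  have law: "equal_in_law P I N G"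
  proof -
    have m: "(\<lambda>\<omega>. \<lambda>t\<in>{0..1}. G t \<omega>) \<in> measurable N (PiM {0..1} (\<lambda>_. borel))"
      by (rule measurable_restrict) (rule Gm)
    have "distr (distr P N fst) (PiM {0..1} (\<lambda>_. borel)) (\<lambda>\<omega>. \<lambda>t\<in>{0..1}. G t \<omega>) =
        distr P (PiM {0..1} (\<lambda>_. borel)) (\<lambda>\<omega>. \<lambda>t\<in>{0..1}. I t \<omega>)"
      by (subst distr_distr[OF m]) (auto simp: P_def I_def comp_def)
    then show ?thesis by (simp add: equal_in_law_def P_def noise.distr_pair_fst)
  qed
  have "cadlag (\<lambda>t. I t \<omega>)" if "\<omega> \<in> space P" for \<omega>
    using cadlag[of "fst \<omega>"] that by (auto simp: I_def P_def space_pair_measure)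
  with P.prob_space_axioms bm opint law show ?thesis
    by (intro exI[of _ P] exI[of _ W] exI[of _ I] conjI ballI)
qed

section \<open>Physical dependence and autocovariances\<close>

locale iid_noise = prob_space M for M :: "'w measure" +
  fixes E :: "'e measure" and \<eta> \<eta>' :: "int \<Rightarrow> 'w \<Rightarrow> 'e"
  assumes indep: "indep_vars (\<lambda>_. E) (case_sum \<eta> \<eta>') UNIV"
    and ident: "\<And>j. distr M E (case_sum \<eta> \<eta>' j) = distr M E (\<eta> 0)"
begin

text \<open>The innovations and their copies form one i.i.d. family over \<open>int + int\<close>.
  The past, the coupled past and the partly refreshed past all read this family along an index map,
  so their joint laws can be compared by reindexing.\<close>

definition draw :: "(nat \<Rightarrow> int + int) \<Rightarrow> 'w \<Rightarrow> nat \<Rightarrow> 'e" where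
  "draw a \<omega> k = case_sum \<eta> \<eta>' (a k) \<omega>"

abbreviation "seqM \<equiv> PiM (UNIV :: nat set) (\<lambda>_. E)"
abbreviation "famM \<equiv> PiM (UNIV :: (int + int) set) (\<lambda>_. E)"

lemma noise_rv: "case_sum \<eta> \<eta>' j \<in> measurable M E"
  using indep by (auto simp: indep_vars_def)

lemma past_draw: "past \<eta> i = draw (\<lambda>k. Inl (i - int k))"
  by (auto simp: fun_eq_iff past_def draw_def)

lemma past_coupled_draw: "past_coupled \<eta> \<eta>' i = draw (\<lambda>k. if i - int k = 0 then Inr 0 else Inl (i - int k))"
  by (auto simp: fun_eq_iff past_coupled_def draw_def)

lemma draw_measurable [measurable]: "draw a \<in> measurable M seqM"
proof -
  have "(\<lambda>\<omega>. \<lambda>k\<in>UNIV. case_sum \<eta> \<eta>' (a k) \<omega>) \<in> measurable M seqM"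
    by (rule measurable_restrict) (rule noise_rv)
  then show ?thesis by (simp add: draw_def[abs_def])
qed

text \<open>The source of all equalities in law below: shifts give stationarity, exchanges with the
  copy give the coupling identities.\<close>

lemma family_law:
  assumes \<rho>: "inj \<rho>"
  shows "distr M famM (\<lambda>\<omega> j. case_sum \<eta> \<eta>' (\<rho> j) \<omega>) = PiM UNIV (\<lambda>_. distr M E (\<eta> 0))"
proof -
  define \<nu> where "\<nu> = distr M E (\<eta> 0)"
  have \<nu>: "prob_space \<nu>" unfolding \<nu>_def using noise_rv[of "Inl 0"] by (intro prob_space_distr) simp
  have sets: "sets (PiM UNIV (\<lambda>_::int + int. \<nu>)) = sets famM"
    by (rule sets_PiM_cong) (auto simp: \<nu>_def)
  have m0: "(\<lambda>\<omega> j. case_sum \<eta> \<eta>' j \<omega>) \<in> measurable M famM"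
    using measurable_restrict[where I=UNIV and X="\<lambda>j. case_sum \<eta> \<eta>' j" and N=M and M="\<lambda>_. E", OF noise_rv] by simp
  have m1: "(\<lambda>z j. z (\<rho> j)) \<in> measurable famM famM"
    using measurable_restrict[where I=UNIV and X="\<lambda>j z. z (\<rho> j)" and N=famM and M="\<lambda>_. E"] by simp
  have "distr M famM (\<lambda>\<omega> j. case_sum \<eta> \<eta>' j \<omega>) = PiM UNIV (\<lambda>j. distr M E (case_sum \<eta> \<eta>' j))"
    using indep indep_vars_iff_distr_eq_PiM'[where I=UNIV and M'="\<lambda>_. E" and X="case_sum \<eta> \<eta>'"] noise_rv by simp
  then have full: "distr M famM (\<lambda>\<omega> j. case_sum \<eta> \<eta>' j \<omega>) = PiM UNIV (\<lambda>_. \<nu>)"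
    unfolding ident \<nu>_def .
  have "distr M famM (\<lambda>\<omega> j. case_sum \<eta> \<eta>' (\<rho> j) \<omega>) = distr (distr M famM (\<lambda>\<omega> j. case_sum \<eta> \<eta>' j \<omega>)) famM (\<lambda>z j. z (\<rho> j))"
    by (subst distr_distr[OF m1 m0]) (simp add: comp_def)
  also have "\<dots> = distr (PiM UNIV (\<lambda>_. \<nu>)) (PiM UNIV (\<lambda>_. \<nu>)) (\<lambda>z. \<lambda>j\<in>UNIV. z (\<rho> j))"
    unfolding full by (rule distr_cong) (auto simp: sets)
  also have "\<dots> = PiM UNIV (\<lambda>_. \<nu>)"
    by (rule distr_PiM_reindex) (use \<nu> \<rho> in auto)
  finally show ?thesis by (simp add: \<nu>_def)
qed

lemma draw_pair_law:
  assumes \<rho>: "inj \<rho>"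
  shows "distr M (seqM \<Otimes>\<^sub>M seqM) (\<lambda>\<omega>. (draw (\<rho> \<circ> a) \<omega>, draw (\<rho> \<circ> b) \<omega>)) =
    distr M (seqM \<Otimes>\<^sub>M seqM) (\<lambda>\<omega>. (draw a \<omega>, draw b \<omega>))"
proof -
  have m: "(\<lambda>\<omega> j. case_sum \<eta> \<eta>' (\<rho> j) \<omega>) \<in> measurable M famM" for \<rho>
    using measurable_restrict[where I=UNIV and X="\<lambda>j. case_sum \<eta> \<eta>' (\<rho> j)" and N=M and M="\<lambda>_. E", OF noise_rv] by simp
  have sel: "(\<lambda>z k. z (a k)) \<in> measurable famM seqM" for a :: "nat \<Rightarrow> int + int"
    using measurable_restrict[where I=UNIV and X="\<lambda>k z. z (a k)" and N=famM and M="\<lambda>_. E"] by simp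
  have sel2: "(\<lambda>z. ((\<lambda>k. z (a k)), (\<lambda>k. z (b k)))) \<in> measurable famM (seqM \<Otimes>\<^sub>M seqM)"
    by (intro measurable_Pair sel)
  have "distr M (seqM \<Otimes>\<^sub>M seqM) (\<lambda>\<omega>. (draw (\<rho> \<circ> a) \<omega>, draw (\<rho> \<circ> b) \<omega>)) =
      distr (distr M famM (\<lambda>\<omega> j. case_sum \<eta> \<eta>' (\<rho> j) \<omega>)) (seqM \<Otimes>\<^sub>M seqM) (\<lambda>z. ((\<lambda>k. z (a k)), (\<lambda>k. z (b k))))" for \<rho>
    by (subst distr_distr[OF sel2 m]) (simp add: comp_def draw_def[abs_def])
  from this[of \<rho>] this[of id] show ?thesis
    unfolding family_law[OF \<rho>] family_law[OF inj_on_id] by simp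
qed

lemma draw_pair_integral:
  fixes F :: "_ \<Rightarrow> 'c::{banach, second_countable_topology}"
  assumes \<rho>: "inj \<rho>" and F: "F \<in> borel_measurable (seqM \<Otimes>\<^sub>M seqM)"
  shows "(\<integral>\<omega>. F (draw (\<rho> \<circ> a) \<omega>, draw (\<rho> \<circ> b) \<omega>) \<partial>M) = (\<integral>\<omega>. F (draw a \<omega>, draw b \<omega>) \<partial>M)"
    "integrable M (\<lambda>\<omega>. F (draw (\<rho> \<circ> a) \<omega>, draw (\<rho> \<circ> b) \<omega>)) \<longleftrightarrow> integrable M (\<lambda>\<omega>. F (draw a \<omega>, draw b \<omega>))"
proof -
  have m: "(\<lambda>\<omega>. (draw a \<omega>, draw b \<omega>)) \<in> measurable M (seqM \<Otimes>\<^sub>M seqM)" for a b by measurable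
  show "(\<integral>\<omega>. F (draw (\<rho> \<circ> a) \<omega>, draw (\<rho> \<circ> b) \<omega>) \<partial>M) = (\<integral>\<omega>. F (draw a \<omega>, draw b \<omega>) \<partial>M)"
    using draw_pair_law[OF \<rho>, of a b] integral_distr[OF m F, of "\<rho> \<circ> a" "\<rho> \<circ> b"] integral_distr[OF m F, of a b] by simp
  show "integrable M (\<lambda>\<omega>. F (draw (\<rho> \<circ> a) \<omega>, draw (\<rho> \<circ> b) \<omega>)) \<longleftrightarrow> integrable M (\<lambda>\<omega>. F (draw a \<omega>, draw b \<omega>))"
    using draw_pair_law[OF \<rho>, of a b] integrable_distr_eq[OF m F, of "\<rho> \<circ> a" "\<rho> \<circ> b"] integrable_distr_eq[OF m F, of a b] by simp
qed

lemma draw_integral: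
  fixes F :: "_ \<Rightarrow> 'c::{banach, second_countable_topology}"
  assumes \<rho>: "inj \<rho>" and F[measurable]: "F \<in> borel_measurable seqM"
  shows "(\<integral>\<omega>. F (draw (\<rho> \<circ> a) \<omega>) \<partial>M) = (\<integral>\<omega>. F (draw a \<omega>) \<partial>M)"
    "integrable M (\<lambda>\<omega>. F (draw (\<rho> \<circ> a) \<omega>)) \<longleftrightarrow> integrable M (\<lambda>\<omega>. F (draw a \<omega>))"
  using draw_pair_integral[OF \<rho>, of "\<lambda>z. F (fst z)" a a] by simp_all

text \<open>Exchanges originals and copies at the \<open>m\<close> times
  \<open>0, - 1, \<dots>, - (m - 1)\<close>. Being an involution it is injective, unlike a mere
  replacement of originals by copies.\<close>

definition swap_range :: "int \<Rightarrow> int + int \<Rightarrow> int + int" where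
  "swap_range m j = (case j of Inl p \<Rightarrow> if - m < p \<and> p \<le> 0 then Inr p else Inl p
     | Inr p \<Rightarrow> if - m < p \<and> p \<le> 0 then Inl p else Inr p)"

definition shift_index :: "int \<Rightarrow> int + int \<Rightarrow> int + int" where
  "shift_index s = map_sum (\<lambda>p. p + s) (\<lambda>p. p + s)"

lemma inj_swap_range: "inj (swap_range m)"
  by (rule inj_on_inverseI[of _ "swap_range m"]) (auto simp: swap_range_def split: sum.split)

lemma inj_shift_index: "inj (shift_index s)"
proof (rule inj_on_inverseI)
  show "shift_index (- s) (shift_index s x) = x" for x by (cases x) (simp_all add: shift_index_def)
qed

text \<open>The past of time \<open>i\<close>, with the innovations at the times \<open>0, - 1, \<dots>, - (m - 1)\<close> replaced by fresh ones.\<close>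

definition refreshed :: "nat \<Rightarrow> nat \<Rightarrow> nat \<Rightarrow> int + int" where
  "refreshed i m k = swap_range (int m) (Inl (int i - int k))"

lemma refreshed_0: "draw (refreshed i 0) = past \<eta> (int i)"
  unfolding past_draw by (rule arg_cong[where f=draw]) (auto simp: refreshed_def swap_range_def)

lemma past_integral:
  fixes F :: "_ \<Rightarrow> 'c::{banach, second_countable_topology}"
  assumes F: "F \<in> borel_measurable (seqM \<Otimes>\<^sub>M seqM)"
  shows "(\<integral>\<omega>. F (past \<eta> (i + s) \<omega>, past \<eta> (j + s) \<omega>) \<partial>M) = (\<integral>\<omega>. F (past \<eta> i \<omega>, past \<eta> j \<omega>) \<partial>M)"
    "integrable M (\<lambda>\<omega>. F (past \<eta> (i + s) \<omega>, past \<eta> (j + s) \<omega>)) \<longleftrightarrow> integrable M (\<lambda>\<omega>. F (past \<eta> i \<omega>, past \<eta> j \<omega>))"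
proof -
  have "past \<eta> (i + s) = draw (shift_index s \<circ> (\<lambda>k. Inl (i - int k)))" for i
    unfolding past_draw by (simp add: shift_index_def comp_def algebra_simps)
  then show "(\<integral>\<omega>. F (past \<eta> (i + s) \<omega>, past \<eta> (j + s) \<omega>) \<partial>M) = (\<integral>\<omega>. F (past \<eta> i \<omega>, past \<eta> j \<omega>) \<partial>M)"
    "integrable M (\<lambda>\<omega>. F (past \<eta> (i + s) \<omega>, past \<eta> (j + s) \<omega>)) \<longleftrightarrow> integrable M (\<lambda>\<omega>. F (past \<eta> i \<omega>, past \<eta> j \<omega>))"
    using draw_pair_integral[OF inj_shift_index F, of s "\<lambda>k. Inl (i - int k)" "\<lambda>k. Inl (j - int k)"]
    by (simp_all add: past_draw)
qed

lemma refreshed_integral: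
  fixes F :: "_ \<Rightarrow> 'c::{banach, second_countable_topology}"
  assumes F: "F \<in> borel_measurable seqM"
  shows "(\<integral>\<omega>. F (draw (refreshed i m) \<omega>) \<partial>M) = (\<integral>\<omega>. F (past \<eta> 0 \<omega>) \<partial>M)"
    "integrable M (\<lambda>\<omega>. F (draw (refreshed i m) \<omega>)) \<longleftrightarrow> integrable M (\<lambda>\<omega>. F (past \<eta> 0 \<omega>))"
proof -
  have eq: "refreshed i m = (swap_range (int m) \<circ> shift_index (int i)) \<circ> (\<lambda>k. Inl (0 - int k))"
    by (simp add: refreshed_def fun_eq_iff shift_index_def algebra_simps)
  note inj = inj_compose[OF inj_swap_range inj_shift_index]
  show "(\<integral>\<omega>. F (draw (refreshed i m) \<omega>) \<partial>M) = (\<integral>\<omega>. F (past \<eta> 0 \<omega>) \<partial>M)"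
    "integrable M (\<lambda>\<omega>. F (draw (refreshed i m) \<omega>)) \<longleftrightarrow> integrable M (\<lambda>\<omega>. F (past \<eta> 0 \<omega>))"
    unfolding eq past_draw by (rule draw_integral[OF inj F])+
qed

text \<open>The two refreshed pasts differ at time \<open>- m\<close> only. Exchanging the first
  \<open>m\<close> innovations back and shifting time by \<open>m\<close> moves this difference to
  time 0 and turns the pair into the past and the coupled past of time \<open>i + m\<close>.\<close>

lemma refreshed_step_integral:
  fixes F :: "_ \<Rightarrow> 'c::{banach, second_countable_topology}"
  assumes F: "F \<in> borel_measurable (seqM \<Otimes>\<^sub>M seqM)"
  shows "(\<integral>\<omega>. F (draw (refreshed i m) \<omega>, draw (refreshed i (Suc m)) \<omega>) \<partial>M) =
      (\<integral>\<omega>. F (past \<eta> (int (i + m)) \<omega>, past_coupled \<eta> \<eta>' (int (i + m)) \<omega>) \<partial>M)"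
    "integrable M (\<lambda>\<omega>. F (draw (refreshed i m) \<omega>, draw (refreshed i (Suc m)) \<omega>)) \<longleftrightarrow>
      integrable M (\<lambda>\<omega>. F (past \<eta> (int (i + m)) \<omega>, past_coupled \<eta> \<eta>' (int (i + m)) \<omega>))"
proof -
  define \<rho> where "\<rho> = swap_range (int m) \<circ> shift_index (- int m)"
  have inj: "inj \<rho>" unfolding \<rho>_def by (rule inj_compose[OF inj_swap_range inj_shift_index])
  have a: "refreshed i m = \<rho> \<circ> (\<lambda>k. Inl (int (i + m) - int k))"
    by (simp add: \<rho>_def refreshed_def fun_eq_iff shift_index_def)
  have b: "refreshed i (Suc m) = \<rho> \<circ> (\<lambda>k. if int (i + m) - int k = 0 then Inr 0 else Inl (int (i + m) - int k))"
    by (auto simp: \<rho>_def refreshed_def fun_eq_iff shift_index_def swap_range_def)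
  show "(\<integral>\<omega>. F (draw (refreshed i m) \<omega>, draw (refreshed i (Suc m)) \<omega>) \<partial>M) =
      (\<integral>\<omega>. F (past \<eta> (int (i + m)) \<omega>, past_coupled \<eta> \<eta>' (int (i + m)) \<omega>) \<partial>M)"
    "integrable M (\<lambda>\<omega>. F (draw (refreshed i m) \<omega>, draw (refreshed i (Suc m)) \<omega>)) \<longleftrightarrow>
      integrable M (\<lambda>\<omega>. F (past \<eta> (int (i + m)) \<omega>, past_coupled \<eta> \<eta>' (int (i + m)) \<omega>))"
    unfolding a b past_draw past_coupled_draw by (rule draw_pair_integral[OF inj F])+
qed

lemma draw_indep:
  assumes disj: "range a \<inter> b ` J = {}"
    and f[measurable]: "f \<in> borel_measurable seqM" and A: "\<And>k. k \<in> J \<Longrightarrow> A k \<in> sets E"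
    and J: "finite J" and int: "integrable M (\<lambda>\<omega>. f (draw a \<omega>) :: real)"
  shows "(\<integral>\<omega>. indicat_real {\<omega>. \<forall>k\<in>J. draw b \<omega> k \<in> A k} \<omega> * f (draw a \<omega>) \<partial>M) =
    (\<integral>\<omega>. indicat_real {\<omega>. \<forall>k\<in>J. draw b \<omega> k \<in> A k} \<omega> \<partial>M) * (\<integral>\<omega>. f (draw a \<omega>) \<partial>M)"
proof -
  define Ba where "Ba = range a"
  define Bb where "Bb = b ` J"
  have ind: "indep_var (PiM Bb (\<lambda>_. E)) (\<lambda>\<omega>. \<lambda>j\<in>Bb. case_sum \<eta> \<eta>' j \<omega>) (PiM Ba (\<lambda>_. E)) (\<lambda>\<omega>. \<lambda>j\<in>Ba. case_sum \<eta> \<eta>' j \<omega>)"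
    by (rule indep_var_restrict[OF indep]) (use disj in \<open>auto simp: Ba_def Bb_def\<close>)
  have m1: "(\<lambda>z. \<Prod>k\<in>J. indicat_real (A k) (z (b k))) \<in> borel_measurable (PiM Bb (\<lambda>_. E))"
    using A by (intro borel_measurable_prod borel_measurable_indicator')
      (auto simp: Bb_def intro!: measurable_sets_Collect)
  have m2: "(\<lambda>z k. z (a k)) \<in> measurable (PiM Ba (\<lambda>_. E)) seqM"
  proof -
    have "(\<lambda>z. \<lambda>k\<in>UNIV. z (a k)) \<in> measurable (PiM Ba (\<lambda>_. E)) seqM"
      by (rule measurable_restrict) (auto simp: Ba_def intro!: measurable_component_singleton)
    then show ?thesis by simp
  qed
  have i: "indep_var borel ((\<lambda>z. \<Prod>k\<in>J. indicat_real (A k) (z (b k))) \<circ> (\<lambda>\<omega>. \<lambda>j\<in>Bb. case_sum \<eta> \<eta>' j \<omega>))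
      borel ((\<lambda>z. f (\<lambda>k. z (a k))) \<circ> (\<lambda>\<omega>. \<lambda>j\<in>Ba. case_sum \<eta> \<eta>' j \<omega>))"
    by (rule indep_var_compose[OF ind m1 measurable_compose[OF m2 f]])
  have e1: "((\<lambda>z. \<Prod>k\<in>J. indicat_real (A k) (z (b k))) \<circ> (\<lambda>\<omega>. \<lambda>j\<in>Bb. case_sum \<eta> \<eta>' j \<omega>)) =
      (\<lambda>\<omega>. indicat_real {\<omega>. \<forall>k\<in>J. draw b \<omega> k \<in> A k} \<omega>)"
  proof
    fix \<omega>
    have "(\<Prod>k\<in>J. indicat_real (A k) (draw b \<omega> k)) = (if \<forall>k\<in>J. draw b \<omega> k \<in> A k then 1 else 0)"
      using J by (auto simp: indicator_def intro!: prod.neutral prod_zero)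
    then show "((\<lambda>z. \<Prod>k\<in>J. indicat_real (A k) (z (b k))) \<circ> (\<lambda>\<omega>. \<lambda>j\<in>Bb. case_sum \<eta> \<eta>' j \<omega>)) \<omega> =
      indicat_real {\<omega>. \<forall>k\<in>J. draw b \<omega> k \<in> A k} \<omega>"
      by (simp add: Bb_def draw_def indicator_def)
  qed
  have e2: "((\<lambda>z. f (\<lambda>k. z (a k))) \<circ> (\<lambda>\<omega>. \<lambda>j\<in>Ba. case_sum \<eta> \<eta>' j \<omega>)) = (\<lambda>\<omega>. f (draw a \<omega>))"
    by (auto simp: Ba_def draw_def[abs_def] fun_eq_iff comp_def)
  note i = i[unfolded e1 e2]
  have "integrable M (indicat_real {\<omega>. \<forall>k\<in>J. draw b \<omega> k \<in> A k})"
    using indep_var_rv1[OF i] by (intro integrable_const_bound[where B=1]) (auto simp: indicator_def)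
  from indep_var_lebesgue_integral[OF i this int] show ?thesis .
qed

end

section \<open>Square-integrable vector-valued random variables\<close>

context prob_space
begin

definition vL2 :: "('a \<Rightarrow> 'b::{banach, second_countable_topology}) set" where
  "vL2 = {X. X \<in> borel_measurable M \<and> (\<lambda>\<omega>. norm (X \<omega>)) \<in> L2 M}"

definition vnorm :: "('a \<Rightarrow> 'b::{banach, second_countable_topology}) \<Rightarrow> real" where
  "vnorm X = sqrt (\<integral>\<omega>. (norm (X \<omega>))\<^sup>2 \<partial>M)"

lemma vnorm_nonneg: "0 \<le> vnorm X"
  by (simp add: vnorm_def)

lemma vL2_integrable:
  assumes "X \<in> vL2" shows "integrable M X" "integrable M (\<lambda>\<omega>. (norm (X \<omega>))\<^sup>2)"
proof -
  have "integrable M (\<lambda>\<omega>. norm (X \<omega>))" using assms L2_integrable by (simp add: vL2_def)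
  then show "integrable M X" using assms by (simp add: vL2_def integrable_norm_iff)
  show "integrable M (\<lambda>\<omega>. (norm (X \<omega>))\<^sup>2)" using assms by (simp add: vL2_def L2_def)
qed

lemma vL2I: "X \<in> borel_measurable M \<Longrightarrow> integrable M (\<lambda>\<omega>. (norm (X \<omega>))\<^sup>2) \<Longrightarrow> X \<in> vL2"
  by (simp add: vL2_def L2_def)

lemma vL2_add:
  assumes "X \<in> vL2" "Y \<in> vL2" shows "(\<lambda>\<omega>. X \<omega> + Y \<omega>) \<in> vL2"
proof (rule vL2I)
  have [measurable]: "X \<in> borel_measurable M" "Y \<in> borel_measurable M" using assms by (auto simp: vL2_def)
  show "(\<lambda>\<omega>. X \<omega> + Y \<omega>) \<in> borel_measurable M" by measurable
  have b: "(norm (x + y))\<^sup>2 \<le> (norm x + norm y)\<^sup>2" for x y :: 'b by (intro power_mono norm_triangle_ineq) simp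
  show "integrable M (\<lambda>\<omega>. (norm (X \<omega> + Y \<omega>))\<^sup>2)"
  proof (rule Bochner_Integration.integrable_bound)
    have "(\<lambda>\<omega>. norm (X \<omega>) + norm (Y \<omega>)) \<in> L2 M" using assms by (intro L2_add) (auto simp: vL2_def)
    then show "integrable M (\<lambda>\<omega>. (norm (X \<omega>) + norm (Y \<omega>))\<^sup>2)" by (rule L2D)
  qed (auto simp: b)
qed

lemma vL2_scale: "X \<in> vL2 \<Longrightarrow> (\<lambda>\<omega>. c *\<^sub>R X \<omega>) \<in> vL2"
  using L2_scale[of "\<lambda>\<omega>. norm (X \<omega>)" M "\<bar>c\<bar>"] by (auto simp: vL2_def)

lemma vL2_diff: "X \<in> vL2 \<Longrightarrow> Y \<in> vL2 \<Longrightarrow> (\<lambda>\<omega>. X \<omega> - Y \<omega>) \<in> vL2"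
  using vL2_add[of X "\<lambda>\<omega>. (- 1) *\<^sub>R Y \<omega>"] vL2_scale[of Y "- 1"] by simp

text \<open>Stated for bilinear maps of norm at most one, so as to cover both the tensor product and
  its flip.\<close>

lemma bilinear_expectation:
  fixes f :: "'b::{banach, second_countable_topology} \<Rightarrow> 'b \<Rightarrow> 'c::{banach, second_countable_topology}"
  assumes f: "bounded_bilinear f" "\<And>x y. norm (f x y) \<le> norm x * norm y"
    and X: "X \<in> vL2" and Y: "Y \<in> vL2"
  shows "integrable M (\<lambda>\<omega>. f (X \<omega>) (Y \<omega>))" "norm (\<integral>\<omega>. f (X \<omega>) (Y \<omega>) \<partial>M) \<le> vnorm X * vnorm Y"
proof -
  have L: "(\<lambda>\<omega>. norm (X \<omega>)) \<in> L2 M" "(\<lambda>\<omega>. norm (Y \<omega>)) \<in> L2 M" using X Y by (auto simp: vL2_def)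
  note i = L2_mult_integrable[OF L]
  have m: "(\<lambda>\<omega>. f (X \<omega>) (Y \<omega>)) \<in> borel_measurable M"
  proof (rule borel_measurable_continuous_Pair[where H=f])
    show "continuous_on UNIV (\<lambda>x. f (fst x) (snd x))"
      by (rule bounded_bilinear.continuous_on[OF f(1)]) (intro continuous_intros)+
  qed (use X Y in \<open>auto simp: vL2_def\<close>)
  show int: "integrable M (\<lambda>\<omega>. f (X \<omega>) (Y \<omega>))"
    by (rule Bochner_Integration.integrable_bound[OF i m]) (use f(2) in \<open>auto simp: abs_mult\<close>)
  have "norm (\<integral>\<omega>. f (X \<omega>) (Y \<omega>) \<partial>M) \<le> (\<integral>\<omega>. norm (f (X \<omega>) (Y \<omega>)) \<partial>M)" by (rule integral_norm_bound)
  also have "\<dots> \<le> (\<integral>\<omega>. norm (X \<omega>) * norm (Y \<omega>) \<partial>M)"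
    by (rule integral_mono) (use int i f(2) in auto)
  also have "\<dots> \<le> vnorm X * vnorm Y" using L2_Cauchy_Schwarz[OF L] by (simp add: vnorm_def)
  finally show "norm (\<integral>\<omega>. f (X \<omega>) (Y \<omega>) \<partial>M) \<le> vnorm X * vnorm Y" .
qed

text \<open>Cauchy-Schwarz. Through the square root of the probability, events of small probability
  contribute little, uniformly over variables of bounded norm.\<close>

lemma indicator_expectation_le:
  assumes A: "{\<omega> \<in> space M. Q \<omega>} \<in> sets M" and X: "X \<in> vL2"
  shows "integrable M (\<lambda>\<omega>. (if Q \<omega> then X \<omega> else 0))"
    "norm (\<integral>\<omega>. (if Q \<omega> then X \<omega> else 0) \<partial>M) \<le> sqrt (prob {\<omega> \<in> space M. Q \<omega>}) * vnorm X"
proof -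
  define I where "I \<omega> = (if Q \<omega> then 1 else 0 :: real)" for \<omega>
  have [measurable]: "X \<in> borel_measurable M" using X by (simp add: vL2_def)
  have Im[measurable]: "I \<in> borel_measurable M"
    by (rule measurable_cong[THEN iffD2, OF _ borel_measurable_indicator[OF A]]) (simp add: I_def indicator_def)
  have IL: "I \<in> L2 M" 
  proof -
    have "AE \<omega> in M. norm ((I \<omega>)\<^sup>2) \<le> 1" by (auto simp: I_def)
    then have "integrable M (\<lambda>\<omega>. (I \<omega>)\<^sup>2)" by (rule integrable_const_bound) measurable
    then show ?thesis using Im by (simp add: L2_def)
  qed
  have XL: "(\<lambda>\<omega>. norm (X \<omega>)) \<in> L2 M" using X by (simp add: vL2_def)
  have eq: "(\<lambda>\<omega>. (if Q \<omega> then X \<omega> else 0)) = (\<lambda>\<omega>. I \<omega> *\<^sub>R X \<omega>)" by (auto simp: I_def)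
  have n: "\<bar>I \<omega>\<bar> = I \<omega>" for \<omega> by (simp add: I_def)
  show int: "integrable M (\<lambda>\<omega>. (if Q \<omega> then X \<omega> else 0))" unfolding eq
    by (rule Bochner_Integration.integrable_bound[OF L2_mult_integrable[OF IL XL]]) (auto simp: n abs_mult)
  have "norm (\<integral>\<omega>. I \<omega> *\<^sub>R X \<omega> \<partial>M) \<le> (\<integral>\<omega>. I \<omega> * norm (X \<omega>) \<partial>M)"
    using integral_norm_bound[of M "\<lambda>\<omega>. I \<omega> *\<^sub>R X \<omega>"] by (simp add: n)
  also have "\<dots> \<le> sqrt (\<integral>\<omega>. (I \<omega>)\<^sup>2 \<partial>M) * vnorm X"
    using L2_Cauchy_Schwarz[OF IL XL] by (simp add: vnorm_def)
  also have "(\<integral>\<omega>. (I \<omega>)\<^sup>2 \<partial>M) = (\<integral>\<omega>. indicator {\<omega> \<in> space M. Q \<omega>} \<omega> \<partial>M)"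
    by (intro Bochner_Integration.integral_cong) (auto simp: I_def indicator_def)
  also have "\<dots> = prob {\<omega> \<in> space M. Q \<omega>}" using A by simp
  finally show "norm (\<integral>\<omega>. (if Q \<omega> then X \<omega> else 0) \<partial>M) \<le> sqrt (prob {\<omega> \<in> space M. Q \<omega>}) * vnorm X"
    unfolding eq .
qed

end

context iid_noise
begin

lemma past_measurable: "past \<eta> j \<in> measurable M seqM"
  unfolding past_draw by measurable

context
  fixes h :: "(nat \<Rightarrow> 'e) \<Rightarrow> 'b::{banach, second_countable_topology}" and i :: nat
  assumes hm[measurable]: "h \<in> borel_measurable seqM"
    and sq: "integrable M (\<lambda>\<omega>. (norm (h (past \<eta> 0 \<omega>)))\<^sup>2)"
    and mean: "(\<integral>\<omega>. h (past \<eta> 0 \<omega>) \<partial>M) = 0"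
begin

abbreviation "ref m \<omega> \<equiv> h (draw (refreshed i m) \<omega>)"

lemma past0_vL2: "(\<lambda>\<omega>. h (past \<eta> 0 \<omega>)) \<in> vL2"
  by (rule vL2I[OF measurable_compose[OF past_measurable hm] sq])

lemma ref_vL2: "ref m \<in> vL2"
proof (rule vL2I)
  show "integrable M (\<lambda>\<omega>. (norm (ref m \<omega>))\<^sup>2)"
    using refreshed_integral(2)[of "\<lambda>z. (norm (h z))\<^sup>2" i m] sq by simp
qed measurable

lemma ref_vnorm: "vnorm (ref m) = vnorm (\<lambda>\<omega>. h (past \<eta> 0 \<omega>))"
  using refreshed_integral(1)[of "\<lambda>z. (norm (h z))\<^sup>2" i m] by (simp add: vnorm_def)

lemma ref_mean: "(\<integral>\<omega>. ref m \<omega> \<partial>M) = 0"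
  using refreshed_integral(1)[of h i m] mean by simp

lemma past_event: "A \<in> sets seqM \<Longrightarrow> {\<omega> \<in> space M. past \<eta> 0 \<omega> \<in> A} \<in> sets M"
  using measurable_sets[OF past_measurable, of A 0] by (simp add: vimage_def Int_def conj_commute)

text \<open>
  On a cylinder event the past of time \<open>0\<close> is eventually independent of the refreshed past; the
  remaining events follow by Dynkin's argument.
\<close>

lemma refreshed_decorrelates:
  assumes "A \<in> sets seqM"
  shows "(\<lambda>m. \<integral>\<omega>. (if past \<eta> 0 \<omega> \<in> A then ref m \<omega> else 0) \<partial>M) \<longlonglongrightarrow> 0"
proof -
  define \<Omega> where "\<Omega> = (\<Pi>\<^sub>E k\<in>(UNIV :: nat set). space E)"
  have gen: "sets seqM = sigma_sets \<Omega> (prod_algebra UNIV (\<lambda>_. E))" unfolding \<Omega>_def by (rule sets_PiM)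
  have A: "A \<in> sigma_sets \<Omega> (prod_algebra UNIV (\<lambda>_. E))" using assms by (simp add: gen)
  have sp: "past \<eta> 0 \<omega> \<in> \<Omega>" if "\<omega> \<in> space M" for \<omega>
    using measurable_space[OF past_measurable that, of 0] by (simp add: \<Omega>_def space_PiM)
  have sub: "prod_algebra UNIV (\<lambda>_. E) \<subseteq> Pow \<Omega>" unfolding \<Omega>_def by (rule prod_algebra_sets_into_space)
  have int: "integrable M (\<lambda>\<omega>. (if past \<eta> 0 \<omega> \<in> B then ref m \<omega> else 0))" if "B \<in> sets seqM" for B m
    by (rule indicator_expectation_le(1)[OF past_event[OF that] ref_vL2])
  from Int_stable_prod_algebra sub A show ?thesis
  proof (induction rule: sigma_sets_induct_disjoint)
    case (basic B)
    then obtain J X where B: "B = prod_emb UNIV (\<lambda>_. E) J (\<Pi>\<^sub>E k\<in>J. X k)" "finite J"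
      "\<And>k. k \<in> J \<Longrightarrow> X k \<in> sets E" by (auto elim!: prod_algebraE)
    \<comment> \<open>From \<open>m0\<close> on, the refreshed past uses none of the innovations at
      the times \<open>- k\<close> with \<open>k \<in> J\<close> that decide the cylinder event, so
      the expectation factorises and its centered factor is 0.\<close>
    obtain m0 where m0: "\<And>k. k \<in> J \<Longrightarrow> k < m0" using B(2) finite_nat_set_iff_bounded by auto
    have "(\<integral>\<omega>. (if past \<eta> 0 \<omega> \<in> B then ref m \<omega> else 0) \<partial>M) = 0" if m: "m \<ge> m0" for m
    proof (rule eq_by_functionals)
      fix c :: "'b \<Rightarrow>\<^sub>L real"
      define b where "b k = (Inl (0 - int k) :: int + int)" for k
      have BQ: "past \<eta> 0 \<omega> \<in> B \<longleftrightarrow> (\<forall>k\<in>J. draw b \<omega> k \<in> X k)" if "\<omega> \<in> space M" for \<omega>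
      proof -
        have "past \<eta> 0 \<omega> \<in> space seqM" by (rule measurable_space[OF past_measurable that])
        then show ?thesis
          unfolding B(1) prod_emb_iff past_draw b_def by (auto simp: space_PiM PiE_iff)
      qed
      have disj: "range (refreshed i m) \<inter> b ` J = {}"
        using m0 m by (fastforce simp: refreshed_def swap_range_def b_def split: if_splits)
      have ci: "integrable M (\<lambda>\<omega>. c (ref m \<omega>))"
        by (rule integrable_bounded_linear[OF blinfun.bounded_linear_right vL2_integrable(1)[OF ref_vL2]])
      have cm: "(\<lambda>z. c (h z)) \<in> borel_measurable seqM"
        by (rule borel_measurable_continuous_on[OF _ hm]) (intro continuous_intros)
      have Bs: "B \<in> sets seqM" using basic by (simp add: gen sigma_sets.Basic)
      have "c (\<integral>\<omega>. (if past \<eta> 0 \<omega> \<in> B then ref m \<omega> else 0) \<partial>M) = (\<integral>\<omega>. c (if past \<eta> 0 \<omega> \<in> B then ref m \<omega> else 0) \<partial>M)"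
        by (rule integral_bounded_linear[OF blinfun.bounded_linear_right int[OF Bs], symmetric])
      also have "\<dots> = (\<integral>\<omega>. indicat_real {\<omega>. \<forall>k\<in>J. draw b \<omega> k \<in> X k} \<omega> * c (ref m \<omega>) \<partial>M)"
        by (intro Bochner_Integration.integral_cong) (auto simp: BQ indicator_def blinfun.zero_right)
      also have "\<dots> = (\<integral>\<omega>. indicat_real {\<omega>. \<forall>k\<in>J. draw b \<omega> k \<in> X k} \<omega> \<partial>M) * (\<integral>\<omega>. c (ref m \<omega>) \<partial>M)"
        by (rule draw_indep[OF disj cm B(3,2) ci])
      also have "(\<integral>\<omega>. c (ref m \<omega>) \<partial>M) = c (\<integral>\<omega>. ref m \<omega> \<partial>M)"
        by (rule integral_bounded_linear[OF blinfun.bounded_linear_right vL2_integrable(1)[OF ref_vL2]])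
      finally show "c (\<integral>\<omega>. (if past \<eta> 0 \<omega> \<in> B then ref m \<omega> else 0) \<partial>M) = c 0"
        by (simp add: ref_mean blinfun.zero_right)
    qed
    then show ?case by (intro tendsto_eventually) (auto simp: eventually_sequentially)
  next
    case empty
    then show ?case by simp
  next
    case (compl B)
    have Bs: "B \<in> sets seqM" using compl(1) by (simp add: gen)
    have "(\<integral>\<omega>. (if past \<eta> 0 \<omega> \<in> \<Omega> - B then ref m \<omega> else 0) \<partial>M) = - (\<integral>\<omega>. (if past \<eta> 0 \<omega> \<in> B then ref m \<omega> else 0) \<partial>M)" for m
    proof -
      have "(\<integral>\<omega>. (if past \<eta> 0 \<omega> \<in> \<Omega> - B then ref m \<omega> else 0) \<partial>M) = (\<integral>\<omega>. ref m \<omega> - (if past \<eta> 0 \<omega> \<in> B then ref m \<omega> else 0) \<partial>M)"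
        using sp by (intro Bochner_Integration.integral_cong) auto
      also have "\<dots> = (\<integral>\<omega>. ref m \<omega> \<partial>M) - (\<integral>\<omega>. (if past \<eta> 0 \<omega> \<in> B then ref m \<omega> else 0) \<partial>M)"
        by (rule Bochner_Integration.integral_diff[OF vL2_integrable(1)[OF ref_vL2] int[OF Bs]])
      finally show ?thesis by (simp add: ref_mean)
    qed
    then show ?case using tendsto_minus[OF compl(2)] by simp
  next
    case (union B)
    have Bs: "B k \<in> sets seqM" for k using union(2) by (auto simp: gen)
    define C where "C = vnorm (\<lambda>\<omega>. h (past \<eta> 0 \<omega>))"
    define D where "D k = {\<omega> \<in> space M. past \<eta> 0 \<omega> \<in> B k}" for k
    have D: "range D \<subseteq> sets M" "disjoint_family D"
      using past_event[OF Bs] union(1) by (auto simp: D_def disjoint_family_on_def)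
    have "(\<lambda>k. prob (D k)) sums prob (\<Union>k. D k)" by (rule finite_measure_UNION[OF D])
    then have "(\<lambda>n. prob (\<Union>k. D k) - (\<Sum>k<n. prob (D k))) \<longlonglongrightarrow> prob (\<Union>k. D k) - prob (\<Union>k. D k)"
      unfolding sums_def by (intro tendsto_diff tendsto_const)
    then have tail0: "(\<lambda>n. prob (\<Union>k. D k) - (\<Sum>k<n. prob (D k))) \<longlonglongrightarrow> 0" by simp
    define S where "S n m = (\<Sum>k<n. \<integral>\<omega>. (if past \<eta> 0 \<omega> \<in> B k then ref m \<omega> else 0) \<partial>M)" for n m
    \<comment> \<open>The bound does not depend on \<open>m\<close>, because all refreshed variables
      have the same norm. So finitely many of the \<open>B k\<close> can be fixed before
      \<open>m\<close> tends to infinity.\<close>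
    have rest: "norm ((\<integral>\<omega>. (if past \<eta> 0 \<omega> \<in> (\<Union>k. B k) then ref m \<omega> else 0) \<partial>M) - S n m)
        \<le> sqrt (prob (\<Union>k. D k) - (\<Sum>k<n. prob (D k))) * C" for n m
    proof -
      define T where "T = (\<Union>k. B k) - (\<Union>k<n. B k)"
      have Ts: "T \<in> sets seqM" unfolding T_def using Bs by auto
      have "(\<Sum>k<n. (if past \<eta> 0 \<omega> \<in> B k then ref m \<omega> else 0)) = (if past \<eta> 0 \<omega> \<in> (\<Union>k<n. B k) then ref m \<omega> else 0)" for \<omega>
      proof (cases "\<exists>k<n. past \<eta> 0 \<omega> \<in> B k")
        case True
        then obtain k where k: "k < n" "past \<eta> 0 \<omega> \<in> B k" by blast
        have "past \<eta> 0 \<omega> \<in> B j \<longleftrightarrow> j = k" for j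
          using k union(1) by (auto simp: disjoint_family_on_def)
        then show ?thesis using k by (simp add: sum.delta')
      next
        case False
        then show ?thesis by (auto intro!: sum.neutral)
      qed
      then have "(\<integral>\<omega>. (if past \<eta> 0 \<omega> \<in> T then ref m \<omega> else 0) \<partial>M) =
          (\<integral>\<omega>. (if past \<eta> 0 \<omega> \<in> (\<Union>k. B k) then ref m \<omega> else 0) - (\<Sum>k<n. (if past \<eta> 0 \<omega> \<in> B k then ref m \<omega> else 0)) \<partial>M)"
        by (intro Bochner_Integration.integral_cong) (auto simp: T_def)
      also have "\<dots> = (\<integral>\<omega>. (if past \<eta> 0 \<omega> \<in> (\<Union>k. B k) then ref m \<omega> else 0) \<partial>M) - S n m"
        unfolding S_def
        by (subst Bochner_Integration.integral_diff[OF int[OF sets.countable_UN] Bochner_Integration.integrable_sum[OF int[OF Bs]]])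
          (use Bs Bochner_Integration.integral_sum[OF int[OF Bs]] in auto)
      finally have eq: "(\<integral>\<omega>. (if past \<eta> 0 \<omega> \<in> (\<Union>k. B k) then ref m \<omega> else 0) \<partial>M) - S n m = (\<integral>\<omega>. (if past \<eta> 0 \<omega> \<in> T then ref m \<omega> else 0) \<partial>M)" by simp
      have "{\<omega> \<in> space M. past \<eta> 0 \<omega> \<in> T} = (\<Union>k. D k) - (\<Union>k<n. D k)" by (auto simp: T_def D_def)
      moreover have "prob ((\<Union>k. D k) - (\<Union>k<n. D k)) = prob (\<Union>k. D k) - (\<Sum>k<n. prob (D k))"
        using D finite_measure_finite_Union[of "{..<n}" D]
        by (subst finite_measure_Diff) (auto simp: disjoint_family_on_def)
      ultimately show ?thesis
        unfolding eq C_def using indicator_expectation_le(2)[OF past_event[OF Ts] ref_vL2, of m] by (simp add: ref_vnorm)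
    qed
    show ?case
    proof (rule LIMSEQ_I)
      fix \<epsilon> :: real assume \<epsilon>: "0 < \<epsilon>"
      have "(\<lambda>n. sqrt (prob (\<Union>k. D k) - (\<Sum>k<n. prob (D k))) * C) \<longlonglongrightarrow> sqrt 0 * C"
        by (intro tendsto_intros tail0)
      then have "(\<lambda>n. sqrt (prob (\<Union>k. D k) - (\<Sum>k<n. prob (D k))) * C) \<longlonglongrightarrow> 0" by simp
      from order_tendstoD(2)[OF this, of "\<epsilon> / 2"] \<epsilon> obtain n
        where n: "sqrt (prob (\<Union>k. D k) - (\<Sum>k<n. prob (D k))) * C < \<epsilon> / 2"
        by (auto simp: eventually_sequentially)
      have "S n \<longlonglongrightarrow> (\<Sum>k<n. 0)" unfolding S_def by (intro tendsto_sum union(3))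
      then have "S n \<longlonglongrightarrow> 0" by simp
      from LIMSEQ_D[OF this, of "\<epsilon> / 2"] \<epsilon> obtain m0 where m0: "\<And>m. m \<ge> m0 \<Longrightarrow> norm (S n m) < \<epsilon> / 2" by auto
      have "norm ((\<integral>\<omega>. (if past \<eta> 0 \<omega> \<in> (\<Union>k. B k) then ref m \<omega> else 0) \<partial>M) - 0) < \<epsilon>" if "m \<ge> m0" for m
        using rest[of m n] n m0[OF that]
          norm_triangle_ineq[of "(\<integral>\<omega>. (if past \<eta> 0 \<omega> \<in> (\<Union>k. B k) then ref m \<omega> else 0) \<partial>M) - S n m" "S n m"] by simp
      then show "\<exists>m0. \<forall>m\<ge>m0. norm ((\<integral>\<omega>. (if past \<eta> 0 \<omega> \<in> (\<Union>k. B k) then ref m \<omega> else 0) \<partial>M) - 0) < \<epsilon>" by blast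
    qed
  qed
qed

text \<open>For a simple function of the past of time 0 the expectation is a finite sum over events,
  covered by \<open>refreshed_decorrelates\<close>. The error of replacing \<open>h\<close> by a
  simple function is uniform in \<open>m\<close>, since the norm of \<open>ref m\<close> does not
  depend on \<open>m\<close>.\<close>

lemma bilinear_decorrelates:
  fixes f :: "'b \<Rightarrow> 'b \<Rightarrow> 'c::{banach, second_countable_topology}"
  assumes f: "bounded_bilinear f" "\<And>x y. norm (f x y) \<le> norm x * norm y"
  shows "(\<lambda>m. \<integral>\<omega>. f (ref m \<omega>) (h (past \<eta> 0 \<omega>)) \<partial>M) \<longlonglongrightarrow> 0"
proof (rule LIMSEQ_I)
  interpret f: bounded_bilinear f by (rule f)
  fix \<epsilon> :: real assume \<epsilon>: "0 < \<epsilon>"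
  define C where "C = vnorm (\<lambda>\<omega>. h (past \<eta> 0 \<omega>))"
  obtain s where s0: "\<forall>n. simple_function seqM (s n)" "\<forall>z\<in>space seqM. (\<lambda>n. s n z) \<longlonglongrightarrow> h z"
    "\<forall>n. \<forall>z\<in>space seqM. dist (s n z) 0 \<le> 2 * dist (h z) 0"
    using borel_measurable_implies_sequence_metric[OF hm, of 0] by (elim exE conjE)
  have s: "simple_function seqM (s n)" "z \<in> space seqM \<Longrightarrow> (\<lambda>n. s n z) \<longlonglongrightarrow> h z"
    "z \<in> space seqM \<Longrightarrow> dist (s n z) 0 \<le> 2 * dist (h z) 0" for n z using s0 by auto
  have sm[measurable]: "s n \<in> borel_measurable seqM" for n by (rule borel_measurable_simple_function[OF s(1)])
  have sp: "past \<eta> 0 \<omega> \<in> space seqM" if "\<omega> \<in> space M" for \<omega> by (rule measurable_space[OF past_measurable that])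
  note [measurable] = past_measurable
  define R where "R n \<omega> = h (past \<eta> 0 \<omega>) - s n (past \<eta> 0 \<omega>)" for n \<omega>
  have Rb: "norm (R n \<omega>) \<le> 3 * norm (h (past \<eta> 0 \<omega>))" if "\<omega> \<in> space M" for n \<omega>
    using norm_triangle_ineq4[of "h (past \<eta> 0 \<omega>)" "s n (past \<eta> 0 \<omega>)"] s(3)[OF sp[OF that], of n] by (simp add: R_def)
  have Rb2: "(norm (R n \<omega>))\<^sup>2 \<le> 9 * (norm (h (past \<eta> 0 \<omega>)))\<^sup>2" if "\<omega> \<in> space M" for n \<omega>
    using power_mono[OF Rb[OF that], of n 2] by (simp add: power_mult_distrib)
  have Rm[measurable]: "R n \<in> borel_measurable M" for n unfolding R_def by measurable
  have RL: "R n \<in> vL2" for n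
  proof (rule vL2I[OF Rm])
    show "integrable M (\<lambda>\<omega>. (norm (R n \<omega>))\<^sup>2)"
      by (rule Bochner_Integration.integrable_bound[OF integrable_mult_right[OF sq, of 9]]) (auto simp: Rb2 intro!: AE_I2)
  qed
  have "(\<lambda>n. \<integral>\<omega>. (norm (R n \<omega>))\<^sup>2 \<partial>M) \<longlonglongrightarrow> (\<integral>\<omega>. 0 \<partial>M)"
  proof (rule integral_dominated_convergence[where w="\<lambda>\<omega>. 9 * (norm (h (past \<eta> 0 \<omega>)))\<^sup>2"])
    show "AE \<omega> in M. (\<lambda>n. (norm (R n \<omega>))\<^sup>2) \<longlonglongrightarrow> 0"
    proof (rule AE_I2)
      fix \<omega> assume "\<omega> \<in> space M"
      from s(2)[OF sp[OF this]] have "(\<lambda>n. (norm (h (past \<eta> 0 \<omega>) - s n (past \<eta> 0 \<omega>)))\<^sup>2) \<longlonglongrightarrow> (norm (h (past \<eta> 0 \<omega>) - h (past \<eta> 0 \<omega>)))\<^sup>2"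
        by (intro tendsto_intros)
      then show "(\<lambda>n. (norm (R n \<omega>))\<^sup>2) \<longlonglongrightarrow> 0" by (simp add: R_def)
    qed
  qed (use sq in \<open>auto simp: Rb2 intro!: AE_I2\<close>)
  then have "(\<lambda>n. C * vnorm (R n)) \<longlonglongrightarrow> 0"
    unfolding vnorm_def by (intro tendsto_mult_right_zero) (use tendsto_real_sqrt in fastforce)
  from order_tendstoD(2)[OF this, of "\<epsilon> / 2"] \<epsilon> obtain n where n: "C * vnorm (R n) < \<epsilon> / 2"
    by (auto simp: eventually_sequentially)
  define Y where "Y = s n ` space seqM"
  have Y: "finite Y" unfolding Y_def by (rule simple_functionD(1)[OF s(1)])
  define A where "A y = s n -` {y} \<inter> space seqM" for y
  have As: "A y \<in> sets seqM" for y unfolding A_def by (rule simple_functionD(2)[OF s(1)])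
  define E1 where "E1 y m = (\<integral>\<omega>. (if past \<eta> 0 \<omega> \<in> A y then ref m \<omega> else 0) \<partial>M)" for y m
  have dec: "(\<integral>\<omega>. f (ref m \<omega>) (h (past \<eta> 0 \<omega>)) \<partial>M) = (\<Sum>y\<in>Y. f (E1 y m) y) + (\<integral>\<omega>. f (ref m \<omega>) (R n \<omega>) \<partial>M)" for m
  proof -
    have E1i: "integrable M (\<lambda>\<omega>. (if past \<eta> 0 \<omega> \<in> A y then ref m \<omega> else 0))" for y
      by (rule indicator_expectation_le(1)[OF past_event[OF As] ref_vL2])
    have fi: "integrable M (\<lambda>\<omega>. f (if past \<eta> 0 \<omega> \<in> A y then ref m \<omega> else 0) y)" for y
      by (rule integrable_bounded_linear[OF f.bounded_linear_left E1i])
    have "f (ref m \<omega>) (h (past \<eta> 0 \<omega>)) = (\<Sum>y\<in>Y. f (if past \<eta> 0 \<omega> \<in> A y then ref m \<omega> else 0) y) + f (ref m \<omega>) (R n \<omega>)"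
      if "\<omega> \<in> space M" for \<omega>
    proof -
      have "(\<Sum>y\<in>Y. f (if past \<eta> 0 \<omega> \<in> A y then ref m \<omega> else 0) y) = (\<Sum>y\<in>Y. if y = s n (past \<eta> 0 \<omega>) then f (ref m \<omega>) y else 0)"
        using sp[OF that] by (intro sum.cong) (auto simp: A_def f.zero_left)
      also have "\<dots> = f (ref m \<omega>) (s n (past \<eta> 0 \<omega>))" using Y sp[OF that] by (simp add: Y_def)
      finally show ?thesis by (simp add: R_def f.diff_right)
    qed
    then have "(\<integral>\<omega>. f (ref m \<omega>) (h (past \<eta> 0 \<omega>)) \<partial>M) =
        (\<integral>\<omega>. (\<Sum>y\<in>Y. f (if past \<eta> 0 \<omega> \<in> A y then ref m \<omega> else 0) y) + f (ref m \<omega>) (R n \<omega>) \<partial>M)"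
      by (intro Bochner_Integration.integral_cong) auto
    also have "\<dots> = (\<integral>\<omega>. (\<Sum>y\<in>Y. f (if past \<eta> 0 \<omega> \<in> A y then ref m \<omega> else 0) y) \<partial>M) + (\<integral>\<omega>. f (ref m \<omega>) (R n \<omega>) \<partial>M)"
      by (intro Bochner_Integration.integral_add Bochner_Integration.integrable_sum fi bilinear_expectation(1)[OF f ref_vL2 RL])
    also have "(\<integral>\<omega>. (\<Sum>y\<in>Y. f (if past \<eta> 0 \<omega> \<in> A y then ref m \<omega> else 0) y) \<partial>M) = (\<Sum>y\<in>Y. f (E1 y m) y)"
      unfolding E1_def using fi
      by (subst Bochner_Integration.integral_sum) (auto intro!: sum.cong integral_bounded_linear[OF f.bounded_linear_left E1i])
    finally show ?thesis .
  qed
  have "(\<lambda>m. \<Sum>y\<in>Y. f (E1 y m) y) \<longlonglongrightarrow> (\<Sum>y\<in>Y. f 0 y)"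
    unfolding E1_def by (rule tendsto_sum) (rule f.tendsto[OF refreshed_decorrelates[OF As] tendsto_const])
  then have "(\<lambda>m. \<Sum>y\<in>Y. f (E1 y m) y) \<longlonglongrightarrow> 0" by (simp add: f.zero_left)
  from LIMSEQ_D[OF this, of "\<epsilon> / 2"] \<epsilon> obtain m0 where m0: "\<And>m. m \<ge> m0 \<Longrightarrow> norm (\<Sum>y\<in>Y. f (E1 y m) y) < \<epsilon> / 2" by auto
  have "norm ((\<integral>\<omega>. f (ref m \<omega>) (h (past \<eta> 0 \<omega>)) \<partial>M) - 0) < \<epsilon>" if "m \<ge> m0" for m
    using m0[OF that] n bilinear_expectation(2)[OF f ref_vL2 RL, of m n] norm_triangle_ineq[of "\<Sum>y\<in>Y. f (E1 y m) y" "\<integral>\<omega>. f (ref m \<omega>) (R n \<omega>) \<partial>M"]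
    unfolding dec by (simp add: ref_vnorm C_def)
  then show "\<exists>m0. \<forall>m\<ge>m0. norm ((\<integral>\<omega>. f (ref m \<omega>) (h (past \<eta> 0 \<omega>)) \<partial>M) - 0) < \<epsilon>" by blast
qed

text \<open>
  Refreshing one more innovation changes \<open>H\<close> by as much, in law, as the coupling in the dependence
  measure does; once all innovations are refreshed, the covariance vanishes.
\<close>

lemma bilinear_cov_bound:
  fixes f :: "'b \<Rightarrow> 'b \<Rightarrow> 'c::{banach, second_countable_topology}"
  assumes f: "bounded_bilinear f" "\<And>x y. norm (f x y) \<le> norm x * norm y"
    and d: "\<And>j. vnorm (\<lambda>\<omega>. h (past \<eta> (int j) \<omega>) - h (past_coupled \<eta> \<eta>' (int j) \<omega>)) \<le> d j"
    and \<theta>: "\<And>m. (\<Sum>j<m. d (i + j)) \<le> \<theta>"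
  shows "norm (\<integral>\<omega>. f (h (past \<eta> (int i) \<omega>)) (h (past \<eta> 0 \<omega>)) \<partial>M) \<le> vnorm (\<lambda>\<omega>. h (past \<eta> 0 \<omega>)) * \<theta>"
proof -
  interpret f: bounded_bilinear f by (rule f)
  define C where "C = vnorm (\<lambda>\<omega>. h (past \<eta> 0 \<omega>))"
  have C: "0 \<le> C" unfolding C_def by (rule vnorm_nonneg)
  define c where "c m = (\<integral>\<omega>. f (ref m \<omega>) (h (past \<eta> 0 \<omega>)) \<partial>M)" for m
  have step: "norm (c m - c (Suc m)) \<le> d (i + m) * C" for m
  proof -
    have "c m - c (Suc m) = (\<integral>\<omega>. f (ref m \<omega> - ref (Suc m) \<omega>) (h (past \<eta> 0 \<omega>)) \<partial>M)"
      unfolding c_def f.diff_left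
      by (rule Bochner_Integration.integral_diff[symmetric]) (rule bilinear_expectation(1)[OF f ref_vL2 past0_vL2])+
    also have "norm \<dots> \<le> vnorm (\<lambda>\<omega>. ref m \<omega> - ref (Suc m) \<omega>) * C"
      unfolding C_def by (rule bilinear_expectation(2)[OF f vL2_diff[OF ref_vL2 ref_vL2] past0_vL2])
    also have "vnorm (\<lambda>\<omega>. ref m \<omega> - ref (Suc m) \<omega>) =
        vnorm (\<lambda>\<omega>. h (past \<eta> (int (i + m)) \<omega>) - h (past_coupled \<eta> \<eta>' (int (i + m)) \<omega>))"
      using refreshed_step_integral(1)[of "\<lambda>z. (norm (h (fst z) - h (snd z)))\<^sup>2" i m] by (simp add: vnorm_def)
    also have "\<dots> * C \<le> d (i + m) * C" by (intro mult_right_mono d C)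
    finally show ?thesis .
  qed
  have "norm (c 0) \<le> C * \<theta> + norm (c m)" for m
  proof -
    have "c 0 = (\<Sum>j<m. c j - c (Suc j)) + c m" by (simp add: sum_lessThan_telescope')
    then have "norm (c 0) \<le> norm (\<Sum>j<m. c j - c (Suc j)) + norm (c m)" by (metis norm_triangle_ineq)
    also have "norm (\<Sum>j<m. c j - c (Suc j)) \<le> (\<Sum>j<m. d (i + j) * C)" by (intro sum_norm_le step)
    also have "\<dots> = C * (\<Sum>j<m. d (i + j))" by (simp add: sum_distrib_left mult.commute)
    also have "\<dots> \<le> C * \<theta>" by (intro mult_left_mono \<theta> C)
    finally show ?thesis by simp
  qed
  moreover have "(\<lambda>m. C * \<theta> + norm (c m)) \<longlonglongrightarrow> C * \<theta> + norm (0::'c)"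
    unfolding c_def by (rule tendsto_add[OF tendsto_const tendsto_norm[OF bilinear_decorrelates[OF f]]])
  ultimately have "norm (c 0) \<le> C * \<theta> + norm (0::'c)"
    by (intro LIMSEQ_le_const) auto
  then show ?thesis by (simp add: c_def C_def refreshed_0)
qed

end

end

section \<open>The local long-run variance\<close>

lemma norm_ptensor_le: "norm (x \<otimes>\<^sub>\<pi> y) \<le> norm x * norm y"
  by (simp add: ptensor_def norm_ptensor_of proj_norm_atensor_le)

text \<open>The symmetric intervals are cofinal among the finite sets of integers, so an unordered
  sum is also an ordinary limit.\<close>

lemma has_sum_int_intervals:
  fixes f :: "int \<Rightarrow> 'a::{comm_monoid_add, topological_space}"
  assumes "(f has_sum S) UNIV"
  shows "(\<lambda>n. \<Sum>k\<in>{- int n..int n}. f k) \<longlonglongrightarrow> S"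
proof -
  have "filterlim (\<lambda>n. {- int n..int n}) (finite_subsets_at_top UNIV) sequentially"
    unfolding filterlim_finite_subsets_at_top
  proof (intro allI impI)
    fix X :: "int set" assume X: "finite X \<and> X \<subseteq> UNIV"
    then have "finite ((\<lambda>k. nat \<bar>k\<bar>) ` X)" by simp
    then obtain n0 where n0: "\<forall>m\<in>(\<lambda>k. nat \<bar>k\<bar>) ` X. m \<le> n0" using finite_nat_set_iff_bounded_le by blast
    have "X \<subseteq> {- int n..int n}" if n: "n \<ge> n0" for n
    proof
      fix k assume "k \<in> X"
      then have "nat \<bar>k\<bar> \<le> n0" using n0 by blast
      then show "k \<in> {- int n..int n}" using n by auto
    qed
    then show "\<forall>\<^sub>F n in sequentially. finite {- int n..int n} \<and> X \<subseteq> {- int n..int n} \<and> {- int n..int n} \<subseteq> UNIV"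
      unfolding eventually_sequentially by auto
  qed
  from filterlim_compose[OF assms[unfolded has_sum_def] this] show ?thesis .
qed

text \<open>
  The double sums are, up to the factor \<open>n\<close>, the Cesaro means of the partial sums of \<open>\<Sum> a k\<close>: their
  increments are these partial sums.
\<close>

lemma infsum_nonneg_if_toeplitz_nonneg:
  fixes a :: "int \<Rightarrow> real"
  assumes S: "(a has_sum S) UNIV" and nonneg: "\<And>n::nat. 0 \<le> (\<Sum>i<n. \<Sum>j<n. a (int i - int j))"
  shows "0 \<le> S"
proof (rule ccontr)
  assume "\<not> 0 \<le> S"
  then have neg: "S < S / 2" "S / 2 < 0" by auto
  define c where "c n = (\<Sum>i<n. \<Sum>j<n. a (int i - int j))" for n
  \<comment> \<open>Going from \<open>n\<close> to \<open>n + 1\<close> adds the last row and the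
    last column of the Toeplitz matrix, whose index differences are \<open>- n, \<dots>, n\<close>,
    each once.\<close>
  have inc: "c (Suc n) = c n + (\<Sum>k\<in>{- int n..int n}. a k)" for n
  proof -
    have "{- int n..int n} = {- int n..<0} \<union> {0<..int n} \<union> {0}" by auto
    then have "(\<Sum>k\<in>{- int n..int n}. a k) = (\<Sum>k\<in>{- int n..<0}. a k) + (\<Sum>k\<in>{0<..int n}. a k) + a 0"
      by (simp only:) (subst sum.union_disjoint; simp; subst sum.union_disjoint; auto)+
    also have "(\<Sum>k\<in>{- int n..<0}. a k) = (\<Sum>i<n. a (int i - int n))"
      by (rule sum.reindex_bij_witness[of _ "\<lambda>i. int i - int n" "\<lambda>k. nat (k + int n)"]) auto
    also have "(\<Sum>k\<in>{0<..int n}. a k) = (\<Sum>j<n. a (int n - int j))"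
      by (rule sum.reindex_bij_witness[of _ "\<lambda>j. int n - int j" "\<lambda>k. nat (int n - k)"]) auto
    finally show ?thesis by (simp add: c_def sum.distrib)
  qed
  \<comment> \<open>With a negative sum, the increments of \<open>c\<close> are eventually below the
    negative number \<open>S / 2\<close>, so \<open>c\<close> becomes negative.\<close>
  from order_tendstoD(2)[OF has_sum_int_intervals[OF S] neg(1)]
  obtain N where N: "\<And>n. n \<ge> N \<Longrightarrow> (\<Sum>k\<in>{- int n..int n}. a k) < S / 2"
    by (auto simp: eventually_sequentially)
  have le: "c (N + m) \<le> c N + real m * (S / 2)" for m
  proof (induction m)
    case (Suc m)
    then show ?case using inc[of "N + m"] N[of "N + m"] by (simp add: field_simps)
  qed simp
  obtain m where "c N < real m * (- (S / 2))"
    using reals_Archimedean3[of "- (S / 2)"] neg(2) by auto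
  then show False using le[of m] nonneg[of "N + m"] by (simp add: c_def)
qed

text \<open>The dependence and moment assumptions as real L^2 bounds, uniform in \<open>t\<close>:
  \<open>d\<close> for the coupling errors, \<open>\<theta>\<close> for their tail sums,
  \<open>C\<close> for the norm, \<open>L\<close> for the Lipschitz constant. The reasoning with
  extended reals is thereby confined to the derivation of this locale.\<close>

locale weakly_dependent = iid_noise M E \<eta> \<eta>' for M :: "'w measure" and E :: "'e measure" and \<eta> \<eta>' +
  fixes H :: "real \<Rightarrow> (nat \<Rightarrow> 'e) \<Rightarrow> 'b::{banach, second_countable_topology}"
    and d \<theta> :: "nat \<Rightarrow> real" and C L :: real
  assumes H_measurable: "t \<in> {0..1} \<Longrightarrow> H t \<in> borel_measurable (PiM UNIV (\<lambda>_. E))"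
    and H_square: "t \<in> {0..1} \<Longrightarrow> integrable M (\<lambda>\<omega>. (norm (H t (past \<eta> 0 \<omega>)))\<^sup>2)"
    and H_norm: "t \<in> {0..1} \<Longrightarrow> vnorm (\<lambda>\<omega>. H t (past \<eta> 0 \<omega>)) \<le> C"
    and H_mean: "t \<in> {0..1} \<Longrightarrow> (\<integral>\<omega>. H t (past \<eta> 0 \<omega>) \<partial>M) = 0"
    and H_lipschitz: "\<lbrakk>s \<in> {0..1}; t \<in> {0..1}\<rbrakk> \<Longrightarrow>
      vnorm (\<lambda>\<omega>. H t (past \<eta> 0 \<omega>) - H s (past \<eta> 0 \<omega>)) \<le> L * \<bar>t - s\<bar>"
    and dependence: "t \<in> {0..1} \<Longrightarrow>
      vnorm (\<lambda>\<omega>. H t (past \<eta> (int j) \<omega>) - H t (past_coupled \<eta> \<eta>' (int j) \<omega>)) \<le> d j"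
    and dependence_tail: "(\<Sum>j<m. d (i + j)) \<le> \<theta> i"
    and tail_summable: "(\<lambda>i::int. \<theta> (nat \<bar>i\<bar>)) summable_on UNIV"
begin

lemma C_nonneg: "0 \<le> C"
  using H_norm[of 0] vnorm_nonneg[of "\<lambda>\<omega>. H 0 (past \<eta> 0 \<omega>)"] by simp

lemma \<theta>_nonneg: "0 \<le> \<theta> i"
  using dependence_tail[of i 0] by simp

lemma past_vnorm:
  assumes F: "F \<in> borel_measurable seqM"
  shows "vnorm (\<lambda>\<omega>. F (past \<eta> i \<omega>) :: 'b) = vnorm (\<lambda>\<omega>. F (past \<eta> 0 \<omega>))"
  using past_integral(1)[of "\<lambda>z. (norm (F (fst z)))\<^sup>2" 0 i 0] F by (simp add: vnorm_def)

lemma H_vL2: "t \<in> {0..1} \<Longrightarrow> (\<lambda>\<omega>. H t (past \<eta> i \<omega>)) \<in> vL2"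
  using past_integral(2)[of "\<lambda>z. (norm (H t (fst z)))\<^sup>2" 0 i 0] H_measurable[of t] H_square[of t]
  by (intro vL2I measurable_compose[OF past_measurable]) simp_all

lemma H_past_norm: "t \<in> {0..1} \<Longrightarrow> vnorm (\<lambda>\<omega>. H t (past \<eta> i \<omega>)) \<le> C"
  using past_vnorm[of "H t" i] H_measurable H_norm by simp

lemma H_past_lipschitz:
  "s \<in> {0..1} \<Longrightarrow> t \<in> {0..1} \<Longrightarrow> vnorm (\<lambda>\<omega>. H t (past \<eta> i \<omega>) - H s (past \<eta> i \<omega>)) \<le> L * \<bar>t - s\<bar>"
  using past_vnorm[of "\<lambda>z. H t z - H s z" i] H_measurable[of s] H_measurable[of t] H_lipschitz[of s t] by simp

abbreviation "autocov t i \<equiv> tensor_cov M (\<lambda>\<omega>. H t (past \<eta> i \<omega>)) (\<lambda>\<omega>. H t (past \<eta> 0 \<omega>))"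

lemma autocov_form:
  fixes b c :: "'b \<Rightarrow>\<^sub>L real"
  assumes t: "t \<in> {0..1}"
  shows "tensor_form (autocov t i) b c = (\<integral>\<omega>. b (H t (past \<eta> i \<omega>)) * c (H t (past \<eta> 0 \<omega>)) \<partial>M)"
  unfolding tensor_cov_def
  using integral_bounded_linear[OF bounded_linear_tensor_form[of b c]
      bilinear_expectation(1)[OF bounded_bilinear_ptensor norm_ptensor_le H_vL2[OF t, of i] H_vL2[OF t, of 0]]]
  by (simp add: tensor_form_ptensor)

lemma bilinear_stationary:
  fixes f :: "'b \<Rightarrow> 'b \<Rightarrow> 'c::{banach, second_countable_topology}"
  assumes f: "bounded_bilinear f" and t: "t \<in> {0..1}"
  shows "(\<integral>\<omega>. f (H t (past \<eta> (i + s) \<omega>)) (H t (past \<eta> (j + s) \<omega>)) \<partial>M) = (\<integral>\<omega>. f (H t (past \<eta> i \<omega>)) (H t (past \<eta> j \<omega>)) \<partial>M)"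
proof -
  have "(\<lambda>z. f (H t (fst z)) (H t (snd z))) \<in> borel_measurable (seqM \<Otimes>\<^sub>M seqM)"
  proof (rule borel_measurable_continuous_Pair[where H=f])
    show "continuous_on UNIV (\<lambda>x. f (fst x) (snd x))"
      by (rule bounded_bilinear.continuous_on[OF f]) (intro continuous_intros)+
  qed (use H_measurable[OF t] in measurable)
  from past_integral(1)[OF this, of i s j] show ?thesis by simp
qed

text \<open>A negative lag is moved to the other factor by stationarity, and the bound for
  nonnegative lags is applied to the flipped tensor product.\<close>

lemma autocov_bound:
  assumes t: "t \<in> {0..1}"
  shows "norm (autocov t i) \<le> C * \<theta> (nat \<bar>i\<bar>)"
proof -
  have bound: "norm (\<integral>\<omega>. f (H t (past \<eta> (int n) \<omega>)) (H t (past \<eta> 0 \<omega>)) \<partial>M) \<le> C * \<theta> n"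
    if f: "bounded_bilinear f" "\<And>x y. norm (f x y) \<le> norm x * norm y" for f :: "'b \<Rightarrow> 'b \<Rightarrow> 'b ptensor" and n
    using bilinear_cov_bound[OF H_measurable[OF t] H_square[OF t] H_mean[OF t] f dependence[OF t] dependence_tail, of n]
      mult_right_mono[OF H_norm[OF t] \<theta>_nonneg[of n]] by (rule order_trans)
  show ?thesis
  proof (cases "0 \<le> i")
    case True
    then show ?thesis using bound[OF bounded_bilinear_ptensor norm_ptensor_le, of "nat i"] by (simp add: tensor_cov_def)
  next
    case False
    have "autocov t i = (\<integral>\<omega>. H t (past \<eta> 0 \<omega>) \<otimes>\<^sub>\<pi> H t (past \<eta> (- i) \<omega>) \<partial>M)"
      using bilinear_stationary[OF bounded_bilinear_ptensor t, of 0 i "- i"] by (simp add: tensor_cov_def)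
    moreover have "norm (y \<otimes>\<^sub>\<pi> x) \<le> norm x * norm y" for x y :: 'b
      using norm_ptensor_le[of y x] by (simp add: mult.commute)
    ultimately show ?thesis
      using bound[OF bounded_bilinear.flip[OF bounded_bilinear_ptensor], of "nat (- i)"] False by simp
  qed
qed

lemma autocov_abs_summable:
  assumes t: "t \<in> {0..1}"
  shows "(\<lambda>i. norm (autocov t i)) summable_on UNIV"
    and "(\<Sum>\<^sub>\<infinity>i. norm (autocov t i)) \<le> C * (\<Sum>\<^sub>\<infinity>i::int. \<theta> (nat \<bar>i\<bar>))"
proof -
  have s: "(\<lambda>i::int. C * \<theta> (nat \<bar>i\<bar>)) summable_on UNIV" by (rule summable_on_cmult_right[OF tail_summable])
  show 1: "(\<lambda>i. norm (autocov t i)) summable_on UNIV"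
    by (rule summable_on_comparison_test[OF s]) (auto simp: autocov_bound[OF t])
  have "(\<Sum>\<^sub>\<infinity>i. norm (autocov t i)) \<le> (\<Sum>\<^sub>\<infinity>i::int. C * \<theta> (nat \<bar>i\<bar>))"
    by (rule infsum_mono[OF 1 s]) (rule autocov_bound[OF t])
  also have "\<dots> = C * (\<Sum>\<^sub>\<infinity>i::int. \<theta> (nat \<bar>i\<bar>))" by (rule infsum_cmult_right') 
  finally show "(\<Sum>\<^sub>\<infinity>i. norm (autocov t i)) \<le> C * (\<Sum>\<^sub>\<infinity>i::int. \<theta> (nat \<bar>i\<bar>))" .
qed

lemma local_lrv_has_sum: "t \<in> {0..1} \<Longrightarrow> (autocov t has_sum local_lrv M \<eta> H t) UNIV"
  unfolding local_lrv_def by (rule has_sum_infsum[OF abs_summable_summable[OF autocov_abs_summable(1)]])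

lemma local_lrv_bound: "t \<in> {0..1} \<Longrightarrow> norm (local_lrv M \<eta> H t) \<le> C * (\<Sum>\<^sub>\<infinity>i::int. \<theta> (nat \<bar>i\<bar>))"
  unfolding local_lrv_def
  using norm_infsum_bound[OF autocov_abs_summable(1)] autocov_abs_summable(2) by (rule order_trans)

lemma local_lrv_form_has_sum:
  fixes b c :: "'b \<Rightarrow>\<^sub>L real"
  assumes t: "t \<in> {0..1}"
  shows "((\<lambda>i. \<integral>\<omega>. b (H t (past \<eta> i \<omega>)) * c (H t (past \<eta> 0 \<omega>)) \<partial>M) has_sum tensor_form (local_lrv M \<eta> H t) b c) UNIV"
  using has_sum_bounded_linear[OF bounded_linear_tensor_form[of b c] local_lrv_has_sum[OF t]]
  by (simp add: autocov_form[OF t])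

lemma bounded_bilinear_functionals:
  fixes b c :: "'b \<Rightarrow>\<^sub>L real"
  shows "bounded_bilinear (\<lambda>x y. blinfun_apply b x * blinfun_apply c y)"
  using bounded_bilinear.comp[OF bounded_bilinear_mult blinfun.bounded_linear_right[of b] blinfun.bounded_linear_right[of c]] .

text \<open>By stationarity, reversing the lag exchanges \<open>b\<close> and \<open>c\<close>, and
  a sum over all integers is invariant under reflection. For nonnegativity, the Toeplitz sums of the
  autocovariances are second moments of sums of \<open>b (H t (past \<eta> i \<omega>))\<close> over
  \<open>i < n\<close>.\<close>

lemma cov_tensor_local_lrv:
  assumes t: "t \<in> {0..1}"
  shows "cov_tensor (local_lrv M \<eta> H t)"
  unfolding cov_tensor_def
proof (intro conjI allI)
  define r where "r b c i = (\<integral>\<omega>. b (H t (past \<eta> i \<omega>)) * c (H t (past \<eta> 0 \<omega>)) \<partial>M)" for b c :: "'b \<Rightarrow>\<^sub>L real" and i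
  have sum: "(r b c has_sum tensor_form (local_lrv M \<eta> H t) b c) UNIV" for b c
    unfolding r_def by (rule local_lrv_form_has_sum[OF t])
  have shift: "(\<integral>\<omega>. b (H t (past \<eta> i \<omega>)) * c (H t (past \<eta> j \<omega>)) \<partial>M) = r b c (i - j)" for b c :: "'b \<Rightarrow>\<^sub>L real" and i j
    using bilinear_stationary[OF bounded_bilinear_functionals t, of b "i - j" j c 0] by (simp add: r_def)
  show "tensor_form (local_lrv M \<eta> H t) b c = tensor_form (local_lrv M \<eta> H t) c b" for b c
  proof -
    have "r b c (- i) = r c b i" for i
      using shift[of b 0 c i] by (simp add: r_def mult.commute)
    moreover have "bij_betw uminus (UNIV :: int set) UNIV" by (rule bij_uminus)
    ultimately have "(r c b has_sum tensor_form (local_lrv M \<eta> H t) b c) UNIV"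
      using sum[of b c] has_sum_reindex_bij_betw[of uminus UNIV UNIV "r b c"] by simp
    with sum[of c b] show ?thesis by (rule has_sum_unique[symmetric])
  qed
  show "0 \<le> tensor_form (local_lrv M \<eta> H t) b b" for b
  proof (rule infsum_nonneg_if_toeplitz_nonneg[OF sum])
    fix n :: nat
    have L: "integrable M (\<lambda>\<omega>. b (H t (past \<eta> i \<omega>)) * b (H t (past \<eta> j \<omega>)))" for i j
    proof -
      have bL: "(\<lambda>\<omega>. b (H t (past \<eta> i \<omega>))) \<in> L2 M" for i
      proof -
        have i: "integrable M (\<lambda>\<omega>. (norm b)\<^sup>2 * (norm (H t (past \<eta> i \<omega>)))\<^sup>2)"
          using vL2_integrable(2)[OF H_vL2[OF t, of i]] by simp
        have m: "(\<lambda>\<omega>. b (H t (past \<eta> i \<omega>))) \<in> borel_measurable M"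
          by (rule borel_measurable_continuous_on[OF _ measurable_compose[OF past_measurable H_measurable[OF t]]]) (intro continuous_intros)
        have le: "(b x)\<^sup>2 \<le> (norm b)\<^sup>2 * (norm x)\<^sup>2" for x
          using power_mono[OF norm_blinfun[of b x], of 2] by (simp add: power_mult_distrib)
        have "integrable M (\<lambda>\<omega>. (b (H t (past \<eta> i \<omega>)))\<^sup>2)"
        proof (rule Bochner_Integration.integrable_bound[OF i])
          show "(\<lambda>\<omega>. (b (H t (past \<eta> i \<omega>)))\<^sup>2) \<in> borel_measurable M" by (rule borel_measurable_power[OF m])
        qed (use le in simp)
        with m show ?thesis by (simp add: L2_def)
      qed
      show ?thesis by (rule L2_mult_integrable[OF bL bL])
    qed
    have "0 \<le> (\<integral>\<omega>. (\<Sum>i<n. b (H t (past \<eta> (int i) \<omega>)))\<^sup>2 \<partial>M)" by simp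
    also have "\<dots> = (\<integral>\<omega>. (\<Sum>i<n. \<Sum>j<n. b (H t (past \<eta> (int i) \<omega>)) * b (H t (past \<eta> (int j) \<omega>))) \<partial>M)"
      by (simp add: power2_eq_square sum_product)
    also have "\<dots> = (\<Sum>i<n. \<Sum>j<n. r b b (int i - int j))"
      by (simp add: Bochner_Integration.integral_sum[OF Bochner_Integration.integrable_sum[OF L]]
          Bochner_Integration.integral_sum[OF L] shift)
    finally show "0 \<le> (\<Sum>i<n. \<Sum>j<n. r b b (int i - int j))" .
  qed
qed

text \<open>The L^2 Lipschitz bound on \<open>H\<close>, applied to the two factors in turn, makes
  each autocovariance Lipschitz in \<open>t\<close>.\<close>

lemma autocov_continuous: "continuous_on {0..1} (\<lambda>t. autocov t i)"
proof (rule lipschitz_on_continuous_on[where L="2 * C * \<bar>L\<bar>"], rule lipschitz_onI)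
  fix s t :: real assume s: "s \<in> {0..1}" and t: "t \<in> {0..1}"
  interpret p: bounded_bilinear "(\<otimes>\<^sub>\<pi>) :: 'b \<Rightarrow> _" by (rule bounded_bilinear_ptensor)
  note bE = bilinear_expectation[OF bounded_bilinear_ptensor norm_ptensor_le]
  let ?D = "\<lambda>i \<omega>. H s (past \<eta> i \<omega>) - H t (past \<eta> i \<omega>)"
  have D: "?D i \<in> vL2" for i by (rule vL2_diff[OF H_vL2[OF s] H_vL2[OF t]])
  have Dn: "vnorm (?D i) \<le> \<bar>L\<bar> * \<bar>t - s\<bar>" for i
  proof -
    have "vnorm (?D i) \<le> L * \<bar>s - t\<bar>" by (rule H_past_lipschitz[OF t s])
    also have "\<dots> \<le> \<bar>L\<bar> * \<bar>t - s\<bar>" by (simp add: abs_minus_commute mult_right_mono)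
    finally show ?thesis .
  qed
  have "autocov s i - autocov t i = (\<integral>\<omega>. H s (past \<eta> i \<omega>) \<otimes>\<^sub>\<pi> H s (past \<eta> 0 \<omega>) - H t (past \<eta> i \<omega>) \<otimes>\<^sub>\<pi> H t (past \<eta> 0 \<omega>) \<partial>M)"
    unfolding tensor_cov_def by (rule Bochner_Integration.integral_diff[symmetric]; rule bE(1)[OF H_vL2 H_vL2]; fact)
  also have "\<dots> = (\<integral>\<omega>. ?D i \<omega> \<otimes>\<^sub>\<pi> H s (past \<eta> 0 \<omega>) + H t (past \<eta> i \<omega>) \<otimes>\<^sub>\<pi> ?D 0 \<omega> \<partial>M)"
    by (simp add: p.diff_left p.diff_right)
  also have "\<dots> = (\<integral>\<omega>. ?D i \<omega> \<otimes>\<^sub>\<pi> H s (past \<eta> 0 \<omega>) \<partial>M) + (\<integral>\<omega>. H t (past \<eta> i \<omega>) \<otimes>\<^sub>\<pi> ?D 0 \<omega> \<partial>M)"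
    by (rule Bochner_Integration.integral_add[OF bE(1)[OF D H_vL2[OF s]] bE(1)[OF H_vL2[OF t] D]])
  finally have "norm (autocov s i - autocov t i) \<le> norm (\<integral>\<omega>. ?D i \<omega> \<otimes>\<^sub>\<pi> H s (past \<eta> 0 \<omega>) \<partial>M) + norm (\<integral>\<omega>. H t (past \<eta> i \<omega>) \<otimes>\<^sub>\<pi> ?D 0 \<omega> \<partial>M)"
    by (simp only: norm_triangle_ineq)
  also have "\<dots> \<le> vnorm (?D i) * vnorm (\<lambda>\<omega>. H s (past \<eta> 0 \<omega>)) + vnorm (\<lambda>\<omega>. H t (past \<eta> i \<omega>)) * vnorm (?D 0)"
    by (rule add_mono[OF bE(2)[OF D H_vL2[OF s]] bE(2)[OF H_vL2[OF t] D]])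
  also have "\<dots> \<le> (\<bar>L\<bar> * \<bar>t - s\<bar>) * C + C * (\<bar>L\<bar> * \<bar>t - s\<bar>)"
    by (intro add_mono mult_mono Dn H_past_norm s t vnorm_nonneg C_nonneg) auto
  finally show "dist (autocov s i) (autocov t i) \<le> 2 * C * \<bar>L\<bar> * dist s t"
    by (simp add: dist_norm abs_minus_commute algebra_simps)
qed (simp add: C_nonneg)

text \<open>A pointwise limit of the sums over symmetric intervals of lags, each continuous on the
  unit interval.\<close>

lemma local_lrv_measurable:
  "(\<lambda>u. if u \<in> {0..1} then local_lrv M \<eta> H u else 0) \<in> borel_measurable borel"
proof (rule borel_measurable_LIMSEQ_metric)
  fix n :: nat
  have "continuous_on {0..1} (\<lambda>t. \<Sum>i\<in>{- int n..int n}. autocov t i)"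
    by (intro continuous_on_sum autocov_continuous)
  then show "(\<lambda>u. if u \<in> {0..1} then \<Sum>i\<in>{- int n..int n}. autocov u i else 0) \<in> borel_measurable borel"
    by (intro borel_measurable_continuous_on_if) auto
next
  fix u :: real
  show "(\<lambda>n. if u \<in> {0..1} then \<Sum>i\<in>{- int n..int n}. autocov u i else 0) \<longlonglongrightarrow> (if u \<in> {0..1} then local_lrv M \<eta> H u else 0)"
  proof (cases "u \<in> {0..1}")
    case True
    from has_sum_int_intervals[OF local_lrv_has_sum[OF this]] show ?thesis unfolding if_P[OF True] .
  next
    case False
    show ?thesis unfolding if_not_P[OF False] by (rule tendsto_const)
  qed
qed

end

section \<open>Real L^2 bounds from the extended-real conditions\<close>

lemma Lp_enorm_leD:
  assumes "Lp_enorm M \<rho> Z \<le> ennreal D" "0 \<le> D" "0 < \<rho>"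
  shows "(\<integral>\<^sup>+\<omega>. ennreal (norm (Z \<omega>) powr \<rho>) \<partial>M) \<le> ennreal (D powr \<rho>)"
proof -
  define x where "x = (\<integral>\<^sup>+\<omega>. ennreal (norm (Z \<omega>) powr \<rho>) \<partial>M)"
  have e: "epowr x (1 / \<rho>) \<le> ennreal D" using assms(1) by (simp add: Lp_enorm_def x_def)
  have x: "x \<noteq> \<infinity>" using e by (auto simp: epowr_def top_unique)
  then have "enn2real x powr (1 / \<rho>) \<le> D" using e assms(2) by (simp add: epowr_def)
  then have "(enn2real x powr (1 / \<rho>)) powr \<rho> \<le> D powr \<rho>" using assms(3) by (intro powr_mono2) auto
  then have "enn2real x \<le> D powr \<rho>" using assms(3) by (simp add: powr_powr)
  then have "ennreal (enn2real x) \<le> ennreal (D powr \<rho>)" by (rule ennreal_leI)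
  moreover have "ennreal (enn2real x) = x" using x by (simp add: less_top)
  ultimately show ?thesis by (simp only: x_def)
qed

text \<open>Below the threshold \<open>s\<close> the square is at most \<open>s\<^sup>2\<close>;
  above it, the factor \<open>z powr \<kappa> / s powr \<kappa>\<close> is at least 1. This compares
  moments of order 2 and \<open>2 + \<kappa>\<close> in an elementary way.\<close>

lemma square_le_powr:
  fixes z s \<kappa> :: real
  assumes "0 \<le> z" "0 < s" "0 < \<kappa>"
  shows "z\<^sup>2 \<le> s\<^sup>2 + z powr (2 + \<kappa>) / s powr \<kappa>"
proof (cases "z \<le> s")
  case True
  then have "z\<^sup>2 \<le> s\<^sup>2" using assms by (intro power_mono) auto
  then show ?thesis by (simp add: add_increasing2)
next
  case False
  then have z: "0 < z" using assms by simp
  have "z\<^sup>2 * s powr \<kappa> \<le> z\<^sup>2 * z powr \<kappa>" using False assms by (intro mult_left_mono powr_mono2) auto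
  also have "\<dots> = z powr (2 + \<kappa>)" using z by (simp add: powr_add powr_numeral)
  finally have "z\<^sup>2 \<le> z powr (2 + \<kappa>) / s powr \<kappa>" using assms by (simp add: field_simps)
  then show ?thesis by (simp add: add_increasing)
qed

context prob_space
begin

lemma vL2_nn:
  assumes Z: "Z \<in> borel_measurable M" and K: "(\<integral>\<^sup>+\<omega>. ennreal ((norm (Z \<omega>))\<^sup>2) \<partial>M) \<le> ennreal (K\<^sup>2)" and "0 \<le> K"
  shows "Z \<in> vL2" "vnorm Z \<le> K"
proof -
  have int: "integrable M (\<lambda>\<omega>. (norm (Z \<omega>))\<^sup>2)"
    using Z K by (intro integrableI_bounded) (auto intro: le_less_trans)
  then show "Z \<in> vL2" by (rule vL2I[OF Z])
  have "ennreal (\<integral>\<omega>. (norm (Z \<omega>))\<^sup>2 \<partial>M) \<le> ennreal (K\<^sup>2)"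
    using K nn_integral_eq_integral[OF int] by simp
  then have "(\<integral>\<omega>. (norm (Z \<omega>))\<^sup>2 \<partial>M) \<le> K\<^sup>2" by simp
  then show "vnorm Z \<le> K" unfolding vnorm_def using \<open>0 \<le> K\<close> real_le_lsqrt by (simp add: real_sqrt_le_iff)
qed

text \<open>With threshold \<open>s\<close> both terms of \<open>square_le_powr\<close> contribute
  at most \<open>s\<^sup>2\<close>, which is the origin of the factor \<open>sqrt 2\<close>.
  Thresholds just above \<open>D\<close> are used, as \<open>D\<close> may be 0.\<close>

lemma vL2_powr:
  assumes Z: "Z \<in> borel_measurable M" and D: "(\<integral>\<^sup>+\<omega>. ennreal (norm (Z \<omega>) powr (2 + \<kappa>)) \<partial>M) \<le> ennreal (D powr (2 + \<kappa>))"
    and "0 \<le> D" and \<kappa>: "0 < \<kappa>"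
  shows "Z \<in> vL2" "vnorm Z \<le> sqrt 2 * D"
proof -
  note [measurable] = Z
  have b: "Z \<in> vL2 \<and> vnorm Z \<le> sqrt 2 * s" if s: "D \<le> s" "0 < s" for s
  proof -
    have "(\<integral>\<^sup>+\<omega>. ennreal ((norm (Z \<omega>))\<^sup>2) \<partial>M)
        \<le> (\<integral>\<^sup>+\<omega>. ennreal (s\<^sup>2) + ennreal (1 / s powr \<kappa>) * ennreal (norm (Z \<omega>) powr (2 + \<kappa>)) \<partial>M)"
    proof (rule nn_integral_mono)
      fix \<omega>
      have "ennreal ((norm (Z \<omega>))\<^sup>2) \<le> ennreal (s\<^sup>2 + norm (Z \<omega>) powr (2 + \<kappa>) / s powr \<kappa>)"
        by (intro ennreal_leI square_le_powr) (use s \<kappa> in auto)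
      then show "ennreal ((norm (Z \<omega>))\<^sup>2) \<le> ennreal (s\<^sup>2) + ennreal (1 / s powr \<kappa>) * ennreal (norm (Z \<omega>) powr (2 + \<kappa>))"
        by (simp add: ennreal_plus ennreal_mult[symmetric])
    qed
    also have "\<dots> = ennreal (s\<^sup>2) + ennreal (1 / s powr \<kappa>) * (\<integral>\<^sup>+\<omega>. ennreal (norm (Z \<omega>) powr (2 + \<kappa>)) \<partial>M)"
      by (simp add: nn_integral_add nn_integral_cmult emeasure_space_1)
    also have "\<dots> \<le> ennreal (s\<^sup>2) + ennreal (1 / s powr \<kappa>) * ennreal (s powr (2 + \<kappa>))"
      using s \<open>0 \<le> D\<close> \<kappa> by (intro add_left_mono mult_left_mono order_trans[OF D] ennreal_leI powr_mono2) auto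
    also have "\<dots> = ennreal ((sqrt 2 * s)\<^sup>2)"
      using s by (simp add: ennreal_mult[symmetric] ennreal_plus[symmetric] powr_add powr_numeral power_mult_distrib del: ennreal_plus)
    finally show ?thesis using vL2_nn[OF Z, of "sqrt 2 * s"] s by simp
  qed
  show "Z \<in> vL2" using b[of "D + 1"] \<open>0 \<le> D\<close> by simp
  show "vnorm Z \<le> sqrt 2 * D"
  proof (rule field_le_epsilon)
    fix \<epsilon> :: real assume "0 < \<epsilon>"
    then show "vnorm Z \<le> sqrt 2 * D + \<epsilon>" using b[of "D + \<epsilon> / sqrt 2"] \<open>0 \<le> D\<close> by (simp add: distrib_left add_nonneg_pos)
  qed
qed

lemma norm_expectation_le: "Z \<in> vL2 \<Longrightarrow> norm (\<integral>\<omega>. Z \<omega> \<partial>M) \<le> vnorm Z"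
  using indicator_expectation_le(2)[of "\<lambda>_. True" Z] by (simp add: prob_space)

end

lemma real_infsum_le_ennreal:
  fixes f :: "'a \<Rightarrow> ennreal"
  assumes "infsum f A < \<infinity>"
  shows "(\<lambda>x. enn2real (f x)) summable_on A" and "x \<in> A \<Longrightarrow> f x < \<infinity>"
proof -
  have le: "sum f F \<le> infsum f A" if "finite F" "F \<subseteq> A" for F
    using infsum_mono_neutral[of f F f A] nonneg_summable_on_complete[of A f] that by auto
  show fin: "f x < \<infinity>" if "x \<in> A" for x
    using le[of "{x}"] that assms by (auto intro: le_less_trans)
  have "sum (\<lambda>x. enn2real (f x)) F \<le> enn2real (infsum f A)" if F: "finite F" "F \<subseteq> A" for F
  proof -
    have "ennreal (sum (\<lambda>x. enn2real (f x)) F) = (\<Sum>x\<in>F. ennreal (enn2real (f x)))" by (rule sum_ennreal[symmetric]) simp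
    also have "\<dots> = sum f F" using fin F by (intro sum.cong) (auto simp: subset_iff)
    also have "\<dots> \<le> ennreal (enn2real (infsum f A))" using le[OF F] assms by simp
    finally show ?thesis by simp
  qed
  then show "(\<lambda>x. enn2real (f x)) summable_on A"
    by (intro nonneg_bdd_above_summable_on bdd_aboveI[of _ "enn2real (infsum f A)"]) auto
qed

text \<open>Rounding up, with the maximum with 1 because rows of the array start at
  \<open>i = 1\<close>, so that \<open>t = 0\<close> is served by the first grid point.\<close>

lemma grid_point_near:
  fixes t :: real and n :: nat
  assumes t: "t \<in> {0..1}" and n: "1 \<le> n"
  obtains i where "1 \<le> i" "i \<le> n" "\<bar>t - real i / real n\<bar> \<le> 1 / real n"
proof
  define i where "i = max 1 (nat \<lceil>t * real n\<rceil>)"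
  show "1 \<le> i" by (simp add: i_def)
  have tn: "0 \<le> t * real n" "t * real n \<le> real n" using t by (auto intro: mult_left_le_one_le)
  then have "\<lceil>t * real n\<rceil> \<le> int n" by (simp add: ceiling_le_iff)
  then have "nat \<lceil>t * real n\<rceil> \<le> n" by linarith
  then show "i \<le> n" using n unfolding i_def by (rule max.boundedI[rotated])
  have "0 \<le> \<lceil>t * real n\<rceil>" using tn(1) by linarith
  then have "\<bar>t * real n - real i\<bar> \<le> 1"
    using tn unfolding i_def max_def by (auto split: if_splits) linarith+
  moreover have "t - real i / real n = (t * real n - real i) / real n"
    using n by (simp add: field_simps)
  ultimately show "\<bar>t - real i / real n\<bar> \<le> 1 / real n" using n by (simp add: divide_right_mono)
qed

lemma weakly_dependent_if_moment_dependence_condition: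
  fixes H :: "real \<Rightarrow> (nat \<Rightarrow> 'e) \<Rightarrow> 'b::{banach, second_countable_topology}"
  assumes iid: "iid_with_copy M E \<eta> \<eta>'" and cond: "moment_dependence_condition M E \<eta> \<eta>' H \<mu> X \<kappa>"
  shows "\<exists>d \<theta> C L. weakly_dependent M E \<eta> \<eta>' H d \<theta> C L"
proof -
  interpret prob_space M using iid by (simp add: iid_with_copy_def)
  interpret iid_noise M E \<eta> \<eta>' by standard (use iid in \<open>auto simp: iid_with_copy_def\<close>)
  obtain \<epsilon> where stat: "locally_stationary M E \<eta> H \<epsilon>"
    and centered: "\<And>n i. 1 \<le> i \<Longrightarrow> i \<le> n \<Longrightarrow> (\<integral>\<omega>. \<epsilon> i n \<omega> \<partial>M) = 0"
    using cond by (auto simp: moment_dependence_condition_def)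
  have \<kappa>: "0 < \<kappa>" and lip: "lipschitz_L2 M \<eta> H"
    and mom: "(SUP t\<in>{0..1}. \<integral>\<^sup>+\<omega>. ennreal (norm (H t (past \<eta> 0 \<omega>)) powr (2 + \<kappa>)) \<partial>M) < \<infinity>"
    and tails: "(\<Sum>\<^sub>\<infinity>k\<in>(UNIV :: int set). dep_tail M \<eta> \<eta>' H (2 + \<kappa>) (nat \<bar>k\<bar>)) < \<infinity>"
    using cond by (simp_all add: moment_dependence_condition_def)
  have Hm: "H t \<in> borel_measurable seqM" if "t \<in> {0..1}" for t
    using stat that by (simp add: locally_stationary_def)
  have pm: "past \<eta> i \<in> measurable M seqM" for i unfolding past_draw by measurable
  have pcm: "past_coupled \<eta> \<eta>' i \<in> measurable M seqM" for i unfolding past_coupled_draw by measurable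
  have Hp: "(\<lambda>\<omega>. H t (past \<eta> i \<omega>)) \<in> borel_measurable M" if "t \<in> {0..1}" for t i
    by (rule measurable_compose[OF pm Hm[OF that]])

  define S where "S = (SUP t\<in>{0..1}. \<integral>\<^sup>+\<omega>. ennreal (norm (H t (past \<eta> 0 \<omega>)) powr (2 + \<kappa>)) \<partial>M)"
  \<comment> \<open>Chosen with \<open>D powr (2 + \<kappa>) = S\<close>, the shape required by
    \<open>vL2_powr\<close>.\<close>
  define D where "D = enn2real S powr (1 / (2 + \<kappa>))"
  have DS: "ennreal (D powr (2 + \<kappa>)) = S" using mom \<kappa> by (simp add: D_def S_def powr_powr less_top)
  have H0: "(\<lambda>\<omega>. H t (past \<eta> 0 \<omega>)) \<in> vL2" "vnorm (\<lambda>\<omega>. H t (past \<eta> 0 \<omega>)) \<le> sqrt 2 * D" if t: "t \<in> {0..1}" for t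
  proof -
    have "(\<integral>\<^sup>+\<omega>. ennreal (norm (H t (past \<eta> 0 \<omega>)) powr (2 + \<kappa>)) \<partial>M) \<le> ennreal (D powr (2 + \<kappa>))"
      unfolding DS S_def by (rule SUP_upper[OF t])
    from vL2_powr[OF Hp[OF t] this _ \<kappa>]
    show "(\<lambda>\<omega>. H t (past \<eta> 0 \<omega>)) \<in> vL2" "vnorm (\<lambda>\<omega>. H t (past \<eta> 0 \<omega>)) \<le> sqrt 2 * D" by (simp_all add: D_def)
  qed

  define R where "R = (SUP (s, t)\<in>{(s, t). 0 \<le> s \<and> s < t \<and> t \<le> 1}.
        Lp_enorm M 2 (\<lambda>\<omega>. H t (past \<eta> 0 \<omega>) - H s (past \<eta> 0 \<omega>)) / ennreal (t - s))"
  have R: "R < \<infinity>" using lip unfolding lipschitz_L2_def R_def by blast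
  define L where "L = enn2real R"
  have lip1: "vnorm (\<lambda>\<omega>. H t (past \<eta> 0 \<omega>) - H s (past \<eta> 0 \<omega>)) \<le> L * (t - s)" if st: "0 \<le> s" "s < t" "t \<le> 1" for s t
  proof -
    let ?x = "Lp_enorm M 2 (\<lambda>\<omega>. H t (past \<eta> 0 \<omega>) - H s (past \<eta> 0 \<omega>))"
    have "?x / ennreal (t - s) \<le> R"
      unfolding R_def using st by (intro SUP_upper2[of "(s, t)"]) auto
    then have "?x / ennreal (t - s) * ennreal (t - s) \<le> R * ennreal (t - s)" by (intro mult_right_mono) auto
    also have "?x / ennreal (t - s) * ennreal (t - s) = ?x"
      using st by (simp add: ennreal_divide_times ennreal_divide_self)
    also have "R * ennreal (t - s) = ennreal (L * (t - s))"
      using R st by (simp add: L_def ennreal_mult less_top)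
    finally have "(\<integral>\<^sup>+\<omega>. ennreal (norm (H t (past \<eta> 0 \<omega>) - H s (past \<eta> 0 \<omega>)) powr 2) \<partial>M) \<le> ennreal ((L * (t - s)) powr 2)"
      using st by (intro Lp_enorm_leD) (auto simp: L_def)
    moreover have "norm x powr 2 = (norm x)\<^sup>2" for x :: 'b by (cases "x = 0") (simp_all add: powr_numeral)
    moreover have "(L * (t - s)) powr 2 \<le> (L * (t - s))\<^sup>2" using st by (cases "L = 0") (simp_all add: L_def powr_numeral)
    ultimately have "(\<integral>\<^sup>+\<omega>. ennreal ((norm (H t (past \<eta> 0 \<omega>) - H s (past \<eta> 0 \<omega>)))\<^sup>2) \<partial>M) \<le> ennreal ((L * (t - s))\<^sup>2)"
      by (auto intro: order_trans ennreal_leI)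
    then show ?thesis
      using st by (intro vL2_nn(2) borel_measurable_diff Hp) (auto simp: L_def)
  qed
  have lip2: "vnorm (\<lambda>\<omega>. H t (past \<eta> 0 \<omega>) - H s (past \<eta> 0 \<omega>)) \<le> L * \<bar>t - s\<bar>" if st: "s \<in> {0..1}" "t \<in> {0..1}" for s t
  proof -
    consider "s < t" | "s = t" | "t < s" by linarith
    then show ?thesis
    proof cases
      case 1
      then show ?thesis using lip1[of s t] st by simp
    next
      case 2
      then show ?thesis by (simp add: vnorm_def)
    next
      case 3
      have "vnorm (\<lambda>\<omega>. H t (past \<eta> 0 \<omega>) - H s (past \<eta> 0 \<omega>)) = vnorm (\<lambda>\<omega>. H s (past \<eta> 0 \<omega>) - H t (past \<eta> 0 \<omega>))"
        unfolding vnorm_def by (simp add: norm_minus_commute)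
      then show ?thesis using lip1[of t s] st 3 by simp
    qed
  qed

  have grid: "(\<integral>\<omega>. H (real i / real n) (past \<eta> 0 \<omega>) \<partial>M) = 0" if i: "1 \<le> i" "i \<le> n" for i n
  proof -
    have t: "real i / real n \<in> {0..1}" using i by (auto simp: field_simps)
    have "(\<integral>\<omega>. H (real i / real n) (past \<eta> 0 \<omega>) \<partial>M) = (\<integral>\<omega>. H (real i / real n) (past \<eta> (int i) \<omega>) \<partial>M)"
      using past_integral(1)[of "\<lambda>z. H (real i / real n) (fst z)" 0 "int i" 0] Hm[OF t] by simp
    also have "\<dots> = (\<integral>\<omega>. \<epsilon> i n \<omega> \<partial>M)"
      using stat i by (intro Bochner_Integration.integral_cong) (auto simp: locally_stationary_def)
    finally show ?thesis using centered[OF i] by simp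
  qed
  \<comment> \<open>The errors are centered only at the grid times \<open>i / n\<close>. The L^2
    Lipschitz bound carries the zero mean to every \<open>t\<close>, with an error at most
    \<open>L / (n + 1)\<close> for each \<open>n\<close>.\<close>
  have mean: "(\<integral>\<omega>. H t (past \<eta> 0 \<omega>) \<partial>M) = 0" if t: "t \<in> {0..1}" for t
  proof -
    have "norm (\<integral>\<omega>. H t (past \<eta> 0 \<omega>) \<partial>M) \<le> L * (1 / real (Suc n))" for n
    proof -
      obtain i where i: "1 \<le> i" "i \<le> Suc n" "\<bar>t - real i / real (Suc n)\<bar> \<le> 1 / real (Suc n)"
        using grid_point_near[OF t, of "Suc n"] by auto
      define s where "s = real i / real (Suc n)"
      have s: "s \<in> {0..1}" using i(1,2) by (auto simp: s_def field_simps)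
      have "(\<integral>\<omega>. H t (past \<eta> 0 \<omega>) \<partial>M) = (\<integral>\<omega>. H t (past \<eta> 0 \<omega>) - H s (past \<eta> 0 \<omega>) \<partial>M)"
        using Bochner_Integration.integral_diff[OF vL2_integrable(1)[OF H0(1)[OF t]] vL2_integrable(1)[OF H0(1)[OF s]]]
          grid[OF i(1,2), folded s_def] by simp
      also have "norm \<dots> \<le> vnorm (\<lambda>\<omega>. H t (past \<eta> 0 \<omega>) - H s (past \<eta> 0 \<omega>))"
        by (rule norm_expectation_le[OF vL2_diff[OF H0(1)[OF t] H0(1)[OF s]]])
      also have "\<dots> \<le> L * \<bar>t - s\<bar>" by (rule lip2[OF s t])
      also have "\<dots> \<le> L * (1 / real (Suc n))" using i(3) by (intro mult_left_mono) (auto simp: s_def L_def)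
      finally show ?thesis .
    qed
    moreover have "(\<lambda>n. L * (1 / real (Suc n))) \<longlonglongrightarrow> 0"
      using tendsto_mult_right_zero[OF LIMSEQ_inverse_real_of_nat, of L] by (simp add: inverse_eq_divide)
    ultimately have "norm (\<integral>\<omega>. H t (past \<eta> 0 \<omega>) \<partial>M) \<le> 0" by (intro LIMSEQ_le_const) auto
    then show ?thesis by simp
  qed

  define p where "p = phys_dep M \<eta> \<eta>' H (2 + \<kappa>)"
  \<comment> \<open>The factor \<open>sqrt 2\<close> is the price of passing from moments of order
    \<open>2 + \<kappa>\<close> to second moments in \<open>vL2_powr\<close>.\<close>
  define d where "d j = sqrt 2 * enn2real (p j)" for j
  define \<theta> where "\<theta> i = sqrt 2 * enn2real (dep_tail M \<eta> \<eta>' H (2 + \<kappa>) i)" for i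
  have tail_fin: "dep_tail M \<eta> \<eta>' H (2 + \<kappa>) i < \<infinity>" for i
    using real_infsum_le_ennreal(2)[OF tails, of "int i"] by simp
  have tail: "dep_tail M \<eta> \<eta>' H (2 + \<kappa>) i = (\<Sum>j. p (i + j))" for i by (simp add: dep_tail_def p_def)
  have p_fin: "p j < \<infinity>" for j
    using ennreal_suminf_lessD[of "\<lambda>i. p (0 + i)" \<infinity> j] tail_fin[of 0] by (simp add: tail)
  have dep: "vnorm (\<lambda>\<omega>. H t (past \<eta> (int j) \<omega>) - H t (past_coupled \<eta> \<eta>' (int j) \<omega>)) \<le> d j" if t: "t \<in> {0..1}" for t j
    unfolding d_def
  proof (rule vL2_powr(2)[OF _ Lp_enorm_leD])
    show "(\<lambda>\<omega>. H t (past \<eta> (int j) \<omega>) - H t (past_coupled \<eta> \<eta>' (int j) \<omega>)) \<in> borel_measurable M"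
      by (intro borel_measurable_diff Hp[OF t] measurable_compose[OF pcm Hm[OF t]])
    have "Lp_enorm M (2 + \<kappa>) (\<lambda>\<omega>. H t (past \<eta> (int j) \<omega>) - H t (past_coupled \<eta> \<eta>' (int j) \<omega>)) \<le> p j"
      unfolding p_def phys_dep_def by (rule SUP_upper[OF t])
    then show "Lp_enorm M (2 + \<kappa>) (\<lambda>\<omega>. H t (past \<eta> (int j) \<omega>) - H t (past_coupled \<eta> \<eta>' (int j) \<omega>)) \<le> ennreal (enn2real (p j))"
      using p_fin[of j] by simp
  qed (use \<kappa> in auto)
  have dt: "(\<Sum>j<m. d (i + j)) \<le> \<theta> i" for i m
  proof -
    have "ennreal (\<Sum>j<m. enn2real (p (i + j))) = (\<Sum>j<m. p (i + j))"
      using p_fin by (simp add: sum_ennreal[symmetric])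
    also have "\<dots> \<le> dep_tail M \<eta> \<eta>' H (2 + \<kappa>) i" unfolding tail by (rule sum_le_suminf) auto
    also have "\<dots> = ennreal (enn2real (dep_tail M \<eta> \<eta>' H (2 + \<kappa>) i))" using tail_fin[of i] by simp
    finally show ?thesis by (simp add: d_def \<theta>_def sum_distrib_left[symmetric])
  qed
  have "(\<lambda>i::int. \<theta> (nat \<bar>i\<bar>)) summable_on UNIV"
    unfolding \<theta>_def by (rule summable_on_cmult_right[OF real_infsum_le_ennreal(1)[OF tails]])
  then have "weakly_dependent M E \<eta> \<eta>' H d \<theta> (sqrt 2 * D) L"
    by unfold_locales (use Hm vL2_integrable(2)[OF H0(1)] H0(2) mean lip2 dep dt in auto)
  then show ?thesis by blast
qed

theorem corollary8:
  fixes M :: "'w measure" and E :: "'e measure"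
    and \<eta> \<eta>' :: "int \<Rightarrow> 'w \<Rightarrow> 'e"
    and H :: "real \<Rightarrow> (nat \<Rightarrow> 'e) \<Rightarrow> 'b::{banach, second_countable_topology}"
    and \<mu> :: "real \<Rightarrow> 'b"
    and X :: "nat \<Rightarrow> nat \<Rightarrow> 'w \<Rightarrow> 'b"
    and \<kappa> :: real
    and e :: "nat \<Rightarrow> 'b" and e' :: "nat \<Rightarrow> 'b \<Rightarrow>\<^sub>L real"
    and N :: "'g measure" and G :: "real \<Rightarrow> 'g \<Rightarrow> 'b"
  assumes "schauder_basis e e'"
    and "iid_with_copy M E \<eta> \<eta>'"
    and "moment_dependence_condition M E \<eta> \<eta>' H \<mu> X \<kappa>"
    and "tail_entropy_condition M \<eta> \<eta>' H X e e'"
    and "block_length_condition M \<eta> \<eta>' H \<kappa>"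
    and "prob_space N"
    and "centered_gaussian_process N G"
    and "\<And>s t. s \<in> {0..1} \<Longrightarrow> t \<in> {0..1} \<Longrightarrow>
           tensor_cov N (G t) (G s) = (LINT x:{0..min t s}|lborel. local_lrv M \<eta> H x)"
    and "weak_limit_D M (partial_sum_process M X) N G"
  shows "\<exists>(P :: ('g \<times> (nat \<Rightarrow> real)) measure) (W :: real \<Rightarrow> ell2 \<Rightarrow> 'g \<times> (nat \<Rightarrow> real) \<Rightarrow> real)
           (\<sigma> :: real \<Rightarrow> ell2 \<Rightarrow>\<^sub>L 'b) (\<sigma>' :: real \<Rightarrow> ('b \<Rightarrow>\<^sub>L real) \<Rightarrow>\<^sub>L ell2)
           (I :: real \<Rightarrow> 'g \<times> (nat \<Rightarrow> real) \<Rightarrow> 'b).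
           prob_space P \<and>
           cylindrical_brownian_motion P W \<and>
           (\<forall>u\<in>{0..1}. is_adjoint (\<sigma> u) (\<sigma>' u) \<and>
              canonical_map (local_lrv M \<eta> H u) = \<sigma> u o\<^sub>L \<sigma>' u) \<and>
           (\<forall>t\<in>{0..1}. has_operator_integral P W \<sigma>' t (I t)) \<and>
           (\<forall>\<omega>\<in>space P. cadlag (\<lambda>t. I t \<omega>)) \<and>
           equal_in_law P I N G"
proof -
  obtain d \<theta> C L where "weakly_dependent M E \<eta> \<eta>' H d \<theta> C L"
    using weakly_dependent_if_moment_dependence_condition[OF assms(2,3)] by blast
  then interpret weakly_dependent M E \<eta> \<eta>' H d \<theta> C L .
  interpret N: prob_space N by fact
  \<comment> \<open>Extended by 0 so that positivity, measurability and the norm bound hold on the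
    whole real line, where the representation is formulated. The integrals only see the unit
    interval.\<close>
  define U where "U u = (if u \<in> {0..1} then local_lrv M \<eta> H u else 0)" for u
  have Um: "U \<in> borel_measurable borel"
    unfolding U_def[abs_def] by (rule local_lrv_measurable)
  have zero: "cov_tensor (0 :: 'b ptensor)"
  proof -
    have "tensor_form (0 :: 'b ptensor) b c = 0" for b c by (rule linear_simps(3)[OF bounded_linear_tensor_form])
    then show ?thesis by (simp add: cov_tensor_def)
  qed
  have U: "cov_tensor (U u)" for u
    using cov_tensor_local_lrv zero by (simp add: U_def)
  define B where "B = \<bar>C * (\<Sum>\<^sub>\<infinity>i::int. \<theta> (nat \<bar>i\<bar>))\<bar>"
  have UB: "norm (U u) \<le> B" for u
    using local_lrv_bound[of u] by (auto simp: U_def B_def)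
  obtain K where K: "0 < K" "\<And>V :: 'b ptensor. norm (canonical_map V) \<le> norm V * K"
    using canonical_map_bound by blast
  have UK: "norm (canonical_map (U u)) \<le> B * K" for u
    using K(2)[of "U u"] mult_right_mono[OF UB, of K u] K(1) by linarith
  \<comment> \<open>The equation between tensors is tested with pairs of functionals:
    \<open>tensor_form\<close> is bounded and linear in the tensor, so it passes under the Bochner
    integrals on both sides.\<close>
  have cov: "(\<integral>\<omega>. b (G t \<omega>) * c (G s \<omega>) \<partial>N) = (LINT u:{0..min t s}|lborel. tensor_form (U u) b c)"
    if st: "s \<in> {0..1}" "t \<in> {0..1}" for s t and b c :: "'b \<Rightarrow>\<^sub>L real"
  proof -
    have G: "G t \<in> N.vL2" if "t \<in> {0..1}" for t
      using assms(7) that by (intro N.vL2I) (auto simp: centered_gaussian_process_def square_integrable_def)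
    have "(\<integral>\<omega>. b (G t \<omega>) * c (G s \<omega>) \<partial>N) = tensor_form (tensor_cov N (G t) (G s)) b c"
      unfolding tensor_cov_def
      using integral_bounded_linear[OF bounded_linear_tensor_form[of b c]
          N.bilinear_expectation(1)[OF bounded_bilinear_ptensor norm_ptensor_le G[OF st(2)] G[OF st(1)]]]
      by (simp add: tensor_form_ptensor)
    also have "tensor_cov N (G t) (G s) = (LINT u:{0..min t s}|lborel. U u)"
      unfolding assms(8)[OF st] by (rule set_lebesgue_integral_cong) (use st in \<open>auto simp: U_def\<close>)
    also have "tensor_form \<dots> b c = (LINT u:{0..min t s}|lborel. tensor_form (U u) b c)"
    proof -
      have "set_integrable lborel {0..min t s} U"
        unfolding set_integrable_def
      proof (rule Bochner_Integration.integrable_bound)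
        show "integrable lborel (\<lambda>u. indicat_real {0..min t s} u *\<^sub>R B)"
          by (intro integrable_scaleR_left integrable_real_indicator) (auto simp: emeasure_lborel_Icc_eq)
        show "(\<lambda>u. indicat_real {0..min t s} u *\<^sub>R U u) \<in> borel_measurable lborel" using Um by measurable
        have "0 \<le> B" by (simp add: B_def)
        then show "AE u in lborel. norm (indicat_real {0..min t s} u *\<^sub>R U u) \<le> norm (indicat_real {0..min t s} u *\<^sub>R B)"
          using UB by (auto simp: indicator_def)
      qed
      from integral_bounded_linear[OF bounded_linear_tensor_form[of b c] this[unfolded set_integrable_def]]
      show ?thesis
        unfolding set_lebesgue_integral_def by (simp add: linear_simps(5)[OF bounded_linear_tensor_form])
    qed
    finally show ?thesis .
  qed
  have cadlag: "cadlag (\<lambda>t. G t \<omega>)" if "\<omega> \<in> space N" for \<omega>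
    using assms(9) that by (simp add: weak_limit_D_def)
  obtain P :: "('g \<times> (nat \<Rightarrow> real)) measure" and W :: "real \<Rightarrow> ell2 \<Rightarrow> 'g \<times> (nat \<Rightarrow> real) \<Rightarrow> real"
      and I :: "real \<Rightarrow> 'g \<times> (nat \<Rightarrow> real) \<Rightarrow> 'b"
    where PWI: "prob_space P" "cylindrical_brownian_motion P W"
      "\<forall>t\<in>{0..1}. has_operator_integral P W (\<lambda>u. cov_factor_adj e' (U u)) t (I t)"
      "\<forall>\<omega>\<in>space P. cadlag (\<lambda>t. I t \<omega>)" "equal_in_law P I N G"
    using cylindrical_representation[OF assms(1) U Um UK assms(6,7) cov cadlag] by blast
  have "is_adjoint (cov_factor e' (U u)) (cov_factor_adj e' (U u)) \<and>
      canonical_map (local_lrv M \<eta> H u) = cov_factor e' (U u) o\<^sub>L cov_factor_adj e' (U u)" if "u \<in> {0..1}" for u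
    using cov_factor_adjoint[OF U, of e' u] cov_factor_compose[OF U assms(1), of u] that by (simp add: U_def)
  with PWI show ?thesis
    by (intro exI[of _ P] exI[of _ W] exI[of _ "\<lambda>u. cov_factor e' (U u)"]
        exI[of _ "\<lambda>u. cov_factor_adj e' (U u)"] exI[of _ I] conjI ballI) auto
qed

end
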